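(* Let $n\ge2$, $s\in(\frac12,1]$ and $\mathcal M\in\{\mathcal N^{1+s},\mathcal A^{1+s}\}$. Let $\mathcal O:=H^{1+s}_{\mathrm r}(\mathbb R/\mathbb Z,\mathbb R^n)$ if $\mathcal M=\mathcal N^{1+s}$ and $\mathcal O:=H^{1+s}_{\mathrm{ir}}(\mathbb R/\mathbb Z,\mathbb R^n)$ if $\mathcal M=\mathcal A^{1+s}$, and let $\mathcal E\in C^1(\mathcal O)$ be a real-valued parameter-invariant energy. If $\gamma\in\mathcal M\cap H^{2+s}(\mathbb R/\mathbb Z,\mathbb R^n)$ is a critical point of the restricted energy $\widetilde{\mathcal E}:=\mathcal E|_{\mathcal M}$, then $\gamma$ is a critical point of $\mathcal E-\lambda\mathcal L$ on $\mathcal O$ for some $\lambda\in\mathbb R$. If $\mathcal E$ is positively $\alpha$-homogeneous for some $\alpha\in\mathbb R$, then $\lambda=\alpha\,\mathcal E(\gamma)=\alpha\,\widetilde{\mathcal E}(\gamma)$. In particular, if $\alpha\ne0$ and $\widetilde{\mathcal E}(\gamma)\ne0$ then $\lambda\ne0$, whereas if $\mathcal E$ is scale-invariant (i.e. $\alpha=0$) or $\widetilde{\mathcal E}(\gamma)=0$, then $\lambda=0$.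
   Context: $\mathbb R/\mathbb Z$ is the circle of length $1$. $H^{t}(\mathbb R/\mathbb Z,\mathbb R^n)=W^{t,2}(\mathbb R/\mathbb Z,\mathbb R^n)$ is the (possibly fractional) Sobolev space of $1$-periodic functions. $H^{1+s}_{\mathrm r}$ is the open subset of $H^{1+s}$ of regular curves ($|\gamma'|>0$ everywhere), $H^{1+s}_{\mathrm{ir}}$ the open subset of regular curves that are injective on $[0,1)$. $\mathcal N^{1+s}=\{\gamma\in H^{1+s}:|\gamma'|=1\}$ and $\mathcal A^{1+s}=\{\gamma\in\mathcal N^{1+s}:\gamma|_{[0,1)}\text{ injective}\}$ are smooth submanifolds of $H^{1+s}_{\mathrm r}$ and $H^{1+s}_{\mathrm{ir}}$, respectively, with tangent space $T_\gamma\mathcal M=\{h\in H^{1+s}(\mathbb R/\mathbb Z,\mathbb R^n):\langle\gamma',h'\rangle=0\}$; $\gamma$ is critical for $\mathcal E|_{\mathcal M}$ if $D\mathcal E_\gamma h=0$ for all $h\in T_\gamma\mathcal M$, and critical for $\mathcal E-\lambda\mathcal L$ on $\mathcal O$ if $D\mathcal E_\gamma h-\lambda D\mathcal L_\gamma h=0$ for all $h\in H^{1+s}$. $\mathcal L(\gamma)=\int_0^1|\gamma'(u)|\,du$ is the length. $\mathcal E$ is parameter-invariant if $\mathcal E(\eta)=\mathcal E(\eta\circ\psi)$ for every $\eta\in\mathcal O$ and every strictly increasing $\psi\in H^{1+s}([0,1])$ with $\psi(0)=0$, $\psi(1)=1$, extended to $\mathbb R$ by $\psi(t+1)=1+\psi(t)$,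 such that $\eta\circ\psi\in\mathcal O$. Positively $\alpha$-homogeneous means $\mathcal E(t\eta)=t^\alpha\mathcal E(\eta)$ for all $t>0$, $\eta\in\mathcal O$. *)

theory Defs
  imports "HOL-Analysis.Analysis"
begin

subsection \<open>Sobolev--Slobodeckij spaces \<open>W\<^sup>t\<^sup>,\<^sup>2\<close> on the circle and on the unit interval\<close>

text \<open>
  The circle of length 1 and the interval \<open>[0,1]\<close> are treated together: a domain is described by
  its set \<open>T\<close> of test functions and its distance \<open>d\<close> on \<open>[0,1]\<close>. Only values on \<open>[0,1]\<close> enter
  the integrals. The order \<open>t\<close> is split into \<open>nat \<lfloor>t\<rfloor>\<close> weak derivatives in \<open>L\<^sup>2\<close> and, if \<open>frac t > 0\<close>,
  a Gagliardo seminorm of order \<open>frac t\<close> of the highest one.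
\<close>

definition smooth_fun :: "(real \<Rightarrow> real) \<Rightarrow> bool" where
  "smooth_fun \<phi> \<longleftrightarrow> (\<forall>k x. (deriv ^^ k) \<phi> field_differentiable at x)"

definition circle_tests :: "(real \<Rightarrow> real) set" where
  "circle_tests = {\<phi>. smooth_fun \<phi> \<and> (\<forall>u. \<phi> (u + 1) = \<phi> u)}"

definition interval_tests :: "(real \<Rightarrow> real) set" where
  "interval_tests = {\<phi>. smooth_fun \<phi> \<and> closure {u. \<phi> u \<noteq> 0} \<subseteq> {0<..<1}}"

definition circle_dist :: "real \<Rightarrow> real \<Rightarrow> real" where
  "circle_dist u v = min \<bar>u - v\<bar> (1 - \<bar>u - v\<bar>)"

definition square_integrable :: "(real \<Rightarrow> 'a::euclidean_space) \<Rightarrow> bool" where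
  "square_integrable g \<longleftrightarrow>
     set_borel_measurable lborel {0..1} g \<and> set_integrable lborel {0..1} (\<lambda>u. (norm (g u))\<^sup>2)"

definition weak_deriv ::
  "(real \<Rightarrow> real) set \<Rightarrow> nat \<Rightarrow> (real \<Rightarrow> 'a::euclidean_space) \<Rightarrow> (real \<Rightarrow> 'a) \<Rightarrow> bool" where
  "weak_deriv T j f g \<longleftrightarrow>
     (\<forall>\<phi>\<in>T. (LINT u:{0..1}|lborel. (deriv ^^ j) \<phi> u *\<^sub>R f u)
            = (-1) ^ j *\<^sub>R (LINT u:{0..1}|lborel. \<phi> u *\<^sub>R g u))"

text \<open>The square of the Gagliardo seminorm of order \<open>\<sigma>\<close>; the diagonal is a null set.\<close>

definition gagliardo2 ::
  "(real \<Rightarrow> real \<Rightarrow> real) \<Rightarrow> real \<Rightarrow> (real \<Rightarrow> 'a::euclidean_space) \<Rightarrow> ennreal" where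
  "gagliardo2 d \<sigma> g =
     (\<integral>\<^sup>+u\<in>{0..1}. (\<integral>\<^sup>+v\<in>{0..1}. ennreal ((norm (g u - g v))\<^sup>2 / d u v powr (1 + 2 * \<sigma>)) \<partial>lborel) \<partial>lborel)"

definition in_sobolev ::
  "(real \<Rightarrow> real) set \<Rightarrow> (real \<Rightarrow> real \<Rightarrow> real) \<Rightarrow> real \<Rightarrow> (real \<Rightarrow> 'a::euclidean_space) \<Rightarrow> bool" where
  "in_sobolev T d t f \<longleftrightarrow>
     square_integrable f \<and>
     (\<forall>j\<le>nat \<lfloor>t\<rfloor>. \<exists>g. square_integrable g \<and> weak_deriv T j f g \<and>
        (j = nat \<lfloor>t\<rfloor> \<and> frac t > 0 \<longrightarrow> gagliardo2 d (frac t) g < \<infinity>))"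

text \<open>
  For \<open>t > 1/2\<close> every class in \<open>W\<^sup>t\<^sup>,\<^sup>2\<close> has exactly one continuous representative; the elements of
  the following spaces are these representatives. They are used only for \<open>t > 3/2\<close>, where they are
  continuously differentiable.
\<close>

definition H_circle :: "real \<Rightarrow> (real \<Rightarrow> 'a::euclidean_space) set" where
  "H_circle t = {f. continuous_on UNIV f \<and> (\<forall>u. f (u + 1) = f u) \<and>
                    in_sobolev circle_tests circle_dist t f}"

definition H_interval :: "real \<Rightarrow> (real \<Rightarrow> 'a::euclidean_space) set" where
  "H_interval t = {f. continuous_on {0..1} f \<and>
                      in_sobolev interval_tests (\<lambda>u v. \<bar>u - v\<bar>) t f}"

text \<open>The weak derivative on the circle is unique up to null sets, so the norm does not depend on
  the choice.\<close>

definition circle_wderiv :: "nat \<Rightarrow> (real \<Rightarrow> 'a::euclidean_space) \<Rightarrow> real \<Rightarrow> 'a" where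
  "circle_wderiv j f = (SOME g. square_integrable g \<and> weak_deriv circle_tests j f g)"

definition H_norm :: "real \<Rightarrow> (real \<Rightarrow> 'a::euclidean_space) \<Rightarrow> real" where
  "H_norm t f =
     sqrt ((\<Sum>j\<le>nat \<lfloor>t\<rfloor>. LINT u:{0..1}|lborel. (norm (circle_wderiv j f u))\<^sup>2)
           + (if frac t > 0
              then enn2real (gagliardo2 circle_dist (frac t) (circle_wderiv (nat \<lfloor>t\<rfloor>) f)) else 0))"


subsection \<open>Spaces of curves\<close>

abbreviation curve_deriv :: "(real \<Rightarrow> real ^ 'n) \<Rightarrow> real \<Rightarrow> real ^ 'n" where
  "curve_deriv \<gamma> u \<equiv> vector_derivative \<gamma> (at u)"

definition regular_curves :: "real \<Rightarrow> (real \<Rightarrow> real ^ 'n) set" where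
  "regular_curves s = {\<gamma> \<in> H_circle (1 + s). \<forall>u. norm (curve_deriv \<gamma> u) > 0}"

definition injective_regular_curves :: "real \<Rightarrow> (real \<Rightarrow> real ^ 'n) set" where
  "injective_regular_curves s = {\<gamma> \<in> regular_curves s. inj_on \<gamma> {0..<1}}"

definition arclength_curves :: "real \<Rightarrow> (real \<Rightarrow> real ^ 'n) set" where
  "arclength_curves s = {\<gamma> \<in> H_circle (1 + s). \<forall>u. norm (curve_deriv \<gamma> u) = 1}"

definition injective_arclength_curves :: "real \<Rightarrow> (real \<Rightarrow> real ^ 'n) set" where
  "injective_arclength_curves s = {\<gamma> \<in> arclength_curves s. inj_on \<gamma> {0..<1}}"

text \<open>The tangent space at \<open>\<gamma>\<close> of either manifold of arclength parametrized curves.\<close>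

definition tangent_space :: "real \<Rightarrow> (real \<Rightarrow> real ^ 'n) \<Rightarrow> (real \<Rightarrow> real ^ 'n) set" where
  "tangent_space s \<gamma> = {h \<in> H_circle (1 + s). \<forall>u. curve_deriv \<gamma> u \<bullet> curve_deriv h u = 0}"

definition curve_length :: "(real \<Rightarrow> real ^ 'n) \<Rightarrow> real" where
  "curve_length \<gamma> = (LINT u:{0..1}|lborel. norm (curve_deriv \<gamma> u))"


subsection \<open>Differentiable energies on open subsets of \<open>H\<^sup>1\<^sup>+\<^sup>s\<close>\<close>

text \<open>
  Energies are total functions, of which only the values on an open set of curves matter: the
  Frechet derivative at a point of an open set only depends on the values in that set.
  The derivative \<open>D\<close> is only relevant (and unique) on \<^term>\<open>H_circle (1 + s)\<close>.
\<close>

definition has_energy_derivative ::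
  "real \<Rightarrow> ((real \<Rightarrow> real ^ 'n) \<Rightarrow> real) \<Rightarrow> ((real \<Rightarrow> real ^ 'n) \<Rightarrow> real) \<Rightarrow> (real \<Rightarrow> real ^ 'n) \<Rightarrow> bool"
where
  "has_energy_derivative s F D \<eta> \<longleftrightarrow>
     (\<forall>h\<in>H_circle (1 + s). \<forall>k\<in>H_circle (1 + s). D (\<lambda>u. h u + k u) = D h + D k) \<and>
     (\<forall>c. \<forall>h\<in>H_circle (1 + s). D (\<lambda>u. c *\<^sub>R h u) = c * D h) \<and>
     (\<exists>C. \<forall>h\<in>H_circle (1 + s). \<bar>D h\<bar> \<le> C * H_norm (1 + s) h) \<and>
     (\<forall>\<epsilon>>0. \<exists>\<delta>>0. \<forall>h\<in>H_circle (1 + s). H_norm (1 + s) h < \<delta> \<longrightarrow>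
        \<bar>F (\<lambda>u. \<eta> u + h u) - F \<eta> - D h\<bar> \<le> \<epsilon> * H_norm (1 + s) h)"

definition energy_derivative ::
  "real \<Rightarrow> ((real \<Rightarrow> real ^ 'n) \<Rightarrow> real) \<Rightarrow> (real \<Rightarrow> real ^ 'n) \<Rightarrow> (real \<Rightarrow> real ^ 'n) \<Rightarrow> real" where
  "energy_derivative s F \<eta> = (SOME D. has_energy_derivative s F D \<eta>)"

text \<open>Continuity of the derivative is with respect to the dual norm on \<open>(H\<^sup>1\<^sup>+\<^sup>s)*\<close>.\<close>

definition C1_energy ::
  "real \<Rightarrow> (real \<Rightarrow> real ^ 'n) set \<Rightarrow> ((real \<Rightarrow> real ^ 'n) \<Rightarrow> real) \<Rightarrow> bool" where
  "C1_energy s \<O> F \<longleftrightarrow>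
     (\<forall>\<eta>\<in>\<O>. \<exists>D. has_energy_derivative s F D \<eta>) \<and>
     (\<forall>\<eta>\<in>\<O>. \<forall>\<epsilon>>0. \<exists>\<delta>>0. \<forall>\<zeta>\<in>\<O>. H_norm (1 + s) (\<lambda>u. \<zeta> u - \<eta> u) < \<delta> \<longrightarrow>
        (\<forall>h\<in>H_circle (1 + s).
           \<bar>energy_derivative s F \<zeta> h - energy_derivative s F \<eta> h\<bar> \<le> \<epsilon> * H_norm (1 + s) h))"

definition parameter_invariant ::
  "real \<Rightarrow> (real \<Rightarrow> real ^ 'n) set \<Rightarrow> ((real \<Rightarrow> real ^ 'n) \<Rightarrow> real) \<Rightarrow> bool" where
  "parameter_invariant s \<O> F \<longleftrightarrow>
     (\<forall>\<eta>\<in>\<O>. \<forall>\<psi> :: real \<Rightarrow> real.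
        \<psi> \<in> H_interval (1 + s) \<and> strict_mono_on {0..1} \<psi> \<and> \<psi> 0 = 0 \<and> \<psi> 1 = 1 \<and>
        (\<forall>t. \<psi> (t + 1) = 1 + \<psi> t) \<and> \<eta> \<circ> \<psi> \<in> \<O> \<longrightarrow> F \<eta> = F (\<eta> \<circ> \<psi>))"

definition pos_homogeneous ::
  "real \<Rightarrow> (real \<Rightarrow> real ^ 'n) set \<Rightarrow> ((real \<Rightarrow> real ^ 'n) \<Rightarrow> real) \<Rightarrow> bool" where
  "pos_homogeneous \<alpha> \<O> F \<longleftrightarrow> (\<forall>t>0. \<forall>\<eta>\<in>\<O>. F (\<lambda>u. t *\<^sub>R \<eta> u) = t powr \<alpha> * F \<eta>)"

definition critical_restricted ::
  "real \<Rightarrow> (real \<Rightarrow> real ^ 'n) set \<Rightarrow> ((real \<Rightarrow> real ^ 'n) \<Rightarrow> real) \<Rightarrow> (real \<Rightarrow> real ^ 'n) \<Rightarrow> bool" where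
  "critical_restricted s \<M> F \<gamma> \<longleftrightarrow>
     \<gamma> \<in> \<M> \<and> (\<forall>h\<in>tangent_space s \<gamma>. energy_derivative s F \<gamma> h = 0)"

text \<open>Critical points of \<open>F - \<mu> L\<close> on \<open>\<O>\<close>, where \<open>L\<close> is the length.\<close>

definition critical_length_multiplier ::
  "real \<Rightarrow> (real \<Rightarrow> real ^ 'n) set \<Rightarrow> ((real \<Rightarrow> real ^ 'n) \<Rightarrow> real) \<Rightarrow> real \<Rightarrow> (real \<Rightarrow> real ^ 'n) \<Rightarrow> bool"
where
  "critical_length_multiplier s \<O> F \<mu> \<gamma> \<longleftrightarrow>
     \<gamma> \<in> \<O> \<and>
     (\<forall>h\<in>H_circle (1 + s).
        energy_derivative s F \<gamma> h - \<mu> * energy_derivative s curve_length \<gamma> h = 0)"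

end

theory Submission
  imports Defs
begin

text \<open>
  Write \<open>D\<close> for the derivative of the energy at \<open>\<gamma>\<close>. Since \<open>|\<gamma>'| = 1\<close>, the derivative of the length at
  \<open>\<gamma>\<close> in the direction \<open>h\<close> is \<open>c = \<integral> \<langle>\<gamma>', h'\<rangle>\<close>. The function \<open>\<langle>\<gamma>', h'\<rangle> - c\<close> has mean value zero, so it
  is the derivative \<open>\<phi>'\<close> of a periodic function \<open>\<phi>\<close> with \<open>\<phi>(0) = 0\<close>, and \<open>h\<close> splits as

    \<open>h = t + \<phi> \<gamma>' + c \<gamma>\<close>.

  From \<open>\<langle>\<gamma>', \<gamma>''\<rangle> = 0\<close> it follows that \<open>\<langle>\<gamma>', t'\<rangle> = \<langle>\<gamma>', h'\<rangle> - \<phi>' - c = 0\<close>: the first summand is tangential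
  to the manifold of arclength parametrized curves, and \<open>D t = 0\<close> because \<open>\<gamma>\<close> is critical there. The
  second summand generates the reparametrizations \<open>\<gamma>(u + \<epsilon> \<phi>(u))\<close>, along which the energy is constant, so
  that \<open>D (\<phi> \<gamma>') = 0\<close> (\<open>derivative_tangential_eq_0\<close>). Hence \<open>D h = c D \<gamma>\<close>, which says that \<open>\<gamma>\<close> is critical
  for the energy minus \<open>\<lambda>\<close> times the length with \<open>\<lambda> = D \<gamma>\<close>. The multiplier is unique, as the
  derivative of the length in the direction \<open>\<gamma>\<close> is \<open>1\<close>. For a homogeneous energy, Euler's relation
  turns \<open>D \<gamma>\<close> into \<open>\<alpha> E(\<gamma>)\<close>.

  The analytic work lies in \<open>D (\<phi> \<gamma>') = 0\<close>. As the energy is only differentiable with respect to the norm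
  of \<open>H\<^sup>1\<^sup>+\<^sup>s\<close>, the curve \<open>\<epsilon> \<mapsto> \<gamma>(u + \<epsilon> \<phi>(u))\<close> has to be differentiable at \<open>\<epsilon> = 0\<close> in that norm
  (\<open>reparametrization_expansion\<close>). Differentiation in \<open>\<epsilon>\<close> costs one derivative in \<open>u\<close>, and this is why
  \<open>\<gamma>\<close> has to be in \<open>H\<^sup>2\<^sup>+\<^sup>s\<close>. What remains is the continuity of composition with \<open>u + \<epsilon> \<phi>(u)\<close> in the
  top order seminorm of \<open>\<gamma>''\<close>. For \<open>s < 1\<close> that is the continuity at \<open>0\<close> of the Gagliardo seminorm of
  \<open>g(u + \<epsilon> \<phi>(u)) - g(u)\<close> (\<open>composition_continuous\<close>): close to the diagonal both functions contribute
  little, and away from it uniform convergence suffices. For \<open>s = 1\<close> it is the convergence in \<open>L\<^sup>2\<close> of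
  difference quotients of an absolutely continuous function (\<open>reparametrization_remainder_1\<close>), proved
  by approximation of its derivative by continuous functions.

  In order to speak of derivatives at all, the weak formulation of \<open>H\<^sup>1\<^sup>+\<^sup>s\<close> is translated into
  a classical one: \<open>h\<close> belongs to \<open>H\<^sup>1\<^sup>+\<^sup>s\<close> iff it is continuously differentiable and periodic with a
  derivative of finite top order seminorm (\<open>H_circle_imp_C1\<close>, \<open>H_circleI\<close>). This rests on the
  fundamental lemma of the calculus of variations, on absolutely continuous functions as primitives,
  and, for \<open>s < 1\<close>, on the embedding of fractional Sobolev functions of order greater than \<open>1/2\<close> into the
  continuous functions (\<open>gagliardo_embedding\<close>).
\<close>

section \<open>Square integrable functions on the unit interval\<close>

lemma square_integrable_imp_set_integrable:
  fixes g :: "real \<Rightarrow> 'a::euclidean_space"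
  assumes "square_integrable g"
  shows "set_integrable lborel {0..1} g"
proof -
  have "set_integrable lborel {0..1} (\<lambda>u. 1 + (norm (g u))\<^sup>2)"
    using assms unfolding square_integrable_def
    by (intro set_integral_add) (auto simp: set_integrable_def intro!: integrable_real_indicator)
  moreover have "norm x \<le> 1 + (norm x)\<^sup>2" for x :: 'a
  proof -
    have "(norm x - 1)\<^sup>2 = 1 + (norm x)\<^sup>2 - 2 * norm x" by (simp add: power2_eq_square algebra_simps)
    then show ?thesis using zero_le_power2[of "norm x - 1"] norm_ge_zero[of x] by linarith
  qed
  ultimately show ?thesis
    using assms unfolding square_integrable_def
    by (elim set_integrable_bound) (auto intro!: AE_I2)
qed

lemma norm_add_squared_le:
  fixes x y :: "'a::real_normed_vector"
  shows "(norm (x + y))\<^sup>2 \<le> 2 * (norm x)\<^sup>2 + 2 * (norm y)\<^sup>2"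
proof -
  have "(norm (x + y))\<^sup>2 \<le> (norm x + norm y)\<^sup>2"
    by (simp add: norm_triangle_ineq power_mono)
  also have "\<dots> \<le> 2 * (norm x)\<^sup>2 + 2 * (norm y)\<^sup>2"
    using zero_le_power2[of "norm x - norm y"] by (simp add: power2_eq_square algebra_simps)
  finally show ?thesis .
qed

lemma measurable_norm_squared:
  fixes g :: "real \<Rightarrow> 'a::euclidean_space"
  assumes "set_borel_measurable lborel A g"
  shows "set_borel_measurable lborel A (\<lambda>u. (norm (g u))\<^sup>2)"
    and "(\<lambda>u. ennreal ((norm (g u))\<^sup>2) * indicator A u) \<in> borel_measurable lborel"
proof -
  have m: "(\<lambda>u. (norm (indicator A u *\<^sub>R g u))\<^sup>2) \<in> borel_measurable lborel"
    using assms unfolding set_borel_measurable_def by measurable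
  also have "(\<lambda>u. (norm (indicator A u *\<^sub>R g u))\<^sup>2) = (\<lambda>u. indicator A u *\<^sub>R (norm (g u))\<^sup>2)"
    by (auto simp: indicator_def)
  finally show "set_borel_measurable lborel A (\<lambda>u. (norm (g u))\<^sup>2)" unfolding set_borel_measurable_def .
  have "(\<lambda>u. ennreal ((norm (indicator A u *\<^sub>R g u))\<^sup>2)) \<in> borel_measurable lborel"
    using m by (rule measurable_compose_rev[rotated]) measurable
  also have "(\<lambda>u. ennreal ((norm (indicator A u *\<^sub>R g u))\<^sup>2)) = (\<lambda>u. ennreal ((norm (g u))\<^sup>2) * indicator A u)"
    by (auto simp: indicator_def)
  finally show "(\<lambda>u. ennreal ((norm (g u))\<^sup>2) * indicator A u) \<in> borel_measurable lborel" .
qed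

lemma square_integrable_dominated:
  fixes g :: "real \<Rightarrow> 'a::euclidean_space"
  assumes m: "set_borel_measurable lborel {0..1} g" and h: "set_integrable lborel {0..1} h"
    and le: "\<And>u. u \<in> {0..1} \<Longrightarrow> (norm (g u))\<^sup>2 \<le> h u"
  shows "square_integrable g"
proof -
  have "set_integrable lborel {0..1} (\<lambda>u. (norm (g u))\<^sup>2)"
    by (rule set_integrable_bound[OF h measurable_norm_squared(1)[OF m]])
       (use le in \<open>auto intro!: AE_I2 order_trans[OF le]\<close>)
  with m show ?thesis unfolding square_integrable_def by blast
qed

lemma square_integrable_add:
  fixes f g :: "real \<Rightarrow> 'a::euclidean_space"
  assumes "square_integrable f" "square_integrable g"
  shows "square_integrable (\<lambda>u. f u + g u)"
proof (rule square_integrable_dominated)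
  show "set_borel_measurable lborel {0..1} (\<lambda>u. f u + g u)"
    using assms unfolding square_integrable_def set_borel_measurable_def
    by (auto simp add: scaleR_add_right)
  show "set_integrable lborel {0..1} (\<lambda>u. 2 * (norm (f u))\<^sup>2 + 2 * (norm (g u))\<^sup>2)"
    using assms unfolding square_integrable_def by (intro set_integral_add) auto
qed (rule norm_add_squared_le)

lemma square_integrable_cong:
  fixes f g :: "real \<Rightarrow> 'a::euclidean_space"
  assumes "\<And>u. u \<in> {0..1} \<Longrightarrow> f u = g u" and "square_integrable f"
  shows "square_integrable g"
proof -
  have "(\<lambda>u. indicator {0..1} u *\<^sub>R f u) = (\<lambda>u. indicator {0..1} u *\<^sub>R g u)"
    "(\<lambda>u. indicator {0..1} u *\<^sub>R (norm (f u))\<^sup>2) = (\<lambda>u. indicator {0..1} u *\<^sub>R (norm (g u))\<^sup>2)"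
    using assms(1) by (auto simp: indicator_def fun_eq_iff)
  then show ?thesis
    using assms(2) unfolding square_integrable_def set_borel_measurable_def set_integrable_def by metis
qed

lemma square_integrable_continuous:
  fixes f :: "real \<Rightarrow> 'a::euclidean_space"
  assumes "continuous_on {0..1} f"
  shows "square_integrable f"
proof -
  have "(\<lambda>u. indicator {0..1} u *\<^sub>R f u) \<in> borel_measurable borel"
    by (intro borel_measurable_continuous_on_indicator assms) simp
  moreover have "set_integrable lborel {0..1} (\<lambda>u. (norm (f u))\<^sup>2)"
    by (intro borel_integrable_atLeastAtMost' continuous_intros assms)
  ultimately show ?thesis unfolding square_integrable_def set_borel_measurable_def by simp
qed

lemma continuous_on_Icc_bounded:
  fixes f :: "real \<Rightarrow> 'a::euclidean_space"
  assumes "continuous_on {a..b} f"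
  shows "\<exists>C. \<forall>u\<in>{a..b}. norm (f u) \<le> C"
  using compact_imp_bounded[OF compact_continuous_image[OF assms compact_Icc]]
  unfolding bounded_iff by auto

lemma integrable_bounded_scaleR:
  fixes f :: "'b \<Rightarrow> real" and g :: "'b \<Rightarrow> 'a::euclidean_space"
  assumes "integrable M g" and "f \<in> borel_measurable M" and "AE u in M. \<bar>f u\<bar> \<le> C"
  shows "integrable M (\<lambda>u. f u *\<^sub>R g u)"
proof (rule Bochner_Integration.integrable_bound)
  show "integrable M (\<lambda>u. C *\<^sub>R g u)" using assms(1) by simp
  show "(\<lambda>u. f u *\<^sub>R g u) \<in> borel_measurable M" using assms by auto
  show "AE u in M. norm (f u *\<^sub>R g u) \<le> norm (C *\<^sub>R g u)"
    using assms(3) by eventually_elim (auto intro!: mult_right_mono)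
qed

lemma integrable_bounded_scaleR_right:
  fixes f :: "'b \<Rightarrow> real" and g :: "'b \<Rightarrow> 'a::euclidean_space"
  assumes "integrable M f" and "g \<in> borel_measurable M" and "AE u in M. norm (g u) \<le> C"
  shows "integrable M (\<lambda>u. f u *\<^sub>R g u)"
proof (rule Bochner_Integration.integrable_bound)
  show "integrable M (\<lambda>u. C * f u)" using assms(1) by simp
  show "(\<lambda>u. f u *\<^sub>R g u) \<in> borel_measurable M" using assms by auto
  show "AE u in M. norm (f u *\<^sub>R g u) \<le> norm (C * f u)"
    using assms(3) by eventually_elim (auto simp: abs_mult mult.commute[of "\<bar>f _\<bar>"] intro!: mult_right_mono)
qed

lemma set_integrable_mult_continuous:
  fixes f :: "real \<Rightarrow> real" and g :: "real \<Rightarrow> 'a::euclidean_space"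
  assumes f: "continuous_on {0..1} f" and g: "set_integrable lborel {0..1} g"
  shows "set_integrable lborel {0..1} (\<lambda>u. f u *\<^sub>R g u)"
proof -
  obtain C where "\<And>u. u \<in> {0..1} \<Longrightarrow> norm (f u) \<le> C"
    using continuous_on_Icc_bounded[OF f] by blast
  then have "AE u in lborel. \<bar>indicator {0..1} u *\<^sub>R f u\<bar> \<le> \<bar>C\<bar>"
    by (intro AE_I2) (force simp: indicator_def)
  moreover have "(\<lambda>u. indicator {0..1} u *\<^sub>R f u) \<in> borel_measurable lborel"
    using borel_measurable_continuous_on_indicator[OF _ f] by simp
  ultimately have "integrable lborel (\<lambda>u. (indicator {0..1} u *\<^sub>R f u) *\<^sub>R (indicator {0..1} u *\<^sub>R g u))"
    using g integrable_bounded_scaleR unfolding set_integrable_def by blast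
  also have "(\<lambda>u. (indicator {0..1} u *\<^sub>R f u) *\<^sub>R (indicator {0..1} u *\<^sub>R g u)) =
     (\<lambda>u. indicator {0..1} u *\<^sub>R (f u *\<^sub>R g u))" by (auto simp: indicator_def)
  finally show ?thesis unfolding set_integrable_def .
qed

lemma square_integrable_mult_bounded:
  fixes f :: "real \<Rightarrow> real" and g :: "real \<Rightarrow> 'a::euclidean_space"
  assumes f: "continuous_on {0..1} f" and g: "square_integrable g"
  shows "square_integrable (\<lambda>u. f u *\<^sub>R g u)"
proof -
  have mf: "(\<lambda>u. indicator {0..1} u *\<^sub>R f u) \<in> borel_measurable lborel"
    using borel_measurable_continuous_on_indicator[OF _ f] by simp
  have mg: "(\<lambda>u. indicator {0..1} u *\<^sub>R g u) \<in> borel_measurable lborel"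
    using g unfolding square_integrable_def set_borel_measurable_def by simp
  have "(\<lambda>u. (indicator {0..1} u *\<^sub>R f u) *\<^sub>R (indicator {0..1} u *\<^sub>R g u)) \<in> borel_measurable lborel"
    using mf mg by measurable
  also have "(\<lambda>u. (indicator {0..1} u *\<^sub>R f u) *\<^sub>R (indicator {0..1} u *\<^sub>R g u)) =
      (\<lambda>u. indicator {0..1} u *\<^sub>R (f u *\<^sub>R g u))"
    by (auto simp: indicator_def)
  finally have m: "set_borel_measurable lborel {0..1} (\<lambda>u. f u *\<^sub>R g u)"
    unfolding set_borel_measurable_def .
  obtain C where C: "\<And>u. u \<in> {0..1} \<Longrightarrow> norm (f u) \<le> C"
    using continuous_on_Icc_bounded[OF f] by blast
  show ?thesis
  proof (rule square_integrable_dominated[OF m])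
    show "set_integrable lborel {0..1} (\<lambda>u. C\<^sup>2 * (norm (g u))\<^sup>2)"
      using g unfolding square_integrable_def by auto
    show "(norm (f u *\<^sub>R g u))\<^sup>2 \<le> C\<^sup>2 * (norm (g u))\<^sup>2" if "u \<in> {0..1}" for u
      using power_mono[OF C[OF that], of 2] by (simp add: power_mult_distrib mult_right_mono)
  qed
qed

lemma nn_integral_norm_squared:
  fixes g :: "real \<Rightarrow> 'a::euclidean_space"
  assumes "square_integrable g"
  shows "(\<integral>\<^sup>+u\<in>{0..1}. ennreal ((norm (g u))\<^sup>2) \<partial>lborel) = ennreal (LINT u:{0..1}|lborel. (norm (g u))\<^sup>2)"
  using assms unfolding square_integrable_def set_integrable_def set_lebesgue_integral_def
  by (subst nn_integral_eq_integral[symmetric])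
     (auto intro!: nn_integral_cong simp: indicator_def)

lemma square_integrableI_nn:
  fixes g :: "real \<Rightarrow> 'a::euclidean_space"
  assumes "set_borel_measurable lborel {0..1} g"
    and "(\<integral>\<^sup>+u\<in>{0..1}. ennreal ((norm (g u))\<^sup>2) \<partial>lborel) < \<infinity>"
  shows "square_integrable g"
proof -
  note m = measurable_norm_squared(1)[OF assms(1), unfolded set_borel_measurable_def]
  have "(\<integral>\<^sup>+u. ennreal (norm (indicator {0..1} u *\<^sub>R (norm (g u))\<^sup>2)) \<partial>lborel)
    = (\<integral>\<^sup>+u\<in>{0..1}. ennreal ((norm (g u))\<^sup>2) \<partial>lborel)"
    by (intro nn_integral_cong) (auto simp: indicator_def)
  then have "set_integrable lborel {0..1} (\<lambda>u. (norm (g u))\<^sup>2)"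
    unfolding set_integrable_def using m assms(2) by (intro integrableI_bounded) auto
  then show ?thesis using assms(1) unfolding square_integrable_def by blast
qed

lemma set_integral_singleton:
  fixes h :: "real \<Rightarrow> 'a::euclidean_space"
  shows "(LINT x:{a..a}|lborel. h x) = 0"
  unfolding set_lebesgue_integral_def
proof (rule integral_eq_zero_AE)
  show "AE x in lborel. indicator {a..a} x *\<^sub>R h x = 0"
    using AE_lborel_singleton[of a] by eventually_elim auto
qed

text \<open>The integral of \<open>(|g| - m)\<^sup>2\<close> is nonnegative; the inequality is the case where \<open>m\<close> is the mean value
  of \<open>|g|\<close>.\<close>

lemma set_integral_Cauchy_Schwarz:
  fixes g :: "real \<Rightarrow> 'a::euclidean_space"
  assumes ab: "a \<le> b" and g: "set_integrable lborel {a..b} g"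
    and g2: "set_integrable lborel {a..b} (\<lambda>u. (norm (g u))\<^sup>2)"
  shows "(norm (LINT u:{a..b}|lborel. g u))\<^sup>2 \<le> (b - a) * (LINT u:{a..b}|lborel. (norm (g u))\<^sup>2)"
proof -
  define I where "I = (LINT u:{a..b}|lborel. norm (g u))"
  define J where "J = (LINT u:{a..b}|lborel. (norm (g u))\<^sup>2)"
  have n: "set_integrable lborel {a..b} (\<lambda>u. norm (g u))"
    using set_integrable_norm[OF g] .
  have le: "norm (LINT u:{a..b}|lborel. g u) \<le> I"
    unfolding I_def by (rule set_integral_norm_bound[OF g])
  have c: "set_integrable lborel {a..b} (\<lambda>u. c::real)" for c
    by (rule borel_integrable_atLeastAtMost') simp
  have pos: "0 \<le> J - 2 * m * I + m\<^sup>2 * (b - a)" for m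
  proof -
    have "0 \<le> (LINT u:{a..b}|lborel. (norm (g u) - m)\<^sup>2)"
      unfolding set_lebesgue_integral_def by (intro Bochner_Integration.integral_nonneg) auto
    also have "\<dots> = (LINT u:{a..b}|lborel. (norm (g u))\<^sup>2 - (2 * m) * norm (g u) + m\<^sup>2)"
      by (simp add: power2_eq_square algebra_simps)
    also have "\<dots> = (LINT u:{a..b}|lborel. (norm (g u))\<^sup>2 - (2 * m) * norm (g u)) + (LINT u:{a..b}|lborel. m\<^sup>2)"
      by (rule set_integral_add(2)[OF set_integral_diff(1)[OF g2 set_integrable_mult_right] c]) (use n in simp)
    also have "(LINT u:{a..b}|lborel. (norm (g u))\<^sup>2 - (2 * m) * norm (g u)) = J - 2 * m * I"
      unfolding I_def J_def using n by (subst set_integral_diff(2)[OF g2]) auto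
    also have "(LINT u:{a..b}|lborel. m\<^sup>2) = m\<^sup>2 * (b - a)"
      using ab by (simp add: set_lebesgue_integral_def)
    finally show ?thesis .
  qed
  have "I\<^sup>2 \<le> (b - a) * J"
  proof (cases "a = b")
    case True
    have "I = 0" unfolding I_def True by (rule set_integral_singleton)
    then show ?thesis using True by simp
  next
    case False
    then have "b - a > 0" using ab by simp
    then have "(I / (b - a))\<^sup>2 * (b - a) = I / (b - a) * I" by (simp add: power2_eq_square)
    with pos[of "I / (b - a)"] have "I * I / (b - a) \<le> J" by simp
    then show ?thesis using \<open>b - a > 0\<close> by (simp add: power2_eq_square pos_divide_le_eq mult.commute)
  qed
  moreover have "(norm (LINT u:{a..b}|lborel. g u))\<^sup>2 \<le> I\<^sup>2" using le by (intro power_mono) auto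
  ultimately show ?thesis unfolding J_def by linarith
qed

section \<open>Primitives of integrable functions\<close>

text \<open>Absolute continuity of \<open>p\<close> on \<open>[0,1]\<close> with derivative \<open>G\<close> almost everywhere, in the form of the
  fundamental theorem of calculus. This form suits weak derivatives, which are only determined up to
  null sets.\<close>

definition primitive :: "(real \<Rightarrow> 'a::euclidean_space) \<Rightarrow> (real \<Rightarrow> 'a) \<Rightarrow> bool" where
  "primitive G p \<longleftrightarrow> set_integrable lborel {0..1} G \<and>
     (\<forall>u\<in>{0..1}. p u = p 0 + (LINT x:{0..u}|lborel. G x))"

lemma primitive_imp_integrable: "primitive G p \<Longrightarrow> set_integrable lborel {0..1} G"
  unfolding primitive_def by blast

lemma primitive_eq: "primitive G p \<Longrightarrow> u \<in> {0..1} \<Longrightarrow> (LINT x:{0..u}|lborel. G x) = p u - p 0"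
  unfolding primitive_def by (metis add_diff_cancel_left')

lemma set_integrable_subinterval:
  fixes G :: "real \<Rightarrow> 'a::euclidean_space"
  assumes "set_integrable lborel {0..1} G" "0 \<le> a" "b \<le> 1"
  shows "set_integrable lborel {a..b} G"
  using assms by (intro set_integrable_subset[OF assms(1)]) auto

lemma primitive_diff:
  assumes "primitive G p" "0 \<le> a" "a \<le> b" "b \<le> 1"
  shows "p b - p a = (LINT x:{a..b}|lborel. G x)"
proof -
  have i: "set_integrable lborel {0..1} G" using assms unfolding primitive_def by blast
  have e: "set_lebesgue_integral lborel {c..d} G = integral {c..d} G" "G integrable_on {c..d}"
    if "0 \<le> c" "d \<le> 1" for c d
    using set_borel_integral_eq_integral[OF set_integrable_subinterval[OF i that]] by auto
  have "p b = p 0 + set_lebesgue_integral lborel {0..b} G" "p a = p 0 + set_lebesgue_integral lborel {0..a} G"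
    using primitive_eq[OF assms(1), of b] primitive_eq[OF assms(1), of a] assms by simp_all
  then have "p b = p 0 + integral {0..b} G" "p a = p 0 + integral {0..a} G"
    using e(1)[of 0 b] e(1)[of 0 a] assms by simp_all
  then have "p b - p a = integral {0..b} G - integral {0..a} G" by simp
  moreover have "integral {0..a} G + integral {a..b} G = integral {0..b} G"
    using assms by (intro Henstock_Kurzweil_Integration.integral_combine e(2)) simp_all
  ultimately have "p b - p a = integral {a..b} G" by (metis add_diff_cancel_left')
  then show ?thesis using e(1)[of a b] assms by simp
qed

lemma primitive_continuous_on:
  assumes "primitive G p"
  shows "continuous_on {0..1} p"
proof -
  have i: "set_integrable lborel {0..1} G" using assms unfolding primitive_def by blast
  have c: "continuous_on {0..1} (\<lambda>u. p 0 + integral {0..u} G)"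
    using set_borel_integral_eq_integral(1)[OF i]
    by (intro continuous_intros indefinite_integral_continuous_1)
  have e: "p u = p 0 + integral {0..u} G" if "u \<in> {0..1}" for u
  proof -
    have "p u - p 0 = integral {0..u} G"
      using primitive_eq[OF assms that] that
        set_borel_integral_eq_integral(2)[OF set_integrable_subinterval[OF i, of 0 u]] by simp
    then show ?thesis by (metis diff_add_cancel add.commute)
  qed
  show ?thesis by (rule continuous_on_eq[OF c]) (rule e[symmetric])
qed

lemma primitive_exists:
  assumes "set_integrable lborel {0..1} G"
  shows "primitive G (\<lambda>u. LINT x:{0..u}|lborel. G x)"
proof -
  have "(LINT x:{0..0::real}|lborel. G x) = 0" by (rule set_integral_singleton)
  then show ?thesis using assms unfolding primitive_def by simp
qed

lemma primitive_C1:
  fixes p :: "real \<Rightarrow> 'a::euclidean_space"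
  assumes "\<And>u. u \<in> {0..1} \<Longrightarrow> (p has_vector_derivative G u) (at u within {0..1})"
    and "continuous_on {0..1} G"
  shows "primitive G p"
proof -
  have i: "set_integrable lborel {0..1} G" using assms borel_integrable_atLeastAtMost' by blast
  have "p u = p 0 + (LINT x:{0..u}|lborel. G x)" if "u \<in> {0..1}" for u
  proof -
    have "(G has_integral (p u - p 0)) {0..u}"
    proof (rule fundamental_theorem_of_calculus)
      show "0 \<le> u" using that by simp
      fix x assume x: "x \<in> {0..u}"
      show "(p has_vector_derivative G x) (at x within {0..u})"
        by (rule has_vector_derivative_within_subset[OF assms(1)]) (use x that in simp_all)
    qed
    then have "p u - p 0 = integral {0..u} G" by (simp add: integral_unique)
    also have "\<dots> = (LINT x:{0..u}|lborel. G x)"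
      using set_borel_integral_eq_integral(2)[OF set_integrable_subinterval[OF i, of 0 u]] that by simp
    finally show ?thesis by (metis diff_add_cancel add.commute)
  qed
  then show ?thesis using i unfolding primitive_def by blast
qed

lemma primitive_add:
  fixes f g F G :: "real \<Rightarrow> 'a::euclidean_space"
  assumes F: "primitive F f" and G: "primitive G g"
  shows "primitive (\<lambda>u. F u + G u) (\<lambda>u. f u + g u)"
  unfolding primitive_def
proof (intro conjI ballI)
  note i = primitive_imp_integrable[OF F] primitive_imp_integrable[OF G]
  show "set_integrable lborel {0..1} (\<lambda>u. F u + G u)" by (rule set_integral_add(1)[OF i])
  fix u :: real assume u: "u \<in> {0..1}"
  have i': "set_integrable lborel {0..u} F" "set_integrable lborel {0..u} G"
    using set_integrable_subinterval[OF i(1), of 0 u] set_integrable_subinterval[OF i(2), of 0 u] u by auto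
  show "f u + g u = f 0 + g 0 + (LINT x:{0..u}|lborel. F x + G x)"
    using set_integral_add(2)[OF i'] primitive_eq[OF F u] primitive_eq[OF G u] by simp
qed

lemma primitive_minus:
  fixes f F :: "real \<Rightarrow> 'a::euclidean_space"
  assumes F: "primitive F f"
  shows "primitive (\<lambda>u. - F u) (\<lambda>u. - f u)"
  unfolding primitive_def
proof (intro conjI ballI)
  show "set_integrable lborel {0..1} (\<lambda>u. - F u)"
    using set_integrable_scaleR_right[of "-1" lborel "{0..1}" F] primitive_imp_integrable[OF F] by simp
  fix u :: real assume u: "u \<in> {0..1}"
  have "(LINT x:{0..u}|lborel. - F x) = - (LINT x:{0..u}|lborel. F x)"
    using set_integral_scaleR_right[of lborel "{0..u}" "-1" F] by simp
  then show "- f u = - f 0 + (LINT x:{0..u}|lborel. - F x)" using primitive_eq[OF F u] by simp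
qed

text \<open>Integration by parts for two absolutely continuous functions is Fubini's theorem on the square
  \<open>[0,u]\<^sup>2\<close>, cut along its diagonal: each of the two integrals is one of the two triangles.\<close>

lemma primitive_mult:
  fixes f F :: "real \<Rightarrow> real" and g G :: "real \<Rightarrow> 'a::euclidean_space"
  assumes f: "primitive F f" and g: "primitive G g"
  shows "primitive (\<lambda>u. F u *\<^sub>R g u + f u *\<^sub>R G u) (\<lambda>u. f u *\<^sub>R g u)"
    and "set_integrable lborel {0..1} (\<lambda>u. F u *\<^sub>R g u)"
    and "set_integrable lborel {0..1} (\<lambda>u. f u *\<^sub>R G u)"
proof -
  have iF: "set_integrable lborel {0..1} F" and iG: "set_integrable lborel {0..1} G"
    using f g primitive_imp_integrable by blast+
  show iFg: "set_integrable lborel {0..1} (\<lambda>u. F u *\<^sub>R g u)"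
  proof -
    obtain C where "\<And>u. u \<in> {0..1} \<Longrightarrow> norm (g u) \<le> C"
      using continuous_on_Icc_bounded[OF primitive_continuous_on[OF g]] by blast
    then have "AE u in lborel. norm (indicator {0..1} u *\<^sub>R g u) \<le> \<bar>C\<bar>"
      by (intro AE_I2) (force simp: indicator_def)
    moreover have "(\<lambda>u. indicator {0..1} u *\<^sub>R g u) \<in> borel_measurable lborel"
      using borel_measurable_continuous_on_indicator[OF _ primitive_continuous_on[OF g]] by simp
    ultimately have "integrable lborel (\<lambda>u. (indicator {0..1} u *\<^sub>R F u) *\<^sub>R (indicator {0..1} u *\<^sub>R g u))"
      using iF integrable_bounded_scaleR_right unfolding set_integrable_def by blast
    also have "(\<lambda>u. (indicator {0..1} u *\<^sub>R F u) *\<^sub>R (indicator {0..1} u *\<^sub>R g u)) =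
       (\<lambda>u. indicator {0..1} u *\<^sub>R (F u *\<^sub>R g u))" by (auto simp: indicator_def)
    finally show ?thesis unfolding set_integrable_def .
  qed
  show ifG: "set_integrable lborel {0..1} (\<lambda>u. f u *\<^sub>R G u)"
    using set_integrable_mult_continuous[OF primitive_continuous_on[OF f] iG] .
  have parts: "(LINT x:{0..u}|lborel. F x *\<^sub>R (g x - g 0)) + (LINT x:{0..u}|lborel. (f x - f 0) *\<^sub>R G x)
      = (f u - f 0) *\<^sub>R (g u - g 0)" if u: "u \<in> {0..1}" for u
  proof -
    define P where "P x = indicator {0..u} x *\<^sub>R F x" for x
    define Q where "Q y = indicator {0..u} y *\<^sub>R G y" for y
    have iP: "integrable lborel P" and iQ: "integrable lborel Q"
      using set_integrable_subinterval[OF iF, of 0 u] set_integrable_subinterval[OF iG, of 0 u] u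
      unfolding set_integrable_def P_def Q_def by auto
    have mP[measurable]: "P \<in> borel_measurable borel" and mQ[measurable]: "Q \<in> borel_measurable borel"
      using iP iQ by auto
    have iPQ: "integrable (lborel \<Otimes>\<^sub>M lborel) (\<lambda>(x, y). P x *\<^sub>R Q y)"
    proof (rule lborel_pair.Fubini_integrable)
      show "(\<lambda>(x, y). P x *\<^sub>R Q y) \<in> borel_measurable (lborel \<Otimes>\<^sub>M lborel)"
        by measurable
      show "integrable lborel (\<lambda>x. LINT y|lborel. norm (case (x, y) of (x, y) \<Rightarrow> P x *\<^sub>R Q y))"
        using iP iQ by simp
      show "AE x in lborel. integrable lborel (\<lambda>y. case (x, y) of (x, y) \<Rightarrow> P x *\<^sub>R Q y)"
        using iQ by simp
    qed
    have iT: "integrable (lborel \<Otimes>\<^sub>M lborel) (\<lambda>(x, y). (if x \<le> y then 1 else 0) *\<^sub>R P x *\<^sub>R Q y)"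
      by (rule Bochner_Integration.integrable_bound[OF iPQ]) (measurable, auto)
    have "(LINT x:{0..u}|lborel. (f x - f 0) *\<^sub>R G x) =
        (LINT y|lborel. LINT x|lborel. (if x \<le> y then 1 else 0) *\<^sub>R P x *\<^sub>R Q y)"
      unfolding set_lebesgue_integral_def
    proof (rule Bochner_Integration.integral_cong[OF refl])
      fix y :: real
      show "indicator {0..u} y *\<^sub>R (f y - f 0) *\<^sub>R G y = (LINT x|lborel. (if x \<le> y then 1 else 0) *\<^sub>R P x *\<^sub>R Q y)"
      proof (cases "y \<in> {0..u}")
        case True
        have "(LINT x|lborel. (if x \<le> y then 1 else 0) *\<^sub>R P x *\<^sub>R Q y)
            = (LINT x|lborel. (indicator {0..y} x *\<^sub>R F x) *\<^sub>R Q y)"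
          by (rule Bochner_Integration.integral_cong) (use True in \<open>auto simp: P_def indicator_def\<close>)
        also have "\<dots> = (LINT x:{0..y}|lborel. F x) *\<^sub>R Q y"
          unfolding set_lebesgue_integral_def
          using set_integrable_subinterval[OF iF, of 0 y] True u
          by (intro integral_scaleR_left) (auto simp: set_integrable_def)
        also have "(LINT x:{0..y}|lborel. F x) = f y - f 0"
          using primitive_eq[OF f, of y] True u by simp
        finally show ?thesis using True by (simp add: Q_def)
      next
        case False
        then show ?thesis by (simp add: Q_def)
      qed
    qed
    also have "\<dots> = (LINT x|lborel. LINT y|lborel. (if x \<le> y then 1 else 0) *\<^sub>R P x *\<^sub>R Q y)"
      using lborel_pair.Fubini_integral[OF iT] .
    finally have A: "(LINT x:{0..u}|lborel. (f x - f 0) *\<^sub>R G x) =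
      (LINT x|lborel. LINT y|lborel. (if x \<le> y then 1 else 0) *\<^sub>R P x *\<^sub>R Q y)" .
    have Gx: "(LINT y|lborel. (if x \<le> y then 1 else 0) *\<^sub>R P x *\<^sub>R Q y)
        = P x *\<^sub>R (g u - g 0) - indicator {0..u} x *\<^sub>R F x *\<^sub>R (g x - g 0)" for x
    proof (cases "x \<in> {0..u}")
      case True
      have "(LINT y|lborel. (if x \<le> y then 1 else 0) *\<^sub>R P x *\<^sub>R Q y) =
          (LINT y|lborel. P x *\<^sub>R (indicator {x..u} y *\<^sub>R G y))"
        by (rule Bochner_Integration.integral_cong) (use True in \<open>auto simp: Q_def indicator_def\<close>)
      also have "\<dots> = P x *\<^sub>R (LINT y:{x..u}|lborel. G y)"
        unfolding set_lebesgue_integral_def by (rule integral_scaleR_right)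
      also have "(LINT y:{x..u}|lborel. G y) = g u - g x"
        using primitive_diff[OF g, of x u] True u by auto
      finally show ?thesis using True by (simp add: P_def algebra_simps)
    next
      case False
      then show ?thesis by (simp add: P_def)
    qed
    have i1: "integrable lborel (\<lambda>x. P x *\<^sub>R (g u - g 0))" using iP by (intro integrable_scaleR_left)
    have i2: "set_integrable lborel {0..u} (\<lambda>x. F x *\<^sub>R (g x - g 0))"
    proof (rule set_integrable_subinterval)
      have "set_integrable lborel {0..1} (\<lambda>x. F x *\<^sub>R g x - F x *\<^sub>R g 0)"
        by (intro set_integral_diff(1) iFg set_integrable_scaleR_left iF)
      then show "set_integrable lborel {0..1} (\<lambda>x. F x *\<^sub>R (g x - g 0))" by (simp add: scaleR_diff_right)
    qed (use u in auto)
    have "(LINT x:{0..u}|lborel. (f x - f 0) *\<^sub>R G x) =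
       (LINT x|lborel. P x *\<^sub>R (g u - g 0)) - (LINT x:{0..u}|lborel. F x *\<^sub>R (g x - g 0))"
      unfolding A unfolding Gx set_lebesgue_integral_def
      using i1 i2 by (intro Bochner_Integration.integral_diff) (auto simp: set_integrable_def)
    also have "(LINT x|lborel. P x *\<^sub>R (g u - g 0)) = (LINT x|lborel. P x) *\<^sub>R (g u - g 0)"
      using iP by (intro integral_scaleR_left)
    also have "(LINT x|lborel. P x) = f u - f 0"
      using primitive_eq[OF f u] unfolding P_def set_lebesgue_integral_def .
    finally show ?thesis by simp
  qed
  have "f u *\<^sub>R g u = f 0 *\<^sub>R g 0 + (LINT x:{0..u}|lborel. F x *\<^sub>R g x + f x *\<^sub>R G x)" if u: "u \<in> {0..1}" for u
  proof -
    have i: "set_integrable lborel {0..u} (\<lambda>x. F x *\<^sub>R g x)" "set_integrable lborel {0..u} (\<lambda>x. f x *\<^sub>R G x)"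
      "set_integrable lborel {0..u} F" "set_integrable lborel {0..u} G"
      using u by (simp_all add: set_integrable_subinterval iFg ifG iF iG)
    have a: "(LINT x:{0..u}|lborel. F x *\<^sub>R (g x - g 0)) = (LINT x:{0..u}|lborel. F x *\<^sub>R g x) - (f u - f 0) *\<^sub>R g 0"
    proof -
      have "(LINT x:{0..u}|lborel. F x *\<^sub>R g 0) = (LINT x:{0..u}|lborel. F x) *\<^sub>R g 0"
        using integral_scaleR_left[of "g 0" lborel "\<lambda>x. indicator {0..u} x *\<^sub>R F x"] i(3)
        by (simp add: set_lebesgue_integral_def set_integrable_def)
      also have "(LINT x:{0..u}|lborel. F x) = f u - f 0" using primitive_eq[OF f u] .
      finally show ?thesis using i by (simp add: scaleR_diff_right set_integral_diff(2))
    qed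
    have b: "(LINT x:{0..u}|lborel. (f x - f 0) *\<^sub>R G x) = (LINT x:{0..u}|lborel. f x *\<^sub>R G x) - f 0 *\<^sub>R (g u - g 0)"
    proof -
      have "(LINT x:{0..u}|lborel. G x) = g u - g 0" using primitive_eq[OF g u] .
      then show ?thesis using i by (simp add: scaleR_diff_left set_integral_diff(2))
    qed
    have "(LINT x:{0..u}|lborel. F x *\<^sub>R g x + f x *\<^sub>R G x) =
       (LINT x:{0..u}|lborel. F x *\<^sub>R g x) + (LINT x:{0..u}|lborel. f x *\<^sub>R G x)"
      using i by (intro set_integral_add)
    moreover have "(LINT x:{0..u}|lborel. F x *\<^sub>R g x) + (LINT x:{0..u}|lborel. f x *\<^sub>R G x)
        = (f u - f 0) *\<^sub>R (g u - g 0) + (f u - f 0) *\<^sub>R g 0 + f 0 *\<^sub>R (g u - g 0)"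
      unfolding parts[OF u, symmetric] a b by simp
    ultimately show ?thesis by (simp add: scaleR_diff_left scaleR_diff_right)
  qed
  then show "primitive (\<lambda>u. F u *\<^sub>R g u + f u *\<^sub>R G u) (\<lambda>u. f u *\<^sub>R g u)"
    unfolding primitive_def using set_integral_add(1)[OF iFg ifG] by blast
qed


text \<open>The two measures with densities the positive and the negative part of \<open>G\<close> agree on all half
  lines, hence everywhere.\<close>

lemma AE_eq_0_if_integrals_eq_0:
  fixes G :: "real \<Rightarrow> 'a::euclidean_space"
  assumes i: "set_integrable lborel {0..1} G"
    and z: "\<And>u. u \<in> {0..1} \<Longrightarrow> (LINT x:{0..u}|lborel. G x) = 0"
  shows "AE x in lborel. x \<in> {0..1} \<longrightarrow> G x = 0"
proof -
  have real: "AE x in lborel. x \<in> {0..1} \<longrightarrow> H x = 0"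
    if i: "set_integrable lborel {0..1} H" and z: "\<And>u. u \<in> {0..1} \<Longrightarrow> (LINT x:{0..u}|lborel. H x) = 0"
    for H :: "real \<Rightarrow> real"
  proof -
    define K where "K x = indicator {0..1} x * H x" for x
    have iK: "integrable lborel K" using i unfolding set_integrable_def K_def by simp
    have [measurable]: "K \<in> borel_measurable borel" using iK by auto
    define P where "P x = ennreal (K x)" for x
    define N where "N x = ennreal (- K x)" for x
    have [measurable]: "P \<in> borel_measurable borel" "N \<in> borel_measurable borel"
      unfolding P_def N_def by auto
    have fP: "(\<integral>\<^sup>+x. P x \<partial>lborel) < \<infinity>" and fN: "(\<integral>\<^sup>+x. N x \<partial>lborel) < \<infinity>"
    proof -
      have b: "(\<integral>\<^sup>+x. ennreal (norm (K x)) \<partial>lborel) < \<infinity>" using iK by (simp add: integrable_iff_bounded)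
      have "(\<integral>\<^sup>+x. P x \<partial>lborel) \<le> (\<integral>\<^sup>+x. ennreal (norm (K x)) \<partial>lborel)"
        unfolding P_def by (intro nn_integral_mono ennreal_leI) auto
      then show "(\<integral>\<^sup>+x. P x \<partial>lborel) < \<infinity>" using b by (rule le_less_trans)
      have "(\<integral>\<^sup>+x. N x \<partial>lborel) \<le> (\<integral>\<^sup>+x. ennreal (norm (K x)) \<partial>lborel)"
        unfolding N_def by (intro nn_integral_mono ennreal_leI) auto
      then show "(\<integral>\<^sup>+x. N x \<partial>lborel) < \<infinity>" using b by (rule le_less_trans)
    qed
    have all0: "(LINT x:{a<..}|lborel. K x) = 0" for a
    proof -
      have i01: "(LINT x:{0..1}|lborel. H x) = 0" using z by simp
      consider "a < 0" | "a \<in> {0..1}" | "a > 1" by fastforce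
      then show ?thesis
      proof cases
        case 1
        then have "(LINT x:{a<..}|lborel. K x) = (LINT x:{0..1}|lborel. H x)"
          unfolding set_lebesgue_integral_def K_def
          by (intro Bochner_Integration.integral_cong) (auto simp: indicator_def)
        then show ?thesis using i01 by simp
      next
        case 2
        have p: "primitive H (\<lambda>u. LINT x:{0..u}|lborel. H x)" by (rule primitive_exists[OF i])
        have "(LINT x:{a..1}|lborel. H x) = 0" using primitive_diff[OF p, of a 1] 2 z by auto
        moreover have "(LINT x:{a<..}|lborel. K x) = (LINT x:{a..1}|lborel. H x)"
          unfolding set_lebesgue_integral_def
        proof (rule integral_discrete_difference[where X="{a}"])
          show "indicator {a<..} x *\<^sub>R K x = indicator {a..1} x *\<^sub>R H x" if "x \<notin> {a}" for x
            using that 2 by (auto simp: K_def indicator_def)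
        qed auto
        ultimately show ?thesis by simp
      next
        case 3
        then have "(LINT x:{a<..}|lborel. K x) = (LINT x|(lborel :: real measure). (0::real))"
          unfolding set_lebesgue_integral_def K_def
          by (intro Bochner_Integration.integral_cong refl) (auto simp: indicator_def)
        then show ?thesis by simp
      qed
    qed
    have PN: "emeasure (density lborel P) {a<..} = emeasure (density lborel N) {a<..}" for a
    proof -
      have inj: "x = y" if "x \<noteq> \<infinity>" "y \<noteq> \<infinity>" "enn2real x = enn2real y" for x y :: ennreal
        using that by (cases x; cases y) auto
      define L where "L x = K x * indicator {a<..} x" for x
      have iL: "integrable lborel L"
        unfolding L_def using iK by (intro integrable_real_mult_indicator) auto
      have "(\<integral>\<^sup>+x. ennreal (L x) \<partial>lborel) \<noteq> \<infinity>" "(\<integral>\<^sup>+x. ennreal (- L x) \<partial>lborel) \<noteq> \<infinity>"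
        using iL by (auto simp: real_integrable_def)
      moreover have "enn2real (\<integral>\<^sup>+x. ennreal (L x) \<partial>lborel) = enn2real (\<integral>\<^sup>+x. ennreal (- L x) \<partial>lborel)"
      proof -
        have "L = (\<lambda>x. indicator {a<..} x *\<^sub>R K x)" by (simp add: L_def fun_eq_iff)
        then have "integral\<^sup>L lborel L = 0" using all0[of a] by (simp only: set_lebesgue_integral_def)
        then show ?thesis using real_lebesgue_integral_def[OF iL] by simp
      qed
      ultimately have "(\<integral>\<^sup>+x. ennreal (L x) \<partial>lborel) = (\<integral>\<^sup>+x. ennreal (- L x) \<partial>lborel)"
        using inj by blast
      moreover have "(\<integral>\<^sup>+x. P x * indicator {a<..} x \<partial>lborel) = (\<integral>\<^sup>+x. ennreal (L x) \<partial>lborel)"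
        by (intro nn_integral_cong) (auto simp: P_def L_def indicator_def)
      moreover have "(\<integral>\<^sup>+x. N x * indicator {a<..} x \<partial>lborel) = (\<integral>\<^sup>+x. ennreal (- L x) \<partial>lborel)"
        by (intro nn_integral_cong) (auto simp: N_def L_def indicator_def)
      ultimately show ?thesis by (simp add: emeasure_density)
    qed
    have "density lborel P = density lborel N"
    proof (rule measure_eqI_lessThan)
      fix x
      have "emeasure (density lborel P) {x<..} \<le> (\<integral>\<^sup>+x. P x \<partial>lborel)"
        by (subst emeasure_density) (auto intro!: nn_integral_mono simp: indicator_def)
      then show "emeasure (density lborel P) {x<..} < \<infinity>" using fP by (rule le_less_trans)
    qed (simp, simp, rule PN)
    moreover have "(\<integral>\<^sup>+x. P x \<partial>lborel) \<noteq> \<infinity>" using fP by simp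
    ultimately have "AE x in lborel. P x = N x"
      using finite_density_unique[of P lborel N] by simp
    then show ?thesis
    proof (rule AE_mp, intro AE_I2 impI)
      fix x :: real assume e: "P x = N x" and x: "x \<in> {0..1}"
      have "K x = 0" using e unfolding P_def N_def
        by (cases "K x \<ge> 0") (simp_all add: ennreal_neg)
      then show "H x = 0" using x by (simp add: K_def)
    qed
  qed
  have "AE x in lborel. \<forall>e\<in>Basis. x \<in> {0..1} \<longrightarrow> G x \<bullet> e = 0"
  proof (rule AE_finite_allI)
    fix e :: 'a assume "e \<in> Basis"
    show "AE x in lborel. x \<in> {0..1} \<longrightarrow> G x \<bullet> e = 0"
    proof (rule real)
      show "set_integrable lborel {0..1} (\<lambda>x. G x \<bullet> e)"
        using integrable_inner_left[of e lborel "\<lambda>x. indicator {0..1} x *\<^sub>R G x"] i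
        by (simp add: set_integrable_def)
      fix u :: real assume u: "u \<in> {0..1}"
      have "set_integrable lborel {0..u} G" using set_integrable_subinterval[OF i, of 0 u] u by simp
      then have "(LINT x|lborel. (indicator {0..u} x *\<^sub>R G x) \<bullet> e) = (LINT x:{0..u}|lborel. G x) \<bullet> e"
        unfolding set_lebesgue_integral_def set_integrable_def by (intro integral_inner_left) auto
      then show "(LINT x:{0..u}|lborel. G x \<bullet> e) = 0" using z[OF u] by (simp add: set_lebesgue_integral_def)
    qed
  qed auto
  then show ?thesis
  proof (rule AE_mp, intro AE_I2 impI)
    fix x :: real assume "\<forall>e\<in>Basis. x \<in> {0..1} \<longrightarrow> G x \<bullet> e = 0" "x \<in> {0..1}"
    then show "G x = 0" using euclidean_all_zero_iff[of "G x"] by simp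
  qed
qed

section \<open>Test functions and weak derivatives\<close>

lemma set_integral_continuous_eq:
  fixes f :: "real \<Rightarrow> 'a::euclidean_space"
  assumes "continuous_on {a..b} f"
  shows "(LINT x:{a..b}|lborel. f x) = integral {a..b} f"
  by (rule set_borel_integral_eq_integral(2)[OF borel_integrable_atLeastAtMost'[OF assms]])

text \<open>The increment of an antiderivative over one period is constant because \<open>q\<close> is periodic, and it equals
  the mean value of \<open>q\<close>.\<close>

lemma periodic_antiderivative:
  fixes q :: "real \<Rightarrow> 'a::euclidean_space"
  assumes c: "continuous_on UNIV q" and per: "\<And>u. q (u + 1) = q u" and z: "(LINT x:{0..1}|lborel. q x) = 0"
  shows "\<exists>F. F 0 = 0 \<and> (\<forall>u. (F has_vector_derivative q u) (at u)) \<and> (\<forall>u. F (u + 1) = F u)"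
proof -
  have "isCont q x" for x using c by (simp add: continuous_on_eq_continuous_at)
  then obtain F0 where F0: "\<And>x. (F0 has_vector_derivative q x) (at x)"
    using einterval_antiderivative[of "-\<infinity>" "\<infinity>" q] by auto
  define F where "F u = F0 u - F0 0" for u
  have F: "(F has_vector_derivative q x) (at x)" for x
    unfolding F_def using has_vector_derivative_diff[OF F0[of x] has_vector_derivative_const, of "F0 0"] by simp
  define G where "G u = F (u + 1) - F u" for u
  have G: "(G has_derivative (\<lambda>h. 0)) (at x)" for x
  proof -
    have "((F \<circ> (\<lambda>u. u + 1)) has_vector_derivative 1 *\<^sub>R q (x + 1)) (at x)"
    proof (rule vector_diff_chain_at)
      show "((\<lambda>u. u + 1) has_vector_derivative 1) (at x)" by (auto intro!: derivative_eq_intros)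
    qed (rule F)
    from has_vector_derivative_diff[OF this F[of x]] show ?thesis
      unfolding G_def by (simp add: per has_vector_derivative_def o_def)
  qed
  have "\<exists>c. \<forall>x. G x = c"
    using has_derivative_zero_constant[OF convex_UNIV, of G] G by (auto intro: has_derivative_at_withinI)
  then obtain c where Gc: "\<And>x. G x = c" by blast
  have "(q has_integral (F 1 - F 0)) {0..1}"
    by (rule fundamental_theorem_of_calculus) (auto intro: has_vector_derivative_at_within F)
  then have "F 1 - F 0 = (LINT x:{0..1}|lborel. q x)"
    using set_integral_continuous_eq[of 0 1 q] continuous_on_subset[OF c] by (simp add: integral_unique)
  then have "c = 0" using Gc[of 0] z by (simp add: G_def)
  then have "F (u + 1) = F u" for u using Gc[of u] by (simp add: G_def)
  moreover have "F 0 = 0" by (simp add: F_def)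
  ultimately show ?thesis using F by blast
qed

lemma smooth_fun_deriv: "smooth_fun \<phi> \<Longrightarrow> smooth_fun (deriv \<phi>)"
  unfolding smooth_fun_def by (metis funpow_swap1 funpow.simps(2) o_apply)

lemma smooth_fun_has_derivative:
  assumes "smooth_fun \<phi>"
  shows "(\<phi> has_real_derivative deriv \<phi> x) (at x)"
  using assms unfolding smooth_fun_def by (metis field_differentiable_derivI funpow_0)

lemma smooth_fun_continuous:
  assumes "smooth_fun \<phi>"
  shows "continuous_on A \<phi>" "continuous_on A (deriv \<phi>)"
  using smooth_fun_has_derivative[OF assms] smooth_fun_has_derivative[OF smooth_fun_deriv[OF assms]]
  by (meson DERIV_isCont continuous_at_imp_continuous_on)+

lemma smooth_funI:
  assumes "\<And>x. (\<phi> has_real_derivative \<xi> x) (at x)" "smooth_fun \<xi>"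
  shows "smooth_fun \<phi>" "deriv \<phi> = \<xi>"
proof -
  show d: "deriv \<phi> = \<xi>" using assms(1) by (intro ext DERIV_imp_deriv)
  show "smooth_fun \<phi>" unfolding smooth_fun_def
  proof (intro allI)
    fix k x show "(deriv ^^ k) \<phi> field_differentiable at x"
    proof (cases k)
      case 0
      then show ?thesis using assms(1) by (auto simp: field_differentiable_def)
    next
      case (Suc j)
      then have "(deriv ^^ k) \<phi> = (deriv ^^ j) \<xi>" using d by (simp add: funpow_swap1)
      then show ?thesis using assms(2) unfolding smooth_fun_def by metis
    qed
  qed
qed

text \<open>A supply of test functions that is closed under products and derivatives. The phase \<open>v\<close> is the point
  at which a peak is wanted.\<close>

inductive trig_poly :: "real \<Rightarrow> (real \<Rightarrow> real) \<Rightarrow> bool" for v :: real where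
  const: "trig_poly v (\<lambda>u. c)"
| cos: "trig_poly v (\<lambda>u. cos (2 * pi * (u - v)))"
| sin: "trig_poly v (\<lambda>u. sin (2 * pi * (u - v)))"
| add: "trig_poly v f \<Longrightarrow> trig_poly v g \<Longrightarrow> trig_poly v (\<lambda>u. f u + g u)"
| mult: "trig_poly v f \<Longrightarrow> trig_poly v g \<Longrightarrow> trig_poly v (\<lambda>u. f u * g u)"

lemma trig_poly_derivative:
  "trig_poly v f \<Longrightarrow> \<exists>f'. trig_poly v f' \<and> (\<forall>x. (f has_real_derivative f' x) (at x))"
proof (induction rule: trig_poly.induct)
  case (const c)
  then show ?case by (intro exI[of _ "\<lambda>u. 0"]) (auto intro: trig_poly.const)
next
  case cos
  have "trig_poly v (\<lambda>u. (- 2 * pi) * sin (2 * pi * (u - v)))"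
    by (rule trig_poly.mult[OF trig_poly.const trig_poly.sin])
  moreover have "((\<lambda>u. cos (2 * pi * (u - v))) has_real_derivative (- 2 * pi) * sin (2 * pi * (x - v))) (at x)" for x
    by (auto intro!: derivative_eq_intros)
  ultimately show ?case by blast
next
  case sin
  have "trig_poly v (\<lambda>u. (2 * pi) * cos (2 * pi * (u - v)))"
    by (rule trig_poly.mult[OF trig_poly.const trig_poly.cos])
  moreover have "((\<lambda>u. sin (2 * pi * (u - v))) has_real_derivative (2 * pi) * cos (2 * pi * (x - v))) (at x)" for x
    by (auto intro!: derivative_eq_intros)
  ultimately show ?case by blast
next
  case (add f g)
  then obtain f' g' where d: "trig_poly v f'" "\<And>x. (f has_real_derivative f' x) (at x)"
    "trig_poly v g'" "\<And>x. (g has_real_derivative g' x) (at x)" by blast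
  show ?case
    by (rule exI[of _ "\<lambda>u. f' u + g' u"]) (auto intro!: trig_poly.add derivative_eq_intros d)
next
  case (mult f g)
  then obtain f' g' where d: "trig_poly v f'" "\<And>x. (f has_real_derivative f' x) (at x)"
    "trig_poly v g'" "\<And>x. (g has_real_derivative g' x) (at x)" by blast
  have "trig_poly v (\<lambda>u. f' u * g u + g' u * f u)"
    by (intro trig_poly.add trig_poly.mult d mult.hyps)
  moreover have "((\<lambda>u. f u * g u) has_real_derivative f' x * g x + g' x * f x) (at x)" for x
    using DERIV_mult[OF d(2)[of x] d(4)[of x]] by simp
  ultimately show ?case by blast
qed

lemma trig_poly_in_circle_tests:
  assumes "trig_poly v f"
  shows "f \<in> circle_tests"
proof -
  have "trig_poly v ((deriv ^^ k) f)" for k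
  proof (induction k)
    case 0
    then show ?case using assms by simp
  next
    case (Suc k)
    then obtain f' where f': "trig_poly v f'" "\<And>x. ((deriv ^^ k) f has_real_derivative f' x) (at x)"
      using trig_poly_derivative by blast
    have "deriv ((deriv ^^ k) f) = f'" using f'(2) by (intro ext DERIV_imp_deriv)
    then show ?case using f'(1) by simp
  qed
  then have "smooth_fun f"
    unfolding smooth_fun_def field_differentiable_def using trig_poly_derivative by blast
  moreover have "f (u + 1) = f u" for u
    using assms
  proof (induction rule: trig_poly.induct)
    case cos
    have "2 * pi * (u + 1 - v) = 2 * pi * (u - v) + 2 * pi" by (simp add: algebra_simps)
    then show ?case by (metis cos_periodic)
  next
    case sin
    have "2 * pi * (u + 1 - v) = 2 * pi * (u - v) + 2 * pi" by (simp add: algebra_simps)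
    then show ?case by (metis sin_periodic)
  qed auto
  ultimately show ?thesis unfolding circle_tests_def by simp
qed

lemma trig_poly_power: "trig_poly v f \<Longrightarrow> trig_poly v (\<lambda>u. f u ^ n)"
  by (induction n) (auto intro: trig_poly.const[of v 1] trig_poly.mult)

text \<open>If \<open>f v \<noteq> 0\<close>, then testing \<open>f\<close> with high powers of \<open>1 - cos (2 \<pi> d) + cos (2 \<pi> (u - v))\<close> gives
  arbitrarily large values: this trigonometric polynomial is at least \<open>1\<close> at distance less than \<open>d\<close> from
  \<open>v\<close>, at least \<open>1 + \<eta> > 1\<close> at distance at most \<open>d / 2\<close>, and bounded by \<open>1\<close> in modulus on the rest of
  \<open>[0,1]\<close>.\<close>

lemma continuous_orthogonal_to_tests:
  fixes f :: "real \<Rightarrow> 'a::euclidean_space"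
  assumes c: "continuous_on {0..1} f"
    and z: "\<And>\<phi>. \<phi> \<in> circle_tests \<Longrightarrow> (LINT u:{0..1}|lborel. \<phi> u *\<^sub>R f u) = 0"
    and v: "v \<in> {0<..<1}"
  shows "f v = 0"
proof (rule ccontr)
  assume nz: "f v \<noteq> 0"
  define g where "g u = f u \<bullet> f v" for u
  have cg: "continuous_on {0..1} g" unfolding g_def by (intro continuous_intros c)
  define a where "a = g v / 2"
  have a: "0 < a" unfolding a_def g_def using nz by simp
  have "\<exists>d>0. \<forall>u\<in>{0..1}. dist u v < d \<longrightarrow> dist (g u) (g v) < a"
    using cg v a unfolding continuous_on_iff by (meson atLeastAtMost_iff greaterThanLessThan_iff less_imp_le)
  then obtain d0 where d0: "d0 > 0" "\<And>u. u \<in> {0..1} \<Longrightarrow> \<bar>u - v\<bar> < d0 \<Longrightarrow> \<bar>g u - g v\<bar> < a"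
    by (auto simp: dist_real_def)
  define d where "d = min (min d0 (min v (1 - v))) (1/2)"
  have d: "0 < d" "d \<le> 1/2" "d \<le> v" "d \<le> 1 - v" "d \<le> d0" using d0 v by (auto simp: d_def min_def)
  have gd: "a \<le> g u" if "\<bar>u - v\<bar> < d" for u
    using d0(2)[of u] that d unfolding a_def by (simp add: abs_if split: if_splits)
  define K where "K u = (1 - cos (2 * pi * d)) + cos (2 * pi * (u - v))" for u
  define \<eta> where "\<eta> = cos (pi * d) - cos (2 * pi * d)"
  have \<eta>: "0 < \<eta>" unfolding \<eta>_def using d by (simp add: cos_monotone_0_pi)
  have cosabs: "cos (2 * pi * (u - v)) = cos (2 * pi * \<bar>u - v\<bar>)" for u
    by (cases "u \<le> v") (auto simp: abs_if algebra_simps intro: cos_minus[symmetric, THEN trans] arg_cong[where f=cos])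
  have K1: "1 + \<eta> \<le> K u" if "\<bar>u - v\<bar> \<le> d / 2" for u
  proof -
    have "cos (pi * d) \<le> cos (2 * pi * \<bar>u - v\<bar>)"
      using that d by (intro cos_monotone_0_pi_le) (auto simp: field_simps)
    then show ?thesis unfolding K_def \<eta>_def cosabs by simp
  qed
  have K2: "1 \<le> K u" if "\<bar>u - v\<bar> < d" for u
  proof -
    have "cos (2 * pi * d) \<le> cos (2 * pi * \<bar>u - v\<bar>)"
      using that d by (intro cos_monotone_0_pi_le) (auto simp: field_simps)
    then show ?thesis unfolding K_def cosabs by simp
  qed
  have K3: "\<bar>K u\<bar> \<le> 1" if "d \<le> \<bar>u - v\<bar>" "u \<in> {0..1}" for u
  proof -
    have le: "\<bar>u - v\<bar> \<le> 1 - d" using that v d by (auto simp: abs_if)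
    have "cos (2 * pi * \<bar>u - v\<bar>) \<le> cos (2 * pi * d)"
    proof (cases "\<bar>u - v\<bar> \<le> 1/2")
      case True
      then show ?thesis using that d by (intro cos_monotone_0_pi_le) (auto simp: field_simps)
    next
      case False
      have "cos (2 * pi * \<bar>u - v\<bar>) = cos (2 * pi - 2 * pi * \<bar>u - v\<bar>)"
        by (simp add: cos_diff)
      also have "2 * pi - 2 * pi * \<bar>u - v\<bar> = 2 * pi * (1 - \<bar>u - v\<bar>)" by (simp add: algebra_simps)
      also have "cos (2 * pi * (1 - \<bar>u - v\<bar>)) \<le> cos (2 * pi * d)"
      proof (rule cos_monotone_0_pi_le)
        show "2 * pi * d \<le> 2 * pi * (1 - \<bar>u - v\<bar>)" using le by (intro mult_left_mono) auto
        show "2 * pi * (1 - \<bar>u - v\<bar>) \<le> pi" using False by (simp add: algebra_simps)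
      qed (use d in simp)
      finally show ?thesis .
    qed
    then show ?thesis
      unfolding K_def cosabs using cos_le_one[of "2 * pi * d"] cos_ge_minus_one[of "2 * pi * \<bar>u - v\<bar>"]
      by linarith
  qed
  define I where "I = (LINT u:{0..1}|lborel. \<bar>g u\<bar>)"
  have ig: "set_integrable lborel {0..1} (\<lambda>u. \<bar>g u\<bar>)"
    by (intro borel_integrable_atLeastAtMost' continuous_intros cg)
  have le: "(1 + \<eta>) ^ n * a * d \<le> I" for n
  proof -
    have tp: "trig_poly v (\<lambda>u. K u ^ n)"
      unfolding K_def by (intro trig_poly_power trig_poly.add trig_poly.const trig_poly.cos)
    have cK: "continuous_on {0..1} K" unfolding K_def by (intro continuous_intros)
    have i: "set_integrable lborel {0..1} (\<lambda>u. K u ^ n *\<^sub>R f u)"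
      by (intro borel_integrable_atLeastAtMost' continuous_intros cK c)
    have "(LINT u:{0..1}|lborel. K u ^ n * g u) = (LINT u:{0..1}|lborel. K u ^ n *\<^sub>R f u) \<bullet> f v"
    proof -
      have "(LINT u|lborel. (indicator {0..1} u *\<^sub>R (K u ^ n *\<^sub>R f u)) \<bullet> f v) = (LINT u:{0..1}|lborel. K u ^ n *\<^sub>R f u) \<bullet> f v"
        using i unfolding set_integrable_def set_lebesgue_integral_def by (rule integral_inner_left)
      then show ?thesis by (simp add: set_lebesgue_integral_def g_def mult.assoc)
    qed
    also have "\<dots> = 0" using z[OF trig_poly_in_circle_tests[OF tp]] by simp
    finally have I0: "(LINT u:{0..1}|lborel. K u ^ n * g u) = 0" .
    define J where "J = {v - d/2..v + d/2}"
    have iJ: "set_integrable lborel {0..1} (\<lambda>u. (1 + \<eta>) ^ n * a * indicator J u :: real)"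
    proof -
      have "integrable lborel (\<lambda>u. (1 + \<eta>) ^ n * a * indicator J u :: real)"
        unfolding J_def using d by (intro integrable_mult_right impI integrable_real_indicator) auto
      also have "(\<lambda>u. (1 + \<eta>) ^ n * a * indicator J u :: real) =
          (\<lambda>u. indicator {0..1} u *\<^sub>R ((1 + \<eta>) ^ n * a * indicator J u))"
        using d by (auto simp: J_def indicator_def fun_eq_iff)
      finally show ?thesis unfolding set_integrable_def .
    qed
    have "(LINT u:{0..1}|lborel. (1 + \<eta>) ^ n * a * indicator J u - \<bar>g u\<bar>) \<le> (LINT u:{0..1}|lborel. K u ^ n * g u)"
    proof (rule set_integral_mono)
      show "set_integrable lborel {0..1} (\<lambda>u. (1 + \<eta>) ^ n * a * indicator J u - \<bar>g u\<bar>)"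
        by (rule set_integral_diff(1)[OF iJ ig])
      show "set_integrable lborel {0..1} (\<lambda>u. K u ^ n * g u)"
        by (intro borel_integrable_atLeastAtMost' continuous_intros cK cg)
      fix u :: real assume u: "u \<in> {0..1}"
      consider "\<bar>u - v\<bar> \<le> d/2" | "d/2 < \<bar>u - v\<bar>" "\<bar>u - v\<bar> < d" | "d \<le> \<bar>u - v\<bar>" by linarith
      then show "(1 + \<eta>) ^ n * a * indicator J u - \<bar>g u\<bar> \<le> K u ^ n * g u"
      proof cases
        case 1
        then have "(1 + \<eta>) ^ n \<le> K u ^ n" using K1 \<eta> by (intro power_mono) auto
        moreover have "a \<le> g u" using 1 d by (intro gd) auto
        moreover have "0 \<le> K u" using K1[OF 1] \<eta> by simp
        ultimately have "(1 + \<eta>) ^ n * a \<le> K u ^ n * g u" using a \<eta> by (intro mult_mono) auto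
        moreover have "(1 + \<eta>) ^ n * a * indicator J u \<le> (1 + \<eta>) ^ n * a" using a \<eta> by (auto simp: indicator_def)
        ultimately show ?thesis using abs_ge_zero[of "g u"] by linarith
      next
        case 2
        have "0 \<le> K u ^ n * g u" using K2[OF 2(2)] gd[OF 2(2)] a by simp
        moreover have "u \<notin> J" using 2(1) by (auto simp: J_def abs_if split: if_splits)
        ultimately show ?thesis by (simp add: indicator_def)
      next
        case 3
        have "\<bar>K u ^ n\<bar> \<le> 1" using K3[OF 3 u] by (simp add: power_abs power_le_one)
        then have "\<bar>K u ^ n * g u\<bar> \<le> \<bar>g u\<bar>" by (simp add: abs_mult mult_left_le_one_le)
        moreover have "u \<notin> J" using 3 d by (auto simp: J_def abs_if split: if_splits)
        ultimately show ?thesis by simp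
      qed
    qed
    also have "\<dots> = 0" by (rule I0)
    also have "(LINT u:{0..1}|lborel. (1 + \<eta>) ^ n * a * indicator J u - \<bar>g u\<bar>) =
       (LINT u:{0..1}|lborel. (1 + \<eta>) ^ n * a * indicator J u) - I"
      unfolding I_def by (rule set_integral_diff(2)[OF iJ ig])
    also have "(LINT u:{0..1}|lborel. (1 + \<eta>) ^ n * a * indicator J u) = (LINT u|lborel. (1 + \<eta>) ^ n * a * indicator J u)"
      unfolding set_lebesgue_integral_def
      by (rule Bochner_Integration.integral_cong) (use d in \<open>auto simp: J_def indicator_def\<close>)
    also have "\<dots> = (1 + \<eta>) ^ n * a * d" using d by (simp add: J_def)
    finally show ?thesis by simp
  qed
  obtain n where "I / (a * d) < (1 + \<eta>) ^ n" using real_arch_pow[of "1 + \<eta>"] \<eta> by auto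
  then have "I < (1 + \<eta>) ^ n * a * d" using a d by (simp add: field_simps)
  with le[of n] show False by simp
qed

lemma circle_tests_const: "(\<lambda>u. c) \<in> circle_tests"
  by (rule trig_poly_in_circle_tests[OF trig_poly.const])

lemma circle_tests_deriv:
  assumes "\<phi> \<in> circle_tests"
  shows "deriv \<phi> \<in> circle_tests"
proof -
  have s: "smooth_fun \<phi>" and p: "\<And>u. \<phi> (u + 1) = \<phi> u" using assms by (auto simp: circle_tests_def)
  have "deriv \<phi> (u + 1) = deriv \<phi> u" for u
  proof -
    have "(\<phi> has_real_derivative deriv \<phi> (u + 1)) (at (u + 1))" by (rule smooth_fun_has_derivative[OF s])
    then have "((\<lambda>x. \<phi> (x + 1)) has_real_derivative deriv \<phi> (u + 1)) (at u)"
      by (simp add: DERIV_shift)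
    then show ?thesis using smooth_fun_has_derivative[OF s, of u] p DERIV_unique by simp
  qed
  then show ?thesis using smooth_fun_deriv[OF s] by (simp add: circle_tests_def)
qed

lemma circle_tests_antiderivative:
  assumes "\<xi> \<in> circle_tests" and "(LINT u:{0..1}|lborel. \<xi> u) = 0"
  shows "\<exists>\<phi>\<in>circle_tests. deriv \<phi> = \<xi>"
proof -
  have s: "smooth_fun \<xi>" and p: "\<And>u. \<xi> (u + 1) = \<xi> u" using assms by (auto simp: circle_tests_def)
  obtain F where F: "\<And>u. (F has_vector_derivative \<xi> u) (at u)" "\<And>u. F (u + 1) = F u"
    using periodic_antiderivative[OF smooth_fun_continuous(1)[OF s] p assms(2)] by blast
  then have "(F has_real_derivative \<xi> u) (at u)" for u by (simp add: has_real_derivative_iff_has_vector_derivative)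
  from smooth_funI[OF this s] F(2) show ?thesis unfolding circle_tests_def by blast
qed

lemma circle_tests_minus_const:
  assumes "\<xi> \<in> circle_tests"
  shows "(\<lambda>u. \<xi> u - c) \<in> circle_tests"
proof -
  have s: "smooth_fun \<xi>" and p: "\<And>u. \<xi> (u + 1) = \<xi> u" using assms by (auto simp: circle_tests_def)
  have "((\<lambda>u. \<xi> u - c) has_real_derivative deriv \<xi> x) (at x)" for x
    using DERIV_diff[OF smooth_fun_has_derivative[OF s] DERIV_const[of c]] by simp
  from smooth_funI(1)[OF this smooth_fun_deriv[OF s]] p show ?thesis by (simp add: circle_tests_def)
qed

lemma integral_by_parts_smooth:
  fixes p g :: "real \<Rightarrow> 'a::euclidean_space"
  assumes "smooth_fun \<phi>" and "primitive g p"
  shows "(LINT u:{0..1}|lborel. deriv \<phi> u *\<^sub>R p u) =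
     \<phi> 1 *\<^sub>R p 1 - \<phi> 0 *\<^sub>R p 0 - (LINT u:{0..1}|lborel. \<phi> u *\<^sub>R g u)"
proof -
  have pr: "primitive (deriv \<phi>) \<phi>"
  proof (rule primitive_C1)
    show "(\<phi> has_vector_derivative deriv \<phi> u) (at u within {0..1})" for u
      using smooth_fun_has_derivative[OF assms(1), of u]
      by (simp add: has_real_derivative_iff_has_vector_derivative has_vector_derivative_at_within)
  qed (rule smooth_fun_continuous(2)[OF assms(1)])
  note m = primitive_mult[OF pr assms(2)]
  have "(LINT u:{0..1}|lborel. deriv \<phi> u *\<^sub>R p u + \<phi> u *\<^sub>R g u) = \<phi> 1 *\<^sub>R p 1 - \<phi> 0 *\<^sub>R p 0"
    using primitive_eq[OF m(1), of 1] by simp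
  moreover have "(LINT u:{0..1}|lborel. deriv \<phi> u *\<^sub>R p u + \<phi> u *\<^sub>R g u) =
     (LINT u:{0..1}|lborel. deriv \<phi> u *\<^sub>R p u) + (LINT u:{0..1}|lborel. \<phi> u *\<^sub>R g u)"
    by (rule set_integral_add(2)[OF m(2,3)])
  ultimately show ?thesis by (simp add: eq_diff_eq)
qed

text \<open>The argument of du Bois-Reymond: a test function minus its mean value is the derivative of a test
  function, so a function that is orthogonal to all such derivatives is, up to its mean value, orthogonal
  to all test functions.\<close>

lemma orthogonal_to_derivatives:
  fixes h :: "real \<Rightarrow> 'a::euclidean_space"
  assumes i: "set_integrable lborel {0..1} h"
    and z: "\<And>\<phi>. \<phi> \<in> circle_tests \<Longrightarrow> (LINT u:{0..1}|lborel. deriv \<phi> u *\<^sub>R h u) = 0"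
    and t: "\<xi> \<in> circle_tests"
  shows "(LINT u:{0..1}|lborel. \<xi> u *\<^sub>R (h u - (LINT x:{0..1}|lborel. h x))) = 0"
proof -
  define c where "c = (LINT u:{0..1}|lborel. \<xi> u)"
  define m where "m = (LINT x:{0..1}|lborel. h x)"
  have s: "smooth_fun \<xi>" using t by (auto simp: circle_tests_def)
  have i\<xi>: "set_integrable lborel {0..1} \<xi>" by (intro borel_integrable_atLeastAtMost' smooth_fun_continuous s)
  have ic: "set_integrable lborel {0..1} (\<lambda>u::real. b::real)" for b by (intro borel_integrable_atLeastAtMost' continuous_intros)
  have "(LINT u:{0..1}|lborel. \<xi> u - c) = (LINT u:{0..1}|lborel. \<xi> u) - (LINT u:{0..1::real}|lborel. c)"
    by (rule set_integral_diff(2)[OF i\<xi> ic])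
  also have "(LINT u:{0..1::real}|lborel. c) = c" by (simp add: set_lebesgue_integral_def)
  finally have "(LINT u:{0..1}|lborel. \<xi> u - c) = 0" by (simp add: c_def)
  then obtain \<phi> where \<phi>: "\<phi> \<in> circle_tests" "deriv \<phi> = (\<lambda>u. \<xi> u - c)"
    using circle_tests_antiderivative[OF circle_tests_minus_const[OF t]] by blast
  have i1: "set_integrable lborel {0..1} (\<lambda>u. \<xi> u *\<^sub>R h u)"
    by (intro set_integrable_mult_continuous smooth_fun_continuous s i)
  have i2: "set_integrable lborel {0..1} (\<lambda>u. c *\<^sub>R h u)" by (intro set_integrable_scaleR_right i)
  have i3: "set_integrable lborel {0..1} (\<lambda>u. \<xi> u *\<^sub>R m)"
    by (intro borel_integrable_atLeastAtMost' continuous_intros smooth_fun_continuous s)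
  have "0 = (LINT u:{0..1}|lborel. \<xi> u *\<^sub>R h u - c *\<^sub>R h u)"
    using z[OF \<phi>(1)] by (simp add: \<phi>(2) scaleR_diff_left)
  also have "\<dots> = (LINT u:{0..1}|lborel. \<xi> u *\<^sub>R h u) - (LINT u:{0..1}|lborel. c *\<^sub>R h u)"
    by (rule set_integral_diff(2)[OF i1 i2])
  also have "(LINT u:{0..1}|lborel. c *\<^sub>R h u) = c *\<^sub>R m" by (simp add: m_def)
  also have "c *\<^sub>R m = (LINT u:{0..1}|lborel. \<xi> u *\<^sub>R m)"
    using integral_scaleR_left[of m lborel "\<lambda>u. indicator {0..1} u *\<^sub>R \<xi> u"] i\<xi>
    by (simp add: c_def set_lebesgue_integral_def set_integrable_def)
  also have "(LINT u:{0..1}|lborel. \<xi> u *\<^sub>R h u) - (LINT u:{0..1}|lborel. \<xi> u *\<^sub>R m) =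
     (LINT u:{0..1}|lborel. \<xi> u *\<^sub>R h u - \<xi> u *\<^sub>R m)"
    by (rule set_integral_diff(2)[OF i1 i3, symmetric])
  finally show ?thesis by (simp add: m_def scaleR_diff_right)
qed

text \<open>The fundamental lemma for integrable functions reduces to the continuous one: by integration by parts
  the primitive of \<open>g\<close> is orthogonal to all derivatives of test functions, hence constant, and it vanishes
  at \<open>0\<close>.\<close>

lemma orthogonal_to_tests:
  fixes g :: "real \<Rightarrow> 'a::euclidean_space"
  assumes i: "set_integrable lborel {0..1} g"
    and z: "\<And>\<phi>. \<phi> \<in> circle_tests \<Longrightarrow> (LINT u:{0..1}|lborel. \<phi> u *\<^sub>R g u) = 0"
  shows "AE x in lborel. x \<in> {0..1} \<longrightarrow> g x = 0"
proof -
  define p where "p u = (LINT x:{0..u}|lborel. g x)" for u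
  have p: "primitive g p" unfolding p_def by (rule primitive_exists[OF i])
  have p0: "p 0 = 0" unfolding p_def by (rule set_integral_singleton)
  have p1: "p 1 = 0" using z[OF circle_tests_const[of 1]] by (simp add: p_def)
  have cp: "continuous_on {0..1} p" by (rule primitive_continuous_on[OF p])
  have ip: "set_integrable lborel {0..1} p" by (rule borel_integrable_atLeastAtMost'[OF cp])
  have zp: "(LINT u:{0..1}|lborel. deriv \<phi> u *\<^sub>R p u) = 0" if "\<phi> \<in> circle_tests" for \<phi>
    using integral_by_parts_smooth[OF _ p, of \<phi>] that z[OF that] p0 p1 by (simp add: circle_tests_def)
  define m where "m = (LINT x:{0..1}|lborel. p x)"
  have "p v - m = 0" if "v \<in> {0<..<1}" for v
    using continuous_orthogonal_to_tests[of "\<lambda>u. p u - m" v]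
      orthogonal_to_derivatives[OF ip zp] that cp
    by (simp add: m_def continuous_on_diff)
  then have pm: "p v = m" if "v \<in> {0<..<1}" for v using that by simp
  have "p 0 = m"
    by (rule continuous_constant_on_closure[of "{0<..<1}" p]) (auto simp: cp pm closure_greaterThanLessThan)
  then have "p v = 0" if "v \<in> {0..1}" for v
  proof -
    have "v = 0 \<or> v = 1 \<or> v \<in> {0<..<1}" using that by auto
    then show ?thesis using p0 p1 pm \<open>p 0 = m\<close> by metis
  qed
  then show ?thesis by (intro AE_eq_0_if_integrals_eq_0[OF i]) (simp add: p_def)
qed

lemma set_integral_diff_tests:
  fixes f g :: "real \<Rightarrow> 'a::euclidean_space"
  assumes "smooth_fun \<phi>" "set_integrable lborel {0..1} f" "set_integrable lborel {0..1} g"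
  shows "(LINT u:{0..1}|lborel. \<phi> u *\<^sub>R (f u - g u)) =
    (LINT u:{0..1}|lborel. \<phi> u *\<^sub>R f u) - (LINT u:{0..1}|lborel. \<phi> u *\<^sub>R g u)"
  using set_integral_diff(2)[OF set_integrable_mult_continuous[OF smooth_fun_continuous(1)[OF assms(1)] assms(2)]
      set_integrable_mult_continuous[OF smooth_fun_continuous(1)[OF assms(1)] assms(3)]]
  by (simp add: scaleR_diff_right)

lemma weak_deriv_unique:
  assumes "square_integrable g" "square_integrable h"
    and "weak_deriv circle_tests j f g" "weak_deriv circle_tests j f h"
  shows "AE x in lborel. x \<in> {0..1} \<longrightarrow> g x = h x"
proof -
  have i: "set_integrable lborel {0..1} g" "set_integrable lborel {0..1} h"
    using assms square_integrable_imp_set_integrable by blast+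
  have "AE x in lborel. x \<in> {0..1} \<longrightarrow> g x - h x = 0"
  proof (rule orthogonal_to_tests)
    show "set_integrable lborel {0..1} (\<lambda>x. g x - h x)" using i by (intro set_integral_diff(1))
    fix \<phi> assume t: "\<phi> \<in> circle_tests"
    have "(-1) ^ j *\<^sub>R (LINT u:{0..1}|lborel. \<phi> u *\<^sub>R g u) = (-1) ^ j *\<^sub>R (LINT u:{0..1}|lborel. \<phi> u *\<^sub>R h u)"
      using bspec[OF assms(3)[unfolded weak_deriv_def] t] bspec[OF assms(4)[unfolded weak_deriv_def] t] by (rule trans[OF sym])
    then have "(LINT u:{0..1}|lborel. \<phi> u *\<^sub>R g u) = (LINT u:{0..1}|lborel. \<phi> u *\<^sub>R h u)" by simp
    then show "(LINT u:{0..1}|lborel. \<phi> u *\<^sub>R (g u - h u)) = 0"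
      using set_integral_diff_tests[OF _ i, of \<phi>] t by (simp add: circle_tests_def)
  qed
  then show ?thesis by simp
qed

lemma weak_deriv_0: "weak_deriv T 0 f f"
  unfolding weak_deriv_def by simp

lemma weak_deriv_Suc:
  assumes "weak_deriv T j f g" "weak_deriv T 1 g k" "\<And>\<phi>. \<phi> \<in> T \<Longrightarrow> deriv \<phi> \<in> T"
  shows "weak_deriv T (Suc j) f k"
  unfolding weak_deriv_def
proof
  fix \<phi> assume t: "\<phi> \<in> T"
  have "(LINT u:{0..1}|lborel. (deriv ^^ Suc j) \<phi> u *\<^sub>R f u) = (LINT u:{0..1}|lborel. (deriv ^^ j) (deriv \<phi>) u *\<^sub>R f u)"
    by (simp add: funpow_swap1)
  also have "\<dots> = (-1) ^ j *\<^sub>R (LINT u:{0..1}|lborel. deriv \<phi> u *\<^sub>R g u)"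
    using assms(1) assms(3)[OF t] unfolding weak_deriv_def by blast
  also have "(LINT u:{0..1}|lborel. deriv \<phi> u *\<^sub>R g u) = - (LINT u:{0..1}|lborel. \<phi> u *\<^sub>R k u)"
    using assms(2) t unfolding weak_deriv_def by simp
  finally show "(LINT u:{0..1}|lborel. (deriv ^^ Suc j) \<phi> u *\<^sub>R f u) = (-1) ^ Suc j *\<^sub>R (LINT u:{0..1}|lborel. \<phi> u *\<^sub>R k u)"
    by simp
qed

text \<open>Membership in a Sobolev space provides weak derivatives of each order separately; this lemma relates
  consecutive ones.\<close>

lemma weak_deriv_quotient:
  assumes "weak_deriv T j f g" "weak_deriv T (Suc j) f k" "\<And>\<phi>. \<phi> \<in> T \<Longrightarrow> deriv \<phi> \<in> T"
  shows "weak_deriv T 1 g k"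
  unfolding weak_deriv_def
proof
  fix \<phi> assume t: "\<phi> \<in> T"
  have "(-1) ^ j *\<^sub>R (LINT u:{0..1}|lborel. deriv \<phi> u *\<^sub>R g u) = (LINT u:{0..1}|lborel. (deriv ^^ j) (deriv \<phi>) u *\<^sub>R f u)"
    using assms(1) assms(3)[OF t] unfolding weak_deriv_def by metis
  also have "\<dots> = (LINT u:{0..1}|lborel. (deriv ^^ Suc j) \<phi> u *\<^sub>R f u)" by (simp add: funpow_swap1)
  also have "\<dots> = (-1) ^ Suc j *\<^sub>R (LINT u:{0..1}|lborel. \<phi> u *\<^sub>R k u)"
    using assms(2) t unfolding weak_deriv_def by blast
  also have "\<dots> = (-1) ^ j *\<^sub>R (- (LINT u:{0..1}|lborel. \<phi> u *\<^sub>R k u))" by simp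
  finally have "(LINT u:{0..1}|lborel. deriv \<phi> u *\<^sub>R g u) = - (LINT u:{0..1}|lborel. \<phi> u *\<^sub>R k u)"
    by (subst (asm) scaleR_cancel_left) simp
  then show "(LINT u:{0..1}|lborel. (deriv ^^ 1) \<phi> u *\<^sub>R g u) = (-1) ^ 1 *\<^sub>R (LINT u:{0..1}|lborel. \<phi> u *\<^sub>R k u)"
    by simp
qed

lemma weak_deriv_circle_primitive:
  assumes "primitive g p" "p 0 = p 1"
  shows "weak_deriv circle_tests 1 p g"
  unfolding weak_deriv_def
proof
  fix \<phi> assume "\<phi> \<in> circle_tests"
  then have s: "smooth_fun \<phi>" and "\<phi> (0 + 1) = \<phi> 0" unfolding circle_tests_def by blast+
  then show "(LINT u:{0..1}|lborel. (deriv ^^ 1) \<phi> u *\<^sub>R p u) = (-1) ^ 1 *\<^sub>R (LINT u:{0..1}|lborel. \<phi> u *\<^sub>R g u)"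
    using integral_by_parts_smooth[OF s assms(1)] assms(2) by simp
qed

lemma interval_tests_eq_0:
  assumes "\<phi> \<in> interval_tests" "u \<notin> {0<..<1}"
  shows "\<phi> u = 0"
  using assms closure_subset[of "{u. \<phi> u \<noteq> 0}"] unfolding interval_tests_def by auto

lemma interval_tests_deriv:
  assumes "\<phi> \<in> interval_tests"
  shows "deriv \<phi> \<in> interval_tests"
proof -
  have s: "smooth_fun \<phi>" and cl: "closure {u. \<phi> u \<noteq> 0} \<subseteq> {0<..<1}" using assms unfolding interval_tests_def by auto
  have "deriv \<phi> u = 0" if u: "u \<notin> closure {u. \<phi> u \<noteq> 0}" for u
  proof -
    have "open (- closure {u. \<phi> u \<noteq> 0})" by auto
    moreover have "u \<in> - closure {u. \<phi> u \<noteq> 0}" using u by auto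
    moreover have "0 = \<phi> y" if "y \<in> - closure {u. \<phi> u \<noteq> 0}" for y
      using that closure_subset[of "{u. \<phi> u \<noteq> 0}"] by auto
    ultimately have "(\<phi> has_real_derivative 0) (at u)"
      using has_field_derivative_transform_within_open[OF DERIV_const[of 0 "at u"]] by blast
    then show ?thesis by (rule DERIV_imp_deriv)
  qed
  then have "{u. deriv \<phi> u \<noteq> 0} \<subseteq> closure {u. \<phi> u \<noteq> 0}" by auto
  then have "closure {u. deriv \<phi> u \<noteq> 0} \<subseteq> closure {u. \<phi> u \<noteq> 0}" by (rule closure_minimal) auto
  then show ?thesis using cl smooth_fun_deriv[OF s] unfolding interval_tests_def by auto
qed

lemma weak_deriv_interval_primitive:
  assumes "primitive g p"
  shows "weak_deriv interval_tests 1 p g"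
  unfolding weak_deriv_def
proof
  fix \<phi> assume t: "\<phi> \<in> interval_tests"
  then have s: "smooth_fun \<phi>" unfolding interval_tests_def by blast
  show "(LINT u:{0..1}|lborel. (deriv ^^ 1) \<phi> u *\<^sub>R p u) = (-1) ^ 1 *\<^sub>R (LINT u:{0..1}|lborel. \<phi> u *\<^sub>R g u)"
    using integral_by_parts_smooth[OF s assms] interval_tests_eq_0[OF t, of 0] interval_tests_eq_0[OF t, of 1] by simp
qed

text \<open>The difference between \<open>f\<close> and a primitive of its weak derivative \<open>g\<close> is orthogonal to the derivatives
  of test functions, hence constant almost everywhere.\<close>

lemma weak_deriv_1_imp_primitive:
  assumes f: "square_integrable f" and g: "square_integrable g" and w: "weak_deriv circle_tests 1 f g"
  shows "\<exists>p. primitive g p \<and> p 0 = p 1 \<and> (AE x in lborel. x \<in> {0..1} \<longrightarrow> f x = p x)"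
proof -
  have i: "set_integrable lborel {0..1} f" "set_integrable lborel {0..1} g"
    using f g square_integrable_imp_set_integrable by blast+
  define P where "P u = (LINT x:{0..u}|lborel. g x)" for u
  have P: "primitive g P" unfolding P_def by (rule primitive_exists[OF i(2)])
  have P0: "P 0 = 0" unfolding P_def by (rule set_integral_singleton)
  have "(LINT u:{0..1}|lborel. deriv (\<lambda>u. 1) u *\<^sub>R f u) = - (LINT u:{0..1}|lborel. (\<lambda>u. 1) u *\<^sub>R g u)"
    using w circle_tests_const[of 1] unfolding weak_deriv_def by fastforce
  then have P1: "P 1 = 0" by (simp add: P_def)
  have iP: "set_integrable lborel {0..1} P"
    by (rule borel_integrable_atLeastAtMost'[OF primitive_continuous_on[OF P]])
  define h where "h u = f u - P u" for u
  have ih: "set_integrable lborel {0..1} h" unfolding h_def by (rule set_integral_diff(1)[OF i(1) iP])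
  have zh: "(LINT u:{0..1}|lborel. deriv \<phi> u *\<^sub>R h u) = 0" if t: "\<phi> \<in> circle_tests" for \<phi>
  proof -
    have s: "smooth_fun \<phi>" using t unfolding circle_tests_def by blast
    have "(LINT u:{0..1}|lborel. deriv \<phi> u *\<^sub>R f u) = - (LINT u:{0..1}|lborel. \<phi> u *\<^sub>R g u)"
      using w t unfolding weak_deriv_def by simp
    moreover have "(LINT u:{0..1}|lborel. deriv \<phi> u *\<^sub>R P u) = - (LINT u:{0..1}|lborel. \<phi> u *\<^sub>R g u)"
      using integral_by_parts_smooth[OF s P] P0 P1 by simp
    ultimately show ?thesis
      unfolding h_def using set_integral_diff_tests[OF smooth_fun_deriv[OF s] i(1) iP] by simp
  qed
  define m where "m = (LINT x:{0..1}|lborel. h x)"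
  have "AE x in lborel. x \<in> {0..1} \<longrightarrow> h x - m = 0"
  proof (rule orthogonal_to_tests)
    show "set_integrable lborel {0..1} (\<lambda>x. h x - m)"
      by (intro set_integral_diff(1) ih borel_integrable_atLeastAtMost' continuous_intros)
  next
    fix \<phi> assume "\<phi> \<in> circle_tests"
    then show "(LINT u:{0..1}|lborel. \<phi> u *\<^sub>R (h u - m)) = 0"
      using orthogonal_to_derivatives[OF ih zh] unfolding m_def by blast
  qed
  then have "AE x in lborel. x \<in> {0..1} \<longrightarrow> f x = P x + m"
    by (rule AE_mp) (intro AE_I2 impI, simp add: h_def algebra_simps)
  moreover have "primitive g (\<lambda>u. P u + m)"
  proof -
    have "P u + m = (P 0 + m) + (LINT x:{0..u}|lborel. g x)" for u
      unfolding P0 by (simp add: P_def)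
    then show ?thesis unfolding primitive_def using i(2) by blast
  qed
  moreover have "P 0 + m = P 1 + m" by (simp add: P0 P1)
  ultimately show ?thesis by (intro exI[of _ "\<lambda>u. P u + m"] conjI)
qed

section \<open>Periodic functions and the fractional Sobolev embedding\<close>

lemma periodic_of_int:
  fixes f :: "real \<Rightarrow> 'a"
  assumes "\<And>u. f (u + 1) = f u"
  shows "f (u + of_int k) = f u"
proof (induction k rule: int_induct[where k=0])
  case (step1 i)
  then show ?case using assms[of "u + of_int i"] by (simp add: add.assoc)
next
  case (step2 i)
  then show ?case using assms[of "u + of_int (i - 1)"] by simp
qed simp

lemma periodic_frac:
  fixes f :: "real \<Rightarrow> 'a"
  assumes "\<And>u. f (u + 1) = f u"
  shows "f (frac u) = f u"
  using periodic_of_int[of f, OF assms, of "frac u" "\<lfloor>u\<rfloor>"] by (simp add: frac_def)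

lemma periodic_bounded:
  fixes f :: "real \<Rightarrow> 'a::euclidean_space"
  assumes "continuous_on UNIV f" "\<And>u. f (u + 1) = f u"
  obtains C where "0 \<le> C" "\<And>u. norm (f u) \<le> C"
proof -
  obtain C where C: "\<And>u. u \<in> {0..1} \<Longrightarrow> norm (f u) \<le> C"
    using continuous_on_Icc_bounded[of 0 1 f] continuous_on_subset[OF assms(1)] by blast
  have "norm (f u) \<le> C" for u
    using C[of "frac u"] periodic_frac[of f u, OF assms(2)] frac_ge_0[of u] frac_lt_1[of u] by simp
  moreover from this[of 0] have "0 \<le> C" using norm_ge_zero order_trans by blast
  ultimately show ?thesis using that by blast
qed

lemma periodic_extension:
  fixes q :: "real \<Rightarrow> 'a::euclidean_space"
  assumes c: "continuous_on {0..1} q" and e: "q 0 = q 1"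
  obtains Q where "continuous_on UNIV Q" "\<And>u. Q (u + 1) = Q u" "\<And>u. u \<in> {0..1} \<Longrightarrow> Q u = q u"
proof
  define Q where "Q u = q (frac u)" for u
  show "Q (u + 1) = Q u" for u by (simp add: Q_def frac_1_eq)
  show "Q u = q u" if "u \<in> {0..1}" for u
  proof (cases "u = 1")
    case False
    then have "frac u = u" using that by (simp add: frac_eq)
    then show ?thesis by (simp add: Q_def)
  qed (simp add: Q_def e)
  have piece: "continuous_on {of_int n..of_int n + 1} Q" for n :: int
  proof (rule continuous_on_eq)
    show "continuous_on {of_int n..of_int n + 1} (\<lambda>u. q (u - of_int n))"
      by (rule continuous_on_compose2[OF c]) (auto intro!: continuous_intros)
    fix u :: real assume u: "u \<in> {of_int n..of_int n + 1}"
    show "q (u - of_int n) = Q u"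
    proof (cases "u = of_int n + 1")
      case True
      then have "frac u = 0" by simp
      then show ?thesis using True e by (simp add: Q_def)
    next
      case False
      then have "\<lfloor>u\<rfloor> = n" using u by (intro floor_unique) auto
      then show ?thesis by (simp add: Q_def frac_def)
    qed
  qed
  have "isCont Q x" for x
  proof -
    define n where "n = \<lfloor>x\<rfloor>"
    have "continuous_on ({of_int (n - 1)..of_int (n - 1) + 1} \<union> {of_int n..of_int n + 1}) Q"
      by (intro continuous_on_closed_Un piece) auto
    also have "{of_int (n - 1)..of_int (n - 1) + 1} \<union> {of_int n..of_int n + 1} = {of_int n - 1..of_int n + (1::real)}"
      by auto
    finally show ?thesis
      by (rule continuous_on_interior) (auto simp: n_def, linarith+)
  qed
  then show "continuous_on UNIV Q" by (simp add: continuous_on_eq_continuous_at)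
qed

text \<open>On \<open>[0,1]\<close> alone, the fundamental theorem yields one-sided derivatives at the end points. The periodicity
  of \<open>h\<close> and \<open>q\<close> makes them two-sided.\<close>

lemma primitive_periodic_C1:
  fixes h q :: "real \<Rightarrow> 'a::euclidean_space"
  assumes h: "\<And>u. h (u + 1) = h u" and q: "continuous_on UNIV q" "\<And>u. q (u + 1) = q u"
    and p: "primitive q h"
  shows "(h has_vector_derivative q u) (at u)"
proof -
  have h1: "h 1 = h 0" using h[of 0] by simp
  have z: "(LINT x:{0..1}|lborel. q x) = 0" using primitive_eq[OF p, of 1] h1 by simp
  obtain F where F: "F 0 = 0" "\<And>u. (F has_vector_derivative q u) (at u)" "\<And>u. F (u + 1) = F u"
    using periodic_antiderivative[OF q z] by blast
  have pF: "primitive q F"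
    by (rule primitive_C1) (auto intro: has_vector_derivative_at_within F(2) continuous_on_subset[OF q(1)])
  have "h x = F x + h 0" for x
  proof -
    have fx: "frac x \<in> {0..1}" using frac_ge_0[of x] frac_lt_1[of x] by simp
    have "h (frac x) - h 0 = F (frac x) - F 0"
      using primitive_eq[OF p fx] primitive_eq[OF pF fx] by simp
    then have "h (frac x) = F (frac x) + h 0" by (simp add: F(1) algebra_simps)
    then show ?thesis using periodic_frac[of h x, OF h] periodic_frac[of F x, OF F(3)] by simp
  qed
  then have "h = (\<lambda>x. F x + h 0)" by blast
  moreover have "((\<lambda>x. F x + h 0) has_vector_derivative q u) (at u)"
    using has_vector_derivative_add[OF F(2)[of u] has_vector_derivative_const[of "h 0"]] by simp
  ultimately show ?thesis by metis
qed

text \<open>An interval of length at most \<open>1/2\<close> with left end point in \<open>[0,1]\<close> may extend beyond \<open>1\<close>; integrals over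
  it, taken on the circle, are estimated by folding \<open>[0,2]\<close> onto one period.\<close>

lemma nn_integral_two_periods:
  fixes F :: "real \<Rightarrow> ennreal"
  assumes F[measurable]: "F \<in> borel_measurable borel"
  shows "(\<integral>\<^sup>+x\<in>{0..2}. F (frac x) \<partial>lborel) \<le> 2 * (\<integral>\<^sup>+x\<in>{0..1}. F x \<partial>lborel)"
proof -
  define f where "f x = F x * indicator {0..1} x" for x
  have [measurable]: "f \<in> borel_measurable borel" unfolding f_def by measurable
  have "(\<integral>\<^sup>+x\<in>{0..2}. F (frac x) \<partial>lborel) \<le> (\<integral>\<^sup>+x. f x + f (-1 + 1 * x) \<partial>lborel)"
  proof (rule nn_integral_mono_AE)
    show "AE x in lborel. F (frac x) * indicator {0..2} x \<le> f x + f (-1 + 1 * x)"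
      using AE_lborel_singleton[of 2]
    proof (rule AE_mp, intro AE_I2 impI)
      fix x :: real assume "x \<noteq> 2"
      then consider "x \<notin> {0..2}" | "x \<in> {0..<1}" | "x \<in> {1..<2}" by fastforce
      then show "F (frac x) * indicator {0..2} x \<le> f x + f (-1 + 1 * x)"
      proof cases
        case 2
        then have "frac x = x" by (simp add: frac_eq)
        then show ?thesis using 2 by (simp add: f_def indicator_def)
      next
        case 3
        then have "\<lfloor>x\<rfloor> = 1" by (intro floor_unique) auto
        then have "frac x = x - 1" by (simp add: frac_def)
        then show ?thesis using 3 by (simp add: f_def indicator_def)
      qed simp
    qed
  qed
  also have "\<dots> = (\<integral>\<^sup>+x. f x \<partial>lborel) + (\<integral>\<^sup>+x. f (-1 + 1 * x) \<partial>lborel)"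
    by (rule nn_integral_add) measurable
  also have "(\<integral>\<^sup>+x. f (-1 + 1 * x) \<partial>lborel) = (\<integral>\<^sup>+x. f x \<partial>lborel)"
    using nn_integral_real_affine[of f 1 "-1"] by simp
  finally show ?thesis by (simp add: f_def mult_2)
qed

lemma circle_dist_frac_le:
  assumes "\<bar>x - y\<bar> \<le> 1/2"
  shows "circle_dist (frac x) (frac y) \<le> \<bar>x - y\<bar>"
proof -
  define m where "m = \<lfloor>x\<rfloor> - \<lfloor>y\<rfloor>"
  have e: "frac x - frac y = x - y - of_int m" by (simp add: frac_def m_def)
  have "\<bar>of_int m :: real\<bar> < 2"
    using e assms frac_ge_0[of x] frac_lt_1[of x] frac_ge_0[of y] frac_lt_1[of y] by linarith
  then have "m = -1 \<or> m = 0 \<or> m = 1" by linarith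
  then show ?thesis unfolding circle_dist_def e using assms by (auto simp: min_def abs_if split: if_splits)
qed

lemma circle_dist_pos:
  assumes "x \<in> {0..<1}" "y \<in> {0..<1}" "x \<noteq> y"
  shows "0 < circle_dist x y"
  using assms by (auto simp: circle_dist_def)

lemma gagliardo_cong:
  assumes "AE u in lborel. u \<in> {0..1} \<longrightarrow> f u = g u"
  shows "gagliardo2 d \<sigma> f = gagliardo2 d \<sigma> g"
  unfolding gagliardo2_def
proof (rule nn_integral_cong_AE, rule AE_mp[OF assms], intro AE_I2 impI)
  fix u :: real assume u: "u \<in> {0..1} \<longrightarrow> f u = g u"
  show "(\<integral>\<^sup>+v\<in>{0..1}. ennreal ((norm (f u - f v))\<^sup>2 / d u v powr (1 + 2 * \<sigma>)) \<partial>lborel) * indicator {0..1} u =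
    (\<integral>\<^sup>+v\<in>{0..1}. ennreal ((norm (g u - g v))\<^sup>2 / d u v powr (1 + 2 * \<sigma>)) \<partial>lborel) * indicator {0..1} u"
  proof (cases "u \<in> {0..1}")
    case True
    have "(\<integral>\<^sup>+v\<in>{0..1}. ennreal ((norm (f u - f v))\<^sup>2 / d u v powr (1 + 2 * \<sigma>)) \<partial>lborel) =
      (\<integral>\<^sup>+v\<in>{0..1}. ennreal ((norm (g u - g v))\<^sup>2 / d u v powr (1 + 2 * \<sigma>)) \<partial>lborel)"
      by (rule nn_integral_cong_AE, rule AE_mp[OF assms], intro AE_I2 impI)
        (use u True in \<open>auto simp: indicator_def\<close>)
    then show ?thesis by simp
  qed simp
qed

text \<open>On an interval of length \<open>r \<le> 1/2\<close> of the circle, the Gagliardo seminorm provides a point \<open>y\<close>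
  in the first half of the interval whose value is close, in the quadratic mean, to the values on
  the whole interval. Hence the mean values over the interval and over its first half are close to
  each other. One point \<open>y\<close> for both means avoids double integrals.\<close>

lemma gagliardo_good_point:
  fixes g :: "real \<Rightarrow> 'a::euclidean_space"
  assumes s: "0 < \<sigma>" and g: "g \<in> borel_measurable borel"
    and N: "4 * gagliardo2 circle_dist \<sigma> g < ennreal K" and K: "0 < K"
    and u: "u \<in> {0..1}" and r: "0 < r" "r \<le> 1/2"
  shows "\<exists>y\<in>{u..u + r/2}. (\<integral>\<^sup>+x\<in>{u..u + r}. ennreal ((norm (g (frac x) - g (frac y)))\<^sup>2) \<partial>lborel)
      \<le> ennreal (2 * K * r powr (2 * \<sigma>))"
proof (rule ccontr)
  assume "\<not> ?thesis"
  then have big: "ennreal (2 * K * r powr (2 * \<sigma>)) \<le> (\<integral>\<^sup>+x\<in>{u..u + r}. ennreal ((norm (g (frac x) - g (frac y)))\<^sup>2) \<partial>lborel)"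
    if "y \<in> {u..u + r/2}" for y
    using that by (meson linear)
  note [measurable] = g
  define k where "k y x = ennreal ((norm (g y - g x))\<^sup>2 / circle_dist y x powr (1 + 2 * \<sigma>))" for y x
  have mk[measurable]: "(\<lambda>(y, x). k y x) \<in> borel_measurable (borel \<Otimes>\<^sub>M borel)"
    unfolding k_def circle_dist_def by measurable
  define Fi where "Fi y = (\<integral>\<^sup>+x\<in>{0..1}. k y x \<partial>lborel)" for y
  have mF[measurable]: "Fi \<in> borel_measurable borel" unfolding Fi_def by measurable
  have pw: "ennreal ((norm (g (frac x) - g (frac y)))\<^sup>2) \<le> ennreal (r powr (1 + 2 * \<sigma>)) * k (frac y) (frac x)"
    if xy: "\<bar>x - y\<bar> \<le> r" for x y
  proof (cases "frac x = frac y")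
    case False
    define d where "d = circle_dist (frac y) (frac x)"
    have d: "0 < d" unfolding d_def using False frac_ge_0 frac_lt_1 by (intro circle_dist_pos) auto
    have "d \<le> r" using circle_dist_frac_le[of y x] xy r unfolding d_def by linarith
    then have le: "d powr (1 + 2 * \<sigma>) \<le> r powr (1 + 2 * \<sigma>)" using d s by (intro powr_mono2) auto
    define n where "n = (norm (g (frac x) - g (frac y)))\<^sup>2"
    have "n * d powr (1 + 2 * \<sigma>) \<le> n * r powr (1 + 2 * \<sigma>)" using le by (intro mult_left_mono) (auto simp: n_def)
    then have "n \<le> r powr (1 + 2 * \<sigma>) * (n / d powr (1 + 2 * \<sigma>))" using d by (simp add: field_simps)
    then show ?thesis unfolding k_def
      by (subst ennreal_mult[symmetric]) (auto simp: n_def d_def norm_minus_commute intro: ennreal_leI)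
  qed simp
  have "ennreal (K * r powr (1 + 2 * \<sigma>)) = (\<integral>\<^sup>+y. ennreal (2 * K * r powr (2 * \<sigma>)) * indicator {u..u + r/2} y \<partial>lborel)"
  proof -
    have "2 * K * r powr (2 * \<sigma>) * (r / 2) = K * r powr (1 + 2 * \<sigma>)" using r by (simp add: powr_add)
    then show ?thesis using r K by (simp add: nn_integral_cmult_indicator ennreal_mult[symmetric])
  qed
  also have "\<dots> \<le> (\<integral>\<^sup>+y. ennreal (r powr (1 + 2 * \<sigma>)) * (2 * (Fi (frac y) * indicator {0..2} y)) \<partial>lborel)"
  proof (rule nn_integral_mono)
    fix y :: real
    show "ennreal (2 * K * r powr (2 * \<sigma>)) * indicator {u..u + r/2} y
      \<le> ennreal (r powr (1 + 2 * \<sigma>)) * (2 * (Fi (frac y) * indicator {0..2} y))"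
    proof (cases "y \<in> {u..u + r/2}")
      case True
      have "ennreal (2 * K * r powr (2 * \<sigma>)) \<le> (\<integral>\<^sup>+x\<in>{u..u + r}. ennreal ((norm (g (frac x) - g (frac y)))\<^sup>2) \<partial>lborel)"
        by (rule big[OF True])
      also have "\<dots> \<le> (\<integral>\<^sup>+x. ennreal (r powr (1 + 2 * \<sigma>)) * (k (frac y) (frac x) * indicator {0..2} x) \<partial>lborel)"
      proof (rule nn_integral_mono)
        fix x :: real
        show "ennreal ((norm (g (frac x) - g (frac y)))\<^sup>2) * indicator {u..u + r} x
          \<le> ennreal (r powr (1 + 2 * \<sigma>)) * (k (frac y) (frac x) * indicator {0..2} x)"
        proof (cases "x \<in> {u..u + r}")
          case x: True
          then have "\<bar>x - y\<bar> \<le> r" using True by auto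
          moreover have "x \<in> {0..2}" using x u r by auto
          ultimately show ?thesis using pw[of x y] x by simp
        qed simp
      qed
      also have "\<dots> = ennreal (r powr (1 + 2 * \<sigma>)) * (\<integral>\<^sup>+x\<in>{0..2}. k (frac y) (frac x) \<partial>lborel)"
        by (rule nn_integral_cmult) (unfold frac_def, measurable)
      also have "\<dots> \<le> ennreal (r powr (1 + 2 * \<sigma>)) * (2 * Fi (frac y))"
        unfolding Fi_def by (intro mult_left_mono nn_integral_two_periods) auto
      also have "\<dots> = ennreal (r powr (1 + 2 * \<sigma>)) * (2 * (Fi (frac y) * indicator {0..2} y))"
        using True u r by simp
      finally show ?thesis using True by simp
    qed simp
  qed
  also have "\<dots> = ennreal (r powr (1 + 2 * \<sigma>)) * (\<integral>\<^sup>+y. 2 * (Fi (frac y) * indicator {0..2} y) \<partial>lborel)"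
    by (rule nn_integral_cmult) (unfold frac_def, measurable)
  also have "(\<integral>\<^sup>+y. 2 * (Fi (frac y) * indicator {0..2} y) \<partial>lborel) = 2 * (\<integral>\<^sup>+y\<in>{0..2}. Fi (frac y) \<partial>lborel)"
    by (rule nn_integral_cmult) (unfold frac_def, measurable)
  also have "ennreal (r powr (1 + 2 * \<sigma>)) * (2 * (\<integral>\<^sup>+y\<in>{0..2}. Fi (frac y) \<partial>lborel))
     \<le> ennreal (r powr (1 + 2 * \<sigma>)) * (2 * (2 * (\<integral>\<^sup>+y\<in>{0..1}. Fi y \<partial>lborel)))"
    by (intro mult_left_mono nn_integral_two_periods) auto
  also have "2 * (2 * (\<integral>\<^sup>+y\<in>{0..1}. Fi y \<partial>lborel)) = 4 * gagliardo2 circle_dist \<sigma> g"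
    unfolding gagliardo2_def Fi_def k_def by (simp add: mult.assoc[symmetric])
  also have "ennreal (r powr (1 + 2 * \<sigma>)) * (4 * gagliardo2 circle_dist \<sigma> g) < ennreal (r powr (1 + 2 * \<sigma>)) * ennreal K"
    using N r by (intro ennreal_mult_strict_left_mono) auto
  finally show False using K by (simp add: ennreal_mult[symmetric] mult.commute)
qed

text \<open>The left hand side is the norm of the integral of \<open>g - c\<close> over \<open>[u, u + r]\<close>, which the inequality of
  Cauchy and Schwarz estimates. The factor \<open>2\<close> is due to intervals that extend beyond \<open>1\<close>: they are cut
  there, since \<open>h\<close> is a primitive of \<open>g\<close> on one period only.\<close>

lemma mean_oscillation:
  fixes g h :: "real \<Rightarrow> 'a::euclidean_space"
  assumes p: "primitive g h" and g: "square_integrable g" and per: "\<And>u. h (u + 1) = h u"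
    and u: "u \<in> {0..1}" and r: "0 \<le> r" "r \<le> R" "R \<le> 1/2" and a: "0 \<le> a"
    and A: "(\<integral>\<^sup>+x\<in>{u..u + R}. ennreal ((norm (g (frac x) - c))\<^sup>2) \<partial>lborel) \<le> ennreal a"
  shows "norm (h (u + r) - h u - r *\<^sub>R c) \<le> 2 * sqrt (r * a)"
proof -
  have sq: "square_integrable (\<lambda>x. g x + - c)"
    by (intro square_integrable_add g square_integrable_continuous continuous_intros)
  have i: "set_integrable lborel {0..1} g" "set_integrable lborel {0..1} (\<lambda>x. g x + - c)"
    "set_integrable lborel {0..1} (\<lambda>x. (norm (g x + - c))\<^sup>2)"
    using sq g square_integrable_imp_set_integrable unfolding square_integrable_def by blast+
  have piece: "norm (h b' - h a' - (b' - a') *\<^sub>R c) \<le> sqrt (r * a)"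
    if ab: "0 \<le> a'" "a' \<le> b'" "b' \<le> 1" "b' - a' \<le> r"
      and le: "(\<integral>\<^sup>+x\<in>{a'..b'}. ennreal ((norm (g x - c))\<^sup>2) \<partial>lborel) \<le> ennreal a" for a' b'
  proof -
    have i': "set_integrable lborel {a'..b'} g" "set_integrable lborel {a'..b'} (\<lambda>x. g x + - c)"
      "set_integrable lborel {a'..b'} (\<lambda>x. (norm (g x + - c))\<^sup>2)"
      using ab set_integrable_subinterval[OF i(1)] set_integrable_subinterval[OF i(2)]
        set_integrable_subinterval[OF i(3)] by auto
    have ic: "set_integrable lborel {a'..b'} (\<lambda>x::real. - c)"
      by (intro borel_integrable_atLeastAtMost' continuous_intros)
    have "(LINT x:{a'..b'}|lborel. g x + - c) = (LINT x:{a'..b'}|lborel. g x) + (LINT x:{a'..b'}|lborel. - c)"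
      by (rule set_integral_add(2)[OF i'(1) ic])
    also have "(LINT x:{a'..b'}|lborel. - c) = - ((b' - a') *\<^sub>R c)"
      using set_integral_continuous_eq[of a' b' "\<lambda>x. - c"] ab by simp
    also have "(LINT x:{a'..b'}|lborel. g x) = h b' - h a'" using primitive_diff[OF p] ab by simp
    finally have e: "h b' - h a' - (b' - a') *\<^sub>R c = (LINT x:{a'..b'}|lborel. g x + - c)" by simp
    have "(LINT x:{a'..b'}|lborel. (norm (g x + - c))\<^sup>2) \<le> a"
    proof -
      have "ennreal (LINT x:{a'..b'}|lborel. (norm (g x + - c))\<^sup>2) = (\<integral>\<^sup>+x\<in>{a'..b'}. ennreal ((norm (g x + - c))\<^sup>2) \<partial>lborel)"
        using i'(3) unfolding set_integrable_def set_lebesgue_integral_def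
        by (subst nn_integral_eq_integral[symmetric]) (auto intro!: nn_integral_cong simp: indicator_def)
      also have "\<dots> \<le> ennreal a" using le by simp
      finally show ?thesis using a by (simp add: ennreal_le_iff)
    qed
    then have "(norm (h b' - h a' - (b' - a') *\<^sub>R c))\<^sup>2 \<le> (b' - a') * a"
      unfolding e using set_integral_Cauchy_Schwarz[OF ab(2) i'(2,3)] ab by (meson mult_left_mono order_trans diff_ge_0_iff_ge)
    also have "\<dots> \<le> r * a" using ab a by (intro mult_right_mono) auto
    finally show ?thesis by (rule real_le_rsqrt)
  qed
  show ?thesis
  proof (cases "u + r \<le> 1")
    case True
    have "(\<integral>\<^sup>+x\<in>{u..u + r}. ennreal ((norm (g x - c))\<^sup>2) \<partial>lborel) \<le> (\<integral>\<^sup>+x\<in>{u..u + R}. ennreal ((norm (g (frac x) - c))\<^sup>2) \<partial>lborel)"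
    proof (rule nn_integral_mono_AE, rule AE_mp[OF AE_lborel_singleton[of 1]], intro AE_I2 impI)
      fix x :: real assume x: "x \<noteq> 1"
      show "ennreal ((norm (g x - c))\<^sup>2) * indicator {u..u + r} x \<le> ennreal ((norm (g (frac x) - c))\<^sup>2) * indicator {u..u + R} x"
      proof (cases "x \<in> {u..u + r}")
        case t: True
        then have "x \<in> {0..<1}" using u True x by auto
        then have "frac x = x" by (simp add: frac_eq)
        then show ?thesis using t r by (simp add: indicator_def)
      qed simp
    qed
    from order_trans[OF this A] have "norm (h (u + r) - h u - (u + r - u) *\<^sub>R c) \<le> sqrt (r * a)"
      using u True r by (intro piece) auto
    moreover have "0 \<le> sqrt (r * a)" using r a by simp
    ultimately have "norm (h (u + r) - h u - r *\<^sub>R c) \<le> sqrt (r * a)" "0 \<le> sqrt (r * a)" by simp_all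
    then show ?thesis by linarith
  next
    case False
    have l1: "(\<integral>\<^sup>+x\<in>{u..1}. ennreal ((norm (g x - c))\<^sup>2) \<partial>lborel) \<le> (\<integral>\<^sup>+x\<in>{u..u + R}. ennreal ((norm (g (frac x) - c))\<^sup>2) \<partial>lborel)"
    proof (rule nn_integral_mono_AE, rule AE_mp[OF AE_lborel_singleton[of 1]], intro AE_I2 impI)
      fix x :: real assume x: "x \<noteq> 1"
      show "ennreal ((norm (g x - c))\<^sup>2) * indicator {u..1} x \<le> ennreal ((norm (g (frac x) - c))\<^sup>2) * indicator {u..u + R} x"
      proof (cases "x \<in> {u..1}")
        case t: True
        then have "x \<in> {0..<1}" using u x by auto
        then have "frac x = x" by (simp add: frac_eq)
        then show ?thesis using t r False by (simp add: indicator_def)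
      qed simp
    qed
    define f where "f x = ennreal ((norm (g x - c))\<^sup>2) * indicator {0..u + r - 1} x" for x
    have mf: "f \<in> borel_measurable borel"
    proof -
      have "(\<lambda>x. indicator {0..1} x *\<^sub>R (norm (g x + - c))\<^sup>2) \<in> borel_measurable borel"
        using i(3) unfolding set_integrable_def by auto
      then have "(\<lambda>x. ennreal (indicator {0..1} x *\<^sub>R (norm (g x + - c))\<^sup>2) * indicator {0..u + r - 1} x) \<in> borel_measurable borel"
        by measurable
      also have "(\<lambda>x. ennreal (indicator {0..1} x *\<^sub>R (norm (g x + - c))\<^sup>2) * indicator {0..u + r - 1} x) = f"
        using u r by (auto simp: f_def indicator_def fun_eq_iff)
      finally show ?thesis .
    qed
    have "(\<integral>\<^sup>+x\<in>{0..u + r - 1}. ennreal ((norm (g x - c))\<^sup>2) \<partial>lborel) = (\<integral>\<^sup>+x. f (-1 + 1 * x) \<partial>lborel)"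
      using nn_integral_real_affine[OF mf, of 1 "-1"] by (simp add: f_def)
    also have "\<dots> \<le> (\<integral>\<^sup>+x\<in>{u..u + R}. ennreal ((norm (g (frac x) - c))\<^sup>2) \<partial>lborel)"
    proof (rule nn_integral_mono)
      fix x :: real
      show "f (-1 + 1 * x) \<le> ennreal ((norm (g (frac x) - c))\<^sup>2) * indicator {u..u + R} x"
      proof (cases "x \<in> {1..u + r}")
        case t: True
        then have "\<lfloor>x\<rfloor> = 1" using u r by (intro floor_unique) auto
        then have "frac x = x - 1" by (simp add: frac_def)
        then show ?thesis using t r u by (simp add: f_def indicator_def)
      qed (auto simp: f_def indicator_def)
    qed
    finally have l2: "(\<integral>\<^sup>+x\<in>{0..u + r - 1}. ennreal ((norm (g x - c))\<^sup>2) \<partial>lborel) \<le> ennreal a"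
      using A by (rule order_trans)
    have n1: "norm (h 1 - h u - (1 - u) *\<^sub>R c) \<le> sqrt (r * a)"
      using u r False by (intro piece order_trans[OF l1 A]) auto
    have n2: "norm (h (u + r - 1) - h 0 - (u + r - 1 - 0) *\<^sub>R c) \<le> sqrt (r * a)"
      using u r False by (intro piece l2) auto
    have "h (u + r) = h (u + r - 1)" "h 1 = h 0" using per[of "u + r - 1"] per[of 0] by simp_all
    then have "h (u + r) - h u - r *\<^sub>R c = (h 1 - h u - (1 - u) *\<^sub>R c) + (h (u + r - 1) - h 0 - (u + r - 1 - 0) *\<^sub>R c)"
      by (simp add: algebra_simps)
    then have "norm (h (u + r) - h u - r *\<^sub>R c) \<le> norm (h 1 - h u - (1 - u) *\<^sub>R c) + norm (h (u + r - 1) - h 0 - (u + r - 1 - 0) *\<^sub>R c)"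
      using norm_triangle_ineq by metis
    then show ?thesis using n1 n2 by linarith
  qed
qed

text \<open>The fractional Sobolev embedding: the difference quotients of \<open>h\<close> with steps \<open>2\<^sup>-\<^sup>k\<close> are mean values
  of \<open>g\<close>, and by the two preceding lemmas consecutive ones differ by at most a constant times
  \<open>2\<^sup>-\<^sup>k\<^sup>(\<^sup>\<sigma>\<^sup>-\<^sup>1\<^sup>/\<^sup>2\<^sup>)\<close>. So they converge uniformly, and the limit is the continuous representative of \<open>g\<close>.\<close>

lemma gagliardo_embedding:
  fixes g h :: "real \<Rightarrow> 'a::euclidean_space"
  assumes \<sigma>: "1/2 < \<sigma>" and p: "primitive g h" and g: "square_integrable g"
    and c: "continuous_on UNIV h" and per: "\<And>u. h (u + 1) = h u"
    and fin: "gagliardo2 circle_dist \<sigma> g < \<infinity>"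
  obtains q where "continuous_on UNIV q" "\<And>u. q (u + 1) = q u" "primitive q h"
proof -
  \<comment> \<open>Square integrability makes \<open>g\<close> measurable on \<open>[0,1]\<close> only.\<close>
  define g0 where "g0 x = indicator {0..1} x *\<^sub>R g x" for x :: real
  have mg0: "g0 \<in> borel_measurable borel"
    using g unfolding square_integrable_def set_borel_measurable_def g0_def by simp
  have gg0: "g0 x = g x" if "x \<in> {0..1}" for x using that by (simp add: g0_def)
  have p0: "primitive g0 h"
  proof -
    have "set_integrable lborel {0..1} g0"
    proof -
      have "(\<lambda>x. indicator {0..1} x *\<^sub>R g0 x) = (\<lambda>x. indicator {0..1} x *\<^sub>R g x)"
        by (auto simp: g0_def indicator_def)
      then show ?thesis using primitive_imp_integrable[OF p] unfolding set_integrable_def by metis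
    qed
    moreover have "(LINT x:{0..u}|lborel. g0 x) = (LINT x:{0..u}|lborel. g x)" if "u \<in> {0..1}" for u
      using that by (intro set_lebesgue_integral_cong) (auto simp: g0_def)
    ultimately show ?thesis using p unfolding primitive_def by metis
  qed
  have sq0: "square_integrable g0"
    by (rule square_integrable_cong[OF _ g]) (rule gg0[symmetric])
  have "gagliardo2 circle_dist \<sigma> g0 = gagliardo2 circle_dist \<sigma> g"
    by (rule gagliardo_cong) (simp add: gg0)
  then have "4 * gagliardo2 circle_dist \<sigma> g0 < top" using fin by (simp add: ennreal_mult_less_top)
  then obtain K0 where K0: "0 \<le> K0" "4 * gagliardo2 circle_dist \<sigma> g0 = ennreal K0"
    by (cases "4 * gagliardo2 circle_dist \<sigma> g0") auto
  define K where "K = K0 + 1"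
  have K: "0 < K" "4 * gagliardo2 circle_dist \<sigma> g0 < ennreal K"
    using K0 by (auto simp: K_def ennreal_less_iff)
  define r :: "nat \<Rightarrow> real" where "r k = (1/2) ^ Suc k" for k
  have r: "0 < r k" "r k \<le> 1/2" "r (Suc k) = r k / 2" for k
    by (auto simp: r_def power_le_one)
  define f where "f k u = (1 / r k) *\<^sub>R (h (u + r k) - h u)" for k u
  define \<rho> where "\<rho> = (1/2) powr (\<sigma> - 1/2)"
  have "(\<sigma> - 1/2) * ln (1/2) < 0" using \<sigma> by (intro mult_pos_neg) auto
  then have \<rho>: "0 < \<rho>" "\<rho> < 1" unfolding \<rho>_def powr_def by simp_all
  have step: "norm (f (Suc k) u - f k u) \<le> (6 * sqrt (2 * K)) * \<rho> ^ k" for k u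
  proof -
    have main: "norm (f (Suc k) u - f k u) \<le> (6 * sqrt (2 * K)) * \<rho> ^ k" if u: "u \<in> {0..1}" for u
    proof -
      define R where "R = r k"
      have R: "0 < R" "R \<le> 1/2" using r[of k] by (auto simp: R_def)
      have s0: "0 < \<sigma>" using \<sigma> by simp
      obtain y where y: "(\<integral>\<^sup>+x\<in>{u..u + R}. ennreal ((norm (g0 (frac x) - g0 (frac y)))\<^sup>2) \<partial>lborel)
          \<le> ennreal (2 * K * R powr (2 * \<sigma>))"
        using gagliardo_good_point[OF s0 mg0 K(2) K(1) u R] by blast
      define a where "a = 2 * K * R powr (2 * \<sigma>)"
      define c where "c = g0 (frac y)"
      have a: "0 \<le> a" using K by (simp add: a_def)
      have osc: "norm ((1 / t) *\<^sub>R (h (u + t) - h u) - c) \<le> 2 * sqrt (a / t)" if t: "0 < t" "t \<le> R" for t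
      proof -
        have "norm (h (u + t) - h u - t *\<^sub>R c) \<le> 2 * sqrt (t * a)"
          using mean_oscillation[OF p0 sq0 per u _ t(2) R(2) a, of c] y t by (simp add: a_def c_def)
        then have "(1 / t) * norm (h (u + t) - h u - t *\<^sub>R c) \<le> (1 / t) * (2 * sqrt (t * a))"
          using t by (intro mult_left_mono) auto
        moreover have "(1 / t) * norm (h (u + t) - h u - t *\<^sub>R c) = norm ((1 / t) *\<^sub>R (h (u + t) - h u - t *\<^sub>R c))"
          using t by simp
        moreover have "(1 / t) *\<^sub>R (h (u + t) - h u - t *\<^sub>R c) = (1 / t) *\<^sub>R (h (u + t) - h u) - c"
          using t by (simp add: scaleR_diff_right)
        moreover have "(1 / t) * (2 * sqrt (t * a)) = 2 * sqrt (a / t)"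
        proof -
          have "sqrt (a / t) = sqrt (t * a / t\<^sup>2)" using t by (simp add: power2_eq_square)
          also have "\<dots> = sqrt (t * a) / t" using t by (simp add: real_sqrt_divide)
          finally show ?thesis by simp
        qed
        ultimately show ?thesis by simp
      qed
      have aR: "sqrt (a / R) = sqrt (2 * K) * R powr (\<sigma> - 1/2)"
      proof -
        have "a / R = 2 * K * (R powr (\<sigma> - 1/2))\<^sup>2"
        proof -
          have "R powr (2 * \<sigma>) = R powr ((\<sigma> - 1/2) + (\<sigma> - 1/2) + 1)" by (simp add: algebra_simps)
          also have "\<dots> = R powr (\<sigma> - 1/2) * R powr (\<sigma> - 1/2) * R" using R by (simp only: powr_add) simp
          finally show ?thesis using R by (simp add: a_def power2_eq_square)
        qed
        then show ?thesis by (simp add: real_sqrt_mult)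
      qed
      have Rk: "R powr (\<sigma> - 1/2) \<le> \<rho> ^ k"
      proof -
        have "R \<le> (1/2) ^ k" unfolding R_def r_def by simp
        then have "R powr (\<sigma> - 1/2) \<le> ((1/2) ^ k) powr (\<sigma> - 1/2)" using R \<sigma> by (intro powr_mono2) auto
        also have "\<dots> = \<rho> ^ k" unfolding \<rho>_def by (simp add: powr_power powr_realpow[symmetric] powr_powr mult.commute)
        finally show ?thesis .
      qed
      have "norm (f (Suc k) u - f k u) \<le> norm (f (Suc k) u - c) + norm (f k u - c)"
        using norm_triangle_ineq4[of "f (Suc k) u - c" "f k u - c"] by simp
      also have "norm (f (Suc k) u - c) \<le> 2 * sqrt (a / (R / 2))"
        unfolding f_def r(3) R_def[symmetric] using osc[of "R / 2"] R by simp
      also have "sqrt (a / (R / 2)) \<le> 2 * sqrt (a / R)"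
      proof -
        have "a / (R / 2) = 2 * (a / R)" by simp
        then have "sqrt (a / (R / 2)) = sqrt 2 * sqrt (a / R)" by (simp only: real_sqrt_mult)
        also have "\<dots> \<le> 2 * sqrt (a / R)" using a R by (intro mult_right_mono) (auto simp: real_le_lsqrt)
        finally show ?thesis .
      qed
      also have "norm (f k u - c) \<le> 2 * sqrt (a / R)"
        unfolding f_def R_def[symmetric] using osc[of R] R by simp
      finally have "norm (f (Suc k) u - f k u) \<le> 6 * sqrt (a / R)" by simp
      also have "\<dots> = 6 * sqrt (2 * K) * R powr (\<sigma> - 1/2)" by (simp add: aR)
      also have "\<dots> \<le> 6 * sqrt (2 * K) * \<rho> ^ k" using Rk K by (intro mult_left_mono) auto
      finally show ?thesis .
    qed
    have pf: "f j (v + 1) = f j v" for j v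
      using per[of v] per[of "v + r j"] by (simp add: f_def add.commute add.left_commute)
    have "f j (frac u) = f j u" for j by (rule periodic_frac[of "f j"]) (rule pf)
    then show ?thesis using main[of "frac u"] frac_ge_0[of u] frac_lt_1[of u] by simp
  qed
  \<comment> \<open>The differences are summable with ratio \<open>\<rho> < 1\<close>, so the telescoping series converges uniformly.\<close>
  define L where "L u = (\<Sum>k. f (Suc k) u - f k u)" for u
  have ul: "uniform_limit UNIV (\<lambda>n u. \<Sum>k<n. f (Suc k) u - f k u) L sequentially"
    unfolding L_def
  proof (rule Weierstrass_m_test)
    show "norm (f (Suc n) x - f n x) \<le> (6 * sqrt (2 * K)) * \<rho> ^ n" for n x by (rule step)
    show "summable (\<lambda>n. (6 * sqrt (2 * K)) * \<rho> ^ n)" using \<rho> by (intro summable_mult summable_geometric) simp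
  qed
  define q where "q u = L u + f 0 u" for u
  have "uniform_limit UNIV (\<lambda>n u. (\<Sum>k<n. f (Suc k) u - f k u) + f 0 u) (\<lambda>u. L u + f 0 u) sequentially"
    by (intro uniform_limit_add ul uniform_limit_const)
  moreover have "(\<lambda>n u. (\<Sum>k<n. f (Suc k) u - f k u) + f 0 u) = f"
    by (intro ext) (simp add: sum_lessThan_telescope[of "\<lambda>k. f k _"])
  ultimately have uq: "uniform_limit UNIV f q sequentially" by (simp add: q_def[abs_def])
  have cf: "continuous_on A (f k)" for A k
    unfolding f_def by (intro continuous_intros continuous_on_compose2[OF c]) auto
  have cq: "continuous_on UNIV q"
    by (rule uniform_limit_theorem[OF _ uq]) (auto simp: cf)
  have lim: "(\<lambda>k. f k u) \<longlonglongrightarrow> q u" for u by (rule tendsto_uniform_limitI[OF uq]) simp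
  have pq: "q (u + 1) = q u" for u
  proof -
    have "f k (u + 1) = f k u" for k
      using per[of u] per[of "u + r k"] by (simp add: f_def add.commute add.left_commute)
    then show ?thesis using lim[of u] lim[of "u + 1"] by (simp add: LIMSEQ_unique)
  qed
  have "isCont h x" for x using c by (simp add: continuous_on_eq_continuous_at)
  \<comment> \<open>The integral of \<open>f k\<close> over \<open>[0,u]\<close> is a difference of two difference quotients of an antiderivative of \<open>h\<close>, so it tends to \<open>h u - h 0\<close>.\<close>
  then obtain H where H: "\<And>x. (H has_vector_derivative h x) (at x)"
    using einterval_antiderivative[of "-\<infinity>" "\<infinity>" h] by auto
  have r0: "r \<longlonglongrightarrow> 0" unfolding r_def by (rule LIMSEQ_Suc) (rule LIMSEQ_power_zero, simp)
  have Hlim: "(\<lambda>k. (1 / r k) *\<^sub>R (H (b + r k) - H b)) \<longlonglongrightarrow> h b" for b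
  proof -
    have "((\<lambda>t. norm (H (b + t) - H b - t *\<^sub>R h b) / norm t) \<longlongrightarrow> 0) (at 0)"
      using H[of b] unfolding has_vector_derivative_def has_derivative_at by blast
    moreover have "filterlim r (at 0) sequentially"
    proof (rule filterlim_atI[OF r0 always_eventually], rule allI)
      show "r k \<noteq> 0" for k using r(1)[of k] by simp
    qed
    ultimately have "(\<lambda>k. norm (H (b + r k) - H b - r k *\<^sub>R h b) / norm (r k)) \<longlonglongrightarrow> 0"
      by (rule filterlim_compose)
    moreover have "norm (A - t *\<^sub>R c) / norm t = norm ((1 / t) *\<^sub>R A - c)" if "0 < t" for A c :: 'a and t :: real
    proof -
      have "(1 / t) *\<^sub>R A - c = (1 / t) *\<^sub>R (A - t *\<^sub>R c)"
        using that by (simp add: scaleR_diff_right)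
      then show ?thesis using that by simp
    qed
    ultimately have "(\<lambda>k. norm ((1 / r k) *\<^sub>R (H (b + r k) - H b) - h b)) \<longlonglongrightarrow> 0"
      by (simp only: r(1))
    then show ?thesis by (rule LIM_zero_cancel[OF tendsto_norm_zero_cancel])
  qed
  have prim: "h u = h 0 + (LINT x:{0..u}|lborel. q x)" if u: "u \<in> {0..1}" for u
  proof -
    have I: "(f k has_integral ((1 / r k) *\<^sub>R (H (u + r k) - H u) - (1 / r k) *\<^sub>R (H (0 + r k) - H 0))) {0..u}" for k
    proof (rule fundamental_theorem_of_calculus)
      fix x
      have "((\<lambda>x. H (x + r k)) has_vector_derivative h (x + r k)) (at x)"
      proof -
        have "((H \<circ> (\<lambda>x. x + r k)) has_vector_derivative 1 *\<^sub>R h (x + r k)) (at x)"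
        proof (rule vector_diff_chain_at)
          show "((\<lambda>x. x + r k) has_vector_derivative 1) (at x)" by (auto intro!: derivative_eq_intros)
        qed (rule H)
        then show ?thesis by (simp add: o_def)
      qed
      then have "((\<lambda>x. (1 / r k) *\<^sub>R (H (x + r k) - H x)) has_vector_derivative (1 / r k) *\<^sub>R (h (x + r k) - h x)) (at x)"
        by (intro bounded_linear.has_vector_derivative[OF bounded_linear_scaleR_right] has_vector_derivative_diff H)
      then show "((\<lambda>x. (1 / r k) *\<^sub>R (H (x + r k) - H x)) has_vector_derivative f k x) (at x within {0..u})"
        unfolding f_def by (rule has_vector_derivative_at_within)
    qed (use u in simp)
    have UL: "uniform_limit {0..u} f q sequentially" by (rule uniform_limit_on_subset[OF uq]) simp
    obtain I' J where IJ: "\<And>n. (f n has_integral I' n) {0..u}" "(q has_integral J) {0..u}" "I' \<longlonglongrightarrow> J"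
      by (rule uniform_limit_integral[OF UL cf sequentially_bot]) (rule that)
    have "I' = (\<lambda>k. (1 / r k) *\<^sub>R (H (u + r k) - H u) - (1 / r k) *\<^sub>R (H (0 + r k) - H 0))"
      using IJ(1) I has_integral_unique by blast
    then have "I' \<longlonglongrightarrow> h u - h 0" using tendsto_diff[OF Hlim[of u] Hlim[of 0]] by simp
    then have "J = h u - h 0" using IJ(3) LIMSEQ_unique by blast
    moreover have "(LINT x:{0..u}|lborel. q x) = J"
      using set_integral_continuous_eq[of 0 u q] continuous_on_subset[OF cq] IJ(2) by (simp add: integral_unique)
    ultimately show ?thesis by simp
  qed
  then have "primitive q h"
    unfolding primitive_def using borel_integrable_atLeastAtMost'[OF continuous_on_subset[OF cq]] by blast
  with cq pq show ?thesis using that by blast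
qed

section \<open>The spaces of order \<open>1 + s\<close> in terms of classical derivatives\<close>

text \<open>A bound for the square of the top order seminorm of the derivative of a function in
  \<open>H\<^sup>1\<^sup>+\<^sup>s\<close>. It treats \<open>s < 1\<close> and \<open>s = 1\<close> alike, so that the analysis below
  can use it without a case distinction.\<close>

definition sobolev_bound :: "real \<Rightarrow> (real \<Rightarrow> 'a::euclidean_space) \<Rightarrow> real \<Rightarrow> bool" where
  "sobolev_bound s g B \<longleftrightarrow>
     continuous_on UNIV g \<and> (\<forall>u. g (u + 1) = g u) \<and> 0 \<le> B \<and>
     (if s < 1 then gagliardo2 circle_dist s g \<le> ennreal B
      else \<exists>G. square_integrable G \<and> primitive G g \<and> (LINT u:{0..1}|lborel. (norm (G u))\<^sup>2) \<le> B)"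

lemma sobolev_boundD:
  assumes "sobolev_bound s g B"
  shows "continuous_on A g" "g (u + 1) = g u" "0 \<le> B"
  using assms unfolding sobolev_bound_def by (auto intro: continuous_on_subset)

lemma sobolev_bound_mono:
  assumes "sobolev_bound s g B" "B \<le> B'"
  shows "sobolev_bound s g B'"
proof -
  have "gagliardo2 circle_dist s g \<le> ennreal B'" if "gagliardo2 circle_dist s g \<le> ennreal B"
    using order_trans[OF that ennreal_leI[OF assms(2)]] .
  then show ?thesis using assms unfolding sobolev_bound_def by (auto split: if_splits intro: order_trans)
qed

lemma primitive_unique:
  fixes g q :: "real \<Rightarrow> 'a::euclidean_space"
  assumes "primitive g h" "primitive q h"
  shows "AE x in lborel. x \<in> {0..1} \<longrightarrow> g x = q x"
proof -
  note i = primitive_imp_integrable[OF assms(1)] primitive_imp_integrable[OF assms(2)]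
  have "AE x in lborel. x \<in> {0..1} \<longrightarrow> g x - q x = 0"
  proof (rule AE_eq_0_if_integrals_eq_0)
    show "set_integrable lborel {0..1} (\<lambda>x. g x - q x)" by (rule set_integral_diff(1)[OF i])
    fix u :: real assume u: "u \<in> {0..1}"
    have i': "set_integrable lborel {0..u} g" "set_integrable lborel {0..u} q"
      using set_integrable_subinterval[OF i(1), of 0 u] set_integrable_subinterval[OF i(2), of 0 u] u by auto
    show "(LINT x:{0..u}|lborel. g x - q x) = 0"
      using set_integral_diff(2)[OF i'] primitive_eq[OF assms(1) u] primitive_eq[OF assms(2) u] by simp
  qed
  then show ?thesis by simp
qed

lemma primitive_cong_AE:
  fixes g q :: "real \<Rightarrow> 'a::euclidean_space"
  assumes g: "primitive g h" and q: "set_integrable lborel {0..1} q"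
    and e: "AE x in lborel. x \<in> {0..1} \<longrightarrow> g x = q x"
  shows "primitive q h"
proof -
  have "(LINT x:{0..u}|lborel. g x) = (LINT x:{0..u}|lborel. q x)" if u: "u \<in> {0..1}" for u
  proof -
    have i: "set_integrable lborel {0..u} g" "set_integrable lborel {0..u} q"
      using set_integrable_subinterval[OF primitive_imp_integrable[OF g], of 0 u]
        set_integrable_subinterval[OF q, of 0 u] u by auto
    show ?thesis
      unfolding set_lebesgue_integral_def
    proof (rule integral_cong_AE)
      show "(\<lambda>x. indicator {0..u} x *\<^sub>R g x) \<in> borel_measurable lborel"
        "(\<lambda>x. indicator {0..u} x *\<^sub>R q x) \<in> borel_measurable lborel"
        by (fact i[unfolded set_integrable_def, THEN borel_measurable_integrable])+
      show "AE x in lborel. indicator {0..u} x *\<^sub>R g x = indicator {0..u} x *\<^sub>R q x"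
        using e by (rule AE_mp) (intro AE_I2 impI, use u in \<open>auto simp: indicator_def\<close>)
    qed
  qed
  then show ?thesis using g q unfolding primitive_def by metis
qed

lemma primitive_cong:
  assumes "primitive g h" "\<And>u. u \<in> {0..1} \<Longrightarrow> h u = k u"
  shows "primitive g k"
proof -
  have "h 0 = k 0" using assms(2)[of 0] by simp
  then show ?thesis using assms unfolding primitive_def by metis
qed

text \<open>The difference is orthogonal to all test functions and continuous.\<close>

lemma continuous_AE_eq:
  fixes f g :: "real \<Rightarrow> 'a::euclidean_space"
  assumes "continuous_on {0..1} f" "continuous_on {0..1} g"
    and "AE x in lborel. x \<in> {0..1} \<longrightarrow> f x = g x" and u: "u \<in> {0..1}"
  shows "f u = g u"
proof -
  have "f v - g v = 0" if "v \<in> {0<..<1}" for v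
  proof (rule continuous_orthogonal_to_tests[OF _ _ that])
    show "continuous_on {0..1} (\<lambda>v. f v - g v)" by (intro continuous_intros assms)
    fix \<phi> assume "\<phi> \<in> circle_tests"
    have "AE x in lborel. indicator {0..1} x *\<^sub>R \<phi> x *\<^sub>R (f x - g x) = 0"
      using assms(3) by (rule AE_mp) (intro AE_I2 impI, auto simp: indicator_def)
    then show "(LINT u:{0..1}|lborel. \<phi> u *\<^sub>R (f u - g u)) = 0"
      unfolding set_lebesgue_integral_def by (rule integral_eq_zero_AE)
  qed
  moreover have "closure {0<..<1} = {0..1::real}" by (simp add: closure_greaterThanLessThan)
  ultimately have "f u - g u = 0"
    using continuous_constant_on_closure[of "{0<..<1}" "\<lambda>v. f v - g v" 0 u] u assms(1,2)
    by (simp add: continuous_on_diff)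
  then show ?thesis by simp
qed

lemma order_1s:
  assumes "1/2 < s" "s \<le> (1::real)"
  shows "s < 1 \<Longrightarrow> nat \<lfloor>1 + s\<rfloor> = 1" "s < 1 \<Longrightarrow> frac (1 + s) = s"
    "s < 1 \<Longrightarrow> nat \<lfloor>2 + s\<rfloor> = 2" "s < 1 \<Longrightarrow> frac (2 + s) = s"
    "\<not> s < 1 \<Longrightarrow> nat \<lfloor>1 + s\<rfloor> = 2" "\<not> s < 1 \<Longrightarrow> frac (1 + s) = 0"
    "\<not> s < 1 \<Longrightarrow> nat \<lfloor>2 + s\<rfloor> = 3" "\<not> s < 1 \<Longrightarrow> frac (2 + s) = 0"
proof -
  have f: "\<lfloor>1 + s\<rfloor> = 1" "\<lfloor>2 + s\<rfloor> = 2" if "s < 1"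
    using that assms by (auto intro!: floor_unique)
  then show "s < 1 \<Longrightarrow> nat \<lfloor>1 + s\<rfloor> = 1" "s < 1 \<Longrightarrow> frac (1 + s) = s"
    "s < 1 \<Longrightarrow> nat \<lfloor>2 + s\<rfloor> = 2" "s < 1 \<Longrightarrow> frac (2 + s) = s" by (simp_all add: frac_def)
  have e: "s = 1" if "\<not> s < 1" using that assms by simp
  show "\<not> s < 1 \<Longrightarrow> nat \<lfloor>1 + s\<rfloor> = 2" "\<not> s < 1 \<Longrightarrow> frac (1 + s) = 0"
    "\<not> s < 1 \<Longrightarrow> nat \<lfloor>2 + s\<rfloor> = 3" "\<not> s < 1 \<Longrightarrow> frac (2 + s) = 0"
    using e by (simp_all add: frac_def)
qed

text \<open>The weak derivative \<open>g\<close> has a continuous representative: for \<open>s < 1\<close> by the fractional embedding, and for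
  \<open>s = 1\<close> because it has a square integrable weak derivative itself and is therefore a primitive.\<close>

lemma weak_derivative_is_classical:
  fixes h g :: "real \<Rightarrow> 'a::euclidean_space"
  assumes s: "1/2 < s" and c: "continuous_on UNIV h" and per: "\<And>u. h (u + 1) = h u"
    and g: "square_integrable g" and w: "weak_deriv circle_tests 1 h g"
    and top: "s < 1 \<Longrightarrow> gagliardo2 circle_dist s g < \<infinity>"
      "\<not> s < 1 \<Longrightarrow> \<exists>G. square_integrable G \<and> weak_deriv circle_tests 1 g G"
  shows "\<exists>q B. (\<forall>u. (h has_vector_derivative q u) (at u)) \<and> sobolev_bound s q B"
proof -
  have c01: "continuous_on {0..1} h" using c by (rule continuous_on_subset) simp
  obtain p where p: "primitive g p" "AE x in lborel. x \<in> {0..1} \<longrightarrow> h x = p x"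
    using weak_deriv_1_imp_primitive[OF square_integrable_continuous[OF c01] g w] by blast
  have "h u = p u" if "u \<in> {0..1}" for u
    by (rule continuous_AE_eq[OF c01 primitive_continuous_on[OF p(1)] p(2) that])
  then have ph: "primitive g h" using primitive_cong[OF p(1), of h] by simp
  show ?thesis
  proof (cases "s < 1")
    case True
    obtain q where q: "continuous_on UNIV q" "\<And>u. q (u + 1) = q u" "primitive q h"
      by (rule gagliardo_embedding[OF s ph g c per top(1)[OF True]]) (rule that)
    have "gagliardo2 circle_dist s q = gagliardo2 circle_dist s g"
      by (rule gagliardo_cong[OF primitive_unique[OF q(3) ph]])
    then have "gagliardo2 circle_dist s q \<le> ennreal (enn2real (gagliardo2 circle_dist s g))"
      using top(1)[OF True] by (simp add: ennreal_enn2real_if)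
    then have "sobolev_bound s q (enn2real (gagliardo2 circle_dist s g))"
      unfolding sobolev_bound_def using q True by simp
    moreover have "(h has_vector_derivative q u) (at u)" for u
      by (rule primitive_periodic_C1[of h q]) (fact per q)+
    ultimately show ?thesis by blast
  next
    case False
    obtain G where G: "square_integrable G" "weak_deriv circle_tests 1 g G" using top(2)[OF False] by blast
    obtain p2 where p2: "primitive G p2" "p2 0 = p2 1" "AE x in lborel. x \<in> {0..1} \<longrightarrow> g x = p2 x"
      using weak_deriv_1_imp_primitive[OF g G] by blast
    obtain q where q: "continuous_on UNIV q" "\<And>u. q (u + 1) = q u" "\<And>u. u \<in> {0..1} \<Longrightarrow> q u = p2 u"
      by (rule periodic_extension[OF primitive_continuous_on[OF p2(1)] p2(2)]) (rule that)
    have pq: "primitive G q" using primitive_cong[OF p2(1), of q] q(3) by simp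
    have "AE x in lborel. x \<in> {0..1} \<longrightarrow> g x = q x"
      using p2(3) by (rule AE_mp) (intro AE_I2 impI, simp add: q(3))
    then have "primitive q h"
      by (rule primitive_cong_AE[OF ph borel_integrable_atLeastAtMost'[OF continuous_on_subset[OF q(1) subset_UNIV]]])
    then have "(h has_vector_derivative q u) (at u)" for u
      using primitive_periodic_C1[of h q] per q(1,2) by blast
    moreover have "sobolev_bound s q (LINT u:{0..1}|lborel. (norm (G u))\<^sup>2)"
      unfolding sobolev_bound_def using q False G(1) pq
      by (auto simp: set_lebesgue_integral_def intro!: Bochner_Integration.integral_nonneg)
    ultimately show ?thesis by blast
  qed
qed

text \<open>Together with \<open>H_circleI\<close> below, this characterizes \<open>H\<^sup>1\<^sup>+\<^sup>s\<close> by classical derivatives.\<close>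

lemma H_circle_imp_C1:
  fixes h :: "real \<Rightarrow> 'a::euclidean_space"
  assumes s: "1/2 < s" "s \<le> 1" and h: "h \<in> H_circle (1 + s)"
  shows "\<exists>q B. (\<forall>u. (h has_vector_derivative q u) (at u)) \<and> sobolev_bound s q B"
proof -
  have c: "continuous_on UNIV h" "\<And>u. h (u + 1) = h u"
    and so: "\<And>j. j \<le> nat \<lfloor>1 + s\<rfloor> \<Longrightarrow> \<exists>g. square_integrable g \<and> weak_deriv circle_tests j h g \<and>
        (j = nat \<lfloor>1 + s\<rfloor> \<and> frac (1 + s) > 0 \<longrightarrow> gagliardo2 circle_dist (frac (1 + s)) g < \<infinity>)"
    using h unfolding H_circle_def in_sobolev_def by auto
  have "1 \<le> nat \<lfloor>1 + s\<rfloor>" using order_1s[OF s] by (cases "s < 1") auto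
  then obtain g where g: "square_integrable g" "weak_deriv circle_tests 1 h g"
    "1 = nat \<lfloor>1 + s\<rfloor> \<and> frac (1 + s) > 0 \<longrightarrow> gagliardo2 circle_dist (frac (1 + s)) g < \<infinity>"
    using so[of 1] by blast
  show ?thesis
  proof (rule weak_derivative_is_classical[OF s(1) c g(1,2)])
    show "gagliardo2 circle_dist s g < \<infinity>" if "s < 1" using g(3) order_1s[OF s] that s by auto
    show "\<exists>G. square_integrable G \<and> weak_deriv circle_tests 1 g G" if ns: "\<not> s < 1"
    proof -
      obtain G where G: "square_integrable G" "weak_deriv circle_tests (Suc 1) h G"
        using so[of "Suc 1"] order_1s(5)[OF s ns] by auto
      then show ?thesis using weak_deriv_quotient[OF g(2) G(2) circle_tests_deriv] by blast
    qed
  qed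
qed

text \<open>The first weak derivative of \<open>h\<close> is a primitive of the second one and thus has a continuous
  representative \<open>p\<close>. The preceding argument then applies to \<open>p\<close> in place of \<open>h\<close>.\<close>

lemma H_circle_imp_C2:
  fixes h :: "real \<Rightarrow> 'a::euclidean_space"
  assumes s: "1/2 < s" "s \<le> 1" and h: "h \<in> H_circle (2 + s)"
  shows "\<exists>p q B. (\<forall>u. (h has_vector_derivative p u) (at u)) \<and> (\<forall>u. p (u + 1) = p u) \<and>
    (\<forall>u. (p has_vector_derivative q u) (at u)) \<and> sobolev_bound s q B"
proof -
  have c: "continuous_on UNIV h" "\<And>u. h (u + 1) = h u"
    and so: "\<And>j. j \<le> nat \<lfloor>2 + s\<rfloor> \<Longrightarrow> \<exists>g. square_integrable g \<and> weak_deriv circle_tests j h g \<and>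
        (j = nat \<lfloor>2 + s\<rfloor> \<and> frac (2 + s) > 0 \<longrightarrow> gagliardo2 circle_dist (frac (2 + s)) g < \<infinity>)"
    using h unfolding H_circle_def in_sobolev_def by auto
  have "2 \<le> nat \<lfloor>2 + s\<rfloor>" using order_1s[OF s] by (cases "s < 1") auto
  then obtain g1 g2 where g1: "square_integrable g1" "weak_deriv circle_tests 1 h g1"
    and g2: "square_integrable g2" "weak_deriv circle_tests (Suc 1) h g2"
    "2 = nat \<lfloor>2 + s\<rfloor> \<and> frac (2 + s) > 0 \<longrightarrow> gagliardo2 circle_dist (frac (2 + s)) g2 < \<infinity>"
    using so[of 1] so[of 2] by (auto simp: numeral_2_eq_2)
  have w12: "weak_deriv circle_tests 1 g1 g2" by (rule weak_deriv_quotient[OF g1(2) g2(2) circle_tests_deriv])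
  obtain p0 where p0: "primitive g2 p0" "p0 0 = p0 1" "AE x in lborel. x \<in> {0..1} \<longrightarrow> g1 x = p0 x"
    using weak_deriv_1_imp_primitive[OF g1(1) g2(1) w12] by blast
  obtain p where p: "continuous_on UNIV p" "\<And>u. p (u + 1) = p u" "\<And>u. u \<in> {0..1} \<Longrightarrow> p u = p0 u"
    by (rule periodic_extension[OF primitive_continuous_on[OF p0(1)] p0(2)]) (rule that)
  have c01: "continuous_on {0..1} h" using c(1) by (rule continuous_on_subset) simp
  obtain h0 where h0: "primitive g1 h0" "AE x in lborel. x \<in> {0..1} \<longrightarrow> h x = h0 x"
    using weak_deriv_1_imp_primitive[OF square_integrable_continuous[OF c01] g1] by blast
  have "h u = h0 u" if "u \<in> {0..1}" for u
    by (rule continuous_AE_eq[OF c01 primitive_continuous_on[OF h0(1)] h0(2) that])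
  then have ph: "primitive g1 h" using primitive_cong[OF h0(1), of h] by simp
  have "AE x in lborel. x \<in> {0..1} \<longrightarrow> g1 x = p x"
    using p0(3) by (rule AE_mp) (intro AE_I2 impI, simp add: p(3))
  then have "primitive p h"
    by (rule primitive_cong_AE[OF ph borel_integrable_atLeastAtMost'[OF continuous_on_subset[OF p(1) subset_UNIV]]])
  then have d1: "(h has_vector_derivative p u) (at u)" for u
    using primitive_periodic_C1[of h p] c(2) p(1,2) by blast
  have "primitive g2 p" using primitive_cong[OF p0(1), of p] p(3) by simp
  moreover have "p 0 = p 1" using p(2)[of 0] by simp
  ultimately have wp: "weak_deriv circle_tests 1 p g2" by (rule weak_deriv_circle_primitive)
  have "\<exists>q B. (\<forall>u. (p has_vector_derivative q u) (at u)) \<and> sobolev_bound s q B"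
  proof (rule weak_derivative_is_classical[OF s(1) p(1,2) g2(1) wp])
    show "gagliardo2 circle_dist s g2 < \<infinity>" if "s < 1" using g2(3) order_1s[OF s] that s by auto
    show "\<exists>G. square_integrable G \<and> weak_deriv circle_tests 1 g2 G" if ns: "\<not> s < 1"
    proof -
      obtain G where G: "square_integrable G" "weak_deriv circle_tests (Suc (Suc 1)) h G"
        using so[of "Suc (Suc 1)"] order_1s(7)[OF s ns] by auto
      then show ?thesis using weak_deriv_quotient[OF g2(2) G(2) circle_tests_deriv] by blast
    qed
  qed
  then show ?thesis using d1 p(2) by blast
qed

lemma primitive_derivative:
  fixes h q :: "real \<Rightarrow> 'a::euclidean_space"
  assumes "\<And>u. (h has_vector_derivative q u) (at u)" "continuous_on UNIV q"
  shows "primitive q h"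
  by (rule primitive_C1) (use assms in \<open>auto intro: has_vector_derivative_at_within continuous_on_subset\<close>)

lemma C1_weak_deriv_circle:
  fixes h q :: "real \<Rightarrow> 'a::euclidean_space"
  assumes "\<And>u. (h has_vector_derivative q u) (at u)" "continuous_on UNIV q" "\<And>u. h (u + 1) = h u"
  shows "weak_deriv circle_tests 1 h q"
  by (rule weak_deriv_circle_primitive[OF primitive_derivative[OF assms(1,2)]]) (use assms(3)[of 0] in simp)

lemma has_vector_derivative_imp_continuous_on:
  assumes "\<And>u. (h has_vector_derivative q u) (at u)"
  shows "continuous_on A h"
  using assms by (meson has_vector_derivative_continuous continuous_at_imp_continuous_on)

lemma H_circleI:
  fixes h q :: "real \<Rightarrow> 'a::euclidean_space"
  assumes s: "1/2 < s" "s \<le> 1" and d: "\<And>u. (h has_vector_derivative q u) (at u)"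
    and per: "\<And>u. h (u + 1) = h u" and B: "sobolev_bound s q B"
  shows "h \<in> H_circle (1 + s)"
proof -
  have ch: "continuous_on A h" for A by (rule has_vector_derivative_imp_continuous_on[OF d])
  have sqh: "square_integrable h" by (rule square_integrable_continuous[OF ch])
  have sqq: "square_integrable q" by (rule square_integrable_continuous[OF sobolev_boundD(1)[OF B]])
  have w1: "weak_deriv circle_tests 1 h q" by (rule C1_weak_deriv_circle[OF d sobolev_boundD(1)[OF B] per])
  have "\<exists>g. square_integrable g \<and> weak_deriv circle_tests j h g \<and>
        (j = nat \<lfloor>1 + s\<rfloor> \<and> frac (1 + s) > 0 \<longrightarrow> gagliardo2 circle_dist (frac (1 + s)) g < \<infinity>)"
    if j: "j \<le> nat \<lfloor>1 + s\<rfloor>" for j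
  proof (cases "s < 1")
    case True
    have "gagliardo2 circle_dist s q < \<infinity>"
      using B True unfolding sobolev_bound_def by (auto intro: le_less_trans)
    then have 1: "square_integrable q \<and> weak_deriv circle_tests 1 h q \<and> gagliardo2 circle_dist s q < \<infinity>"
      using sqq w1 by blast
    have "j = 0 \<or> j = 1" using j order_1s[OF s] True by auto
    then show ?thesis using 1 sqh weak_deriv_0[of circle_tests h] order_1s[OF s] True by auto
  next
    case False
    obtain G where G: "square_integrable G" "primitive G q"
      using B False unfolding sobolev_bound_def by auto
    have "weak_deriv circle_tests 1 q G"
      by (rule weak_deriv_circle_primitive[OF G(2)]) (use sobolev_boundD(2)[OF B, of 0] in simp)
    then have w2: "weak_deriv circle_tests (Suc 1) h G" by (rule weak_deriv_Suc[OF w1 _ circle_tests_deriv])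
    have "j = 0 \<or> j = 1 \<or> j = Suc 1" using j order_1s[OF s] False by auto
    then show ?thesis using G(1) w1 w2 sqh sqq weak_deriv_0[of circle_tests h] order_1s[OF s] False by auto
  qed
  then show ?thesis unfolding H_circle_def in_sobolev_def using ch per sqh by blast
qed

lemma integral_norm_squared_cong_AE:
  fixes f g :: "real \<Rightarrow> 'a::euclidean_space"
  assumes f: "square_integrable f" and g: "square_integrable g"
    and e: "AE x in lborel. x \<in> {0..1} \<longrightarrow> f x = g x"
  shows "(LINT u:{0..1}|lborel. (norm (f u))\<^sup>2) = (LINT u:{0..1}|lborel. (norm (g u))\<^sup>2)"
  unfolding set_lebesgue_integral_def
proof (rule integral_cong_AE)
  show "(\<lambda>x. indicator {0..1} x *\<^sub>R (norm (f x))\<^sup>2) \<in> borel_measurable lborel"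
    "(\<lambda>x. indicator {0..1} x *\<^sub>R (norm (g x))\<^sup>2) \<in> borel_measurable lborel"
    by (fact f[unfolded square_integrable_def set_integrable_def, THEN conjunct2, THEN borel_measurable_integrable]
        g[unfolded square_integrable_def set_integrable_def, THEN conjunct2, THEN borel_measurable_integrable])+
  show "AE x in lborel. indicator {0..1} x *\<^sub>R (norm (f x))\<^sup>2 = indicator {0..1} x *\<^sub>R (norm (g x))\<^sup>2"
    using e by (rule AE_mp) (intro AE_I2 impI, auto simp: indicator_def)
qed

lemma circle_wderiv_eq:
  fixes f g :: "real \<Rightarrow> 'a::euclidean_space"
  assumes "square_integrable g" "weak_deriv circle_tests j f g"
  shows "square_integrable (circle_wderiv j f)" "weak_deriv circle_tests j f (circle_wderiv j f)"
    "AE x in lborel. x \<in> {0..1} \<longrightarrow> circle_wderiv j f x = g x"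
    "(LINT u:{0..1}|lborel. (norm (circle_wderiv j f u))\<^sup>2) = (LINT u:{0..1}|lborel. (norm (g u))\<^sup>2)"
proof -
  have "square_integrable (circle_wderiv j f) \<and> weak_deriv circle_tests j f (circle_wderiv j f)"
    unfolding circle_wderiv_def by (rule someI[of _ g]) (use assms in blast)
  then show *: "square_integrable (circle_wderiv j f)" "weak_deriv circle_tests j f (circle_wderiv j f)" by blast+
  show **: "AE x in lborel. x \<in> {0..1} \<longrightarrow> circle_wderiv j f x = g x"
    by (rule weak_deriv_unique[OF *(1) assms(1) *(2) assms(2)])
  show "(LINT u:{0..1}|lborel. (norm (circle_wderiv j f u))\<^sup>2) = (LINT u:{0..1}|lborel. (norm (g u))\<^sup>2)"
    by (rule integral_norm_squared_cong_AE[OF *(1) assms(1) **])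
qed

lemma integral_norm_squared_nonneg: "0 \<le> (LINT u:{0..1::real}|lborel. (norm (f u))\<^sup>2)"
  unfolding set_lebesgue_integral_def by (intro Bochner_Integration.integral_nonneg) auto

lemma integral_norm_squared_le:
  fixes f :: "real \<Rightarrow> 'a::euclidean_space"
  assumes "square_integrable f" "\<And>u. u \<in> {0..1} \<Longrightarrow> norm (f u) \<le> a"
  shows "(LINT u:{0..1}|lborel. (norm (f u))\<^sup>2) \<le> a\<^sup>2"
proof -
  have "(LINT u:{0..1}|lborel. (norm (f u))\<^sup>2) \<le> (LINT u:{0..1::real}|lborel. a\<^sup>2)"
  proof (rule set_integral_mono)
    show "set_integrable lborel {0..1} (\<lambda>u. (norm (f u))\<^sup>2)" using assms(1) unfolding square_integrable_def by blast
    show "set_integrable lborel {0..1::real} (\<lambda>u. a\<^sup>2)" by (intro borel_integrable_atLeastAtMost' continuous_intros)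
    show "(norm (f u))\<^sup>2 \<le> a\<^sup>2" if "u \<in> {0..1}" for u using assms(2)[OF that] by (intro power_mono) auto
  qed
  also have "\<dots> = a\<^sup>2" by (simp add: set_lebesgue_integral_def)
  finally show ?thesis .
qed

text \<open>Through these estimates the norm of \<open>H\<^sup>1\<^sup>+\<^sup>s\<close> is accessible without reference to weak derivatives: small
  perturbations are recognized by the first estimate, and the remainder of the length is controlled by
  the second.\<close>

lemma H_norm_bounds:
  fixes h q :: "real \<Rightarrow> 'a::euclidean_space"
  assumes s: "1/2 < s" "s \<le> 1" and d: "\<And>u. (h has_vector_derivative q u) (at u)"
    and per: "\<And>u. h (u + 1) = h u" and B: "sobolev_bound s q B"
  shows "(\<And>u. u \<in> {0..1} \<Longrightarrow> norm (h u) \<le> a) \<Longrightarrow> (\<And>u. u \<in> {0..1} \<Longrightarrow> norm (q u) \<le> b) \<Longrightarrow>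
      H_norm (1 + s) h \<le> sqrt (a\<^sup>2 + b\<^sup>2 + B)"
    and "(LINT u:{0..1}|lborel. (norm (q u))\<^sup>2) \<le> (H_norm (1 + s) h)\<^sup>2"
    and "0 \<le> H_norm (1 + s) h"
proof -
  define top where "top = (if s < 1 then enn2real (gagliardo2 circle_dist s (circle_wderiv 1 h))
    else (LINT u:{0..1}|lborel. (norm (circle_wderiv 2 h u))\<^sup>2))"
  have ch: "continuous_on A h" for A by (rule has_vector_derivative_imp_continuous_on[OF d])
  have sqh: "square_integrable h" by (rule square_integrable_continuous[OF ch])
  have sqq: "square_integrable q" by (rule square_integrable_continuous[OF sobolev_boundD(1)[OF B]])
  have w1: "weak_deriv circle_tests 1 h q" by (rule C1_weak_deriv_circle[OF d sobolev_boundD(1)[OF B] per])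
  note c0 = circle_wderiv_eq[OF sqh weak_deriv_0]
  note c1 = circle_wderiv_eq[OF sqq w1]
  have H: "H_norm (1 + s) h = sqrt ((LINT u:{0..1}|lborel. (norm (h u))\<^sup>2) + (LINT u:{0..1}|lborel. (norm (q u))\<^sup>2) + top)"
  proof (cases "s < 1")
    case True
    have "(\<Sum>j\<le>1. f j) = f 0 + f 1" for f :: "nat \<Rightarrow> real" by simp
    then show ?thesis
      unfolding H_norm_def top_def order_1s(1,2)[OF s True] using s True
      by (simp only: c0(4) c1(4)) simp
  next
    case False
    have "(\<Sum>j\<le>2. f j) = f 0 + f 1 + f 2" for f :: "nat \<Rightarrow> real" by (simp add: numeral_2_eq_2)
    then show ?thesis
      unfolding H_norm_def top_def order_1s(5,6)[OF s False] using False
      by (simp only: c0(4) c1(4)) simp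
  qed
  have top: "0 \<le> top" "top \<le> B"
  proof -
    show "0 \<le> top" unfolding top_def by (simp add: integral_norm_squared_nonneg)
    show "top \<le> B"
    proof (cases "s < 1")
      case True
      have "gagliardo2 circle_dist s (circle_wderiv 1 h) = gagliardo2 circle_dist s q"
        by (rule gagliardo_cong[OF c1(3)])
      also have "\<dots> \<le> ennreal B" using B True unfolding sobolev_bound_def by simp
      finally have "enn2real (gagliardo2 circle_dist s (circle_wderiv 1 h)) \<le> B"
        using enn2real_leI[OF sobolev_boundD(3)[OF B]] by blast
      then show ?thesis using True by (simp add: top_def)
    next
      case False
      obtain G where G: "square_integrable G" "primitive G q" "(LINT u:{0..1}|lborel. (norm (G u))\<^sup>2) \<le> B"
        using B False unfolding sobolev_bound_def by auto
      have "weak_deriv circle_tests 1 q G"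
        by (rule weak_deriv_circle_primitive[OF G(2)]) (use sobolev_boundD(2)[OF B, of 0] in simp)
      then have "weak_deriv circle_tests (Suc 1) h G" by (rule weak_deriv_Suc[OF w1 _ circle_tests_deriv])
      then have "(LINT u:{0..1}|lborel. (norm (circle_wderiv (Suc 1) h u))\<^sup>2) \<le> B"
        using circle_wderiv_eq(4)[OF G(1)] G(3) by metis
      then show ?thesis using False by (simp add: top_def numeral_2_eq_2)
    qed
  qed
  show "0 \<le> H_norm (1 + s) h"
    unfolding H using top integral_norm_squared_nonneg[of h] integral_norm_squared_nonneg[of q] by simp
  show "(LINT u:{0..1}|lborel. (norm (q u))\<^sup>2) \<le> (H_norm (1 + s) h)\<^sup>2"
    unfolding H using top integral_norm_squared_nonneg[of h] integral_norm_squared_nonneg[of q] by simp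
  assume "\<And>u. u \<in> {0..1} \<Longrightarrow> norm (h u) \<le> a" "\<And>u. u \<in> {0..1} \<Longrightarrow> norm (q u) \<le> b"
  then show "H_norm (1 + s) h \<le> sqrt (a\<^sup>2 + b\<^sup>2 + B)"
    unfolding H using top integral_norm_squared_le[OF sqh] integral_norm_squared_le[OF sqq]
    by (intro real_sqrt_le_mono add_mono) auto
qed

section \<open>Algebraic operations\<close>

text \<open>A pointwise inequality between squared increments passes to the seminorms. Sums, products and
  components only differ in this inequality.\<close>

lemma gagliardo_combination:
  fixes f :: "real \<Rightarrow> 'a::euclidean_space" and g :: "real \<Rightarrow> 'b::euclidean_space"
    and w :: "real \<Rightarrow> 'c::euclidean_space"
  assumes f: "continuous_on UNIV f" and g: "continuous_on UNIV g" and ab: "0 \<le> a" "0 \<le> b"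
    and le: "\<And>u v. (norm (w u - w v))\<^sup>2 \<le> a * (norm (f u - f v))\<^sup>2 + b * (norm (g u - g v))\<^sup>2"
  shows "gagliardo2 circle_dist \<sigma> w \<le> ennreal a * gagliardo2 circle_dist \<sigma> f + ennreal b * gagliardo2 circle_dist \<sigma> g"
proof -
  have [measurable]: "f \<in> borel_measurable borel" "g \<in> borel_measurable borel"
    using f g by (auto intro: borel_measurable_continuous_onI)
  define k where "k n u v = ennreal ((n u v)\<^sup>2 / circle_dist u v powr (1 + 2 * \<sigma>)) * indicator {0..1} v * indicator {0..1} u"
    for n :: "real \<Rightarrow> real \<Rightarrow> real" and u v
  define df where "df u v = norm (f u - f v)" for u v
  define dg where "dg u v = norm (g u - g v)" for u v
  define dw where "dw u v = norm (w u - w v)" for u v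
  have [measurable]: "(\<lambda>(u, v). df u v) \<in> borel_measurable (borel \<Otimes>\<^sub>M borel)"
    "(\<lambda>(u, v). dg u v) \<in> borel_measurable (borel \<Otimes>\<^sub>M borel)"
    unfolding df_def dg_def by measurable
  have mk: "(\<lambda>(u, v). k df u v) \<in> borel_measurable (borel \<Otimes>\<^sub>M borel)"
    "(\<lambda>(u, v). k dg u v) \<in> borel_measurable (borel \<Otimes>\<^sub>M borel)"
    unfolding k_def circle_dist_def by measurable
  note [measurable] = mk
  have G: "gagliardo2 circle_dist \<sigma> f = (\<integral>\<^sup>+u. \<integral>\<^sup>+v. k df u v \<partial>lborel \<partial>lborel)"
    "gagliardo2 circle_dist \<sigma> g = (\<integral>\<^sup>+u. \<integral>\<^sup>+v. k dg u v \<partial>lborel \<partial>lborel)"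
    unfolding gagliardo2_def
    by (rule nn_integral_cong, auto simp: k_def df_def dg_def indicator_def)+
  have kw: "k dw u v \<le> ennreal a * k df u v + ennreal b * k dg u v" for u v
  proof -
    have "(norm (w u - w v))\<^sup>2 / circle_dist u v powr (1 + 2 * \<sigma>) \<le>
       a * ((norm (f u - f v))\<^sup>2 / circle_dist u v powr (1 + 2 * \<sigma>)) + b * ((norm (g u - g v))\<^sup>2 / circle_dist u v powr (1 + 2 * \<sigma>))"
      using divide_right_mono[OF le[of u v], of "circle_dist u v powr (1 + 2 * \<sigma>)"]
      by (simp add: add_divide_distrib)
    then have "ennreal ((norm (w u - w v))\<^sup>2 / circle_dist u v powr (1 + 2 * \<sigma>)) \<le>
       ennreal a * ennreal ((norm (f u - f v))\<^sup>2 / circle_dist u v powr (1 + 2 * \<sigma>)) +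
       ennreal b * ennreal ((norm (g u - g v))\<^sup>2 / circle_dist u v powr (1 + 2 * \<sigma>))"
      using ab by (simp add: ennreal_mult[symmetric] ennreal_plus[symmetric] ennreal_leI del: ennreal_plus)
    then show ?thesis by (auto simp: k_def dw_def df_def dg_def indicator_def)
  qed
  have "gagliardo2 circle_dist \<sigma> w \<le> (\<integral>\<^sup>+u. \<integral>\<^sup>+v. k dw u v \<partial>lborel \<partial>lborel)"
    unfolding gagliardo2_def
    by (intro nn_integral_mono) (auto simp: k_def dw_def indicator_def)
  also have "\<dots> \<le> (\<integral>\<^sup>+u. \<integral>\<^sup>+v. ennreal a * k df u v + ennreal b * k dg u v \<partial>lborel \<partial>lborel)"
    by (intro nn_integral_mono kw)
  also have "\<dots> = (\<integral>\<^sup>+u. ennreal a * (\<integral>\<^sup>+v. k df u v \<partial>lborel) + ennreal b * (\<integral>\<^sup>+v. k dg u v \<partial>lborel) \<partial>lborel)"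
  proof (rule nn_integral_cong)
    fix u :: real
    have "(\<lambda>v. k df u v) \<in> borel_measurable lborel" "(\<lambda>v. k dg u v) \<in> borel_measurable lborel"
      by measurable
    then show "(\<integral>\<^sup>+v. ennreal a * k df u v + ennreal b * k dg u v \<partial>lborel) =
      ennreal a * (\<integral>\<^sup>+v. k df u v \<partial>lborel) + ennreal b * (\<integral>\<^sup>+v. k dg u v \<partial>lborel)"
      by (subst nn_integral_add) (auto simp: nn_integral_cmult)
  qed
  also have "\<dots> = ennreal a * (\<integral>\<^sup>+u. \<integral>\<^sup>+v. k df u v \<partial>lborel \<partial>lborel) + ennreal b * (\<integral>\<^sup>+u. \<integral>\<^sup>+v. k dg u v \<partial>lborel \<partial>lborel)"
  proof -
    have "(\<lambda>u. \<integral>\<^sup>+v. k df u v \<partial>lborel) \<in> borel_measurable lborel" "(\<lambda>u. \<integral>\<^sup>+v. k dg u v \<partial>lborel) \<in> borel_measurable lborel"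
      by measurable
    then show ?thesis by (subst nn_integral_add) (auto simp: nn_integral_cmult)
  qed
  finally show ?thesis by (simp add: G)
qed

text \<open>For \<open>s = 1\<close> the derivatives have to satisfy the same inequality as the increments do for \<open>s < 1\<close>.\<close>

lemma sobolev_bound_combination:
  fixes f :: "real \<Rightarrow> 'a::euclidean_space" and g :: "real \<Rightarrow> 'b::euclidean_space"
    and w :: "real \<Rightarrow> 'c::euclidean_space"
  assumes f: "sobolev_bound s f A" and g: "sobolev_bound s g B" and ab: "0 \<le> a" "0 \<le> b"
    and w: "continuous_on UNIV w" "\<And>u. w (u + 1) = w u"
    and le: "\<And>u v. (norm (w u - w v))\<^sup>2 \<le> a * (norm (f u - f v))\<^sup>2 + b * (norm (g u - g v))\<^sup>2"
    and prim: "\<And>F G. primitive F f \<Longrightarrow> primitive G g \<Longrightarrow>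
      \<exists>W. primitive W w \<and> (\<forall>u\<in>{0..1}. (norm (W u))\<^sup>2 \<le> a * (norm (F u))\<^sup>2 + b * (norm (G u))\<^sup>2)"
  shows "sobolev_bound s w (a * A + b * B)"
proof (cases "s < 1")
  case True
  note AB = sobolev_boundD(3)[OF f] sobolev_boundD(3)[OF g]
  have "gagliardo2 circle_dist s w \<le> ennreal a * gagliardo2 circle_dist s f + ennreal b * gagliardo2 circle_dist s g"
    by (rule gagliardo_combination[OF sobolev_boundD(1)[OF f] sobolev_boundD(1)[OF g] ab le])
  also have "\<dots> \<le> ennreal a * ennreal A + ennreal b * ennreal B"
    using f g True unfolding sobolev_bound_def by (intro add_mono mult_left_mono) auto
  also have "\<dots> = ennreal (a * A + b * B)" using ab AB by (simp add: ennreal_mult ennreal_plus)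
  finally show ?thesis using w AB ab True unfolding sobolev_bound_def by simp
next
  case False
  note AB = sobolev_boundD(3)[OF f] sobolev_boundD(3)[OF g]
  obtain F where F: "square_integrable F" "primitive F f" "(LINT u:{0..1}|lborel. (norm (F u))\<^sup>2) \<le> A"
    using f False unfolding sobolev_bound_def by auto
  obtain G where G: "square_integrable G" "primitive G g" "(LINT u:{0..1}|lborel. (norm (G u))\<^sup>2) \<le> B"
    using g False unfolding sobolev_bound_def by auto
  obtain W where W: "primitive W w" "\<And>u. u \<in> {0..1} \<Longrightarrow> (norm (W u))\<^sup>2 \<le> a * (norm (F u))\<^sup>2 + b * (norm (G u))\<^sup>2"
    using prim[OF F(2) G(2)] by blast
  have iF: "set_integrable lborel {0..1} (\<lambda>u. a * (norm (F u))\<^sup>2)" and iG: "set_integrable lborel {0..1} (\<lambda>u. b * (norm (G u))\<^sup>2)"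
    using F(1) G(1) unfolding square_integrable_def by auto
  have iFG: "set_integrable lborel {0..1} (\<lambda>u. a * (norm (F u))\<^sup>2 + b * (norm (G u))\<^sup>2)"
    by (rule set_integral_add(1)[OF iF iG])
  have mW: "set_borel_measurable lborel {0..1} W"
    using primitive_imp_integrable[OF W(1)] unfolding set_integrable_def set_borel_measurable_def
    by (rule borel_measurable_integrable)
  have sqW: "square_integrable W" by (rule square_integrable_dominated[OF mW iFG W(2)])
  then have iW: "set_integrable lborel {0..1} (\<lambda>u. (norm (W u))\<^sup>2)" unfolding square_integrable_def by blast
  have "(LINT u:{0..1}|lborel. (norm (W u))\<^sup>2) \<le> (LINT u:{0..1}|lborel. a * (norm (F u))\<^sup>2 + b * (norm (G u))\<^sup>2)"
    by (rule set_integral_mono[OF iW iFG W(2)])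
  also have "\<dots> = a * (LINT u:{0..1}|lborel. (norm (F u))\<^sup>2) + b * (LINT u:{0..1}|lborel. (norm (G u))\<^sup>2)"
    using set_integral_add(2)[OF iF iG] by simp
  also have "\<dots> \<le> a * A + b * B" using F(3) G(3) ab by (intro add_mono mult_left_mono)
  finally show ?thesis
    using w AB ab False W(1) sqW unfolding sobolev_bound_def by auto
qed

lemma sobolev_bound_add:
  fixes f g :: "real \<Rightarrow> 'a::euclidean_space"
  assumes f: "sobolev_bound s f A" and g: "sobolev_bound s g B"
  shows "sobolev_bound s (\<lambda>u. f u + g u) (2 * A + 2 * B)"
proof (rule sobolev_bound_combination[OF f g])
  show "continuous_on UNIV (\<lambda>u. f u + g u)" by (intro continuous_intros sobolev_boundD(1)[OF f] sobolev_boundD(1)[OF g])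
  show "f (u + 1) + g (u + 1) = f u + g u" for u using sobolev_boundD(2)[OF f] sobolev_boundD(2)[OF g] by simp
  show "(norm (f u + g u - (f v + g v)))\<^sup>2 \<le> 2 * (norm (f u - f v))\<^sup>2 + 2 * (norm (g u - g v))\<^sup>2" for u v
    using norm_add_squared_le[of "f u - f v" "g u - g v"] by (simp add: algebra_simps)
  fix F G assume F: "primitive F f" and G: "primitive G g"
  have "primitive (\<lambda>u. F u + G u) (\<lambda>u. f u + g u)" by (rule primitive_add[OF F G])
  then show "\<exists>W. primitive W (\<lambda>u. f u + g u) \<and> (\<forall>u\<in>{0..1}. (norm (W u))\<^sup>2 \<le> 2 * (norm (F u))\<^sup>2 + 2 * (norm (G u))\<^sup>2)"
    using norm_add_squared_le by blast
qed simp_all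

text \<open>The product rule, for increments as well as for derivatives, with both factors bounded.\<close>

lemma sobolev_bound_mult:
  fixes f :: "real \<Rightarrow> real" and g :: "real \<Rightarrow> 'a::euclidean_space"
  assumes f: "sobolev_bound s f A" and g: "sobolev_bound s g B"
    and a: "\<And>u. \<bar>f u\<bar> \<le> a" and b: "\<And>u. norm (g u) \<le> b"
  shows "sobolev_bound s (\<lambda>u. f u *\<^sub>R g u) (2 * b\<^sup>2 * A + 2 * a\<^sup>2 * B)"
proof (rule sobolev_bound_combination[OF f g])
  have scale: "(norm (x *\<^sub>R y + z *\<^sub>R t))\<^sup>2 \<le> 2 * b\<^sup>2 * (norm x)\<^sup>2 + 2 * a\<^sup>2 * (norm t)\<^sup>2"
    if "norm y \<le> b" "\<bar>z\<bar> \<le> a" for x z :: real and y t :: 'a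
  proof -
    have "(norm (x *\<^sub>R y + z *\<^sub>R t))\<^sup>2 \<le> 2 * (norm (x *\<^sub>R y))\<^sup>2 + 2 * (norm (z *\<^sub>R t))\<^sup>2"
      by (rule norm_add_squared_le)
    also have "\<dots> = 2 * ((norm y)\<^sup>2 * (norm x)\<^sup>2) + 2 * (\<bar>z\<bar>\<^sup>2 * (norm t)\<^sup>2)"
      by (simp add: power_mult_distrib mult.commute)
    also have "\<dots> \<le> 2 * (b\<^sup>2 * (norm x)\<^sup>2) + 2 * (a\<^sup>2 * (norm t)\<^sup>2)"
      using that by (intro add_mono mult_left_mono mult_right_mono power_mono) auto
    finally show ?thesis by simp
  qed
  show "continuous_on UNIV (\<lambda>u. f u *\<^sub>R g u)" by (intro continuous_intros sobolev_boundD(1)[OF f] sobolev_boundD(1)[OF g])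
  show "f (u + 1) *\<^sub>R g (u + 1) = f u *\<^sub>R g u" for u using sobolev_boundD(2)[OF f] sobolev_boundD(2)[OF g] by simp
  show "(norm (f u *\<^sub>R g u - f v *\<^sub>R g v))\<^sup>2 \<le> 2 * b\<^sup>2 * (norm (f u - f v))\<^sup>2 + 2 * a\<^sup>2 * (norm (g u - g v))\<^sup>2" for u v
    using scale[OF b[of u] a[of v], of "f u - f v" "g u - g v"] by (simp add: algebra_simps)
  fix F G assume F: "primitive F f" and G: "primitive G g"
  show "\<exists>W. primitive W (\<lambda>u. f u *\<^sub>R g u) \<and>
      (\<forall>u\<in>{0..1}. (norm (W u))\<^sup>2 \<le> 2 * b\<^sup>2 * (norm (F u))\<^sup>2 + 2 * a\<^sup>2 * (norm (G u))\<^sup>2)"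
  proof (intro exI conjI ballI)
    show "primitive (\<lambda>u. F u *\<^sub>R g u + f u *\<^sub>R G u) (\<lambda>u. f u *\<^sub>R g u)"
      by (rule primitive_mult(1)[OF F G])
  qed (rule scale[OF b a])
qed simp_all

lemma sobolev_bound_const: "sobolev_bound s (\<lambda>u. c) 0"
proof -
  have "primitive (\<lambda>u. 0) (\<lambda>u. c)"
    by (rule primitive_C1) (auto intro!: derivative_eq_intros)
  moreover have "square_integrable (\<lambda>u. 0 :: 'a)" by (intro square_integrable_continuous continuous_intros)
  moreover have "gagliardo2 circle_dist s (\<lambda>u. c) = 0" by (simp add: gagliardo2_def)
  ultimately show ?thesis
    unfolding sobolev_bound_def by (auto intro!: exI[of _ "\<lambda>u. 0"] simp: set_lebesgue_integral_def)
qed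

lemma sobolev_bound_scaleR:
  assumes "sobolev_bound s g B"
  shows "sobolev_bound s (\<lambda>u. c *\<^sub>R g u) (2 * c\<^sup>2 * B)"
proof -
  obtain b where "\<And>u. norm (g u) \<le> b"
    by (rule periodic_bounded[OF sobolev_boundD(1)[OF assms] sobolev_boundD(2)[OF assms]]) (rule that)
  from sobolev_bound_mult[OF sobolev_bound_const[of s c] assms order_refl this] show ?thesis by simp
qed

lemma sobolev_bound_component:
  assumes f: "sobolev_bound s f A" and e: "e \<in> Basis"
  shows "sobolev_bound s (\<lambda>u. f u \<bullet> e) A"
proof -
  have "sobolev_bound s (\<lambda>u. f u \<bullet> e) (1 * A + 0 * A)"
  proof (rule sobolev_bound_combination[OF f f])
    show "continuous_on UNIV (\<lambda>u. f u \<bullet> e)" by (intro continuous_intros sobolev_boundD(1)[OF f])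
    show "f (u + 1) \<bullet> e = f u \<bullet> e" for u using sobolev_boundD(2)[OF f] by simp
    have le: "(norm (x \<bullet> e))\<^sup>2 \<le> 1 * (norm x)\<^sup>2 + 0 * c" for x c
      using power_mono[OF Basis_le_norm[OF e, of x], of 2] by simp
    show "(norm (f u \<bullet> e - f v \<bullet> e))\<^sup>2 \<le> 1 * (norm (f u - f v))\<^sup>2 + 0 * (norm (f u - f v))\<^sup>2" for u v
      using le[of "f u - f v"] by (simp add: inner_diff_left)
    fix F G assume F: "primitive F f"
    have "primitive (\<lambda>u. F u \<bullet> e) (\<lambda>u. f u \<bullet> e)"
      unfolding primitive_def
    proof (intro conjI ballI)
      note i = primitive_imp_integrable[OF F]
      show "set_integrable lborel {0..1} (\<lambda>u. F u \<bullet> e)"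
        using integrable_inner_left[of e lborel "\<lambda>x. indicator {0..1} x *\<^sub>R F x"] i
        by (simp add: set_integrable_def)
      fix u :: real assume u: "u \<in> {0..1}"
      have "set_integrable lborel {0..u} F" using set_integrable_subinterval[OF i, of 0 u] u by simp
      then have "(LINT x|lborel. (indicator {0..u} x *\<^sub>R F x) \<bullet> e) = (LINT x:{0..u}|lborel. F x) \<bullet> e"
        unfolding set_lebesgue_integral_def set_integrable_def by (intro integral_inner_left) auto
      then show "f u \<bullet> e = f 0 \<bullet> e + (LINT x:{0..u}|lborel. F x \<bullet> e)"
        unfolding primitive_eq[OF F u] by (simp add: set_lebesgue_integral_def inner_diff_left)
    qed
    then show "\<exists>W. primitive W (\<lambda>u. f u \<bullet> e) \<and> (\<forall>u\<in>{0..1}. (norm (W u))\<^sup>2 \<le> 1 * (norm (F u))\<^sup>2 + 0 * (norm (G u))\<^sup>2)"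
      using le by blast
  qed simp_all
  then show ?thesis by simp
qed

lemma sobolev_bound_sum:
  assumes "finite I" "\<And>i. i \<in> I \<Longrightarrow> \<exists>B. sobolev_bound s (f i) B"
  shows "\<exists>B. sobolev_bound s (\<lambda>u. \<Sum>i\<in>I. f i u) B"
  using assms
proof (induction I)
  case empty
  then show ?case using sobolev_bound_const[of s 0] by auto
next
  case (insert i I)
  then obtain A B where AB: "sobolev_bound s (f i) A" "sobolev_bound s (\<lambda>u. \<Sum>i\<in>I. f i u) B" by blast
  show ?case using sobolev_bound_add[OF AB] insert.hyps by auto
qed

lemma sobolev_bound_inner:
  fixes f g :: "real \<Rightarrow> 'a::euclidean_space"
  assumes f: "sobolev_bound s f A" and g: "sobolev_bound s g B"
  shows "\<exists>C. sobolev_bound s (\<lambda>u. f u \<bullet> g u) C"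
proof -
  have terms: "\<exists>C. sobolev_bound s (\<lambda>u. (f u \<bullet> e) *\<^sub>R (g u \<bullet> e)) C" if e: "e \<in> Basis" for e
  proof -
    note fe = sobolev_bound_component[OF f e] and ge = sobolev_bound_component[OF g e]
    obtain a where a: "\<And>u. norm (f u \<bullet> e) \<le> a"
      by (rule periodic_bounded[OF sobolev_boundD(1)[OF fe] sobolev_boundD(2)[OF fe]]) (rule that)
    obtain b where b: "\<And>u. norm (g u \<bullet> e) \<le> b"
      by (rule periodic_bounded[OF sobolev_boundD(1)[OF ge] sobolev_boundD(2)[OF ge]]) (rule that)
    show ?thesis using sobolev_bound_mult[OF fe ge a[unfolded real_norm_def] b] by blast
  qed
  have "\<exists>C. sobolev_bound s (\<lambda>u. \<Sum>e\<in>Basis. (f u \<bullet> e) *\<^sub>R (g u \<bullet> e)) C"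
    by (rule sobolev_bound_sum[where f="\<lambda>e u. (f u \<bullet> e) *\<^sub>R (g u \<bullet> e)"]) (simp, rule terms)
  moreover have "(\<lambda>u. \<Sum>e\<in>Basis. (f u \<bullet> e) *\<^sub>R (g u \<bullet> e)) = (\<lambda>u. f u \<bullet> g u)"
    unfolding real_scaleR_def by (rule ext) (rule euclidean_inner[symmetric])
  ultimately show ?thesis by (simp only:)
qed

text \<open>Lipschitz functions have a finite seminorm: the integral of \<open>d\<^sup>2 / d\<^sup>1\<^sup>+\<^sup>2\<^sup>s\<close> for the circle distance
  \<open>d\<close> is finite because the exponent \<open>1 - 2s\<close> is larger than \<open>-1\<close>. The circle distance is one of
  \<open>|u - v|\<close>, \<open>|u - v - 1|\<close> and \<open>|u - v + 1|\<close>, so that three copies of \<open>|x|\<^sup>1\<^sup>-\<^sup>2\<^sup>s\<close> dominate the kernel.\<close>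

lemma circle_kernel_finite:
  assumes s: "1/2 < s" "s < 1"
  shows "(\<integral>\<^sup>+u\<in>{0..1}. (\<integral>\<^sup>+v\<in>{0..1}. ennreal ((circle_dist u v)\<^sup>2 / circle_dist u v powr (1 + 2 * s)) \<partial>lborel) \<partial>lborel)
    < \<infinity>"
proof -
  define a where "a = 1 - 2 * s"
  have a: "-1 < a" "a < 0" using s by (auto simp: a_def)
  define k0 where "k0 x = (if x \<in> {0..1} then x powr a else 0)" for x :: real
  have mk0[measurable]: "k0 \<in> borel_measurable borel" unfolding k0_def by measurable
  have "(k0 has_integral (1 powr (a + 1) / (a + 1))) UNIV"
    unfolding k0_def using has_integral_powr_from_0[OF a(1), of 1] by (subst has_integral_restrict_UNIV) simp
  then have I0: "(\<integral>\<^sup>+x. ennreal (k0 x) \<partial>lborel) = ennreal (1 / (a + 1))"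
    using nn_integral_has_integral_lborel[OF mk0] by (simp add: k0_def)
  define k where "k x = ennreal (k0 x) + ennreal (k0 (-x))" for x
  have mk[measurable]: "k \<in> borel_measurable borel" unfolding k_def by measurable
  have Ineg: "(\<integral>\<^sup>+x. ennreal (k0 (-x)) \<partial>lborel) = ennreal (1 / (a + 1))"
    using nn_integral_real_affine[of "\<lambda>x. ennreal (k0 x)" "-1" 0] I0 by simp
  have Ik: "(\<integral>\<^sup>+x. k x \<partial>lborel) = ennreal (2 / (a + 1))"
    unfolding k_def using a by (subst nn_integral_add) (auto simp: I0 Ineg ennreal_plus[symmetric] simp del: ennreal_plus)
  have It: "(\<integral>\<^sup>+v. k (t + (-1) * v) \<partial>lborel) = ennreal (2 / (a + 1))" for t
    using nn_integral_real_affine[of k "-1" t] Ik by simp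
  have kk: "ennreal (\<bar>x\<bar> powr a) \<le> k x" if "\<bar>x\<bar> \<le> 1" for x
  proof (cases "0 \<le> x")
    case True
    then have "ennreal (\<bar>x\<bar> powr a) = ennreal (k0 x)" using that by (simp add: k0_def)
    then show ?thesis by (simp add: k_def)
  next
    case False
    then have "ennreal (\<bar>x\<bar> powr a) = ennreal (k0 (-x))" using that by (simp add: k0_def)
    then show ?thesis by (simp add: k_def)
  qed
  have pw: "ennreal ((circle_dist u v)\<^sup>2 / circle_dist u v powr (1 + 2 * s)) \<le>
      k (u + (-1) * v) + (k ((u + 1) + (-1) * v) + k ((u - 1) + (-1) * v))"
    if uv: "u \<in> {0..1}" "v \<in> {0..1}" for u v
  proof (cases "circle_dist u v = 0")
    case False
    define d where "d = circle_dist u v"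
    have "0 \<le> circle_dist u v" unfolding circle_dist_def using uv by auto
    then have d: "0 < d" using False unfolding d_def by linarith
    have "d\<^sup>2 / d powr (1 + 2 * s) = d powr 2 / d powr (1 + 2 * s)" using d by simp
    also have "\<dots> = d powr a" using powr_diff[of d 2 "1 + 2 * s"] by (simp add: a_def)
    finally have e: "d\<^sup>2 / d powr (1 + 2 * s) = d powr a" .
    have "d = \<bar>u - v\<bar> \<or> d = \<bar>u - v + 1\<bar> \<or> d = \<bar>u - v - 1\<bar>" "d \<le> 1"
      using uv by (auto simp: d_def circle_dist_def min_def abs_if)
    then have "ennreal (d powr a) \<le> k (u - v) \<or> ennreal (d powr a) \<le> k (u - v + 1) \<or> ennreal (d powr a) \<le> k (u - v - 1)"
      using kk by metis
    then have "ennreal (d powr a) \<le> k (u - v) + (k (u - v + 1) + k (u - v - 1))"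
      by (metis add_increasing add_increasing2 zero_le)
    then show ?thesis unfolding d_def[symmetric] e by (simp add: algebra_simps)
  qed simp
  have "(\<integral>\<^sup>+u\<in>{0..1}. (\<integral>\<^sup>+v\<in>{0..1}. ennreal ((circle_dist u v)\<^sup>2 / circle_dist u v powr (1 + 2 * s)) \<partial>lborel) \<partial>lborel)
    \<le> (\<integral>\<^sup>+u. ennreal (6 / (a + 1)) * indicator {0..1::real} u \<partial>lborel)"
  proof (rule nn_integral_mono)
    fix u :: real
    show "(\<integral>\<^sup>+v\<in>{0..1}. ennreal ((circle_dist u v)\<^sup>2 / circle_dist u v powr (1 + 2 * s)) \<partial>lborel) * indicator {0..1} u
      \<le> ennreal (6 / (a + 1)) * indicator {0..1} u"
    proof (cases "u \<in> {0..1}")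
      case True
      have "(\<integral>\<^sup>+v\<in>{0..1}. ennreal ((circle_dist u v)\<^sup>2 / circle_dist u v powr (1 + 2 * s)) \<partial>lborel)
        \<le> (\<integral>\<^sup>+v. k (u + (-1) * v) + (k ((u + 1) + (-1) * v) + k ((u - 1) + (-1) * v)) \<partial>lborel)"
      proof (rule nn_integral_mono)
        fix v :: real
        show "ennreal ((circle_dist u v)\<^sup>2 / circle_dist u v powr (1 + 2 * s)) * indicator {0..1} v
          \<le> k (u + (-1) * v) + (k ((u + 1) + (-1) * v) + k ((u - 1) + (-1) * v))"
        proof (cases "v \<in> {0..1}")
          case v: True
          show ?thesis using pw[OF True v] v by simp
        qed simp
      qed
      also have "\<dots> = (\<integral>\<^sup>+v. k (u + (-1) * v) \<partial>lborel) + ((\<integral>\<^sup>+v. k ((u + 1) + (-1) * v) \<partial>lborel) + (\<integral>\<^sup>+v. k ((u - 1) + (-1) * v) \<partial>lborel))"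
      proof -
        have m: "(\<lambda>v. k (t + (-1) * v)) \<in> borel_measurable lborel" for t by measurable
        show ?thesis by (simp only: nn_integral_add m borel_measurable_add)
      qed
      also have "\<dots> = ennreal (6 / (a + 1))"
        unfolding It using a by (simp add: ennreal_plus[symmetric] add_divide_distrib[symmetric] del: ennreal_plus)
      finally show ?thesis using True by simp
    qed simp
  qed
  also have "\<dots> = ennreal (6 / (a + 1))" by (simp add: nn_integral_cmult_indicator)
  also have "\<dots> < \<infinity>" by simp
  finally show ?thesis .
qed

text \<open>The maximum with \<open>1\<close> serves the case \<open>s = 1\<close>, where the square of the supremum of the derivative
  already bounds the integral of its square.\<close>

definition C1_embedding_constant :: "real \<Rightarrow> real" where
  "C1_embedding_constant s = max 1 (enn2real (\<integral>\<^sup>+u\<in>{0..1}. (\<integral>\<^sup>+v\<in>{0..1}.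
     ennreal ((circle_dist u v)\<^sup>2 / circle_dist u v powr (1 + 2 * s)) \<partial>lborel) \<partial>lborel))"

lemma C1_embedding_constant_nonneg: "0 \<le> C1_embedding_constant s"
  by (simp add: C1_embedding_constant_def)

lemma bounded_derivative_imp_Lipschitz:
  fixes p g :: "real \<Rightarrow> 'a::euclidean_space"
  assumes d: "\<And>u. (p has_vector_derivative g u) (at u)" and L: "\<And>u. norm (g u) \<le> L"
  shows "norm (p x - p y) \<le> L * \<bar>x - y\<bar>"
proof -
  have "norm (p x - p y) \<le> L * norm (x - y)"
  proof (rule differentiable_bound[where S=UNIV and f'="\<lambda>u h. h *\<^sub>R g u"])
    show "(p has_derivative (\<lambda>h. h *\<^sub>R g u)) (at u within UNIV)" for u
      using d[of u] by (simp add: has_vector_derivative_def)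
    show "onorm (\<lambda>h. h *\<^sub>R g u) \<le> L" for u
      by (rule onorm_le) (use L[of u] in \<open>auto simp: mult.commute[of L] intro!: mult_left_mono\<close>)
  qed auto
  then show ?thesis by simp
qed

lemma sobolev_bound_C1:
  fixes w w' :: "real \<Rightarrow> 'a::euclidean_space"
  assumes s: "1/2 < s" and d: "\<And>u. (w has_vector_derivative w' u) (at u)"
    and c': "continuous_on UNIV w'" and per: "\<And>u. w (u + 1) = w u" and L: "\<And>u. norm (w' u) \<le> L"
  shows "sobolev_bound s w (C1_embedding_constant s * L\<^sup>2)"
proof -
  define K where "K = (\<integral>\<^sup>+u\<in>{0..1}. (\<integral>\<^sup>+v\<in>{0..1}. ennreal ((circle_dist u v)\<^sup>2 / circle_dist u v powr (1 + 2 * s)) \<partial>lborel) \<partial>lborel)"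
  define C where "C = max 1 (enn2real K)"
  have C: "C1_embedding_constant s = C" by (simp add: C_def K_def C1_embedding_constant_def)
  have c: "continuous_on A w" for A by (rule has_vector_derivative_imp_continuous_on[OF d])
  have L0: "0 \<le> L" using norm_ge_zero L[of 0] by (rule order_trans)
  have lip: "norm (w x - w y) \<le> L * \<bar>x - y\<bar>" for x y
    by (rule bounded_derivative_imp_Lipschitz[OF d L])
  have top: "gagliardo2 circle_dist s w \<le> ennreal (C * L\<^sup>2)" if s1: "s < 1"
  proof -
    have K: "K < \<infinity>" unfolding K_def by (rule circle_kernel_finite[OF s s1])
    have wd: "norm (w u - w v) \<le> L * circle_dist u v" if uv: "u \<in> {0..1}" "v \<in> {0..1}" for u v
    proof -
      have "norm (w u - w v) \<le> L * \<bar>u + 1 - v\<bar>" using lip[of "u + 1" v] per[of u] by simp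
      moreover have "norm (w u - w v) \<le> L * \<bar>u - (v + 1)\<bar>" using lip[of u "v + 1"] per[of v] by simp
      moreover have "circle_dist u v = \<bar>u - v\<bar> \<or> circle_dist u v = \<bar>u + 1 - v\<bar> \<or> circle_dist u v = \<bar>u - (v + 1)\<bar>"
        using uv by (auto simp: circle_dist_def min_def abs_if)
      ultimately show ?thesis using lip[of u v] by metis
    qed
    have mk: "(\<lambda>(u, v). ennreal ((circle_dist u v)\<^sup>2 / circle_dist u v powr (1 + 2 * s))) \<in> borel_measurable (borel \<Otimes>\<^sub>M borel)"
      unfolding circle_dist_def by measurable
    have "gagliardo2 circle_dist s w \<le> (\<integral>\<^sup>+u. ennreal (L\<^sup>2) * ((\<integral>\<^sup>+v\<in>{0..1}. ennreal ((circle_dist u v)\<^sup>2 / circle_dist u v powr (1 + 2 * s)) \<partial>lborel) * indicator {0..1} u) \<partial>lborel)"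
      unfolding gagliardo2_def
    proof (rule nn_integral_mono)
      fix u :: real
      show "(\<integral>\<^sup>+v\<in>{0..1}. ennreal ((norm (w u - w v))\<^sup>2 / circle_dist u v powr (1 + 2 * s)) \<partial>lborel) * indicator {0..1} u
        \<le> ennreal (L\<^sup>2) * ((\<integral>\<^sup>+v\<in>{0..1}. ennreal ((circle_dist u v)\<^sup>2 / circle_dist u v powr (1 + 2 * s)) \<partial>lborel) * indicator {0..1} u)"
      proof (cases "u \<in> {0..1}")
        case True
        have "(\<integral>\<^sup>+v\<in>{0..1}. ennreal ((norm (w u - w v))\<^sup>2 / circle_dist u v powr (1 + 2 * s)) \<partial>lborel)
          \<le> (\<integral>\<^sup>+v. ennreal (L\<^sup>2) * (ennreal ((circle_dist u v)\<^sup>2 / circle_dist u v powr (1 + 2 * s)) * indicator {0..1} v) \<partial>lborel)"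
        proof (rule nn_integral_mono)
          fix v :: real
          show "ennreal ((norm (w u - w v))\<^sup>2 / circle_dist u v powr (1 + 2 * s)) * indicator {0..1} v
            \<le> ennreal (L\<^sup>2) * (ennreal ((circle_dist u v)\<^sup>2 / circle_dist u v powr (1 + 2 * s)) * indicator {0..1} v)"
          proof (cases "v \<in> {0..1}")
            case v: True
            have "(norm (w u - w v))\<^sup>2 \<le> L\<^sup>2 * (circle_dist u v)\<^sup>2"
              using power_mono[OF wd[OF True v], of 2] by (simp add: power_mult_distrib)
            then have "(norm (w u - w v))\<^sup>2 / circle_dist u v powr (1 + 2 * s) \<le> L\<^sup>2 * ((circle_dist u v)\<^sup>2 / circle_dist u v powr (1 + 2 * s))"
              using divide_right_mono[of _ _ "circle_dist u v powr (1 + 2 * s)"] by fastforce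
            then show ?thesis using v by (simp add: ennreal_mult[symmetric] ennreal_leI)
          qed simp
        qed
        also have "\<dots> = ennreal (L\<^sup>2) * (\<integral>\<^sup>+v\<in>{0..1}. ennreal ((circle_dist u v)\<^sup>2 / circle_dist u v powr (1 + 2 * s)) \<partial>lborel)"
          unfolding circle_dist_def by (rule nn_integral_cmult) measurable
        finally show ?thesis using True by simp
      qed simp
    qed
    also have "\<dots> = ennreal (L\<^sup>2) * K"
      unfolding K_def circle_dist_def by (rule nn_integral_cmult) measurable
    also have "\<dots> \<le> ennreal (L\<^sup>2) * ennreal C"
    proof (rule mult_left_mono)
      have "K = ennreal (enn2real K)" using K by (simp add: ennreal_enn2real_if)
      also have "\<dots> \<le> ennreal C" unfolding C_def by (intro ennreal_leI) simp
      finally show "K \<le> ennreal C" .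
    qed simp
    also have "\<dots> = ennreal (C * L\<^sup>2)" by (simp add: ennreal_mult[symmetric] C_def mult.commute)
    finally show ?thesis .
  qed
  have "primitive w' w" by (rule primitive_derivative[OF d c'])
  moreover have sq: "square_integrable w'" by (rule square_integrable_continuous[OF continuous_on_subset[OF c']]) simp
  moreover have "(LINT u:{0..1}|lborel. (norm (w' u))\<^sup>2) \<le> C * L\<^sup>2"
  proof -
    have "(LINT u:{0..1}|lborel. (norm (w' u))\<^sup>2) \<le> 1 * L\<^sup>2" using integral_norm_squared_le[OF sq L] by simp
    also have "1 * L\<^sup>2 \<le> C * L\<^sup>2" by (rule mult_right_mono) (simp_all add: C_def)
    finally show ?thesis .
  qed
  ultimately show ?thesis
    unfolding sobolev_bound_def C using c per top by (auto simp: C_def)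
qed

section \<open>Small reparametrizations\<close>

lemma periodic_uniformly_continuous:
  fixes g :: "real \<Rightarrow> 'a::euclidean_space"
  assumes c: "continuous_on UNIV g" and per: "\<And>u. g (u + 1) = g u" and e: "0 < e"
  shows "\<exists>d>0. \<forall>x y. \<bar>x - y\<bar> < d \<longrightarrow> norm (g x - g y) < e"
proof -
  have "uniformly_continuous_on {-1..2} g"
    by (rule compact_uniformly_continuous[OF continuous_on_subset[OF c]]) auto
  then obtain d where d: "d > 0" "\<And>x y. x \<in> {-1..2} \<Longrightarrow> y \<in> {-1..2} \<Longrightarrow> dist y x < d \<Longrightarrow> dist (g y) (g x) < e"
    using e unfolding uniformly_continuous_on_def by metis
  have "norm (g x - g y) < e" if xy: "\<bar>x - y\<bar> < min d 1" for x y
  proof -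
    define k where "k = - \<lfloor>x\<rfloor>"
    have "x + of_int k \<in> {0..<1}" unfolding k_def by (simp add: algebra_simps) linarith
    moreover from this have "y + of_int k \<in> {-1..2}" using xy by (auto simp: abs_if split: if_splits)
    ultimately have "dist (g (y + of_int k)) (g (x + of_int k)) < e"
      using xy by (intro d(2)) (auto simp: dist_real_def)
    then show ?thesis
      using periodic_of_int[of g x k, OF per] periodic_of_int[of g y k, OF per] by (simp add: dist_norm norm_minus_commute)
  qed
  then show ?thesis using d(1) by (intro exI[of _ "min d 1"]) auto
qed

lemma nn_integral_linear_combination:
  assumes a: "a \<in> borel_measurable M" and [measurable]: "b \<in> borel_measurable M" "c \<in> borel_measurable M"
  shows "(\<integral>\<^sup>+x. a x + (2 * b x + 2 * c x) \<partial>M) = (\<integral>\<^sup>+x. a x \<partial>M) + (2 * (\<integral>\<^sup>+x. b x \<partial>M) + 2 * (\<integral>\<^sup>+x. c x \<partial>M))"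
proof -
  have "(\<integral>\<^sup>+x. a x + (2 * b x + 2 * c x) \<partial>M) = (\<integral>\<^sup>+x. a x \<partial>M) + (\<integral>\<^sup>+x. 2 * b x + 2 * c x \<partial>M)"
    by (rule nn_integral_add[OF a]) measurable
  also have "(\<integral>\<^sup>+x. 2 * b x + 2 * c x \<partial>M) = (\<integral>\<^sup>+x. 2 * b x \<partial>M) + (\<integral>\<^sup>+x. 2 * c x \<partial>M)"
    by (rule nn_integral_add) measurable
  also have "(\<integral>\<^sup>+x. 2 * b x \<partial>M) = 2 * (\<integral>\<^sup>+x. b x \<partial>M)" by (rule nn_integral_cmult) measurable
  also have "(\<integral>\<^sup>+x. 2 * c x \<partial>M) = 2 * (\<integral>\<^sup>+x. c x \<partial>M)" by (rule nn_integral_cmult) measurable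
  finally show ?thesis .
qed

lemma ennreal_double_sum: "0 \<le> a \<Longrightarrow> 0 \<le> b \<Longrightarrow> ennreal (2 * a + 2 * b) = 2 * ennreal a + 2 * ennreal b"
  by (simp add: ennreal_plus ennreal_mult)

lemma ennreal_triple_product:
  "0 \<le> a \<Longrightarrow> 0 \<le> b \<Longrightarrow> 0 \<le> c \<Longrightarrow> 32 * (ennreal a * ennreal b * ennreal c) = ennreal (32 * (a * b * c))"
  by (simp add: ennreal_mult)

definition near_diagonal :: "real \<Rightarrow> (real \<Rightarrow> 'a::euclidean_space) \<Rightarrow> real \<Rightarrow> ennreal" where
  "near_diagonal \<sigma> g \<theta> = (\<integral>\<^sup>+u\<in>{0..1}. (\<integral>\<^sup>+v\<in>{0..1}.
     ennreal ((norm (g u - g v))\<^sup>2 / circle_dist u v powr (1 + 2 * \<sigma>)) * indicator {..<\<theta>} (circle_dist u v) \<partial>lborel) \<partial>lborel)"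

text \<open>The strips around the diagonal shrink to a set on which the integrand vanishes, so that dominated
  convergence applies.\<close>

lemma near_diagonal_small:
  fixes g :: "real \<Rightarrow> 'a::euclidean_space"
  assumes c: "continuous_on UNIV g" and fin: "gagliardo2 circle_dist \<sigma> g < \<infinity>" and e: "0 < e"
  shows "\<exists>\<theta>>0. near_diagonal \<sigma> g \<theta> < ennreal e"
proof -
  have [measurable]: "g \<in> borel_measurable borel" using c by (rule borel_measurable_continuous_onI)
  define k where "k z = ennreal ((norm (g (fst z) - g (snd z)))\<^sup>2 / circle_dist (fst z) (snd z) powr (1 + 2 * \<sigma>))
      * indicator {0..1} (snd z) * indicator {0..1} (fst z)" for z :: "real \<times> real"
  define K where "K n z = k z * indicator {..<1 / real (Suc n)} (circle_dist (fst z) (snd z))" for n z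
  have mk[measurable]: "k \<in> borel_measurable (lborel \<Otimes>\<^sub>M lborel)"
    unfolding k_def circle_dist_def by measurable
  have mK[measurable]: "K n \<in> borel_measurable (lborel \<Otimes>\<^sub>M lborel)" for n
    unfolding K_def circle_dist_def by measurable
  have Ik: "integral\<^sup>N (lborel \<Otimes>\<^sub>M lborel) k = gagliardo2 circle_dist \<sigma> g"
    unfolding gagliardo2_def lborel.nn_integral_fst[OF mk, symmetric]
    by (rule nn_integral_cong) (auto simp: k_def indicator_def)
  have IK: "integral\<^sup>N (lborel \<Otimes>\<^sub>M lborel) (K n) = near_diagonal \<sigma> g (1 / real (Suc n))" for n
    unfolding near_diagonal_def lborel.nn_integral_fst[OF mK, symmetric]
    by (rule nn_integral_cong) (auto simp: K_def k_def indicator_def intro!: nn_integral_cong)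
  have "(\<lambda>n. integral\<^sup>N (lborel \<Otimes>\<^sub>M lborel) (K n)) \<longlonglongrightarrow> integral\<^sup>N (lborel \<Otimes>\<^sub>M lborel) (\<lambda>z::real \<times> real. 0)"
  proof (rule nn_integral_dominated_convergence[where w=k])
    show "AE z in lborel \<Otimes>\<^sub>M lborel. K n z \<le> k z" for n by (auto simp: K_def indicator_def)
    show "integral\<^sup>N (lborel \<Otimes>\<^sub>M lborel) k < \<infinity>" using fin by (simp add: Ik)
    show "AE z in lborel \<Otimes>\<^sub>M lborel. (\<lambda>n. K n z) \<longlonglongrightarrow> 0"
    proof (rule AE_I2)
      fix z :: "real \<times> real"
      show "(\<lambda>n. K n z) \<longlonglongrightarrow> 0"
      proof (cases "k z = 0")
        case True
        then show ?thesis by (simp add: K_def)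
      next
        case False
        then have "fst z \<in> {0..1}" "snd z \<in> {0..1}" "circle_dist (fst z) (snd z) \<noteq> 0"
          by (auto simp: k_def indicator_def split: if_splits)
        then have "0 < circle_dist (fst z) (snd z)" by (auto simp: circle_dist_def min_def split: if_splits)
        then obtain N where N: "1 / real (Suc N) < circle_dist (fst z) (snd z)"
          using nat_approx_posE by blast
        have "K n z = 0" if "N \<le> n" for n
        proof -
          have "1 / real (Suc n) \<le> 1 / real (Suc N)" using that by (intro divide_left_mono) auto
          then show ?thesis using N by (simp add: K_def)
        qed
        then have "\<forall>\<^sub>F n in sequentially. K n z = 0" using eventually_sequentially by blast
        then show ?thesis by (rule tendsto_eventually)
      qed
    qed
  qed simp_all
  then have "(\<lambda>n. near_diagonal \<sigma> g (1 / real (Suc n))) \<longlonglongrightarrow> 0" by (simp only: IK nn_integral_const) simp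
  moreover have "0 < ennreal e" using e by simp
  ultimately have "\<forall>\<^sub>F n in sequentially. near_diagonal \<sigma> g (1 / real (Suc n)) < ennreal e"
    by (rule order_tendstoD(2))
  then obtain n where "near_diagonal \<sigma> g (1 / real (Suc n)) < ennreal e"
    by (auto simp: eventually_sequentially)
  then show ?thesis by (intro exI[of _ "1 / real (Suc n)"]) simp
qed

lemma near_diagonal_mono:
  assumes "\<theta> \<le> \<theta>'"
  shows "near_diagonal \<sigma> g \<theta> \<le> near_diagonal \<sigma> g \<theta>'"
  unfolding near_diagonal_def
  by (intro nn_integral_mono mult_right_mono mult_left_mono) (use assms in \<open>auto simp: indicator_def\<close>)

text \<open>Change of variables in the part of the seminorm near the diagonal. The constant \<open>32\<close> is
  \<open>2\<^sup>1\<^sup>+\<^sup>2\<^sup>\<sigma> \<le> 8\<close> from the distances times \<open>4\<close> from the two Jacobians.\<close>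

lemma near_diagonal_composition:
  fixes g :: "real \<Rightarrow> 'a::euclidean_space"
  assumes c: "continuous_on UNIV g" and g01: "g 1 = g 0" and \<sigma>: "0 < \<sigma>" "\<sigma> \<le> 1"
    and d: "\<And>u. (\<psi> has_real_derivative \<psi>' u) (at u)" and c': "continuous_on UNIV \<psi>'"
    and b: "\<And>u. 1/2 \<le> \<psi>' u" "\<And>u. \<psi>' u \<le> 2" and e: "\<psi> 0 = 0" "\<psi> 1 = 1"
  shows "near_diagonal \<sigma> (\<lambda>u. g (\<psi> u)) \<theta> \<le> 32 * near_diagonal \<sigma> g (2 * \<theta>)"
proof -
  have [measurable]: "g \<in> borel_measurable borel" using c by (rule borel_measurable_continuous_onI)
  have c\<psi>: "continuous_on UNIV \<psi>" using d by (meson DERIV_isCont continuous_at_imp_continuous_on)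
  have [measurable]: "\<psi> \<in> borel_measurable borel" "\<psi>' \<in> borel_measurable borel"
    using c\<psi> c' by (auto intro: borel_measurable_continuous_onI)
  have lip: "0 \<le> \<psi> y - \<psi> x \<and> \<psi> y - \<psi> x \<le> 2 * (y - x)" if "x \<le> y" for x y
  proof (cases "x = y")
    case False
    then have "x < y" using that by simp
    then obtain z where z: "\<psi> y - \<psi> x = (y - x) * \<psi>' z" using MVT2[of x y \<psi> \<psi>'] d by blast
    have "0 \<le> (y - x) * \<psi>' z" using that b(1)[of z] by simp
    moreover have "(y - x) * \<psi>' z \<le> (y - x) * 2" using that b(2)[of z] by (intro mult_left_mono) auto
    ultimately show ?thesis unfolding z by simp
  qed simp
  have \<psi>01: "\<psi> u \<in> {0..1}" if "u \<in> {0..1}" for u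
    using lip[of 0 u] lip[of u 1] that e by auto
  have dd: "circle_dist (\<psi> u) (\<psi> v) \<le> 2 * circle_dist u v" if uv: "u \<in> {0..1}" "v \<in> {0..1}" for u v
  proof (cases "u \<le> v")
    case True
    then show ?thesis
      using uv lip[of u v] lip[of 0 u] lip[of v 1] e by (auto simp: circle_dist_def min_def)
  next
    case False
    then show ?thesis
      using uv lip[of v u] lip[of 0 v] lip[of u 1] e by (auto simp: circle_dist_def min_def)
  qed
  define q where "q = 1 + 2 * \<sigma>"
  define K where "K x y = ennreal ((norm (g x - g y))\<^sup>2 / circle_dist x y powr q) * indicator {..<2 * \<theta>} (circle_dist x y)" for x y
  have mK[measurable]: "(\<lambda>(x, y). K x y) \<in> borel_measurable (borel \<Otimes>\<^sub>M borel)"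
    unfolding K_def circle_dist_def by measurable
  define I where "I x = (\<integral>\<^sup>+y. K x y * indicator {0..1} y \<partial>lborel)" for x
  have mI[measurable]: "I \<in> borel_measurable borel" unfolding I_def by measurable
  have pw: "ennreal ((norm (g (\<psi> u) - g (\<psi> v)))\<^sup>2 / circle_dist u v powr q) * indicator {..<\<theta>} (circle_dist u v)
      \<le> 32 * (K (\<psi> u) (\<psi> v) * ennreal (\<psi>' v) * ennreal (\<psi>' u))" if uv: "u \<in> {0..1}" "v \<in> {0..1}" for u v
  proof (cases "circle_dist (\<psi> u) (\<psi> v) = 0 \<or> \<not> circle_dist u v < \<theta>")
    case True
    moreover have "g (\<psi> u) = g (\<psi> v)" if "circle_dist (\<psi> u) (\<psi> v) = 0"
    proof -
      have "\<psi> u = \<psi> v \<or> \<psi> u = 0 \<and> \<psi> v = 1 \<or> \<psi> u = 1 \<and> \<psi> v = 0"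
        using that \<psi>01[OF uv(1)] \<psi>01[OF uv(2)] by (auto simp: circle_dist_def min_def abs_if split: if_splits)
      then show ?thesis using g01 by auto
    qed
    ultimately show ?thesis by auto
  next
    case False
    define n where "n = (norm (g (\<psi> u) - g (\<psi> v)))\<^sup>2"
    define D where "D = circle_dist (\<psi> u) (\<psi> v)"
    define d where "d = circle_dist u v"
    have "0 \<le> D" unfolding D_def circle_dist_def using \<psi>01[OF uv(1)] \<psi>01[OF uv(2)] by auto
    then have D: "0 < D" "D \<le> 2 * d" using False dd[OF uv] unfolding D_def d_def by linarith+
    then have d0: "0 < d" by simp
    have "D powr q \<le> (2 * d) powr q" using D \<sigma> by (intro powr_mono2) (auto simp: q_def)
    also have "\<dots> = 2 powr q * d powr q" using d0 by (simp add: powr_mult)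
    also have "\<dots> \<le> 8 * d powr q"
    proof (rule mult_right_mono)
      have "2 powr q \<le> 2 powr (3::real)" using \<sigma> by (intro powr_mono) (auto simp: q_def)
      then show "2 powr q \<le> (8::real)" by simp
    qed simp
    finally have Dd: "D powr q \<le> 8 * d powr q" .
    have "n / d powr q \<le> 8 * (n / D powr q)"
    proof -
      have "n * D powr q \<le> n * (8 * d powr q)" using Dd by (intro mult_left_mono) (auto simp: n_def)
      then show ?thesis using D d0 by (simp add: field_simps)
    qed
    also have "\<dots> = 8 * (n / D powr q) * 1" by simp
    also have "\<dots> \<le> 8 * (n / D powr q) * (4 * (\<psi>' v * \<psi>' u))"
    proof (rule mult_left_mono)
      have "1/2 * (1/2) \<le> \<psi>' v * \<psi>' u" using b(1) by (intro mult_mono) (auto intro: order_trans[OF _ b(1)])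
      then show "1 \<le> 4 * (\<psi>' v * \<psi>' u)" by simp
    qed (simp add: n_def)
    finally have le: "n / d powr q \<le> 32 * (n / D powr q * \<psi>' v * \<psi>' u)" by simp
    have p: "0 \<le> \<psi>' u" "0 \<le> \<psi>' v" using b(1)[of u] b(1)[of v] by simp_all
    have "D < 2 * \<theta>" using False D(2) unfolding d_def by simp
    then have "K (\<psi> u) (\<psi> v) = ennreal (n / D powr q)" unfolding K_def D_def n_def by simp
    then have "32 * (K (\<psi> u) (\<psi> v) * ennreal (\<psi>' v) * ennreal (\<psi>' u)) = ennreal (32 * (n / D powr q * \<psi>' v * \<psi>' u))"
      using ennreal_triple_product[of "n / D powr q" "\<psi>' v" "\<psi>' u"] p by (simp only: n_def) simp
    moreover have "ennreal (n / d powr q) \<le> ennreal (32 * (n / D powr q * \<psi>' v * \<psi>' u))" by (rule ennreal_leI[OF le])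
    ultimately show ?thesis using False by (simp add: n_def d_def)
  qed
  have sub: "(\<integral>\<^sup>+u. f (\<psi> u) * ennreal (\<psi>' u) * indicator {0..1} u \<partial>lborel) = (\<integral>\<^sup>+x. f x * indicator {0..1} x \<partial>lborel)"
    if "f \<in> borel_measurable borel" for f
    using nn_integral_substitution_aux[of f 0 1 \<psi> \<psi>', OF that _ d] b(1) e continuous_on_subset[OF c']
    by (simp add: order_trans[OF _ b(1)])
  have "near_diagonal \<sigma> (\<lambda>u. g (\<psi> u)) \<theta> \<le> (\<integral>\<^sup>+u. 32 * (I (\<psi> u) * ennreal (\<psi>' u) * indicator {0..1} u) \<partial>lborel)"
    unfolding near_diagonal_def q_def[symmetric]
  proof (rule nn_integral_mono)
    fix u :: real
    show "(\<integral>\<^sup>+v\<in>{0..1}. ennreal ((norm (g (\<psi> u) - g (\<psi> v)))\<^sup>2 / circle_dist u v powr q) * indicator {..<\<theta>} (circle_dist u v) \<partial>lborel)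
        * indicator {0..1} u \<le> 32 * (I (\<psi> u) * ennreal (\<psi>' u) * indicator {0..1} u)"
    proof (cases "u \<in> {0..1}")
      case u: True
      have "(\<integral>\<^sup>+v\<in>{0..1}. ennreal ((norm (g (\<psi> u) - g (\<psi> v)))\<^sup>2 / circle_dist u v powr q) * indicator {..<\<theta>} (circle_dist u v) \<partial>lborel)
        \<le> (\<integral>\<^sup>+v. (32 * ennreal (\<psi>' u)) * (K (\<psi> u) (\<psi> v) * ennreal (\<psi>' v) * indicator {0..1} v) \<partial>lborel)"
      proof (rule nn_integral_mono)
        fix v :: real
        show "ennreal ((norm (g (\<psi> u) - g (\<psi> v)))\<^sup>2 / circle_dist u v powr q) * indicator {..<\<theta>} (circle_dist u v) * indicator {0..1} v
          \<le> (32 * ennreal (\<psi>' u)) * (K (\<psi> u) (\<psi> v) * ennreal (\<psi>' v) * indicator {0..1} v)"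
        proof (cases "v \<in> {0..1}")
          case v: True
          then show ?thesis using pw[OF u v] by (simp add: mult.commute mult.left_commute mult.assoc)
        qed simp
      qed
      also have "\<dots> = (32 * ennreal (\<psi>' u)) * (\<integral>\<^sup>+v. K (\<psi> u) (\<psi> v) * ennreal (\<psi>' v) * indicator {0..1} v \<partial>lborel)"
        by (rule nn_integral_cmult) measurable
      also have "(\<integral>\<^sup>+v. K (\<psi> u) (\<psi> v) * ennreal (\<psi>' v) * indicator {0..1} v \<partial>lborel) = I (\<psi> u)"
        unfolding I_def by (rule sub) measurable
      finally show ?thesis using u by (simp add: mult.commute mult.left_commute mult.assoc)
    qed simp
  qed
  also have "\<dots> = 32 * (\<integral>\<^sup>+u. I (\<psi> u) * ennreal (\<psi>' u) * indicator {0..1} u \<partial>lborel)"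
    by (rule nn_integral_cmult) measurable
  also have "(\<integral>\<^sup>+u. I (\<psi> u) * ennreal (\<psi>' u) * indicator {0..1} u \<partial>lborel) = (\<integral>\<^sup>+x. I x * indicator {0..1} x \<partial>lborel)"
    by (rule sub) measurable
  also have "\<dots> = near_diagonal \<sigma> g (2 * \<theta>)" unfolding near_diagonal_def I_def K_def q_def ..
  finally show ?thesis .
qed

text \<open>Away from the diagonal the kernel is bounded, so that uniform smallness suffices there.\<close>

lemma gagliardo_difference_le:
  fixes f g :: "real \<Rightarrow> 'a::euclidean_space"
  assumes f: "continuous_on UNIV f" and g: "continuous_on UNIV g" and \<sigma>: "0 < \<sigma>" and \<theta>: "0 < \<theta>"
    and S: "\<And>u. norm (f u - g u) \<le> S"
  shows "gagliardo2 circle_dist \<sigma> (\<lambda>u. f u - g u) \<le>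
    ennreal (4 * S\<^sup>2 / \<theta> powr (1 + 2 * \<sigma>)) + (2 * near_diagonal \<sigma> f \<theta> + 2 * near_diagonal \<sigma> g \<theta>)"
proof -
  have [measurable]: "f \<in> borel_measurable borel" "g \<in> borel_measurable borel"
    using f g by (auto intro: borel_measurable_continuous_onI)
  define q where "q = 1 + 2 * \<sigma>"
  define c where "c = 4 * S\<^sup>2 / \<theta> powr q"
  define kf where "kf u v = ennreal ((norm (f u - f v))\<^sup>2 / circle_dist u v powr q) * indicator {..<\<theta>} (circle_dist u v) * indicator {0..1} v * indicator {0..1} u" for u v
  define kg where "kg u v = ennreal ((norm (g u - g v))\<^sup>2 / circle_dist u v powr q) * indicator {..<\<theta>} (circle_dist u v) * indicator {0..1} v * indicator {0..1} u" for u v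
  define kc where "kc u v = ennreal c * indicator {0..1} v * indicator {0..1} u" for u v :: real
  have m[measurable]: "(\<lambda>(u, v). kf u v) \<in> borel_measurable (borel \<Otimes>\<^sub>M borel)"
    "(\<lambda>(u, v). kg u v) \<in> borel_measurable (borel \<Otimes>\<^sub>M borel)" "(\<lambda>(u, v). kc u v) \<in> borel_measurable (borel \<Otimes>\<^sub>M borel)"
    unfolding kf_def kg_def kc_def circle_dist_def by measurable
  have S0: "0 \<le> S" using norm_ge_zero S[of 0] by (rule order_trans)
  have pw: "ennreal ((norm (f u - g u - (f v - g v)))\<^sup>2 / circle_dist u v powr q) * indicator {0..1} v * indicator {0..1} u
      \<le> kc u v + (2 * kf u v + 2 * kg u v)" for u v
  proof (cases "u \<in> {0..1} \<and> v \<in> {0..1}")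
    case uv: True
    define n where "n = (norm (f u - g u - (f v - g v)))\<^sup>2"
    show ?thesis
    proof (cases "circle_dist u v < \<theta>")
      case True
      have "n \<le> 2 * (norm (f u - f v))\<^sup>2 + 2 * (norm (g v - g u))\<^sup>2"
        unfolding n_def using norm_add_squared_le[of "f u - f v" "g v - g u"] by (simp add: algebra_simps)
      then have "n / circle_dist u v powr q \<le> (2 * (norm (f u - f v))\<^sup>2 + 2 * (norm (g v - g u))\<^sup>2) / circle_dist u v powr q"
        by (rule divide_right_mono) simp
      also have "\<dots> = 2 * ((norm (f u - f v))\<^sup>2 / circle_dist u v powr q) + 2 * ((norm (g u - g v))\<^sup>2 / circle_dist u v powr q)"
        by (simp add: add_divide_distrib norm_minus_commute)
      finally have "ennreal (n / circle_dist u v powr q) \<le> ennreal (2 * ((norm (f u - f v))\<^sup>2 / circle_dist u v powr q) + 2 * ((norm (g u - g v))\<^sup>2 / circle_dist u v powr q))"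
        by (rule ennreal_leI)
      also have "\<dots> = 2 * kf u v + 2 * kg u v"
        using uv True by (subst ennreal_double_sum) (simp_all add: kf_def kg_def)
      finally show ?thesis using uv by (simp add: n_def add_increasing)
    next
      case False
      have "norm (f u - g u - (f v - g v)) \<le> 2 * S"
        using norm_triangle_ineq4[of "f u - g u" "f v - g v"] S[of u] S[of v] by linarith
      then have "n \<le> (2 * S)\<^sup>2" unfolding n_def by (intro power_mono) auto
      then have n: "n \<le> 4 * S\<^sup>2" by (simp add: power_mult_distrib)
      have "\<theta> powr q \<le> circle_dist u v powr q" using False \<theta> \<sigma> by (intro powr_mono2) (auto simp: q_def)
      then have "n / circle_dist u v powr q \<le> c"
        unfolding c_def using n \<theta> by (intro frac_le) (auto simp: n_def)
      then have "ennreal (n / circle_dist u v powr q) \<le> kc u v" using uv by (simp add: kc_def ennreal_leI)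
      then show ?thesis using uv by (simp add: n_def add_increasing2)
    qed
  qed auto
  have "gagliardo2 circle_dist \<sigma> (\<lambda>u. f u - g u) \<le> (\<integral>\<^sup>+u. \<integral>\<^sup>+v. kc u v + (2 * kf u v + 2 * kg u v) \<partial>lborel \<partial>lborel)"
    unfolding gagliardo2_def q_def[symmetric]
  proof (rule nn_integral_mono)
    fix u :: real
    have "(\<integral>\<^sup>+v\<in>{0..1}. ennreal ((norm (f u - g u - (f v - g v)))\<^sup>2 / circle_dist u v powr q) \<partial>lborel) * indicator {0..1} u
      = (\<integral>\<^sup>+v. ennreal ((norm (f u - g u - (f v - g v)))\<^sup>2 / circle_dist u v powr q) * indicator {0..1} v * indicator {0..1} u \<partial>lborel)"
      by (cases "u \<in> {0..1}") simp_all
    also have "\<dots> \<le> (\<integral>\<^sup>+v. kc u v + (2 * kf u v + 2 * kg u v) \<partial>lborel)"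
      by (rule nn_integral_mono) (rule pw)
    finally show "(\<integral>\<^sup>+v\<in>{0..1}. ennreal ((norm (f u - g u - (f v - g v)))\<^sup>2 / circle_dist u v powr q) \<partial>lborel) * indicator {0..1} u
      \<le> (\<integral>\<^sup>+v. kc u v + (2 * kf u v + 2 * kg u v) \<partial>lborel)" .
  qed
  also have "\<dots> = (\<integral>\<^sup>+u. \<integral>\<^sup>+v. kc u v \<partial>lborel \<partial>lborel) + (2 * (\<integral>\<^sup>+u. \<integral>\<^sup>+v. kf u v \<partial>lborel \<partial>lborel) + 2 * (\<integral>\<^sup>+u. \<integral>\<^sup>+v. kg u v \<partial>lborel \<partial>lborel))"
  proof -
    have 1: "(\<lambda>v. kc u v) \<in> borel_measurable lborel" "(\<lambda>v. kf u v) \<in> borel_measurable lborel" "(\<lambda>v. kg u v) \<in> borel_measurable lborel"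
      for u by measurable
    have 2: "(\<lambda>u. \<integral>\<^sup>+v. kc u v \<partial>lborel) \<in> borel_measurable lborel" "(\<lambda>u. \<integral>\<^sup>+v. kf u v \<partial>lborel) \<in> borel_measurable lborel"
      "(\<lambda>u. \<integral>\<^sup>+v. kg u v \<partial>lborel) \<in> borel_measurable lborel" by measurable
    show ?thesis
      by (simp only: nn_integral_linear_combination 1 2)
  qed
  also have "(\<integral>\<^sup>+u. \<integral>\<^sup>+v. kc u v \<partial>lborel \<partial>lborel) = ennreal c"
  proof -
    have "(\<integral>\<^sup>+v. kc u v \<partial>lborel) = ennreal c * indicator {0..1} u" for u
      by (cases "u \<in> {0..1}") (simp_all add: kc_def nn_integral_cmult_indicator)
    then show ?thesis by (simp add: nn_integral_cmult_indicator)
  qed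
  also have "(\<integral>\<^sup>+u. \<integral>\<^sup>+v. kf u v \<partial>lborel \<partial>lborel) = near_diagonal \<sigma> f \<theta>"
    unfolding near_diagonal_def q_def[symmetric] kf_def
    by (intro nn_integral_cong) (auto simp: indicator_def)
  also have "(\<integral>\<^sup>+u. \<integral>\<^sup>+v. kg u v \<partial>lborel \<partial>lborel) = near_diagonal \<sigma> g \<theta>"
    unfolding near_diagonal_def q_def[symmetric] kg_def
    by (intro nn_integral_cong) (auto simp: indicator_def)
  finally show ?thesis unfolding c_def q_def .
qed

text \<open>Near the diagonal, the seminorm of \<open>g (u + t \<phi> u)\<close> is comparable with the one of \<open>g\<close> on a strip of twice
  the width, uniformly in small \<open>t\<close>. With the width fixed such that these parts are small, uniform
  convergence takes care of the other pairs of points.\<close>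

lemma composition_continuous:
  fixes g :: "real \<Rightarrow> 'a::euclidean_space"
  assumes c: "continuous_on UNIV g" and per: "\<And>u. g (u + 1) = g u" and \<sigma>: "0 < \<sigma>" "\<sigma> \<le> 1"
    and fin: "gagliardo2 circle_dist \<sigma> g < \<infinity>"
    and d: "\<And>u. (\<phi> has_real_derivative \<phi>' u) (at u)" and c': "continuous_on UNIV \<phi>'"
    and M: "\<And>u. \<bar>\<phi>' u\<bar> \<le> M" and F: "\<And>u. \<bar>\<phi> u\<bar> \<le> F" and \<phi>: "\<phi> 0 = 0" "\<phi> 1 = 0" and e: "0 < e"
  shows "\<exists>\<delta>>0. \<forall>t. 0 \<le> t \<longrightarrow> t < \<delta> \<longrightarrow> gagliardo2 circle_dist \<sigma> (\<lambda>u. g (u + t * \<phi> u) - g u) \<le> ennreal e"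
proof -
  \<comment> \<open>The parts near the diagonal amount to at most \<open>2 * 32 + 2 = 66\<close> times that of \<open>g\<close>; they get one half of \<open>e\<close>.\<close>
  obtain \<theta>2 where \<theta>2: "0 < \<theta>2" "near_diagonal \<sigma> g \<theta>2 < ennreal (e / 132)"
    using near_diagonal_small[OF c fin, of "e / 132"] e by auto
  define \<theta> where "\<theta> = \<theta>2 / 2"
  have \<theta>: "0 < \<theta>" using \<theta>2 by (simp add: \<theta>_def)
  define S where "S = sqrt (e / 8 * \<theta> powr (1 + 2 * \<sigma>))"
  have S: "0 < S" unfolding S_def using e \<theta> by simp
  have S2: "4 * S\<^sup>2 / \<theta> powr (1 + 2 * \<sigma>) = e / 2" unfolding S_def using e \<theta> by simp
  obtain d1 where d1: "0 < d1" "\<And>x y. \<bar>x - y\<bar> < d1 \<Longrightarrow> norm (g x - g y) < S"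
    using periodic_uniformly_continuous[OF c per S] by blast
  have M0: "0 \<le> M" and F0: "0 \<le> F" using M[of 0] F[of 0] abs_ge_zero order_trans by blast+
  define \<delta> where "\<delta> = min (1 / (2 * (M + 1))) (d1 / (F + 1))"
  have "gagliardo2 circle_dist \<sigma> (\<lambda>u. g (u + t * \<phi> u) - g u) \<le> ennreal e" if t: "0 \<le> t" "t < \<delta>" for t
  proof -
    define \<psi> where "\<psi> u = u + t * \<phi> u" for u
    define \<psi>' where "\<psi>' u = 1 + t * \<phi>' u" for u
    have d\<psi>: "(\<psi> has_real_derivative \<psi>' u) (at u)" for u
      unfolding \<psi>_def \<psi>'_def by (auto intro!: derivative_eq_intros d)
    have c\<psi>': "continuous_on UNIV \<psi>'" unfolding \<psi>'_def by (intro continuous_intros c')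
    have c\<psi>: "continuous_on UNIV \<psi>" using d\<psi> by (meson DERIV_isCont continuous_at_imp_continuous_on)
    have "t * (M + 1) \<le> 1/2" using t M0 by (simp add: \<delta>_def field_simps)
    moreover have "\<bar>t * \<phi>' u\<bar> \<le> t * (M + 1)" for u
      unfolding abs_mult using M[of u] t by (intro mult_mono) auto
    ultimately have half: "\<bar>t * \<phi>' u\<bar> \<le> 1/2" for u using order_trans by blast
    have b: "1/2 \<le> \<psi>' u" "\<psi>' u \<le> 2" for u
      unfolding \<psi>'_def using half[of u] by linarith+
    have "norm (g (\<psi> u) - g u) \<le> S" for u
    proof -
      have "\<bar>t * \<phi> u\<bar> \<le> t * (F + 1)" unfolding abs_mult using F[of u] t by (intro mult_mono) auto
      also have "\<dots> < d1" using t F0 by (simp add: \<delta>_def field_simps)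
      finally show ?thesis using d1(2)[of "\<psi> u" u] by (simp add: \<psi>_def less_imp_le)
    qed
    then have "gagliardo2 circle_dist \<sigma> (\<lambda>u. g (\<psi> u) - g u) \<le> ennreal (4 * S\<^sup>2 / \<theta> powr (1 + 2 * \<sigma>)) +
        (2 * near_diagonal \<sigma> (\<lambda>u. g (\<psi> u)) \<theta> + 2 * near_diagonal \<sigma> g \<theta>)"
      by (intro gagliardo_difference_le continuous_on_compose2[OF c c\<psi>] c \<sigma> \<theta>) auto
    also have "\<dots> \<le> ennreal (e / 2) + (2 * (32 * near_diagonal \<sigma> g \<theta>2) + 2 * near_diagonal \<sigma> g \<theta>2)"
    proof (intro add_mono mult_left_mono)
      show "ennreal (4 * S\<^sup>2 / \<theta> powr (1 + 2 * \<sigma>)) \<le> ennreal (e / 2)" by (simp only: S2 order_refl)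
      have "near_diagonal \<sigma> (\<lambda>u. g (\<psi> u)) \<theta> \<le> 32 * near_diagonal \<sigma> g (2 * \<theta>)"
        by (rule near_diagonal_composition[OF c _ \<sigma> d\<psi> c\<psi>' b]) (use per[of 0] \<phi> in \<open>auto simp: \<psi>_def\<close>)
      then show "near_diagonal \<sigma> (\<lambda>u. g (\<psi> u)) \<theta> \<le> 32 * near_diagonal \<sigma> g \<theta>2" by (simp add: \<theta>_def)
      show "near_diagonal \<sigma> g \<theta> \<le> near_diagonal \<sigma> g \<theta>2" using \<theta>2 by (intro near_diagonal_mono) (simp add: \<theta>_def)
    qed simp_all
    also have "\<dots> = ennreal (e / 2) + 66 * near_diagonal \<sigma> g \<theta>2"
    proof -
      have "2 * (32 * x) + 2 * x = 66 * x" for x :: ennreal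
        by (simp add: mult.assoc[symmetric] distrib_right[symmetric])
      then show ?thesis by simp
    qed
    also have "\<dots> \<le> ennreal (e / 2) + 66 * ennreal (e / 132)" using \<theta>2(2) by (intro add_mono mult_left_mono) auto
    also have "\<dots> = ennreal e"
    proof -
      have "66 * ennreal (e / 132) = ennreal (66 * (e / 132))" using e by (subst ennreal_mult) auto
      then show ?thesis using e by (simp add: ennreal_plus[symmetric] del: ennreal_plus)
    qed
    finally show ?thesis by (simp add: \<psi>_def)
  qed
  moreover have "0 < \<delta>" unfolding \<delta>_def using M0 F0 d1(1) by simp
  ultimately show ?thesis by blast
qed

text \<open>Convexity of the squared seminorm: the inequality of Cauchy and Schwarz in \<open>t\<close> under the double
  integral, followed by an interchange of the integrals.\<close>

lemma gagliardo_average_le: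
  fixes W :: "real \<Rightarrow> real \<Rightarrow> 'a::euclidean_space"
  assumes cW: "continuous_on UNIV (\<lambda>(u, t). W u t)"
    and le: "\<And>t. t \<in> {0..1} \<Longrightarrow> gagliardo2 circle_dist \<sigma> (\<lambda>u. W u t) \<le> ennreal e"
  shows "gagliardo2 circle_dist \<sigma> (\<lambda>u. integral {0..1} (W u)) \<le> ennreal e"
proof -
  have m[measurable]: "(\<lambda>z. W (fst z) (snd z)) \<in> borel_measurable (borel \<Otimes>\<^sub>M borel)"
    unfolding borel_prod using borel_measurable_continuous_onI[OF cW] by (simp add: case_prod_unfold)
  have cu: "continuous_on A (W u)" for u A
  proof -
    have "continuous_on A (\<lambda>t. (u, t))" by (intro continuous_intros)
    from continuous_on_compose2[OF cW this] show ?thesis by simp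
  qed
  define q where "q = 1 + 2 * \<sigma>"
  define k where "k u v t = ennreal ((norm (W u t - W v t))\<^sup>2 / circle_dist u v powr q) * indicator {0..1} v * indicator {0..1} u * indicator {0..1} t"
    for u v t :: real
  have mk[measurable]: "(\<lambda>((u, v), t). k u v t) \<in> borel_measurable ((borel \<Otimes>\<^sub>M borel) \<Otimes>\<^sub>M borel)"
  proof -
    have a: "(\<lambda>z. W (fst (fst z)) (snd z)) \<in> borel_measurable ((borel \<Otimes>\<^sub>M borel) \<Otimes>\<^sub>M (borel :: real measure))"
      using measurable_compose[OF _ m, of "\<lambda>z. (fst (fst z), snd z)" "(borel \<Otimes>\<^sub>M borel) \<Otimes>\<^sub>M borel"] by simp
    have b: "(\<lambda>z. W (snd (fst z)) (snd z)) \<in> borel_measurable ((borel \<Otimes>\<^sub>M borel) \<Otimes>\<^sub>M (borel :: real measure))"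
      using measurable_compose[OF _ m, of "\<lambda>z. (snd (fst z), snd z)" "(borel \<Otimes>\<^sub>M borel) \<Otimes>\<^sub>M borel"] by simp
    note [measurable] = a b
    show ?thesis unfolding k_def circle_dist_def split_beta by measurable
  qed
  have pw: "ennreal ((norm (integral {0..1} (W u) - integral {0..1} (W v)))\<^sup>2 / circle_dist u v powr q) * indicator {0..1} v * indicator {0..1} u
      \<le> (\<integral>\<^sup>+t. k u v t \<partial>lborel)" for u v
  proof (cases "u \<in> {0..1} \<and> v \<in> {0..1}")
    case uv: True
    define D where "D = circle_dist u v powr q"
    have D0: "0 \<le> D" by (simp add: D_def)
    have c: "continuous_on {0..1} (\<lambda>t. W u t - W v t)" by (intro continuous_intros cu)
    have i: "set_integrable lborel {0..1} (\<lambda>t. W u t - W v t)" by (rule borel_integrable_atLeastAtMost'[OF c])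
    have i2: "set_integrable lborel {0..1} (\<lambda>t. (norm (W u t - W v t))\<^sup>2)"
      by (intro borel_integrable_atLeastAtMost' continuous_intros cu)
    have "integral {0..1} (W u) - integral {0..1} (W v) = (LINT t:{0..1}|lborel. W u t - W v t)"
      unfolding set_integral_continuous_eq[OF c]
      by (rule Henstock_Kurzweil_Integration.integral_diff[symmetric]) (intro integrable_continuous_interval cu)+
    then have "(norm (integral {0..1} (W u) - integral {0..1} (W v)))\<^sup>2 \<le> (LINT t:{0..1}|lborel. (norm (W u t - W v t))\<^sup>2)"
      using set_integral_Cauchy_Schwarz[OF _ i i2] by simp
    then have "(norm (integral {0..1} (W u) - integral {0..1} (W v)))\<^sup>2 / D \<le> (LINT t:{0..1}|lborel. (norm (W u t - W v t))\<^sup>2) / D"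
      using D0 by (rule divide_right_mono)
    also have "\<dots> = (LINT t:{0..1}|lborel. (norm (W u t - W v t))\<^sup>2 / D)" by simp
    finally have "ennreal ((norm (integral {0..1} (W u) - integral {0..1} (W v)))\<^sup>2 / D) \<le> ennreal (LINT t:{0..1}|lborel. (norm (W u t - W v t))\<^sup>2 / D)"
      by (rule ennreal_leI)
    also have "\<dots> = (\<integral>\<^sup>+t. k u v t \<partial>lborel)"
    proof -
      have "set_integrable lborel {0..1} (\<lambda>t. (norm (W u t - W v t))\<^sup>2 / D)" using i2 by simp
      then have "ennreal (LINT t:{0..1}|lborel. (norm (W u t - W v t))\<^sup>2 / D) = (\<integral>\<^sup>+t. ennreal (indicator {0..1} t *\<^sub>R ((norm (W u t - W v t))\<^sup>2 / D)) \<partial>lborel)"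
        unfolding set_lebesgue_integral_def set_integrable_def
        by (subst nn_integral_eq_integral) (auto simp: D0)
      also have "\<dots> = (\<integral>\<^sup>+t. k u v t \<partial>lborel)"
        by (rule nn_integral_cong) (use uv in \<open>auto simp: k_def D_def indicator_def\<close>)
      finally show ?thesis .
    qed
    finally show ?thesis using uv by (simp add: D_def)
  qed auto
  have "gagliardo2 circle_dist \<sigma> (\<lambda>u. integral {0..1} (W u)) \<le> (\<integral>\<^sup>+u. \<integral>\<^sup>+v. \<integral>\<^sup>+t. k u v t \<partial>lborel \<partial>lborel \<partial>lborel)"
    unfolding gagliardo2_def q_def[symmetric]
  proof (rule nn_integral_mono)
    fix u :: real
    have "(\<integral>\<^sup>+v\<in>{0..1}. ennreal ((norm (integral {0..1} (W u) - integral {0..1} (W v)))\<^sup>2 / circle_dist u v powr q) \<partial>lborel) * indicator {0..1} u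
      = (\<integral>\<^sup>+v. ennreal ((norm (integral {0..1} (W u) - integral {0..1} (W v)))\<^sup>2 / circle_dist u v powr q) * indicator {0..1} v * indicator {0..1} u \<partial>lborel)"
      by (cases "u \<in> {0..1}") simp_all
    also have "\<dots> \<le> (\<integral>\<^sup>+v. \<integral>\<^sup>+t. k u v t \<partial>lborel \<partial>lborel)" by (rule nn_integral_mono) (rule pw)
    finally show "(\<integral>\<^sup>+v\<in>{0..1}. ennreal ((norm (integral {0..1} (W u) - integral {0..1} (W v)))\<^sup>2 / circle_dist u v powr q) \<partial>lborel) * indicator {0..1} u
      \<le> (\<integral>\<^sup>+v. \<integral>\<^sup>+t. k u v t \<partial>lborel \<partial>lborel)" .
  qed
  also have "\<dots> = (\<integral>\<^sup>+t. \<integral>\<^sup>+u. \<integral>\<^sup>+v. k u v t \<partial>lborel \<partial>lborel \<partial>lborel)"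
  proof -
    have mk': "(\<lambda>(z, t). k (fst z) (snd z) t) \<in> borel_measurable ((lborel \<Otimes>\<^sub>M lborel) \<Otimes>\<^sub>M lborel)"
    proof -
      have "sets ((lborel \<Otimes>\<^sub>M lborel) \<Otimes>\<^sub>M lborel) = sets ((borel \<Otimes>\<^sub>M borel) \<Otimes>\<^sub>M (borel :: real measure) :: ((real \<times> real) \<times> real) measure)"
        by (intro sets_pair_measure_cong) simp_all
      from measurable_cong_sets[OF this refl] show ?thesis using mk by (simp add: case_prod_unfold)
    qed
    have mt: "(\<lambda>z. k (fst z) (snd z) t) \<in> borel_measurable (lborel \<Otimes>\<^sub>M lborel)" for t
      using measurable_compose[OF _ mk, of "\<lambda>z. (z, t)" "lborel \<Otimes>\<^sub>M lborel"] by (simp add: split_beta)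
    have mi: "(\<lambda>z. \<integral>\<^sup>+t. k (fst z) (snd z) t \<partial>lborel) \<in> borel_measurable (lborel \<Otimes>\<^sub>M lborel)"
      by (rule lborel.borel_measurable_nn_integral[OF mk'])
    have ps: "pair_sigma_finite (lborel \<Otimes>\<^sub>M lborel :: (real \<times> real) measure) (lborel :: real measure)"
      unfolding lborel_prod pair_sigma_finite_def by (intro conjI lborel.sigma_finite_measure_axioms)
    have "(\<integral>\<^sup>+u. \<integral>\<^sup>+v. \<integral>\<^sup>+t. k u v t \<partial>lborel \<partial>lborel \<partial>lborel) = (\<integral>\<^sup>+z. \<integral>\<^sup>+t. k (fst z) (snd z) t \<partial>lborel \<partial>(lborel \<Otimes>\<^sub>M lborel))"
      using lborel.nn_integral_fst[OF mi] by simp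
    also have "\<dots> = (\<integral>\<^sup>+t. \<integral>\<^sup>+z. k (fst z) (snd z) t \<partial>(lborel \<Otimes>\<^sub>M lborel) \<partial>lborel)"
      by (rule pair_sigma_finite.Fubini'[OF ps mk', symmetric])
    also have "\<dots> = (\<integral>\<^sup>+t. \<integral>\<^sup>+u. \<integral>\<^sup>+v. k u v t \<partial>lborel \<partial>lborel \<partial>lborel)"
      using lborel.nn_integral_fst[OF mt] by simp
    finally show ?thesis .
  qed
  also have "\<dots> \<le> (\<integral>\<^sup>+t. ennreal e * indicator {0..1::real} t \<partial>lborel)"
  proof (rule nn_integral_mono)
    fix t :: real
    show "(\<integral>\<^sup>+u. \<integral>\<^sup>+v. k u v t \<partial>lborel \<partial>lborel) \<le> ennreal e * indicator {0..1} t"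
    proof (cases "t \<in> {0..1}")
      case True
      have "(\<integral>\<^sup>+u. \<integral>\<^sup>+v. k u v t \<partial>lborel \<partial>lborel) = gagliardo2 circle_dist \<sigma> (\<lambda>u. W u t)"
        unfolding gagliardo2_def q_def[symmetric]
        by (rule nn_integral_cong) (use True in \<open>auto simp: k_def indicator_def\<close>)
      then show ?thesis using le[OF True] True by simp
    qed (simp add: k_def)
  qed
  also have "\<dots> = ennreal e" by (simp add: nn_integral_cmult_indicator)
  finally show ?thesis .
qed

text \<open>Almost everywhere approximation by continuous functions becomes approximation in the quadratic mean by
  dominated convergence. The metric projection onto a large ball provides the dominating constant, and
  being continuous it preserves the continuity of the approximations.\<close>

lemma continuous_dense_L2:
  fixes G :: "real \<Rightarrow> 'a::euclidean_space"
  assumes G: "square_integrable G" and e: "0 < e"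
  shows "\<exists>C. continuous_on UNIV C \<and> (\<integral>\<^sup>+u\<in>{0..1}. ennreal ((norm (G u - C u))\<^sup>2) \<partial>lborel) \<le> ennreal e"
proof -
  define f where "f x = indicator {0..1} x *\<^sub>R G x" for x :: real
  have mf[measurable]: "f \<in> borel_measurable borel"
    using G unfolding square_integrable_def set_borel_measurable_def f_def by simp
  define T where "T n y = closest_point (cball 0 (real n)) y" for n and y :: 'a
  have cT: "continuous_on UNIV (T n)" for n
    unfolding T_def by (intro continuous_on_closest_point) auto
  have [measurable]: "T n \<in> borel_measurable borel" for n by (rule borel_measurable_continuous_onI[OF cT])
  have Tn: "norm (T n y) \<le> real n" for n y
    using closest_point_in_set[of "cball 0 (real n)" y] by (simp add: T_def)
  have Tid: "T n y = y" if "norm y \<le> real n" for n y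
    unfolding T_def using that by (intro closest_point_self) simp
  have Tle: "norm (T n y - y) \<le> norm y" for n y
    using closest_point_le[of "cball 0 (real n)" 0 y] by (simp add: T_def dist_norm norm_minus_commute)
  have "(\<lambda>n. \<integral>\<^sup>+x. ennreal ((norm (T n (f x) - f x))\<^sup>2) \<partial>lborel) \<longlonglongrightarrow> integral\<^sup>N lborel (\<lambda>x::real. 0)"
  proof (rule nn_integral_dominated_convergence[where w="\<lambda>x. ennreal ((norm (f x))\<^sup>2)"])
    show "AE x in lborel. ennreal ((norm (T n (f x) - f x))\<^sup>2) \<le> ennreal ((norm (f x))\<^sup>2)" for n
      using Tle by (intro AE_I2 ennreal_leI power_mono) auto
    have "(\<integral>\<^sup>+x. ennreal ((norm (f x))\<^sup>2) \<partial>lborel) = (\<integral>\<^sup>+u\<in>{0..1}. ennreal ((norm (G u))\<^sup>2) \<partial>lborel)"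
      by (rule nn_integral_cong) (auto simp: f_def indicator_def)
    then show "(\<integral>\<^sup>+x. ennreal ((norm (f x))\<^sup>2) \<partial>lborel) < \<infinity>"
      using nn_integral_norm_squared[OF G] by simp
    show "AE x in lborel. (\<lambda>n. ennreal ((norm (T n (f x) - f x))\<^sup>2)) \<longlonglongrightarrow> 0"
    proof (rule AE_I2)
      fix x
      obtain N where N: "norm (f x) \<le> real N" using real_arch_simple by blast
      have "ennreal ((norm (T n (f x) - f x))\<^sup>2) = 0" if "N \<le> n" for n
      proof -
        have "norm (f x) \<le> real n" using N that by linarith
        then show ?thesis by (simp add: Tid)
      qed
      then have "\<forall>\<^sub>F n in sequentially. ennreal ((norm (T n (f x) - f x))\<^sup>2) = 0"
        using eventually_sequentially by blast
      then show "(\<lambda>n. ennreal ((norm (T n (f x) - f x))\<^sup>2)) \<longlonglongrightarrow> 0" by (rule tendsto_eventually)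
    qed
  qed simp_all
  then have "(\<lambda>n. \<integral>\<^sup>+x. ennreal ((norm (T n (f x) - f x))\<^sup>2) \<partial>lborel) \<longlonglongrightarrow> 0" by simp
  moreover have e4: "0 < ennreal (e / 4)" using e by simp
  ultimately have "\<forall>\<^sub>F n in sequentially. (\<integral>\<^sup>+x. ennreal ((norm (T n (f x) - f x))\<^sup>2) \<partial>lborel) < ennreal (e / 4)"
    by (rule order_tendstoD(2))
  then obtain K where K: "(\<integral>\<^sup>+x. ennreal ((norm (T K (f x) - f x))\<^sup>2) \<partial>lborel) < ennreal (e / 4)"
    by (auto simp: eventually_sequentially)
  have "f \<in> borel_measurable lebesgue" using mf by (intro measurable_completion) simp
  then have "f measurable_on UNIV" by (rule lebesgue_measurable_imp_measurable_on) simp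
  then obtain N g where N: "negligible N" and g: "\<And>n. continuous_on UNIV (g n)"
    and lim: "\<And>x. x \<notin> N \<Longrightarrow> (\<lambda>n. g n x) \<longlonglongrightarrow> f x"
    unfolding measurable_on_def by auto
  have [measurable]: "g n \<in> borel_measurable borel" for n by (rule borel_measurable_continuous_onI[OF g])
  have "AE x in lebesgue. x \<notin> N" using N by (intro AE_not_in) (simp add: negligible_iff_null_sets)
  then have aeN: "AE x in lborel. x \<notin> N" by (simp add: AE_completion_iff)
  have "(\<lambda>n. \<integral>\<^sup>+x. ennreal ((norm (T K (g n x) - T K (f x)))\<^sup>2) * indicator {0..1} x \<partial>lborel) \<longlonglongrightarrow> integral\<^sup>N lborel (\<lambda>x::real. 0)"
  proof (rule nn_integral_dominated_convergence[where w="\<lambda>x. ennreal ((2 * real K)\<^sup>2) * indicator {0..1} x"])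
    show "AE x in lborel. ennreal ((norm (T K (g n x) - T K (f x)))\<^sup>2) * indicator {0..1} x \<le> ennreal ((2 * real K)\<^sup>2) * indicator {0..1} x" for n
    proof (intro AE_I2 mult_right_mono ennreal_leI power_mono)
      show "norm (T K (g n x) - T K (f x)) \<le> 2 * real K" for x
        using norm_triangle_ineq4[of "T K (g n x)" "T K (f x)"] Tn[of K "g n x"] Tn[of K "f x"] by linarith
    qed simp_all
    show "(\<integral>\<^sup>+x. ennreal ((2 * real K)\<^sup>2) * indicator {0..1::real} x \<partial>lborel) < \<infinity>"
      by (simp add: nn_integral_cmult_indicator)
    show "AE x in lborel. (\<lambda>n. ennreal ((norm (T K (g n x) - T K (f x)))\<^sup>2) * indicator {0..1} x) \<longlonglongrightarrow> 0"
      using aeN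
    proof (rule AE_mp, intro AE_I2 impI)
      fix x assume "x \<notin> N"
      have iso: "isCont (T K) y" for y using cT by (simp add: continuous_on_eq_continuous_at)
      have "(\<lambda>n. T K (g n x)) \<longlonglongrightarrow> T K (f x)" by (rule isCont_tendsto_compose[OF iso lim[OF \<open>x \<notin> N\<close>]])
      then have "(\<lambda>n. norm (T K (g n x) - T K (f x))) \<longlonglongrightarrow> 0" by (intro tendsto_norm_zero LIM_zero)
      from tendsto_power[OF this, of 2] have "(\<lambda>n. (norm (T K (g n x) - T K (f x)))\<^sup>2) \<longlonglongrightarrow> 0" by simp
      from tendsto_ennrealI[OF this] have z: "(\<lambda>n. ennreal ((norm (T K (g n x) - T K (f x)))\<^sup>2)) \<longlonglongrightarrow> 0" by simp
      show "(\<lambda>n. ennreal ((norm (T K (g n x) - T K (f x)))\<^sup>2) * indicator {0..1} x) \<longlonglongrightarrow> 0"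
        by (cases "x \<in> {0..1}") (simp_all add: z)
    qed
  qed simp_all
  then have "(\<lambda>n. \<integral>\<^sup>+x. ennreal ((norm (T K (g n x) - T K (f x)))\<^sup>2) * indicator {0..1} x \<partial>lborel) \<longlonglongrightarrow> 0" by simp
  then have "\<forall>\<^sub>F n in sequentially. (\<integral>\<^sup>+x. ennreal ((norm (T K (g n x) - T K (f x)))\<^sup>2) * indicator {0..1} x \<partial>lborel) < ennreal (e / 4)"
    using e4 by (rule order_tendstoD(2))
  then obtain n where n: "(\<integral>\<^sup>+x. ennreal ((norm (T K (g n x) - T K (f x)))\<^sup>2) * indicator {0..1} x \<partial>lborel) < ennreal (e / 4)"
    by (auto simp: eventually_sequentially)
  define C where "C x = T K (g n x)" for x
  have cC: "continuous_on UNIV C" unfolding C_def by (rule continuous_on_compose2[OF cT g]) simp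
  have "(\<integral>\<^sup>+u\<in>{0..1}. ennreal ((norm (G u - C u))\<^sup>2) \<partial>lborel) \<le>
    (\<integral>\<^sup>+x. 0 + (2 * ennreal ((norm (T K (f x) - f x))\<^sup>2) + 2 * (ennreal ((norm (T K (g n x) - T K (f x)))\<^sup>2) * indicator {0..1} x)) \<partial>lborel)"
  proof (rule nn_integral_mono)
    fix x :: real
    show "ennreal ((norm (G x - C x))\<^sup>2) * indicator {0..1} x \<le>
      0 + (2 * ennreal ((norm (T K (f x) - f x))\<^sup>2) + 2 * (ennreal ((norm (T K (g n x) - T K (f x)))\<^sup>2) * indicator {0..1} x))"
    proof (cases "x \<in> {0..1}")
      case True
      then have fx: "f x = G x" by (simp add: f_def)
      have "(norm (C x - G x))\<^sup>2 \<le> 2 * (norm (T K (f x) - f x))\<^sup>2 + 2 * (norm (T K (g n x) - T K (f x)))\<^sup>2"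
        using norm_add_squared_le[of "T K (f x) - f x" "T K (g n x) - T K (f x)"] by (simp add: C_def fx)
      from ennreal_leI[OF this]
      have "ennreal ((norm (C x - G x))\<^sup>2) \<le> 2 * ennreal ((norm (T K (f x) - f x))\<^sup>2) + 2 * ennreal ((norm (T K (g n x) - T K (f x)))\<^sup>2)"
        unfolding ennreal_double_sum[OF zero_le_power2 zero_le_power2] .
      then show ?thesis using True by (simp add: norm_minus_commute[of "G x"])
    qed simp
  qed
  also have "\<dots> = 2 * (\<integral>\<^sup>+x. ennreal ((norm (T K (f x) - f x))\<^sup>2) \<partial>lborel) +
      2 * (\<integral>\<^sup>+x. ennreal ((norm (T K (g n x) - T K (f x)))\<^sup>2) * indicator {0..1} x \<partial>lborel)"
    by (subst nn_integral_linear_combination) simp_all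
  also have "\<dots> \<le> 2 * ennreal (e / 4) + 2 * ennreal (e / 4)"
    using K n by (intro add_mono mult_left_mono) auto
  also have "\<dots> = ennreal (2 * (e / 4) + 2 * (e / 4))" using e by (intro ennreal_double_sum[symmetric]) auto
  also have "2 * (e / 4) + 2 * (e / 4) = e" by simp
  finally show ?thesis using cC by blast
qed

text \<open>The increment over the segment between \<open>u\<close> and \<open>\<psi> u\<close>, of length at most \<open>r\<close>, is estimated by
  Cauchy and Schwarz. A point \<open>x\<close> lies on such a segment only for \<open>u\<close> in \<open>[x - r, x + r]\<close>, so the interchange
  of the integrals contributes a factor \<open>2 r\<close>.\<close>

lemma shifted_difference_L2:
  fixes g G :: "real \<Rightarrow> 'a::euclidean_space"
  assumes p: "primitive G g" and G: "square_integrable G" and r: "0 \<le> r"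
    and \<psi>: "\<And>u. u \<in> {0..1} \<Longrightarrow> \<psi> u \<in> {0..1}" "\<And>u. u \<in> {0..1} \<Longrightarrow> \<bar>\<psi> u - u\<bar> \<le> r"
  shows "(\<integral>\<^sup>+u\<in>{0..1}. ennreal ((norm (g (\<psi> u) - g u))\<^sup>2) \<partial>lborel) \<le>
    ennreal (2 * r\<^sup>2) * (\<integral>\<^sup>+u\<in>{0..1}. ennreal ((norm (G u))\<^sup>2) \<partial>lborel)"
proof -
  define k where "k x = ennreal ((norm (indicator {0..1} x *\<^sub>R G x))\<^sup>2)" for x :: real
  have mk[measurable]: "k \<in> borel_measurable borel"
  proof -
    have "(\<lambda>x. indicator {0..1} x *\<^sub>R G x) \<in> borel_measurable borel"
      using G unfolding square_integrable_def set_borel_measurable_def by simp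
    then show ?thesis unfolding k_def by measurable
  qed
  have i: "set_integrable lborel {0..1} (\<lambda>x. (norm (G x))\<^sup>2)" using G unfolding square_integrable_def by blast
  have piece: "ennreal ((norm (g b - g a))\<^sup>2) \<le> ennreal r * (\<integral>\<^sup>+x. k x * indicator {x - r..x + r} u \<partial>lborel)"
    if ab: "0 \<le> a" "a \<le> b" "b \<le> 1" "b - a \<le> r" "u \<in> {a..b}" for a b u
  proof -
    have i': "set_integrable lborel {a..b} G" "set_integrable lborel {a..b} (\<lambda>x. (norm (G x))\<^sup>2)"
      using set_integrable_subinterval[OF primitive_imp_integrable[OF p], of a b] set_integrable_subinterval[OF i, of a b] ab by auto
    have J0: "0 \<le> (LINT x:{a..b}|lborel. (norm (G x))\<^sup>2)"
      unfolding set_lebesgue_integral_def by (intro Bochner_Integration.integral_nonneg) auto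
    have "(norm (g b - g a))\<^sup>2 \<le> (b - a) * (LINT x:{a..b}|lborel. (norm (G x))\<^sup>2)"
      using set_integral_Cauchy_Schwarz[OF ab(2) i'] primitive_diff[OF p ab(1-3)] by simp
    also have "\<dots> \<le> r * (LINT x:{a..b}|lborel. (norm (G x))\<^sup>2)" using ab J0 by (intro mult_right_mono) auto
    finally have "ennreal ((norm (g b - g a))\<^sup>2) \<le> ennreal r * ennreal (LINT x:{a..b}|lborel. (norm (G x))\<^sup>2)"
      using r J0 by (simp add: ennreal_mult[symmetric] ennreal_leI)
    also have "ennreal (LINT x:{a..b}|lborel. (norm (G x))\<^sup>2) = (\<integral>\<^sup>+x. ennreal (indicator {a..b} x *\<^sub>R (norm (G x))\<^sup>2) \<partial>lborel)"
      using i'(2) unfolding set_lebesgue_integral_def set_integrable_def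
      by (subst nn_integral_eq_integral) auto
    also have "\<dots> \<le> (\<integral>\<^sup>+x. k x * indicator {x - r..x + r} u \<partial>lborel)"
    proof (rule nn_integral_mono)
      fix x :: real
      show "ennreal (indicator {a..b} x *\<^sub>R (norm (G x))\<^sup>2) \<le> k x * indicator {x - r..x + r} u"
      proof (cases "x \<in> {a..b}")
        case True
        then have "x \<in> {0..1}" "u \<in> {x - r..x + r}" using ab by auto
        then show ?thesis using True by (simp add: k_def)
      qed simp
    qed
    finally show ?thesis by (simp add: mult_left_mono)
  qed
  have m2[measurable]: "(\<lambda>(x, u). k x * indicator {x - r..x + r} u) \<in> borel_measurable (lborel \<Otimes>\<^sub>M lborel)"
  proof -
    have "(\<lambda>(x, u). k x * indicator {z. \<bar>fst z - snd z\<bar> \<le> r} (x, u)) \<in> borel_measurable (lborel \<Otimes>\<^sub>M lborel)"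
      by measurable
    also have "(\<lambda>(x, u). k x * indicator {z. \<bar>fst z - snd z\<bar> \<le> r} (x, u)) = (\<lambda>(x, u). k x * indicator {x - r..x + r} u)"
      by (auto simp: indicator_def fun_eq_iff)
    finally show ?thesis .
  qed
  have "(\<integral>\<^sup>+u\<in>{0..1}. ennreal ((norm (g (\<psi> u) - g u))\<^sup>2) \<partial>lborel) \<le>
    (\<integral>\<^sup>+u. ennreal r * (\<integral>\<^sup>+x. k x * indicator {x - r..x + r} u \<partial>lborel) \<partial>lborel)"
  proof (rule nn_integral_mono)
    fix u :: real
    show "ennreal ((norm (g (\<psi> u) - g u))\<^sup>2) * indicator {0..1} u \<le> ennreal r * (\<integral>\<^sup>+x. k x * indicator {x - r..x + r} u \<partial>lborel)"
    proof (cases "u \<in> {0..1}")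
      case u: True
      show ?thesis
      proof (cases "u \<le> \<psi> u")
        case True
        then show ?thesis using piece[of u "\<psi> u" u] u \<psi>[OF u] by simp
      next
        case False
        then show ?thesis using piece[of "\<psi> u" u u] u \<psi>[OF u] by (simp add: norm_minus_commute)
      qed
    qed simp
  qed
  also have "\<dots> = ennreal r * (\<integral>\<^sup>+u. \<integral>\<^sup>+x. k x * indicator {x - r..x + r} u \<partial>lborel \<partial>lborel)"
  proof (rule nn_integral_cmult)
    have "(\<lambda>(u, x). k x * indicator {x - r..x + r} u) \<in> borel_measurable (lborel \<Otimes>\<^sub>M lborel)"
      using measurable_pair_swap[OF m2] by (simp add: case_prod_unfold)
    then show "(\<lambda>u. \<integral>\<^sup>+x. k x * indicator {x - r..x + r} u \<partial>lborel) \<in> borel_measurable lborel"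
      by (rule lborel.borel_measurable_nn_integral)
  qed
  also have "(\<integral>\<^sup>+u. \<integral>\<^sup>+x. k x * indicator {x - r..x + r} u \<partial>lborel \<partial>lborel) = (\<integral>\<^sup>+x. \<integral>\<^sup>+u. k x * indicator {x - r..x + r} u \<partial>lborel \<partial>lborel)"
    by (rule lborel_pair.Fubini'[OF m2])
  also have "\<dots> = (\<integral>\<^sup>+x. ennreal (2 * r) * k x \<partial>lborel)"
    by (rule nn_integral_cong) (use r in \<open>simp add: nn_integral_cmult_indicator mult.commute\<close>)
  also have "\<dots> = ennreal (2 * r) * (\<integral>\<^sup>+x. k x \<partial>lborel)" by (rule nn_integral_cmult) simp
  also have "(\<integral>\<^sup>+x. k x \<partial>lborel) = (\<integral>\<^sup>+u\<in>{0..1}. ennreal ((norm (G u))\<^sup>2) \<partial>lborel)"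
    by (rule nn_integral_cong) (auto simp: k_def indicator_def)
  also have "ennreal r * (ennreal (2 * r) * (\<integral>\<^sup>+u\<in>{0..1}. ennreal ((norm (G u))\<^sup>2) \<partial>lborel)) =
      ennreal (2 * r\<^sup>2) * (\<integral>\<^sup>+u\<in>{0..1}. ennreal ((norm (G u))\<^sup>2) \<partial>lborel)"
  proof -
    have "ennreal r * ennreal (2 * r) = ennreal (2 * r\<^sup>2)"
      using r by (subst ennreal_mult[symmetric]) (auto simp: power2_eq_square algebra_simps)
    then show ?thesis by (simp only: mult.assoc[symmetric])
  qed
  finally show ?thesis .
qed

lemma linearization_error:
  fixes g G :: "real \<Rightarrow> 'a::euclidean_space"
  assumes d: "\<And>u. (g has_vector_derivative G u) (at u)"
    and k: "\<And>x. x \<in> closed_segment u v \<Longrightarrow> norm (G x - G u) \<le> k"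
  shows "norm (g v - g u - (v - u) *\<^sub>R G u) \<le> k * \<bar>v - u\<bar>"
proof -
  define h where "h x = g x - x *\<^sub>R G u" for x
  have dh: "(h has_vector_derivative G x - G u) (at x)" for x
    unfolding h_def using has_vector_derivative_diff[OF d[of x] has_vector_derivative_scaleR[OF DERIV_ident has_vector_derivative_const]]
    by simp
  have "norm (h v - h u) \<le> k * norm (v - u)"
  proof (rule differentiable_bound[where S="closed_segment u v" and f'="\<lambda>x t. t *\<^sub>R (G x - G u)"])
    show "(h has_derivative (\<lambda>t. t *\<^sub>R (G x - G u))) (at x within closed_segment u v)" for x
      using dh[of x] unfolding has_vector_derivative_def by (rule has_derivative_at_withinI)
    show "onorm (\<lambda>t. t *\<^sub>R (G x - G u)) \<le> k" if "x \<in> closed_segment u v" for x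
      by (rule onorm_le) (use k[OF that] in \<open>auto simp: mult.commute[of k] intro!: mult_left_mono\<close>)
  qed auto
  moreover have "h v - h u = g v - g u - (v - u) *\<^sub>R G u" by (simp add: h_def algebra_simps)
  ultimately show ?thesis by simp
qed

lemma norm_four_squared_le:
  fixes a b c d :: "'a::real_normed_vector"
  shows "(norm (a + b + (c + d)))\<^sup>2 \<le> 4 * (norm a)\<^sup>2 + 4 * (norm b)\<^sup>2 + (4 * (norm c)\<^sup>2 + 4 * (norm d)\<^sup>2)"
  using norm_add_squared_le[of "a + b" "c + d"] norm_add_squared_le[of a b] norm_add_squared_le[of c d] by linarith

text \<open>The case \<open>s = 1\<close>. The derivative of the remainder contains the difference between a difference
  quotient of \<open>g\<close> and \<open>\<phi> G\<close>. It is small in \<open>L\<^sup>2\<close>: this is clear for continuous \<open>G\<close>, and both terms are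
  bounded in \<open>L\<^sup>2\<close> by a constant times the norm of \<open>G\<close>, uniformly in \<open>\<epsilon>\<close>.\<close>

lemma reparametrization_remainder_1:
  fixes p g G :: "real \<Rightarrow> 'a::euclidean_space"
  assumes p: "\<And>u. (p has_vector_derivative g u) (at u)" "\<And>u. p (u + 1) = p u"
    and g: "continuous_on UNIV g" "\<And>u. g (u + 1) = g u" and G: "square_integrable G" "primitive G g"
    and d: "\<And>u. (\<phi> has_real_derivative \<phi>' u) (at u)" and c': "continuous_on UNIV \<phi>'"
    and per: "\<And>u. \<phi> (u + 1) = \<phi> u" and \<phi>0: "\<phi> 0 = 0"
    and M: "\<And>u. \<bar>\<phi>' u\<bar> \<le> M" and F: "\<And>u. \<bar>\<phi> u\<bar> \<le> F" and e: "0 < e"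
  shows "\<exists>\<delta>>0. \<forall>\<epsilon>. 0 < \<epsilon> \<longrightarrow> \<epsilon> < \<delta> \<longrightarrow>
    sobolev_bound 1 (\<lambda>u. (1 / \<epsilon>) *\<^sub>R (p (u + \<epsilon> * \<phi> u) - p u) - \<phi> u *\<^sub>R g u) e"
proof -
  have M0: "0 \<le> M" and F0: "0 \<le> F" using M[of 0] F[of 0] abs_ge_zero order_trans by blast+
  define F1 where "F1 = F + 1"
  have F1: "0 < F1" "F \<le> F1" using F0 by (auto simp: F1_def)
  \<comment> \<open>The two terms with \<open>G - C\<close> below contribute \<open>4 * 2 * F1\<^sup>2 * \<eta> + 4 * F1\<^sup>2 * \<eta> = e / 2\<close>, and \<open>k\<close> is chosen such that the two uniformly small terms contribute the other half.\<close>
  define \<eta> where "\<eta> = e / (24 * F1\<^sup>2)"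
  have \<eta>: "0 < \<eta>" using e F1 by (simp add: \<eta>_def)
  define k where "k = sqrt (e / (8 * (F1\<^sup>2 + M\<^sup>2)))"
  have FM: "0 < F1\<^sup>2 + M\<^sup>2" using F1 by (simp add: add_pos_nonneg)
  have k: "0 < k" using e FM by (simp add: k_def)
  have k2: "4 * (F1\<^sup>2 + M\<^sup>2) * k\<^sup>2 = e / 2" unfolding k_def using e FM by (simp add: field_simps)
  obtain C where C: "continuous_on UNIV C" "(\<integral>\<^sup>+u\<in>{0..1}. ennreal ((norm (G u - C u))\<^sup>2) \<partial>lborel) \<le> ennreal \<eta>"
    using continuous_dense_L2[OF G(1) \<eta>] by blast
  have "isCont C x" for x using C(1) by (simp add: continuous_on_eq_continuous_at)
  then obtain gc where gc: "\<And>x. (gc has_vector_derivative C x) (at x)"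
    using einterval_antiderivative[of "-\<infinity>" "\<infinity>" C] by auto
  define gr where "gr u = g u + - gc u" for u
  have pgr: "primitive (\<lambda>u. G u + - C u) gr"
    unfolding gr_def by (intro primitive_add primitive_minus G(2) primitive_derivative gc C(1))
  have sqr: "square_integrable (\<lambda>u. G u + - C u)"
    by (intro square_integrable_add G(1) square_integrable_continuous continuous_intros continuous_on_subset[OF C(1)]) simp
  have ccg: "continuous_on A gc" "continuous_on A p" for A
    using has_vector_derivative_imp_continuous_on gc p(1) by blast+
  have c\<phi>: "continuous_on A \<phi>" for A using d by (meson DERIV_isCont continuous_at_imp_continuous_on)
  obtain d1 where d1: "0 < d1" "\<And>x y. \<bar>x - y\<bar> < d1 \<Longrightarrow> norm (g x - g y) < k"
    using periodic_uniformly_continuous[OF g k] by blast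
  have "uniformly_continuous_on {0..1} C" by (rule compact_uniformly_continuous[OF continuous_on_subset[OF C(1)]]) auto
  then obtain d2 where d2: "0 < d2" "\<And>x y. x \<in> {0..1} \<Longrightarrow> y \<in> {0..1} \<Longrightarrow> dist y x < d2 \<Longrightarrow> dist (C y) (C x) < k"
    using k unfolding uniformly_continuous_on_def by metis
  define \<delta> where "\<delta> = min (1 / (2 * (M + 1))) (min d1 d2 / F1)"
  have "sobolev_bound 1 (\<lambda>u. (1 / \<epsilon>) *\<^sub>R (p (u + \<epsilon> * \<phi> u) - p u) - \<phi> u *\<^sub>R g u) e" if \<epsilon>: "0 < \<epsilon>" "\<epsilon> < \<delta>" for \<epsilon>
  proof -
    define \<psi> where "\<psi> u = u + \<epsilon> * \<phi> u" for u
    define \<psi>' where "\<psi>' u = 1 + \<epsilon> * \<phi>' u" for u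
    have d\<psi>: "(\<psi> has_real_derivative \<psi>' u) (at u)" for u
      unfolding \<psi>_def \<psi>'_def by (auto intro!: derivative_eq_intros d)
    have c\<psi>: "continuous_on A \<psi>" for A unfolding \<psi>_def by (intro continuous_intros c\<phi>)
    have "\<epsilon> * (M + 1) \<le> 1/2" using \<epsilon> M0 by (simp add: \<delta>_def field_simps)
    moreover have "\<bar>\<epsilon> * \<phi>' u\<bar> \<le> \<epsilon> * (M + 1)" for u
      unfolding abs_mult using M[of u] \<epsilon> by (intro mult_mono) auto
    ultimately have half: "\<bar>\<epsilon> * \<phi>' u\<bar> \<le> 1/2" for u using order_trans by blast
    have pos: "0 \<le> \<psi>' u" for u unfolding \<psi>'_def using half[of u] by linarith
    have mono: "\<psi> x \<le> \<psi> y" if "x \<le> y" for x y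
      using DERIV_nonneg_imp_nondecreasing[OF that, of \<psi>] d\<psi> pos by blast
    have \<psi>01: "\<psi> u \<in> {0..1}" if "u \<in> {0..1}" for u
      using mono[of 0 u] mono[of u 1] that \<phi>0 per[of 0] by (simp add: \<psi>_def)
    have sh: "\<bar>\<psi> u - u\<bar> \<le> \<epsilon> * F1" for u
      unfolding \<psi>_def using F[of u] F1 \<epsilon> by (simp add: abs_mult mult_left_mono order_trans)
    have small: "\<epsilon> * F1 < d1" "\<epsilon> * F1 < d2" using \<epsilon> F1 by (auto simp: \<delta>_def field_simps)
    define R where "R u = ((1 / \<epsilon>) *\<^sub>R (\<psi>' u *\<^sub>R g (\<psi> u) - g u)) + ((- \<phi>' u) *\<^sub>R g u + (- \<phi> u) *\<^sub>R G u)" for u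
    have dp\<psi>: "((\<lambda>u. p (\<psi> u)) has_vector_derivative \<psi>' u *\<^sub>R g (\<psi> u)) (at u)" for u
    proof -
      have "((p \<circ> \<psi>) has_vector_derivative \<psi>' u *\<^sub>R g (\<psi> u)) (at u)"
      proof (rule vector_diff_chain_at)
        show "(\<psi> has_vector_derivative \<psi>' u) (at u)" using d\<psi>[of u] by (simp add: has_real_derivative_iff_has_vector_derivative)
      qed (rule p(1))
      then show ?thesis by (simp add: o_def)
    qed
    have "primitive (\<lambda>u. (1 / \<epsilon>) *\<^sub>R (\<psi>' u *\<^sub>R g (\<psi> u) - g u)) (\<lambda>u. (1 / \<epsilon>) *\<^sub>R (p (\<psi> u) - p u))"
    proof (rule primitive_derivative)
      show "((\<lambda>u. (1 / \<epsilon>) *\<^sub>R (p (\<psi> u) - p u)) has_vector_derivative (1 / \<epsilon>) *\<^sub>R (\<psi>' u *\<^sub>R g (\<psi> u) - g u)) (at u)" for u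
        by (intro bounded_linear.has_vector_derivative[OF bounded_linear_scaleR_right] has_vector_derivative_diff dp\<psi> p(1))
      show "continuous_on UNIV (\<lambda>u. (1 / \<epsilon>) *\<^sub>R (\<psi>' u *\<^sub>R g (\<psi> u) - g u))"
        unfolding \<psi>'_def by (intro continuous_intros c' g(1) continuous_on_compose2[OF g(1) c\<psi>]) simp
    qed
    moreover have "primitive (\<lambda>u. (- \<phi>' u) *\<^sub>R g u + (- \<phi> u) *\<^sub>R G u) (\<lambda>u. (- \<phi> u) *\<^sub>R g u)"
    proof (rule primitive_mult(1)[OF primitive_minus[OF primitive_derivative] G(2)])
      show "(\<phi> has_vector_derivative \<phi>' u) (at u)" for u using d[of u] by (simp add: has_real_derivative_iff_has_vector_derivative)
    qed (rule c')
    ultimately have prim: "primitive R (\<lambda>u. (1 / \<epsilon>) *\<^sub>R (p (\<psi> u) - p u) + (- \<phi> u) *\<^sub>R g u)"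
      unfolding R_def by (rule primitive_add)
    \<comment> \<open>The summands \<open>a\<close> and \<open>b\<close> are linear in the error \<open>G - C\<close> of the approximation and small in \<open>L\<^sup>2\<close>; \<open>cc\<close> is the remainder for the approximation \<open>C\<close>; \<open>dd\<close> comes from the factor \<open>\<psi>'\<close> of the chain rule.\<close>
    define a where "a u = (1 / \<epsilon>) *\<^sub>R (gr (\<psi> u) - gr u)" for u
    define b where "b u = (- \<phi> u) *\<^sub>R (G u + - C u)" for u
    define cc where "cc u = (1 / \<epsilon>) *\<^sub>R (gc (\<psi> u) - gc u - (\<psi> u - u) *\<^sub>R C u)" for u
    define dd where "dd u = \<phi>' u *\<^sub>R (g (\<psi> u) - g u)" for u
    have R: "R u = a u + b u + (cc u + dd u)" for u
    proof -
      have 1: "(1 / \<epsilon>) *\<^sub>R (\<psi>' u *\<^sub>R g (\<psi> u) - g u) = (1 / \<epsilon>) *\<^sub>R (g (\<psi> u) - g u) + \<phi>' u *\<^sub>R g (\<psi> u)"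
        using \<epsilon> by (simp add: \<psi>'_def algebra_simps)
      have 2: "cc u = (1 / \<epsilon>) *\<^sub>R (gc (\<psi> u) - gc u) - \<phi> u *\<^sub>R C u"
        using \<epsilon> by (simp add: cc_def \<psi>_def algebra_simps)
      have 3: "a u = (1 / \<epsilon>) *\<^sub>R (g (\<psi> u) - g u) - (1 / \<epsilon>) *\<^sub>R (gc (\<psi> u) - gc u)"
        by (simp add: a_def gr_def algebra_simps)
      show ?thesis unfolding R_def 1 2 3 b_def dd_def by (simp add: algebra_simps)
    qed
    have cb: "norm (cc u) \<le> F1 * k" if u: "u \<in> {0..1}" for u
    proof -
      have "norm (gc (\<psi> u) - gc u - (\<psi> u - u) *\<^sub>R C u) \<le> k * \<bar>\<psi> u - u\<bar>"
      proof (rule linearization_error[OF gc])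
        fix x assume x: "x \<in> closed_segment u (\<psi> u)"
        then have "x \<in> {0..1}" "\<bar>x - u\<bar> \<le> \<bar>\<psi> u - u\<bar>"
          using u \<psi>01[OF u] by (auto simp: closed_segment_eq_real_ivl split: if_splits)
        then show "norm (C x - C u) \<le> k"
          using d2(2)[of u x] u sh[of u] small(2) by (simp add: dist_norm less_imp_le)
      qed
      also have "\<dots> \<le> k * (\<epsilon> * F1)" using sh[of u] k by (intro mult_left_mono) auto
      finally have "(1 / \<epsilon>) * norm (gc (\<psi> u) - gc u - (\<psi> u - u) *\<^sub>R C u) \<le> (1 / \<epsilon>) * (k * (\<epsilon> * F1))"
        using \<epsilon> by (intro mult_left_mono) auto
      then show ?thesis using \<epsilon> by (simp add: cc_def mult.commute)
    qed
    have db: "norm (dd u) \<le> M * k" for u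
    proof -
      have "norm (g (\<psi> u) - g u) \<le> k" using d1(2)[of "\<psi> u" u] sh[of u] small(1) by simp
      then show ?thesis unfolding dd_def using M[of u] M0 by (simp add: mult_mono)
    qed
    have cgr: "continuous_on {0..1} gr" by (rule primitive_continuous_on[OF pgr])
    have ca: "continuous_on {0..1} a"
      unfolding a_def by (intro continuous_intros cgr continuous_on_compose2[OF cgr c\<psi>]) (use \<psi>01 in auto)
    define A where "A u = ennreal ((norm (a u))\<^sup>2) * indicator {0..1} u" for u
    define B where "B u = ennreal ((norm (b u))\<^sup>2) * indicator {0..1} u" for u
    have mA: "A \<in> borel_measurable lborel"
      using measurable_norm_squared(2)[of "{0..1}" a] square_integrable_continuous[OF ca]
      unfolding A_def square_integrable_def by blast
    have sqb: "square_integrable b"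
      unfolding b_def by (intro square_integrable_mult_bounded sqr continuous_intros c\<phi>)
    have mB: "B \<in> borel_measurable lborel"
      using measurable_norm_squared(2)[of "{0..1}" b] sqb unfolding B_def square_integrable_def by blast
    have C': "(\<integral>\<^sup>+u\<in>{0..1}. ennreal ((norm (G u + - C u))\<^sup>2) \<partial>lborel) \<le> ennreal \<eta>" using C(2) by simp
    have IA: "(\<integral>\<^sup>+u. A u \<partial>lborel) \<le> ennreal (2 * F1\<^sup>2 * \<eta>)"
    proof -
      have "(\<integral>\<^sup>+u. A u \<partial>lborel) = (\<integral>\<^sup>+u. ennreal (1 / \<epsilon>\<^sup>2) * (ennreal ((norm (gr (\<psi> u) - gr u))\<^sup>2) * indicator {0..1} u) \<partial>lborel)"
      proof (rule nn_integral_cong)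
        fix u :: real
        have "(norm (a u))\<^sup>2 = 1 / \<epsilon>\<^sup>2 * (norm (gr (\<psi> u) - gr u))\<^sup>2"
          using \<epsilon> by (simp add: a_def power_mult_distrib power_divide)
        then show "A u = ennreal (1 / \<epsilon>\<^sup>2) * (ennreal ((norm (gr (\<psi> u) - gr u))\<^sup>2) * indicator {0..1} u)"
          by (simp add: A_def ennreal_mult[symmetric] mult.assoc[symmetric])
      qed
      also have "\<dots> = ennreal (1 / \<epsilon>\<^sup>2) * (\<integral>\<^sup>+u\<in>{0..1}. ennreal ((norm (gr (\<psi> u) - gr u))\<^sup>2) \<partial>lborel)"
      proof (rule nn_integral_cmult)
        have cd: "continuous_on {0..1} (\<lambda>u. gr (\<psi> u) - gr u)"
          by (intro continuous_intros cgr continuous_on_compose2[OF cgr c\<psi>]) (use \<psi>01 in auto)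
        show "(\<lambda>u. ennreal ((norm (gr (\<psi> u) - gr u))\<^sup>2) * indicator {0..1} u) \<in> borel_measurable lborel"
          using measurable_norm_squared(2)[of "{0..1}" "\<lambda>u. gr (\<psi> u) - gr u"] square_integrable_continuous[OF cd]
          unfolding square_integrable_def by blast
      qed
      also have "\<dots> \<le> ennreal (1 / \<epsilon>\<^sup>2) * (ennreal (2 * (\<epsilon> * F1)\<^sup>2) * ennreal \<eta>)"
      proof (rule mult_left_mono)
        have "(\<integral>\<^sup>+u\<in>{0..1}. ennreal ((norm (gr (\<psi> u) - gr u))\<^sup>2) \<partial>lborel) \<le>
          ennreal (2 * (\<epsilon> * F1)\<^sup>2) * (\<integral>\<^sup>+u\<in>{0..1}. ennreal ((norm (G u + - C u))\<^sup>2) \<partial>lborel)"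
          using \<epsilon> F1 by (intro shifted_difference_L2[OF pgr sqr] \<psi>01 sh) auto
        also have "\<dots> \<le> ennreal (2 * (\<epsilon> * F1)\<^sup>2) * ennreal \<eta>" by (intro mult_left_mono C') simp
        finally show "(\<integral>\<^sup>+u\<in>{0..1}. ennreal ((norm (gr (\<psi> u) - gr u))\<^sup>2) \<partial>lborel) \<le> ennreal (2 * (\<epsilon> * F1)\<^sup>2) * ennreal \<eta>" .
      qed simp
      also have "\<dots> = ennreal (1 / \<epsilon>\<^sup>2 * (2 * (\<epsilon> * F1)\<^sup>2 * \<eta>))"
      proof -
        have t: "ennreal x * (ennreal y * ennreal z) = ennreal (x * (y * z))" if "0 \<le> x" "0 \<le> y" "0 \<le> z" for x y z
          using that by (simp add: ennreal_mult)
        show ?thesis by (rule t) (use \<eta> in auto)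
      qed
      also have "1 / \<epsilon>\<^sup>2 * (2 * (\<epsilon> * F1)\<^sup>2 * \<eta>) = 2 * F1\<^sup>2 * \<eta>" using \<epsilon> by (simp add: power_mult_distrib)
      finally show ?thesis .
    qed
    have IB: "(\<integral>\<^sup>+u. B u \<partial>lborel) \<le> ennreal (F1\<^sup>2 * \<eta>)"
    proof -
      have "(\<integral>\<^sup>+u. B u \<partial>lborel) \<le> (\<integral>\<^sup>+u. ennreal (F1\<^sup>2) * (ennreal ((norm (G u + - C u))\<^sup>2) * indicator {0..1} u) \<partial>lborel)"
      proof (rule nn_integral_mono)
        fix u :: real
        have "\<bar>\<phi> u\<bar>\<^sup>2 \<le> F1\<^sup>2" using F[of u] F1 by (intro power_mono) auto
        then have "(norm (b u))\<^sup>2 \<le> F1\<^sup>2 * (norm (G u + - C u))\<^sup>2"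
          by (simp add: b_def power_mult_distrib mult_right_mono)
        from ennreal_leI[OF this] show "B u \<le> ennreal (F1\<^sup>2) * (ennreal ((norm (G u + - C u))\<^sup>2) * indicator {0..1} u)"
          by (simp add: B_def ennreal_mult mult.assoc[symmetric] mult_right_mono)
      qed
      also have "\<dots> = ennreal (F1\<^sup>2) * (\<integral>\<^sup>+u\<in>{0..1}. ennreal ((norm (G u + - C u))\<^sup>2) \<partial>lborel)"
      proof (rule nn_integral_cmult)
        show "(\<lambda>u. ennreal ((norm (G u + - C u))\<^sup>2) * indicator {0..1} u) \<in> borel_measurable lborel"
          using measurable_norm_squared(2)[of "{0..1}" "\<lambda>u. G u + - C u"] sqr
          unfolding square_integrable_def by blast
      qed
      also have "\<dots> \<le> ennreal (F1\<^sup>2) * ennreal \<eta>" by (intro mult_left_mono C') simp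
      also have "\<dots> = ennreal (F1\<^sup>2 * \<eta>)" using \<eta> by (simp add: ennreal_mult)
      finally show ?thesis .
    qed
    have "(\<integral>\<^sup>+u\<in>{0..1}. ennreal ((norm (R u))\<^sup>2) \<partial>lborel) \<le>
      (\<integral>\<^sup>+u. ennreal (e / 2) * indicator {0..1} u + (2 * (2 * A u) + 2 * (2 * B u)) \<partial>lborel)"
    proof (rule nn_integral_mono)
      fix u :: real
      show "ennreal ((norm (R u))\<^sup>2) * indicator {0..1} u \<le> ennreal (e / 2) * indicator {0..1} u + (2 * (2 * A u) + 2 * (2 * B u))"
      proof (cases "u \<in> {0..1}")
        case u: True
        have "(norm (cc u))\<^sup>2 \<le> (F1 * k)\<^sup>2" "(norm (dd u))\<^sup>2 \<le> (M * k)\<^sup>2"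
          using cb[OF u] db[of u] by (intro power_mono; simp)+
        then have "4 * (norm (cc u))\<^sup>2 + 4 * (norm (dd u))\<^sup>2 \<le> 4 * (F1\<^sup>2 + M\<^sup>2) * k\<^sup>2"
          by (simp add: power_mult_distrib distrib_left distrib_right)
        then have "(norm (R u))\<^sup>2 \<le> e / 2 + (2 * (2 * (norm (a u))\<^sup>2) + 2 * (2 * (norm (b u))\<^sup>2))"
          using norm_four_squared_le[of "a u" "b u" "cc u" "dd u"] k2 unfolding R[of u] by linarith
        from ennreal_leI[OF this]
        have "ennreal ((norm (R u))\<^sup>2) \<le> ennreal (e / 2) + ennreal (2 * (2 * (norm (a u))\<^sup>2) + 2 * (2 * (norm (b u))\<^sup>2))"
          using e by (subst (asm) ennreal_plus) auto
        also have "ennreal (2 * (2 * (norm (a u))\<^sup>2) + 2 * (2 * (norm (b u))\<^sup>2)) = 2 * (2 * A u) + 2 * (2 * B u)"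
          using u by (subst ennreal_double_sum) (simp_all add: A_def B_def ennreal_mult)
        finally show ?thesis using u by simp
      qed simp
    qed
    also have "\<dots> = ennreal (e / 2) + (2 * (2 * (\<integral>\<^sup>+u. A u \<partial>lborel)) + 2 * (2 * (\<integral>\<^sup>+u. B u \<partial>lborel)))"
    proof -
      have "(\<lambda>u::real. ennreal (e / 2) * indicator {0..1} u) \<in> borel_measurable lborel" by measurable
      moreover have "(\<lambda>u. 2 * A u) \<in> borel_measurable lborel" "(\<lambda>u. 2 * B u) \<in> borel_measurable lborel"
        using mA mB by measurable
      moreover have "(\<integral>\<^sup>+u. ennreal (e / 2) * indicator {0..1::real} u \<partial>lborel) = ennreal (e / 2)"
        by (simp add: nn_integral_cmult_indicator)
      ultimately show ?thesis
        by (simp only: nn_integral_linear_combination nn_integral_cmult mA mB)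
    qed
    also have "\<dots> \<le> ennreal (e / 2) + (2 * (2 * ennreal (2 * F1\<^sup>2 * \<eta>)) + 2 * (2 * ennreal (F1\<^sup>2 * \<eta>)))"
      by (intro add_mono mult_left_mono IA IB) simp_all
    also have "\<dots> = ennreal (e / 2 + (2 * (2 * (2 * F1\<^sup>2 * \<eta>)) + 2 * (2 * (F1\<^sup>2 * \<eta>))))"
    proof -
      have n: "0 \<le> 2 * F1\<^sup>2 * \<eta>" "0 \<le> F1\<^sup>2 * \<eta>" using \<eta> by simp_all
      have t: "2 * (2 * ennreal x) + 2 * (2 * ennreal y) = ennreal (2 * (2 * x) + 2 * (2 * y))" if "0 \<le> x" "0 \<le> y" for x y
        using that by (simp add: ennreal_double_sum ennreal_mult)
      have "ennreal (e / 2) + ennreal z = ennreal (e / 2 + z)" if "0 \<le> z" for z using that e by (simp add: ennreal_plus)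
      then show ?thesis unfolding t[OF n] using n by simp
    qed
    also have "e / 2 + (2 * (2 * (2 * F1\<^sup>2 * \<eta>)) + 2 * (2 * (F1\<^sup>2 * \<eta>))) = e"
    proof -
      have 1: "F1\<^sup>2 * \<eta> = e / 24" unfolding \<eta>_def using F1 by simp
      have "e / 2 + (2 * (2 * (2 * F1\<^sup>2 * \<eta>)) + 2 * (2 * (F1\<^sup>2 * \<eta>))) = e / 2 + 12 * (F1\<^sup>2 * \<eta>)"
        by (simp add: algebra_simps)
      then show ?thesis unfolding 1 by simp
    qed
    finally have nR: "(\<integral>\<^sup>+u\<in>{0..1}. ennreal ((norm (R u))\<^sup>2) \<partial>lborel) \<le> ennreal e" .
    have "set_borel_measurable lborel {0..1} R"
      using primitive_imp_integrable[OF prim] unfolding set_integrable_def set_borel_measurable_def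
      by (rule borel_measurable_integrable)
    then have sqR: "square_integrable R"
      using le_less_trans[OF nR] by (intro square_integrableI_nn) simp_all
    have "ennreal (LINT u:{0..1}|lborel. (norm (R u))\<^sup>2) \<le> ennreal e"
      using nR unfolding nn_integral_norm_squared[OF sqR] .
    then have IR: "(LINT u:{0..1}|lborel. (norm (R u))\<^sup>2) \<le> e" using e by (simp add: ennreal_le_iff)
    have rho: "(\<lambda>u. (1 / \<epsilon>) *\<^sub>R (p (u + \<epsilon> * \<phi> u) - p u) - \<phi> u *\<^sub>R g u) = (\<lambda>u. (1 / \<epsilon>) *\<^sub>R (p (\<psi> u) - p u) + (- \<phi> u) *\<^sub>R g u)"
      by (simp add: \<psi>_def)
    have "continuous_on UNIV (\<lambda>u. (1 / \<epsilon>) *\<^sub>R (p (\<psi> u) - p u) + (- \<phi> u) *\<^sub>R g u)"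
      by (intro continuous_intros ccg c\<phi> g(1) continuous_on_compose2[OF ccg(2)[of UNIV] c\<psi>]) simp
    moreover have "(1 / \<epsilon>) *\<^sub>R (p (\<psi> (u + 1)) - p (u + 1)) + (- \<phi> (u + 1)) *\<^sub>R g (u + 1) =
        (1 / \<epsilon>) *\<^sub>R (p (\<psi> u) - p u) + (- \<phi> u) *\<^sub>R g u" for u
    proof -
      have "\<psi> (u + 1) = \<psi> u + 1" by (simp add: \<psi>_def per)
      then show ?thesis using p(2)[of "\<psi> u"] p(2)[of u] per[of u] g(2)[of u] by simp
    qed
    ultimately show ?thesis unfolding rho sobolev_bound_def using sqR prim IR e by auto
  qed
  moreover have "0 < \<delta>" unfolding \<delta>_def using M0 F1 d1(1) d2(1) by simp
  ultimately show ?thesis by blast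
qed

text \<open>The case \<open>s < 1\<close>. The remainder is \<open>\<phi>\<close> times the mean of \<open>g (u + t \<epsilon> \<phi> u) - g u\<close> over
  \<open>t \<in> [0,1]\<close>.\<close>

lemma reparametrization_remainder_less_1:
  fixes p g :: "real \<Rightarrow> 'a::euclidean_space"
  assumes s: "1/2 < s" "s < 1" and p: "\<And>u. (p has_vector_derivative g u) (at u)"
    and g: "sobolev_bound s g B"
    and d: "\<And>u. (\<phi> has_real_derivative \<phi>' u) (at u)" and c': "continuous_on UNIV \<phi>'"
    and per: "\<And>u. \<phi> (u + 1) = \<phi> u" and \<phi>0: "\<phi> 0 = 0"
    and M: "\<And>u. \<bar>\<phi>' u\<bar> \<le> M" and F: "\<And>u. \<bar>\<phi> u\<bar> \<le> F" and e: "0 < e"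
  shows "\<exists>\<delta>>0. \<forall>\<epsilon>. 0 < \<epsilon> \<longrightarrow> \<epsilon> < \<delta> \<longrightarrow>
    sobolev_bound s (\<lambda>u. (1 / \<epsilon>) *\<^sub>R (p (u + \<epsilon> * \<phi> u) - p u) - \<phi> u *\<^sub>R g u) e"
proof -
  note cg = sobolev_boundD(1)[OF g] and pg = sobolev_boundD(2)[OF g]
  have c\<phi>: "continuous_on A \<phi>" for A using d by (meson DERIV_isCont continuous_at_imp_continuous_on)
  have F0: "0 \<le> F" using F[of 0] abs_ge_zero order_trans by blast
  have fin: "gagliardo2 circle_dist s g < \<infinity>" using g s unfolding sobolev_bound_def by (auto intro: le_less_trans)
  define A0 where "A0 = C1_embedding_constant s * M\<^sup>2"
  have A0: "sobolev_bound s \<phi> A0"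
    unfolding A0_def
  proof (rule sobolev_bound_C1[OF s(1)])
    show "(\<phi> has_vector_derivative \<phi>' u) (at u)" for u using d[of u] by (simp add: has_real_derivative_iff_has_vector_derivative)
    show "norm (\<phi>' u) \<le> M" for u using M[of u] by simp
  qed (fact c' per)+
  have A0n: "0 \<le> A0" by (rule sobolev_boundD(3)[OF A0])
  define e1 where "e1 = e / (4 * (F\<^sup>2 + 1))"
  define S where "S = sqrt (e / (4 * (A0 + 1)))"
  have F2: "0 < F\<^sup>2 + 1" by (simp add: add_nonneg_pos)
  have e1: "0 < e1" unfolding e1_def using e F2 by simp
  have S: "0 < S" unfolding S_def using e A0n by simp
  have tot: "2 * S\<^sup>2 * A0 + 2 * F\<^sup>2 * e1 \<le> e"
  proof -
    have half: "2 * (e / (4 * (x + 1))) * x \<le> e / 2" if "0 \<le> x" for x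
    proof -
      have "2 * (e / (4 * (x + 1))) * x = (e / 2) * (x / (x + 1))" using that by (simp add: field_simps)
      also have "\<dots> \<le> (e / 2) * 1" using e that by (intro mult_left_mono) auto
      finally show ?thesis by simp
    qed
    have "S\<^sup>2 = e / (4 * (A0 + 1))" unfolding S_def using e A0n by simp
    then have 1: "2 * S\<^sup>2 * A0 \<le> e / 2" using half[OF A0n] by simp
    have "2 * F\<^sup>2 * e1 = 2 * e1 * F\<^sup>2" by simp
    also have "\<dots> \<le> e / 2" unfolding e1_def by (rule half) simp
    finally have 2: "2 * F\<^sup>2 * e1 \<le> e / 2" .
    show ?thesis using 1 2 by linarith
  qed
  obtain d0 where d0: "0 < d0" "\<And>t. 0 \<le> t \<Longrightarrow> t < d0 \<Longrightarrow> gagliardo2 circle_dist s (\<lambda>u. g (u + t * \<phi> u) - g u) \<le> ennreal e1"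
  proof -
    have "\<phi> 1 = 0" using per[of 0] \<phi>0 by simp
    then have "\<exists>\<delta>>0. \<forall>t. 0 \<le> t \<longrightarrow> t < \<delta> \<longrightarrow> gagliardo2 circle_dist s (\<lambda>u. g (u + t * \<phi> u) - g u) \<le> ennreal e1"
      using s by (intro composition_continuous[OF cg pg _ _ fin d c' M F \<phi>0 _ e1]) auto
    then show thesis using that by blast
  qed
  obtain d1 where d1: "0 < d1" "\<And>x y. \<bar>x - y\<bar> < d1 \<Longrightarrow> norm (g x - g y) < S"
    using periodic_uniformly_continuous[OF cg pg S] by blast
  define \<delta> where "\<delta> = min d0 (d1 / (F + 1))"
  have "sobolev_bound s (\<lambda>u. (1 / \<epsilon>) *\<^sub>R (p (u + \<epsilon> * \<phi> u) - p u) - \<phi> u *\<^sub>R g u) e" if \<epsilon>: "0 < \<epsilon>" "\<epsilon> < \<delta>" for \<epsilon>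
  proof -
    define W where "W u t = g (u + (t * \<epsilon>) * \<phi> u) - g u" for u t
    define w where "w u = integral {0..1} (W u)" for u
    have cW: "continuous_on UNIV (\<lambda>(u, t). W u t)"
    proof -
      have 1: "continuous_on UNIV (\<lambda>z::real \<times> real. fst z + (snd z * \<epsilon>) * \<phi> (fst z))"
        by (intro continuous_intros continuous_on_compose2[OF c\<phi>[of UNIV]]) auto
      have 2: "continuous_on UNIV (\<lambda>z::real \<times> real. g (fst z))"
        by (intro continuous_on_compose2[OF cg[of UNIV]] continuous_intros) auto
      have "continuous_on UNIV (\<lambda>z. g (fst z + (snd z * \<epsilon>) * \<phi> (fst z)) - g (fst z))"
        by (intro continuous_on_diff 2 continuous_on_compose2[OF cg[of UNIV] 1]) simp
      then show ?thesis by (simp add: W_def case_prod_unfold)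
    qed
    have cu: "continuous_on A (W u)" for u A
    proof -
      have "continuous_on A (\<lambda>t. (u, t))" by (intro continuous_intros)
      from continuous_on_compose2[OF cW this] show ?thesis by simp
    qed
    have gw: "gagliardo2 circle_dist s w \<le> ennreal e1"
      unfolding w_def
    proof (rule gagliardo_average_le[OF cW])
      fix t :: real assume t: "t \<in> {0..1}"
      have "t * \<epsilon> \<le> 1 * \<epsilon>" using t \<epsilon> by (intro mult_right_mono) auto
      moreover have "\<epsilon> < d0" using \<epsilon>(2) unfolding \<delta>_def by simp
      ultimately have "t * \<epsilon> < d0" by linarith
      then show "gagliardo2 circle_dist s (\<lambda>u. W u t) \<le> ennreal e1"
        unfolding W_def using t \<epsilon> by (intro d0(2)) auto
    qed
    have cw: "continuous_on UNIV w"
      unfolding w_def using integral_continuous_on_param[of UNIV 0 1 W] continuous_on_subset[OF cW] by auto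
    have pw: "w (u + 1) = w u" for u
    proof -
      have "W (u + 1) t = W u t" for t
      proof -
        have eq: "u + 1 + t * \<epsilon> * \<phi> (u + 1) = (u + t * \<epsilon> * \<phi> u) + 1" by (simp add: per)
        show ?thesis unfolding W_def eq pg ..
      qed
      then have "W (u + 1) = W u" by (rule ext)
      then show ?thesis by (simp add: w_def)
    qed
    have bw: "norm (w u) \<le> S" for u
    proof -
      have "norm (W u t) \<le> S" if t: "t \<in> {0..1}" for t
      proof -
        have "\<bar>(t * \<epsilon>) * \<phi> u\<bar> \<le> \<epsilon> * (F + 1)"
        proof -
          have "\<bar>(t * \<epsilon>) * \<phi> u\<bar> = (t * \<epsilon>) * \<bar>\<phi> u\<bar>" using t \<epsilon> by (simp add: abs_mult)
          also have "\<dots> \<le> (1 * \<epsilon>) * (F + 1)" using t \<epsilon> F[of u] by (intro mult_mono) auto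
          finally show ?thesis by simp
        qed
        also have "\<dots> < d1" using \<epsilon> F0 by (simp add: \<delta>_def field_simps)
        finally show ?thesis using d1(2)[of "u + (t * \<epsilon>) * \<phi> u" u] by (simp add: W_def less_imp_le)
      qed
      then show ?thesis using integral_bound[of 0 1 "W u" S] cu[of "{0..1}" u] by (simp add: w_def)
    qed
    have rho: "(1 / \<epsilon>) *\<^sub>R (p (u + \<epsilon> * \<phi> u) - p u) - \<phi> u *\<^sub>R g u = \<phi> u *\<^sub>R w u" for u
    proof -
      define y where "y = \<epsilon> * \<phi> u"
      have I1: "((\<lambda>t. y *\<^sub>R g (u + t * y)) has_integral (p (u + 1 * y) - p (u + 0 * y))) {0..1}"
      proof (rule fundamental_theorem_of_calculus)
        fix t :: real
        have "((p \<circ> (\<lambda>t. u + t * y)) has_vector_derivative y *\<^sub>R g (u + t * y)) (at t)"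
        proof (rule vector_diff_chain_at)
          show "((\<lambda>t. u + t * y) has_vector_derivative y) (at t)"
            by (auto intro!: derivative_eq_intros simp: has_real_derivative_iff_has_vector_derivative[symmetric])
        qed (rule p)
        then show "((\<lambda>t. p (u + t * y)) has_vector_derivative y *\<^sub>R g (u + t * y)) (at t within {0..1})"
          by (simp add: o_def has_vector_derivative_at_within)
      qed simp
      have I2: "((\<lambda>t::real. y *\<^sub>R g u) has_integral y *\<^sub>R g u) {0..1}"
        using has_integral_const_real[of "y *\<^sub>R g u" 0 1] by simp
      from has_integral_diff[OF I1 I2]
      have "((\<lambda>t. y *\<^sub>R g (u + t * y) - y *\<^sub>R g u) has_integral (p (u + y) - p u - y *\<^sub>R g u)) {0..1}" by simp
      moreover have "(\<lambda>t. y *\<^sub>R g (u + t * y) - y *\<^sub>R g u) = (\<lambda>t. y *\<^sub>R W u t)"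
        by (simp add: W_def y_def scaleR_diff_right mult.assoc)
      ultimately have "((\<lambda>t. y *\<^sub>R W u t) has_integral (p (u + y) - p u - y *\<^sub>R g u)) {0..1}" by simp
      then have A: "integral {0..1} (\<lambda>t. y *\<^sub>R W u t) = p (u + y) - p u - y *\<^sub>R g u" by (rule integral_unique)
      have B: "integral {0..1} (\<lambda>t. y *\<^sub>R W u t) = y *\<^sub>R w u"
        unfolding w_def by (rule Henstock_Kurzweil_Integration.integral_cmul)
      have "y *\<^sub>R w u = p (u + y) - p u - y *\<^sub>R g u" by (rule trans[OF B[symmetric] A])
      then have "p (u + y) - p u = y *\<^sub>R g u + y *\<^sub>R w u" by (simp add: algebra_simps)
      then show ?thesis using \<epsilon> by (simp add: y_def scaleR_add_right)
    qed
    have "sobolev_bound s w e1" unfolding sobolev_bound_def using cw pw gw e1 s by simp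
    from sobolev_bound_mult[OF A0 this F bw]
    have "sobolev_bound s (\<lambda>u. \<phi> u *\<^sub>R w u) e" using tot by (rule sobolev_bound_mono)
    then show ?thesis by (simp only: rho)
  qed
  moreover have "0 < \<delta>" unfolding \<delta>_def using d0(1) d1(1) F0 by simp
  ultimately show ?thesis by blast
qed

text \<open>Applied to the derivative \<open>p\<close> of a curve, this is the top order part of the expansion below.\<close>

lemma reparametrization_remainder:
  fixes p g :: "real \<Rightarrow> 'a::euclidean_space"
  assumes s: "1/2 < s" "s \<le> 1" and p: "\<And>u. (p has_vector_derivative g u) (at u)" "\<And>u. p (u + 1) = p u"
    and g: "sobolev_bound s g B"
    and d: "\<And>u. (\<phi> has_real_derivative \<phi>' u) (at u)" and c': "continuous_on UNIV \<phi>'"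
    and per: "\<And>u. \<phi> (u + 1) = \<phi> u" and \<phi>0: "\<phi> 0 = 0"
    and M: "\<And>u. \<bar>\<phi>' u\<bar> \<le> M" and F: "\<And>u. \<bar>\<phi> u\<bar> \<le> F" and e: "0 < e"
  shows "\<exists>\<delta>>0. \<forall>\<epsilon>. 0 < \<epsilon> \<longrightarrow> \<epsilon> < \<delta> \<longrightarrow>
    sobolev_bound s (\<lambda>u. (1 / \<epsilon>) *\<^sub>R (p (u + \<epsilon> * \<phi> u) - p u) - \<phi> u *\<^sub>R g u) e"
proof (cases "s < 1")
  case True
  show ?thesis by (rule reparametrization_remainder_less_1[OF s(1) True p(1) g d c' per \<phi>0 M F e])
next
  case False
  then have s1: "s = 1" using s by simp
  obtain G where G: "square_integrable G" "primitive G g" using g False unfolding sobolev_bound_def by auto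
  show ?thesis
    unfolding s1
    by (rule reparametrization_remainder_1[OF p sobolev_boundD(1,2)[OF g] G d c' per \<phi>0 M F e])
qed

text \<open>Differentiability at \<open>0\<close> of \<open>\<epsilon> \<mapsto> \<gamma> (u + \<epsilon> \<phi> u)\<close> as a curve in \<open>H\<^sup>1\<^sup>+\<^sup>s\<close>, with derivative \<open>\<phi> \<gamma>'\<close>: the
  bounds on \<open>m\<close> and \<open>m'\<close> say that the remainder \<open>\<epsilon> m\<close> is \<open>\<epsilon>\<close> times something small in \<open>H\<^sup>1\<^sup>+\<^sup>s\<close>. Control of
  \<open>m'\<close> in the top order seminorm requires \<open>\<gamma>''\<close> to be in \<open>H\<^sup>s\<close>.\<close>

lemma reparametrization_expansion:
  fixes \<gamma> p g :: "real \<Rightarrow> 'a::euclidean_space"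
  assumes s: "1/2 < s" "s \<le> 1" and \<gamma>: "\<And>u. (\<gamma> has_vector_derivative p u) (at u)" "\<And>u. \<gamma> (u + 1) = \<gamma> u"
    and p: "\<And>u. (p has_vector_derivative g u) (at u)" "\<And>u. p (u + 1) = p u"
    and g: "sobolev_bound s g B"
    and d: "\<And>u. (\<phi> has_real_derivative \<phi>' u) (at u)" and \<phi>': "sobolev_bound s \<phi>' A"
    and per: "\<And>u. \<phi> (u + 1) = \<phi> u" and \<phi>0: "\<phi> 0 = 0" and e: "0 < e"
  shows "\<exists>\<delta>>0. \<forall>\<epsilon>. 0 < \<epsilon> \<longrightarrow> \<epsilon> < \<delta> \<longrightarrow>
    (\<exists>m m'. (\<forall>u. (m has_vector_derivative m' u) (at u)) \<and> (\<forall>u. m (u + 1) = m u) \<and> sobolev_bound s m' e \<and>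
      (\<forall>u. norm (m u) \<le> e) \<and> (\<forall>u. norm (m' u) \<le> e) \<and>
      (\<forall>u. \<gamma> (u + \<epsilon> * \<phi> u) = \<gamma> u + \<epsilon> *\<^sub>R (\<phi> u *\<^sub>R p u + m u)))"
proof -
  have c\<phi>: "continuous_on A \<phi>" for A using d by (meson DERIV_isCont continuous_at_imp_continuous_on)
  note c\<phi>' = sobolev_boundD(1)[OF \<phi>'] and p\<phi>' = sobolev_boundD(2)[OF \<phi>']
  note cg = sobolev_boundD(1)[OF g] and pg = sobolev_boundD(2)[OF g]
  obtain F0 where F0: "\<And>u. norm (\<phi> u) \<le> F0" by (rule periodic_bounded[OF c\<phi> per]) (rule that)
  obtain M where M: "0 \<le> M" "\<And>u. norm (\<phi>' u) \<le> M" by (rule periodic_bounded[OF c\<phi>' p\<phi>']) (rule that)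
  obtain L where L: "0 \<le> L" "\<And>u. norm (g u) \<le> L" by (rule periodic_bounded[OF cg pg]) (rule that)
  define F where "F = max F0 1"
  have F: "1 \<le> F" "\<And>u. norm (\<phi> u) \<le> F" using F0 by (auto simp: F_def intro: le_max_iff_disj[THEN iffD2])
  define C where "C = C1_embedding_constant s"
  have C: "0 \<le> C" unfolding C_def by (rule C1_embedding_constant_nonneg)
  have A: "0 \<le> A" by (rule sobolev_boundD(3)[OF \<phi>'])
  \<comment> \<open>All three bounds in the conclusion turn out to be at most \<open>k * Q\<close> for \<open>k \<le> 1\<close>.\<close>
  define Q where "Q = 2 + 4 * A + 16 * M\<^sup>2 * C + F + M"
  have Q: "2 \<le> Q" "F + M \<le> Q" "F \<le> Q" using A C M(1) F(1) unfolding Q_def by (simp_all add: add_nonneg_nonneg)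
  define k where "k = min 1 (e / Q)"
  have k: "0 < k" "k \<le> 1" "k * Q \<le> e" using e Q by (auto simp: k_def min_def field_simps)
  obtain d1 where d1: "0 < d1" "\<And>x y. \<bar>x - y\<bar> < d1 \<Longrightarrow> norm (g x - g y) < k"
    using periodic_uniformly_continuous[OF cg pg k(1)] by blast
  obtain d2 where d2: "0 < d2" "\<And>\<epsilon>. 0 < \<epsilon> \<Longrightarrow> \<epsilon> < d2 \<Longrightarrow>
      sobolev_bound s (\<lambda>u. (1 / \<epsilon>) *\<^sub>R (p (u + \<epsilon> * \<phi> u) - p u) - \<phi> u *\<^sub>R g u) k"
    using reparametrization_remainder[OF s p g d c\<phi>' per \<phi>0 M(2)[unfolded real_norm_def] F(2)[unfolded real_norm_def] k(1)] by blast
  define \<delta> where "\<delta> = min d2 (min (d1 / F) (min (k / (L * F + 1)) (k / (M * L + 1))))"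
  have "\<exists>m m'. (\<forall>u. (m has_vector_derivative m' u) (at u)) \<and> (\<forall>u. m (u + 1) = m u) \<and> sobolev_bound s m' e \<and>
      (\<forall>u. norm (m u) \<le> e) \<and> (\<forall>u. norm (m' u) \<le> e) \<and>
      (\<forall>u. \<gamma> (u + \<epsilon> * \<phi> u) = \<gamma> u + \<epsilon> *\<^sub>R (\<phi> u *\<^sub>R p u + m u))" if \<epsilon>: "0 < \<epsilon>" "\<epsilon> < \<delta>" for \<epsilon>
  proof -
    have e2: "\<epsilon> < d2" using \<epsilon>(2) by (simp add: \<delta>_def)
    have eF: "\<epsilon> * F < d1" using \<epsilon>(2) F(1) by (simp add: \<delta>_def field_simps)
    have "\<epsilon> < k / (L * F + 1)" "\<epsilon> < k / (M * L + 1)" using \<epsilon>(2) by (simp_all add: \<delta>_def)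
    moreover have "0 \<le> L * F" "0 \<le> M * L" using L(1) F(1) M(1) by simp_all
    ultimately have "\<epsilon> * (L * F + 1) < k" "\<epsilon> * (M * L + 1) < k"
      by (simp_all add: pos_less_divide_eq add_nonneg_pos)
    then have eL: "\<epsilon> * (L * F) \<le> k" "\<epsilon> * (M * L) \<le> k" using \<epsilon>(1) by (simp_all add: distrib_left)
    define \<psi> where "\<psi> u = u + \<epsilon> * \<phi> u" for u
    define \<psi>' where "\<psi>' u = 1 + \<epsilon> * \<phi>' u" for u
    have d\<psi>: "(\<psi> has_vector_derivative \<psi>' u) (at u)" for u
      unfolding \<psi>_def \<psi>'_def has_real_derivative_iff_has_vector_derivative[symmetric] by (auto intro!: derivative_eq_intros d)
    have sh: "\<bar>\<psi> u - u\<bar> \<le> \<epsilon> * F" for u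
      unfolding \<psi>_def using F(2)[of u] \<epsilon>(1) by (simp add: abs_mult)
    have comp: "((\<lambda>u. f (\<psi> u)) has_vector_derivative \<psi>' u *\<^sub>R f' (\<psi> u)) (at u)"
      if "\<And>u. (f has_vector_derivative f' u) (at u)" for f f' :: "real \<Rightarrow> 'a" and u
      using vector_diff_chain_at[OF d\<psi>[of u] that[of "\<psi> u"]] by (simp add: o_def)
    define q where "q u = p (\<psi> u) - p u" for u
    define q' where "q' u = \<psi>' u *\<^sub>R g (\<psi> u) - g u" for u
    define \<rho> where "\<rho> u = (1 / \<epsilon>) *\<^sub>R q u - \<phi> u *\<^sub>R g u" for u
    define m where "m u = (1 / \<epsilon>) *\<^sub>R (\<gamma> (\<psi> u) - \<gamma> u) - \<phi> u *\<^sub>R p u" for u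
    \<comment> \<open>The derivative of \<open>m\<close> consists of the remainder \<open>\<rho>\<close> of the same expansion for \<open>p\<close> and a product that is small because \<open>q\<close> is small together with its derivative.\<close>
    define m' where "m' u = \<rho> u + \<phi>' u *\<^sub>R q u" for u
    have dq: "(q has_vector_derivative q' u) (at u)" for u
      unfolding q_def q'_def by (rule has_vector_derivative_diff[OF comp[OF p(1)] p(1)])
    have dm: "(m has_vector_derivative m' u) (at u)" for u
    proof -
      have "(m has_vector_derivative ((1 / \<epsilon>) *\<^sub>R (\<psi>' u *\<^sub>R p (\<psi> u) - p u) - (\<phi> u *\<^sub>R g u + \<phi>' u *\<^sub>R p u))) (at u)"
        unfolding m_def
        by (intro has_vector_derivative_diff bounded_linear.has_vector_derivative[OF bounded_linear_scaleR_right]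
            has_vector_derivative_scaleR comp \<gamma>(1) p(1) d)
      moreover have "(1 / \<epsilon>) *\<^sub>R (\<psi>' u *\<^sub>R p (\<psi> u) - p u) - (\<phi> u *\<^sub>R g u + \<phi>' u *\<^sub>R p u) = m' u"
        unfolding m'_def \<rho>_def q_def \<psi>'_def using \<epsilon>(1) by (simp add: algebra_simps)
      ultimately show ?thesis by simp
    qed
    have per\<psi>: "\<psi> (u + 1) = \<psi> u + 1" for u by (simp add: \<psi>_def per)
    have pm: "m (u + 1) = m u" for u unfolding m_def per\<psi> by (simp add: \<gamma>(2) p(2) per)
    have pq: "q (u + 1) = q u" for u unfolding q_def per\<psi> by (simp add: p(2))
    have seg: "\<bar>x - u\<bar> \<le> \<epsilon> * F" if "x \<in> closed_segment u (\<psi> u)" for x u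
    proof -
      have "\<bar>x - u\<bar> \<le> \<bar>\<psi> u - u\<bar>" using that by (auto simp: closed_segment_eq_real_ivl split: if_splits)
      then show ?thesis using sh[of u] by linarith
    qed
    have lip: "norm (p x - p u) \<le> L * \<bar>x - u\<bar>" for x u
      by (rule bounded_derivative_imp_Lipschitz[OF p(1) L(2)])
    have lipk: "norm (p x - p u) \<le> k" if "\<bar>x - u\<bar> \<le> \<epsilon> * F" for x u
    proof -
      have "L * \<bar>x - u\<bar> \<le> L * (\<epsilon> * F)" using that L(1) by (rule mult_left_mono)
      then show ?thesis using lip[of x u] eL(1) by (simp add: mult.left_commute)
    qed
    have qb: "norm (q u) \<le> k" for u unfolding q_def by (rule lipk[OF sh])
    have remb: "norm ((1 / \<epsilon>) *\<^sub>R (f (\<psi> u) - f u) - \<phi> u *\<^sub>R f' u) \<le> k * F"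
      if df: "\<And>u. (f has_vector_derivative f' u) (at u)" and bf: "\<And>x u. \<bar>x - u\<bar> \<le> \<epsilon> * F \<Longrightarrow> norm (f' x - f' u) \<le> k"
      for f f' :: "real \<Rightarrow> 'a" and u
    proof -
      have "norm (f (\<psi> u) - f u - (\<psi> u - u) *\<^sub>R f' u) \<le> k * \<bar>\<psi> u - u\<bar>"
        by (rule linearization_error[OF df]) (rule bf[OF seg])
      also have "\<dots> \<le> k * (\<epsilon> * F)" using sh[of u] k(1) by (intro mult_left_mono) auto
      finally have "(1 / \<epsilon>) * norm (f (\<psi> u) - f u - (\<psi> u - u) *\<^sub>R f' u) \<le> (1 / \<epsilon>) * (k * (\<epsilon> * F))"
        using \<epsilon>(1) by (intro mult_left_mono) auto
      moreover have "(1 / \<epsilon>) * norm (f (\<psi> u) - f u - (\<psi> u - u) *\<^sub>R f' u) = norm ((1 / \<epsilon>) *\<^sub>R (f (\<psi> u) - f u - (\<psi> u - u) *\<^sub>R f' u))"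
        using \<epsilon>(1) by simp
      moreover have "(1 / \<epsilon>) *\<^sub>R (f (\<psi> u) - f u - (\<psi> u - u) *\<^sub>R f' u) = (1 / \<epsilon>) *\<^sub>R (f (\<psi> u) - f u) - \<phi> u *\<^sub>R f' u"
        using \<epsilon>(1) by (simp add: \<psi>_def algebra_simps)
      ultimately show ?thesis using \<epsilon>(1) by (simp add: mult.left_commute)
    qed
    have mb: "norm (m u) \<le> e" for u
    proof -
      have "norm (m u) \<le> k * F" unfolding m_def by (rule remb[OF \<gamma>(1) lipk])
      also have "\<dots> \<le> k * Q" using Q k by (intro mult_left_mono) auto
      finally show ?thesis using k(3) by linarith
    qed
    have \<rho>b: "norm (\<rho> u) \<le> k * F" for u
      unfolding \<rho>_def q_def
    proof (rule remb[OF p(1)])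
      show "norm (g x - g u) \<le> k" if "\<bar>x - u\<bar> \<le> \<epsilon> * F" for x u
        using d1(2)[of x u] that eF by (simp add: less_imp_le)
    qed
    have m'b: "norm (m' u) \<le> e" for u
    proof -
      have "norm (m' u) \<le> norm (\<rho> u) + norm (\<phi>' u *\<^sub>R q u)" unfolding m'_def by (rule norm_triangle_ineq)
      also have "norm (\<phi>' u *\<^sub>R q u) \<le> M * k"
        using mult_mono[OF M(2)[of u] qb[of u] M(1)] by simp
      also have "norm (\<rho> u) \<le> k * F" by (rule \<rho>b)
      finally have "norm (m' u) \<le> k * (F + M)" by (simp add: algebra_simps)
      also have "\<dots> \<le> k * Q" using Q k by (intro mult_left_mono) auto
      finally show ?thesis using k(3) by linarith
    qed
    have q'b: "norm (q' u) \<le> 2 * k" for u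
    proof -
      have e1: "q' u = (g (\<psi> u) - g u) + (\<epsilon> * \<phi>' u) *\<^sub>R g (\<psi> u)" by (simp add: q'_def \<psi>'_def algebra_simps)
      have "norm (g (\<psi> u) - g u) \<le> k" using d1(2)[of "\<psi> u" u] sh[of u] eF by (simp add: less_imp_le)
      moreover have "norm ((\<epsilon> * \<phi>' u) *\<^sub>R g (\<psi> u)) \<le> k"
      proof -
        have "\<bar>\<phi>' u\<bar> * norm (g (\<psi> u)) \<le> M * L" using M(2)[of u] L(2)[of "\<psi> u"] M(1) by (intro mult_mono) auto
        then have "\<epsilon> * (\<bar>\<phi>' u\<bar> * norm (g (\<psi> u))) \<le> \<epsilon> * (M * L)" using \<epsilon>(1) by (intro mult_left_mono) auto
        moreover have "norm ((\<epsilon> * \<phi>' u) *\<^sub>R g (\<psi> u)) = \<epsilon> * (\<bar>\<phi>' u\<bar> * norm (g (\<psi> u)))" using \<epsilon>(1) by (simp add: abs_mult)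
        ultimately show ?thesis using eL(2) by linarith
      qed
      ultimately show ?thesis unfolding e1 using norm_triangle_ineq[of "g (\<psi> u) - g u" "(\<epsilon> * \<phi>' u) *\<^sub>R g (\<psi> u)"] by linarith
    qed
    have cq': "continuous_on UNIV q'"
    proof -
      have "continuous_on UNIV \<psi>" by (rule has_vector_derivative_imp_continuous_on[OF d\<psi>])
      then have "continuous_on UNIV (\<lambda>u. g (\<psi> u))" by (rule continuous_on_compose2[OF cg[of UNIV]]) simp
      then show ?thesis unfolding q'_def \<psi>'_def by (intro continuous_intros c\<phi>' cg)
    qed
    have sq: "sobolev_bound s q (C * (2 * k)\<^sup>2)"
      unfolding C_def by (rule sobolev_bound_C1[OF s(1) dq cq' pq q'b])
    have s\<phi>q: "sobolev_bound s (\<lambda>u. \<phi>' u *\<^sub>R q u) (2 * k\<^sup>2 * A + 2 * M\<^sup>2 * (C * (2 * k)\<^sup>2))"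
      by (rule sobolev_bound_mult[OF \<phi>' sq M(2)[unfolded real_norm_def] qb])
    have s\<rho>: "sobolev_bound s \<rho> k"
      using d2(2)[OF \<epsilon>(1) e2] unfolding \<rho>_def q_def \<psi>_def .
    have sm': "sobolev_bound s m' e"
    proof (rule sobolev_bound_mono)
      show "sobolev_bound s m' (2 * k + 2 * (2 * k\<^sup>2 * A + 2 * M\<^sup>2 * (C * (2 * k)\<^sup>2)))"
        unfolding m'_def by (rule sobolev_bound_add[OF s\<rho> s\<phi>q])
      have "k\<^sup>2 \<le> k" using k by (simp add: power2_eq_square mult_left_le)
      then have "k\<^sup>2 * (4 * A + 16 * M\<^sup>2 * C) \<le> k * (4 * A + 16 * M\<^sup>2 * C)"
        using A C by (intro mult_right_mono add_nonneg_nonneg) auto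
      moreover have "2 * k + 2 * (2 * k\<^sup>2 * A + 2 * M\<^sup>2 * (C * (2 * k)\<^sup>2)) = 2 * k + k\<^sup>2 * (4 * A + 16 * M\<^sup>2 * C)"
        by (simp add: power_mult_distrib algebra_simps)
      moreover have "k * Q = 2 * k + k * (4 * A + 16 * M\<^sup>2 * C) + k * (F + M)" by (simp add: Q_def algebra_simps)
      moreover have "0 \<le> k * (F + M)" using k(1) F(1) M(1) by simp
      ultimately show "2 * k + 2 * (2 * k\<^sup>2 * A + 2 * M\<^sup>2 * (C * (2 * k)\<^sup>2)) \<le> e" using k(3) by linarith
    qed
    have exp: "\<gamma> (u + \<epsilon> * \<phi> u) = \<gamma> u + \<epsilon> *\<^sub>R (\<phi> u *\<^sub>R p u + m u)" for u
      using \<epsilon>(1) by (simp add: m_def \<psi>_def)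
    show ?thesis using dm pm sm' mb m'b exp by blast
  qed
  moreover have "0 < \<delta>"
  proof -
    have "0 < L * F + 1" "0 < M * L + 1" using L(1) F(1) M(1) by (simp_all add: add_nonneg_pos)
    then show ?thesis unfolding \<delta>_def using d1(1) d2(1) F(1) k(1) by simp
  qed
  ultimately show ?thesis by blast
qed

section \<open>Curves and energies\<close>

lemma H_circle_periodic: "h \<in> H_circle t \<Longrightarrow> h (u + 1) = h u"
  unfolding H_circle_def by blast

lemma H_circle_curve_deriv:
  fixes h :: "real \<Rightarrow> real ^ 'n"
  assumes s: "1/2 < s" "s \<le> 1" and h: "h \<in> H_circle (1 + s)"
  obtains B where "\<And>u. (h has_vector_derivative curve_deriv h u) (at u)" "sobolev_bound s (curve_deriv h) B"
proof -
  obtain q B where q: "\<And>u. (h has_vector_derivative q u) (at u)" "sobolev_bound s q B"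
    using H_circle_imp_C1[OF s h] by blast
  have "curve_deriv h u = q u" for u using q(1) by (rule vector_derivative_at)
  then show ?thesis using that[of B] q by (simp only:)
qed

lemma H_circle_add_scale:
  fixes h k :: "real \<Rightarrow> 'a::euclidean_space"
  assumes s: "1/2 < s" "s \<le> 1" and h: "h \<in> H_circle (1 + s)" and k: "k \<in> H_circle (1 + s)"
  shows "(\<lambda>u. h u + c *\<^sub>R k u) \<in> H_circle (1 + s)"
proof -
  obtain q B where q: "\<And>u. (h has_vector_derivative q u) (at u)" "sobolev_bound s q B"
    using H_circle_imp_C1[OF s h] by blast
  obtain r C where r: "\<And>u. (k has_vector_derivative r u) (at u)" "sobolev_bound s r C"
    using H_circle_imp_C1[OF s k] by blast
  show ?thesis
  proof (rule H_circleI[OF s])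
    show "((\<lambda>u. h u + c *\<^sub>R k u) has_vector_derivative q u + c *\<^sub>R r u) (at u)" for u
      by (intro has_vector_derivative_add bounded_linear.has_vector_derivative[OF bounded_linear_scaleR_right] q r)
    show "h (u + 1) + c *\<^sub>R k (u + 1) = h u + c *\<^sub>R k u" for u
      using H_circle_periodic[OF h] H_circle_periodic[OF k] by simp
    show "sobolev_bound s (\<lambda>u. q u + c *\<^sub>R r u) (2 * B + 2 * (2 * c\<^sup>2 * C))"
      by (rule sobolev_bound_add[OF q(2) sobolev_bound_scaleR[OF r(2)]])
  qed
qed

lemma H_circle_scale:
  fixes h :: "real \<Rightarrow> 'a::euclidean_space"
  assumes s: "1/2 < s" "s \<le> 1" and h: "h \<in> H_circle (1 + s)"
  shows "(\<lambda>u. c *\<^sub>R h u) \<in> H_circle (1 + s)"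
  using H_circle_add_scale[OF s h h, of "c - 1"] by (simp add: algebra_simps)

lemma H_norm_scale_le:
  fixes h q :: "real \<Rightarrow> 'a::euclidean_space"
  assumes s: "1/2 < s" "s \<le> 1" and d: "\<And>u. (h has_vector_derivative q u) (at u)" and per: "\<And>u. h (u + 1) = h u"
    and B: "sobolev_bound s q B" and a: "\<And>u. norm (h u) \<le> a" and b: "\<And>u. norm (q u) \<le> b"
  shows "H_norm (1 + s) (\<lambda>u. c *\<^sub>R h u) \<le> \<bar>c\<bar> * sqrt (a\<^sup>2 + b\<^sup>2 + 2 * B)"
proof -
  have "H_norm (1 + s) (\<lambda>u. c *\<^sub>R h u) \<le> sqrt ((\<bar>c\<bar> * a)\<^sup>2 + (\<bar>c\<bar> * b)\<^sup>2 + 2 * c\<^sup>2 * B)"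
  proof (rule H_norm_bounds(1)[OF s])
    show "((\<lambda>u. c *\<^sub>R h u) has_vector_derivative c *\<^sub>R q u) (at u)" for u
      by (intro bounded_linear.has_vector_derivative[OF bounded_linear_scaleR_right] d)
    show "sobolev_bound s (\<lambda>u. c *\<^sub>R q u) (2 * c\<^sup>2 * B)" by (rule sobolev_bound_scaleR[OF B])
    show "norm (c *\<^sub>R h u) \<le> \<bar>c\<bar> * a" for u using a[of u] by (simp add: mult_left_mono)
    show "norm (c *\<^sub>R q u) \<le> \<bar>c\<bar> * b" for u using b[of u] by (simp add: mult_left_mono)
  qed (simp add: per)
  also have "(\<bar>c\<bar> * a)\<^sup>2 + (\<bar>c\<bar> * b)\<^sup>2 + 2 * c\<^sup>2 * B = c\<^sup>2 * (a\<^sup>2 + b\<^sup>2 + 2 * B)"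
    by (simp add: power_mult_distrib algebra_simps)
  also have "sqrt (c\<^sup>2 * (a\<^sup>2 + b\<^sup>2 + 2 * B)) = \<bar>c\<bar> * sqrt (a\<^sup>2 + b\<^sup>2 + 2 * B)" by (simp add: real_sqrt_mult)
  finally show ?thesis .
qed

lemma H_norm_ray:
  fixes h :: "real \<Rightarrow> 'a::euclidean_space"
  assumes s: "1/2 < s" "s \<le> 1" and h: "h \<in> H_circle (1 + s)"
  shows "\<exists>K>0. \<forall>c. H_norm (1 + s) (\<lambda>u. c *\<^sub>R h u) \<le> \<bar>c\<bar> * K"
proof -
  obtain q B where q: "\<And>u. (h has_vector_derivative q u) (at u)" "sobolev_bound s q B"
    using H_circle_imp_C1[OF s h] by blast
  have per: "h (u + 1) = h u" for u by (rule H_circle_periodic[OF h])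
  obtain a where a: "\<And>u. norm (h u) \<le> a"
    by (rule periodic_bounded[OF has_vector_derivative_imp_continuous_on[OF q(1)] per]) (rule that)
  obtain b where b: "\<And>u. norm (q u) \<le> b"
    by (rule periodic_bounded[OF sobolev_boundD(1)[OF q(2)] sobolev_boundD(2)[OF q(2)]]) (rule that)
  define K where "K = sqrt (a\<^sup>2 + b\<^sup>2 + 2 * B) + 1"
  have K0: "0 \<le> sqrt (a\<^sup>2 + b\<^sup>2 + 2 * B)" using sobolev_boundD(3)[OF q(2)] by simp
  have "H_norm (1 + s) (\<lambda>u. c *\<^sub>R h u) \<le> \<bar>c\<bar> * K" for c
  proof -
    have "\<bar>c\<bar> * sqrt (a\<^sup>2 + b\<^sup>2 + 2 * B) \<le> \<bar>c\<bar> * K" unfolding K_def by (intro mult_left_mono) auto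
    with H_norm_scale_le[OF s q(1) per q(2) a b, of c] show ?thesis by linarith
  qed
  moreover have "0 < K" using K0 unfolding K_def by linarith
  ultimately show ?thesis by blast
qed

text \<open>A derivative with respect to the norm is in particular a derivative along rays, and hence is unique.\<close>

lemma has_energy_derivative_ray:
  fixes h :: "real \<Rightarrow> real ^ 'n"
  assumes s: "1/2 < s" "s \<le> 1" and D: "has_energy_derivative s F D \<eta>" and h: "h \<in> H_circle (1 + s)"
  shows "((\<lambda>c. F (\<lambda>u. \<eta> u + c *\<^sub>R h u)) has_real_derivative D h) (at 0)"
proof -
  obtain K where K: "0 < K" "\<And>c. H_norm (1 + s) (\<lambda>u. c *\<^sub>R h u) \<le> \<bar>c\<bar> * K" using H_norm_ray[OF s h] by blast
  have lin: "D (\<lambda>u. c *\<^sub>R h u) = c * D h" for c using D h unfolding has_energy_derivative_def by blast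
  have "((\<lambda>c. F (\<lambda>u. \<eta> u + c *\<^sub>R h u)) has_derivative (\<lambda>t. t * D h)) (at 0)"
    unfolding has_derivative_at_alt
  proof (intro conjI allI impI)
    show "bounded_linear (\<lambda>t. t * D h)" by (rule bounded_linear_mult_left)
    fix e :: real assume e: "0 < e"
    then have "0 < e / K" using K(1) by simp
    then obtain \<delta> where \<delta>: "0 < \<delta>" "\<And>k. k \<in> H_circle (1 + s) \<Longrightarrow> H_norm (1 + s) k < \<delta> \<Longrightarrow>
        \<bar>F (\<lambda>u. \<eta> u + k u) - F \<eta> - D k\<bar> \<le> e / K * H_norm (1 + s) k"
      using D unfolding has_energy_derivative_def by meson
    have "norm (F (\<lambda>u. \<eta> u + y *\<^sub>R h u) - F (\<lambda>u. \<eta> u + 0 *\<^sub>R h u) - (y - 0) * D h) \<le> e * norm (y - 0)"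
      if y: "norm (y - 0) < \<delta> / K" for y
    proof -
      have "\<bar>y\<bar> * K < \<delta>" using y K(1) by (simp add: pos_less_divide_eq)
      then have "H_norm (1 + s) (\<lambda>u. y *\<^sub>R h u) < \<delta>" using K(2)[of y] by linarith
      then have "\<bar>F (\<lambda>u. \<eta> u + y *\<^sub>R h u) - F \<eta> - D (\<lambda>u. y *\<^sub>R h u)\<bar> \<le> e / K * H_norm (1 + s) (\<lambda>u. y *\<^sub>R h u)"
        by (intro \<delta>(2) H_circle_scale s h)
      also have "\<dots> \<le> e / K * (\<bar>y\<bar> * K)" using K e by (intro mult_left_mono) auto
      also have "\<dots> = e * \<bar>y\<bar>" using K(1) by simp
      finally show ?thesis by (simp add: lin)
    qed
    then show "\<exists>d>0. \<forall>y. norm (y - 0) < d \<longrightarrow>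
        norm (F (\<lambda>u. \<eta> u + y *\<^sub>R h u) - F (\<lambda>u. \<eta> u + 0 *\<^sub>R h u) - (y - 0) * D h) \<le> e * norm (y - 0)"
      using \<delta>(1) K(1) by (intro exI[of _ "\<delta> / K"]) simp
  qed
  moreover have "(\<lambda>t. t * D h) = (*) (D h)" by (simp add: fun_eq_iff mult.commute)
  ultimately show ?thesis by (simp add: has_field_derivative_def)
qed

lemma energy_derivative_eq:
  fixes h :: "real \<Rightarrow> real ^ 'n"
  assumes s: "1/2 < s" "s \<le> 1" and D: "has_energy_derivative s F D \<eta>" and h: "h \<in> H_circle (1 + s)"
  shows "energy_derivative s F \<eta> h = D h"
proof -
  have "has_energy_derivative s F (energy_derivative s F \<eta>) \<eta>"
    unfolding energy_derivative_def by (rule someI[of _ D]) (rule D)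
  from DERIV_unique[OF has_energy_derivative_ray[OF s this h] has_energy_derivative_ray[OF s D h]] show ?thesis .
qed

text \<open>For a unit vector \<open>p\<close>, \<open>0 \<le> |p + q| - |p| - \<langle>p, q\<rangle> \<le> |q|\<^sup>2 / 2\<close>: the lower bound is the inequality of
  Cauchy and Schwarz, and the upper one follows from \<open>2 |p + q| \<le> 1 + |p + q|\<^sup>2\<close>.\<close>

lemma curve_length_derivative:
  fixes \<gamma> p :: "real \<Rightarrow> real ^ 'n"
  assumes s: "1/2 < s" "s \<le> 1" and \<gamma>: "\<And>u. (\<gamma> has_vector_derivative p u) (at u)"
    and cp: "continuous_on UNIV p" and unit: "\<And>u. norm (p u) = 1"
  shows "has_energy_derivative s curve_length (\<lambda>h. LINT u:{0..1}|lborel. p u \<bullet> curve_deriv h u) \<gamma>"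
proof -
  have cp': "continuous_on {0..1} p" by (rule continuous_on_subset[OF cp]) simp
  have data: "\<exists>q B. curve_deriv h = q \<and> (\<forall>u. (h has_vector_derivative q u) (at u)) \<and> sobolev_bound s q B \<and>
     continuous_on {0..1} q \<and> set_integrable lborel {0..1} (\<lambda>u. p u \<bullet> q u) \<and>
     (LINT u:{0..1}|lborel. (norm (q u))\<^sup>2) \<le> (H_norm (1 + s) h)\<^sup>2 \<and> 0 \<le> H_norm (1 + s) h"
    if h: "h \<in> H_circle (1 + s)" for h :: "real \<Rightarrow> real ^ 'n"
  proof -
    obtain B where q: "\<And>u. (h has_vector_derivative curve_deriv h u) (at u)" "sobolev_bound s (curve_deriv h) B"
      by (rule H_circle_curve_deriv[OF s h]) (rule that)
    have cq: "continuous_on {0..1} (curve_deriv h)" by (rule sobolev_boundD(1)[OF q(2)])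
    have "set_integrable lborel {0..1} (\<lambda>u. p u \<bullet> curve_deriv h u)"
      by (intro borel_integrable_atLeastAtMost' continuous_on_inner cp' cq)
    then show ?thesis using q cq H_norm_bounds(2,3)[OF s q(1) H_circle_periodic[OF h] q(2)] by blast
  qed
  show ?thesis
    unfolding has_energy_derivative_def
  proof (intro conjI ballI allI impI)
    fix h k :: "real \<Rightarrow> real ^ 'n" assume h: "h \<in> H_circle (1 + s)" and k: "k \<in> H_circle (1 + s)"
    obtain q where q: "curve_deriv h = q" "\<And>u. (h has_vector_derivative q u) (at u)" "set_integrable lborel {0..1} (\<lambda>u. p u \<bullet> q u)"
      using data[OF h] by blast
    obtain r where r: "curve_deriv k = r" "\<And>u. (k has_vector_derivative r u) (at u)" "set_integrable lborel {0..1} (\<lambda>u. p u \<bullet> r u)"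
      using data[OF k] by blast
    have "curve_deriv (\<lambda>u. h u + k u) u = q u + r u" for u
      by (rule vector_derivative_at) (rule has_vector_derivative_add[OF q(2) r(2)])
    then have "(LINT u:{0..1}|lborel. p u \<bullet> curve_deriv (\<lambda>u. h u + k u) u) = (LINT u:{0..1}|lborel. p u \<bullet> q u + p u \<bullet> r u)"
      by (simp only: inner_add_right)
    also have "\<dots> = (LINT u:{0..1}|lborel. p u \<bullet> q u) + (LINT u:{0..1}|lborel. p u \<bullet> r u)"
      by (rule set_integral_add(2)[OF q(3) r(3)])
    finally show "(LINT u:{0..1}|lborel. p u \<bullet> curve_deriv (\<lambda>u. h u + k u) u) =
        (LINT u:{0..1}|lborel. p u \<bullet> curve_deriv h u) + (LINT u:{0..1}|lborel. p u \<bullet> curve_deriv k u)"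
      unfolding fun_cong[OF q(1)] fun_cong[OF r(1)] .
  next
    fix c :: real and h :: "real \<Rightarrow> real ^ 'n" assume h: "h \<in> H_circle (1 + s)"
    obtain q where q: "curve_deriv h = q" "\<And>u. (h has_vector_derivative q u) (at u)"
      using data[OF h] by blast
    have "curve_deriv (\<lambda>u. c *\<^sub>R h u) u = c *\<^sub>R q u" for u
      by (rule vector_derivative_at) (rule bounded_linear.has_vector_derivative[OF bounded_linear_scaleR_right q(2)])
    then show "(LINT u:{0..1}|lborel. p u \<bullet> curve_deriv (\<lambda>u. c *\<^sub>R h u) u) = c * (LINT u:{0..1}|lborel. p u \<bullet> curve_deriv h u)"
      unfolding fun_cong[OF q(1)] by simp
  next
    show "\<exists>C. \<forall>h\<in>H_circle (1 + s). \<bar>LINT u:{0..1}|lborel. p u \<bullet> curve_deriv h u\<bar> \<le> C * H_norm (1 + s) h"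
    proof (intro exI[of _ 1] ballI)
      fix h :: "real \<Rightarrow> real ^ 'n" assume h: "h \<in> H_circle (1 + s)"
      obtain q where q: "curve_deriv h = q" "continuous_on {0..1} q" "set_integrable lborel {0..1} (\<lambda>u. p u \<bullet> q u)"
        "(LINT u:{0..1}|lborel. (norm (q u))\<^sup>2) \<le> (H_norm (1 + s) h)\<^sup>2" "0 \<le> H_norm (1 + s) h"
        using data[OF h] by blast
      have i2: "set_integrable lborel {0..1} (\<lambda>u. (norm (p u \<bullet> q u))\<^sup>2)" "set_integrable lborel {0..1} (\<lambda>u. (norm (q u))\<^sup>2)"
        by (intro borel_integrable_atLeastAtMost' continuous_intros cp' q(2))+
      have "(norm (LINT u:{0..1}|lborel. p u \<bullet> q u))\<^sup>2 \<le> (LINT u:{0..1}|lborel. (norm (p u \<bullet> q u))\<^sup>2)"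
        using set_integral_Cauchy_Schwarz[OF _ q(3) i2(1)] by simp
      also have "\<dots> \<le> (LINT u:{0..1}|lborel. (norm (q u))\<^sup>2)"
      proof (rule set_integral_mono[OF i2])
        show "(norm (p u \<bullet> q u))\<^sup>2 \<le> (norm (q u))\<^sup>2" for u
          using Cauchy_Schwarz_ineq2[of "p u" "q u"] unit[of u] by (intro power_mono) auto
      qed
      also have "\<dots> \<le> (H_norm (1 + s) h)\<^sup>2" by (rule q(4))
      finally have "norm (LINT u:{0..1}|lborel. p u \<bullet> q u) \<le> H_norm (1 + s) h" using q(5) by (rule power2_le_imp_le)
      then show "\<bar>LINT u:{0..1}|lborel. p u \<bullet> curve_deriv h u\<bar> \<le> 1 * H_norm (1 + s) h" unfolding fun_cong[OF q(1)] by simp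
    qed
  next
    fix e :: real assume e: "0 < e"
    show "\<exists>\<delta>>0. \<forall>h\<in>H_circle (1 + s). H_norm (1 + s) h < \<delta> \<longrightarrow>
      \<bar>curve_length (\<lambda>u. \<gamma> u + h u) - curve_length \<gamma> - (LINT u:{0..1}|lborel. p u \<bullet> curve_deriv h u)\<bar> \<le> e * H_norm (1 + s) h"
    proof (intro exI[of _ "2 * e"] conjI ballI impI)
      fix h :: "real \<Rightarrow> real ^ 'n" assume h: "h \<in> H_circle (1 + s)" and small: "H_norm (1 + s) h < 2 * e"
      obtain q where q: "curve_deriv h = q" "\<And>u. (h has_vector_derivative q u) (at u)"
        "continuous_on {0..1} q" "set_integrable lborel {0..1} (\<lambda>u. p u \<bullet> q u)"
        "(LINT u:{0..1}|lborel. (norm (q u))\<^sup>2) \<le> (H_norm (1 + s) h)\<^sup>2" "0 \<le> H_norm (1 + s) h"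
        using data[OF h] by blast
      have i: "set_integrable lborel {0..1} (\<lambda>u. norm (p u + q u))" "set_integrable lborel {0..1} (\<lambda>u. norm (p u))"
        "set_integrable lborel {0..1} (\<lambda>u. (norm (q u))\<^sup>2 / 2)" "set_integrable lborel {0..1} (\<lambda>u. norm (p u + q u) - norm (p u) - p u \<bullet> q u)"
        by (intro borel_integrable_atLeastAtMost' continuous_intros cp' q(3); simp)+
      have l1: "curve_length (\<lambda>u. \<gamma> u + h u) = (LINT u:{0..1}|lborel. norm (p u + q u))"
      proof -
        have "curve_deriv (\<lambda>u. \<gamma> u + h u) u = p u + q u" for u
          by (rule vector_derivative_at) (rule has_vector_derivative_add[OF \<gamma> q(2)])
        then show ?thesis unfolding curve_length_def by simp
      qed
      have l2: "curve_length \<gamma> = (LINT u:{0..1}|lborel. norm (p u))"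
        unfolding curve_length_def vector_derivative_at[OF \<gamma>] ..
      have diff: "curve_length (\<lambda>u. \<gamma> u + h u) - curve_length \<gamma> - (LINT u:{0..1}|lborel. p u \<bullet> q u) =
        (LINT u:{0..1}|lborel. norm (p u + q u) - norm (p u) - p u \<bullet> q u)"
        unfolding l1 l2 set_integral_diff(2)[OF set_integral_diff(1)[OF i(1,2)] q(4)] set_integral_diff(2)[OF i(1,2)] ..
      have pw: "0 \<le> norm (p u + q u) - norm (p u) - p u \<bullet> q u \<and> norm (p u + q u) - norm (p u) - p u \<bullet> q u \<le> (norm (q u))\<^sup>2 / 2" for u
      proof -
        have pp: "p u \<bullet> p u = 1" using unit[of u] by (simp add: norm_eq_1)
        have "p u \<bullet> (p u + q u) \<le> norm (p u) * norm (p u + q u)" by (rule norm_cauchy_schwarz)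
        then have lo: "1 + p u \<bullet> q u \<le> norm (p u + q u)" using unit[of u] pp by (simp add: inner_add_right)
        have "(norm (p u + q u))\<^sup>2 = 1 + 2 * (p u \<bullet> q u) + (norm (q u))\<^sup>2"
          by (simp add: power2_norm_eq_inner inner_add_left inner_add_right pp inner_commute)
        moreover have "2 * norm (p u + q u) \<le> 1 + (norm (p u + q u))\<^sup>2"
          using zero_le_power2[of "norm (p u + q u) - 1"] by (simp add: power2_eq_square algebra_simps)
        ultimately show ?thesis using lo unit[of u] by simp
      qed
      have "0 \<le> (LINT u:{0..1}|lborel. norm (p u + q u) - norm (p u) - p u \<bullet> q u)"
        unfolding set_lebesgue_integral_def using pw by (intro Bochner_Integration.integral_nonneg) simp
      moreover have "(LINT u:{0..1}|lborel. norm (p u + q u) - norm (p u) - p u \<bullet> q u) \<le> (LINT u:{0..1}|lborel. (norm (q u))\<^sup>2 / 2)"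
        using pw by (intro set_integral_mono i) blast
      moreover have "(LINT u:{0..1}|lborel. (norm (q u))\<^sup>2 / 2) \<le> (H_norm (1 + s) h)\<^sup>2 / 2" using q(5) by simp
      moreover have "(H_norm (1 + s) h)\<^sup>2 / 2 \<le> e * H_norm (1 + s) h"
      proof -
        have "H_norm (1 + s) h * H_norm (1 + s) h \<le> (2 * e) * H_norm (1 + s) h" using small q(6) by (intro mult_right_mono) auto
        then show ?thesis by (simp add: power2_eq_square)
      qed
      ultimately show "\<bar>curve_length (\<lambda>u. \<gamma> u + h u) - curve_length \<gamma> - (LINT u:{0..1}|lborel. p u \<bullet> curve_deriv h u)\<bar> \<le> e * H_norm (1 + s) h"
        unfolding fun_cong[OF q(1)] diff by linarith
    qed (use e in simp)
  qed
qed

text \<open>The distance on the interval is at least the one on the circle, so the seminorm on the interval is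
  bounded by the one on the circle.\<close>

lemma H_intervalI:
  fixes \<psi> \<psi>' :: "real \<Rightarrow> real"
  assumes s: "1/2 < s" "s \<le> 1" and d: "\<And>u. (\<psi> has_real_derivative \<psi>' u) (at u)" and B: "sobolev_bound s \<psi>' B"
  shows "\<psi> \<in> H_interval (1 + s)"
proof -
  have dv: "(\<psi> has_vector_derivative \<psi>' u) (at u)" for u using d[of u] by (simp add: has_real_derivative_iff_has_vector_derivative)
  have c: "continuous_on A \<psi>" for A by (rule has_vector_derivative_imp_continuous_on[OF dv])
  have sq: "square_integrable \<psi>" "square_integrable \<psi>'"
    by (intro square_integrable_continuous c sobolev_boundD(1)[OF B])+
  have w1: "weak_deriv interval_tests 1 \<psi> \<psi>'"
    by (rule weak_deriv_interval_primitive[OF primitive_derivative[OF dv sobolev_boundD(1)[OF B]]])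
  have "\<exists>g. square_integrable g \<and> weak_deriv interval_tests j \<psi> g \<and>
      (j = nat \<lfloor>1 + s\<rfloor> \<and> frac (1 + s) > 0 \<longrightarrow> gagliardo2 (\<lambda>u v. \<bar>u - v\<bar>) (frac (1 + s)) g < \<infinity>)"
    if j: "j \<le> nat \<lfloor>1 + s\<rfloor>" for j
  proof (cases "s < 1")
    case True
    have "gagliardo2 (\<lambda>u v. \<bar>u - v\<bar>) s \<psi>' \<le> gagliardo2 circle_dist s \<psi>'"
      unfolding gagliardo2_def
    proof (rule nn_integral_mono)
      fix u :: real
      show "(\<integral>\<^sup>+v\<in>{0..1}. ennreal ((norm (\<psi>' u - \<psi>' v))\<^sup>2 / \<bar>u - v\<bar> powr (1 + 2 * s)) \<partial>lborel) * indicator {0..1} u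
        \<le> (\<integral>\<^sup>+v\<in>{0..1}. ennreal ((norm (\<psi>' u - \<psi>' v))\<^sup>2 / circle_dist u v powr (1 + 2 * s)) \<partial>lborel) * indicator {0..1} u"
      proof (cases "u \<in> {0..1}")
        case u: True
        have "(\<integral>\<^sup>+v\<in>{0..1}. ennreal ((norm (\<psi>' u - \<psi>' v))\<^sup>2 / \<bar>u - v\<bar> powr (1 + 2 * s)) \<partial>lborel)
          \<le> (\<integral>\<^sup>+v\<in>{0..1}. ennreal ((norm (\<psi>' u - \<psi>' v))\<^sup>2 / circle_dist u v powr (1 + 2 * s)) \<partial>lborel)"
        proof (rule nn_integral_mono)
          fix v :: real
          show "ennreal ((norm (\<psi>' u - \<psi>' v))\<^sup>2 / \<bar>u - v\<bar> powr (1 + 2 * s)) * indicator {0..1} v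
            \<le> ennreal ((norm (\<psi>' u - \<psi>' v))\<^sup>2 / circle_dist u v powr (1 + 2 * s)) * indicator {0..1} v"
          proof (cases "v \<in> {0..1}")
            case v: True
            have "(norm (\<psi>' u - \<psi>' v))\<^sup>2 / \<bar>u - v\<bar> powr (1 + 2 * s) \<le> (norm (\<psi>' u - \<psi>' v))\<^sup>2 / circle_dist u v powr (1 + 2 * s)"
            proof (cases "circle_dist u v = 0")
              case True
              then have "u = v \<or> u = 0 \<and> v = 1 \<or> u = 1 \<and> v = 0"
                using u v by (auto simp: circle_dist_def min_def abs_if split: if_splits)
              then have "\<psi>' u = \<psi>' v" using sobolev_boundD(2)[OF B, of 0] by auto
              then show ?thesis by simp
            next
              case False
              have "0 \<le> circle_dist u v" using u v by (auto simp: circle_dist_def)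
              then have d0: "0 < circle_dist u v" using False by simp
              moreover have "circle_dist u v \<le> \<bar>u - v\<bar>" by (simp add: circle_dist_def)
              ultimately have "circle_dist u v powr (1 + 2 * s) \<le> \<bar>u - v\<bar> powr (1 + 2 * s)"
                using s by (intro powr_mono2) auto
              then show ?thesis using d0 by (intro divide_left_mono mult_pos_pos) auto
            qed
            then show ?thesis using v by (simp add: ennreal_leI)
          qed simp
        qed
        then show ?thesis using u by simp
      qed simp
    qed
    also have "\<dots> < \<infinity>" using B True unfolding sobolev_bound_def by (auto intro: le_less_trans)
    finally have 1: "square_integrable \<psi>' \<and> weak_deriv interval_tests 1 \<psi> \<psi>' \<and> gagliardo2 (\<lambda>u v. \<bar>u - v\<bar>) s \<psi>' < \<infinity>"
      using sq w1 by blast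
    have "j = 0 \<or> j = 1" using j order_1s[OF s] True by auto
    then show ?thesis using 1 sq weak_deriv_0[of interval_tests \<psi>] order_1s[OF s] True by auto
  next
    case False
    obtain G where G: "square_integrable G" "primitive G \<psi>'"
      using B False unfolding sobolev_bound_def by auto
    have w2: "weak_deriv interval_tests (Suc 1) \<psi> G"
      by (rule weak_deriv_Suc[OF w1 weak_deriv_interval_primitive[OF G(2)] interval_tests_deriv])
    have "j = 0 \<or> j = 1 \<or> j = Suc 1" using j order_1s[OF s] False by auto
    then show ?thesis using G(1) w1 w2 sq weak_deriv_0[of interval_tests \<psi>] order_1s[OF s] False by auto
  qed
  then show ?thesis unfolding H_interval_def in_sobolev_def using c sq by blast
qed

section \<open>Parameter invariance and critical points\<close>

text \<open>The energy is constant along the reparametrizations \<open>\<gamma> (u + \<epsilon> \<phi> u)\<close>, whose velocity at \<open>\<epsilon> = 0\<close> is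
  \<open>\<phi> \<gamma>'\<close>. For a given tolerance \<open>e\<close>, a single small \<open>\<epsilon>\<close> with \<open>\<gamma> (u + \<epsilon> \<phi> u) = \<gamma> u + \<epsilon> (k u + m u)\<close>
  and \<open>k = \<phi> \<gamma>'\<close> suffices: constancy of the energy bounds \<open>D k + D m\<close>, continuity of \<open>D\<close> bounds \<open>D m\<close>, and
  both bounds tend to \<open>0\<close> with \<open>e\<close>.\<close>

lemma derivative_tangential_eq_0:
  fixes \<gamma> p g :: "real \<Rightarrow> real ^ 'n"
  assumes s: "1/2 < s" "s \<le> 1" and \<gamma>: "\<And>u. (\<gamma> has_vector_derivative p u) (at u)" "\<And>u. \<gamma> (u + 1) = \<gamma> u"
    and p: "\<And>u. (p has_vector_derivative g u) (at u)" "\<And>u. p (u + 1) = p u" and unit: "\<And>u. norm (p u) = 1"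
    and g: "sobolev_bound s g B"
    and d: "\<And>u. (\<phi> has_real_derivative \<phi>' u) (at u)" and \<phi>': "sobolev_bound s \<phi>' A"
    and per: "\<And>u. \<phi> (u + 1) = \<phi> u" and \<phi>0: "\<phi> 0 = 0"
    and O: "\<O> = regular_curves s \<or> \<O> = injective_regular_curves s" and \<gamma>O: "\<gamma> \<in> \<O>"
    and inv: "parameter_invariant s \<O> E" and D: "has_energy_derivative s E D \<gamma>"
  shows "(\<lambda>u. \<phi> u *\<^sub>R p u) \<in> H_circle (1 + s) \<and> D (\<lambda>u. \<phi> u *\<^sub>R p u) = 0"
proof -
  have \<gamma>H: "\<gamma> \<in> H_circle (1 + s)" using O \<gamma>O unfolding regular_curves_def injective_regular_curves_def by blast
  have c\<phi>: "continuous_on A \<phi>" for A using d by (meson DERIV_isCont continuous_at_imp_continuous_on)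
  have d\<phi>: "(\<phi> has_vector_derivative \<phi>' u) (at u)" for u using d[of u] by (simp add: has_real_derivative_iff_has_vector_derivative)
  obtain F where F: "0 \<le> F" "\<And>u. norm (\<phi> u) \<le> F" by (rule periodic_bounded[OF c\<phi> per]) (rule that)
  obtain M where M: "0 \<le> M" "\<And>u. norm (\<phi>' u) \<le> M"
    by (rule periodic_bounded[OF sobolev_boundD(1)[OF \<phi>'] sobolev_boundD(2)[OF \<phi>']]) (rule that)
  obtain L where L: "0 \<le> L" "\<And>u. norm (g u) \<le> L"
    by (rule periodic_bounded[OF sobolev_boundD(1)[OF g] sobolev_boundD(2)[OF g]]) (rule that)
  define k where "k u = \<phi> u *\<^sub>R p u" for u
  define k' where "k' u = \<phi> u *\<^sub>R g u + \<phi>' u *\<^sub>R p u" for u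
  have dk: "(k has_vector_derivative k' u) (at u)" for u
    unfolding k_def k'_def by (rule has_vector_derivative_scaleR[OF d p(1)])
  have pk: "k (u + 1) = k u" for u by (simp add: k_def per p(2))
  have sp: "sobolev_bound s p (C1_embedding_constant s * L\<^sup>2)"
    by (rule sobolev_bound_C1[OF s(1) p(1) sobolev_boundD(1)[OF g] p(2) L(2)])
  have s\<phi>: "sobolev_bound s \<phi> (C1_embedding_constant s * M\<^sup>2)"
    by (rule sobolev_bound_C1[OF s(1) d\<phi> sobolev_boundD(1)[OF \<phi>'] per M(2)])
  have unit': "norm (p u) \<le> 1" for u using unit[of u] by simp
  obtain Bk where Bk: "sobolev_bound s k' Bk"
    unfolding k'_def using sobolev_bound_add[OF sobolev_bound_mult[OF s\<phi> g F(2)[unfolded real_norm_def] L(2)]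
      sobolev_bound_mult[OF \<phi>' sp M(2)[unfolded real_norm_def] unit']] by blast
  have kH: "k \<in> H_circle (1 + s)" by (rule H_circleI[OF s dk pk Bk])
  have kb: "norm (k u) \<le> F" for u using F(2)[of u] unit[of u] by (simp add: k_def)
  have k'b: "norm (k' u) \<le> F * L + M" for u
  proof -
    have "norm (\<phi> u *\<^sub>R g u) \<le> F * L" using mult_mono[OF F(2)[of u] L(2)[of u] F(1)] by simp
    moreover have "norm (\<phi>' u *\<^sub>R p u) \<le> M" using M(2)[of u] unit[of u] by simp
    ultimately show ?thesis unfolding k'_def using norm_triangle_ineq[of "\<phi> u *\<^sub>R g u" "\<phi>' u *\<^sub>R p u"] by linarith
  qed
  define K where "K = sqrt ((F + 1)\<^sup>2 + (F * L + M + 1)\<^sup>2 + 2 * (2 * Bk + 2)) + 1"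
  have Bk0: "0 \<le> Bk" by (rule sobolev_boundD(3)[OF Bk])
  have K: "0 < K" unfolding K_def using Bk0 by (simp add: add_nonneg_pos)
  obtain C0 where C0: "\<And>h. h \<in> H_circle (1 + s) \<Longrightarrow> \<bar>D h\<bar> \<le> C0 * H_norm (1 + s) h"
    using D unfolding has_energy_derivative_def by blast
  define C where "C = max C0 0"
  have C: "0 \<le> C" "\<bar>D h\<bar> \<le> C * H_norm (1 + s) h" if "h \<in> H_circle (1 + s)" "0 \<le> H_norm (1 + s) h" for h
  proof -
    show "0 \<le> C" by (simp add: C_def)
    have "C0 * H_norm (1 + s) h \<le> C * H_norm (1 + s) h" using that(2) by (intro mult_right_mono) (simp add: C_def)
    then show "\<bar>D h\<bar> \<le> C * H_norm (1 + s) h" using C0[OF that(1)] by linarith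
  qed
  have C_nonneg: "0 \<le> C" by (simp add: C_def)
  have Dadd: "D (\<lambda>u. h u + k u) = D h + D k" if "h \<in> H_circle (1 + s)" "k \<in> H_circle (1 + s)" for h k
    using D that unfolding has_energy_derivative_def by blast
  have Dscale: "D (\<lambda>u. c *\<^sub>R h u) = c * D h" if "h \<in> H_circle (1 + s)" for h c
    using D that unfolding has_energy_derivative_def by blast
  have small: "\<bar>D k\<bar> \<le> e * K + C * sqrt (e\<^sup>2 + e\<^sup>2 + e)" if e: "0 < e" "e \<le> 1" for e
  proof -
    obtain d1 where d1: "0 < d1" "\<And>h. h \<in> H_circle (1 + s) \<Longrightarrow> H_norm (1 + s) h < d1 \<Longrightarrow>
        \<bar>E (\<lambda>u. \<gamma> u + h u) - E \<gamma> - D h\<bar> \<le> e * H_norm (1 + s) h"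
      using D e(1) unfolding has_energy_derivative_def by meson
    obtain d2 where d2: "0 < d2" "\<And>\<epsilon>. 0 < \<epsilon> \<Longrightarrow> \<epsilon> < d2 \<Longrightarrow>
        \<exists>m m'. (\<forall>u. (m has_vector_derivative m' u) (at u)) \<and> (\<forall>u. m (u + 1) = m u) \<and> sobolev_bound s m' e \<and>
          (\<forall>u. norm (m u) \<le> e) \<and> (\<forall>u. norm (m' u) \<le> e) \<and>
          (\<forall>u. \<gamma> (u + \<epsilon> * \<phi> u) = \<gamma> u + \<epsilon> *\<^sub>R (\<phi> u *\<^sub>R p u + m u))"
      using reparametrization_expansion[OF s \<gamma> p g d \<phi>' per \<phi>0 e(1)] by blast
    \<comment> \<open>The last bound makes \<open>u + \<epsilon> \<phi> u\<close> strictly increasing.\<close>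
    define \<epsilon> where "\<epsilon> = min (d2 / 2) (min (d1 / (2 * K)) (1 / (2 * (M + 1))))"
    have \<epsilon>: "0 < \<epsilon>" unfolding \<epsilon>_def using d1(1) d2(1) K M(1) by simp
    have \<epsilon>2: "\<epsilon> < d2" using d2(1) by (simp add: \<epsilon>_def min_def)
    have "\<epsilon> \<le> d1 / (2 * K)" by (simp add: \<epsilon>_def)
    then have \<epsilon>1: "\<epsilon> * K < d1" using K d1(1) by (simp add: field_simps)
    have "\<epsilon> \<le> 1 / (2 * (M + 1))" by (simp add: \<epsilon>_def)
    then have \<epsilon>M: "\<epsilon> * (M + 1) \<le> 1 / 2" using M(1) by (simp add: field_simps)
    obtain m m' where m: "\<And>u. (m has_vector_derivative m' u) (at u)" "\<And>u. m (u + 1) = m u" "sobolev_bound s m' e"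
      "\<And>u. norm (m u) \<le> e" "\<And>u. norm (m' u) \<le> e"
      and exp: "\<And>u. \<gamma> (u + \<epsilon> * \<phi> u) = \<gamma> u + \<epsilon> *\<^sub>R (k u + m u)"
      using d2(2)[OF \<epsilon> \<epsilon>2] unfolding k_def by blast
    have mH: "m \<in> H_circle (1 + s)" by (rule H_circleI[OF s m(1-3)])
    have mn: "H_norm (1 + s) m \<le> sqrt (e\<^sup>2 + e\<^sup>2 + e)" "0 \<le> H_norm (1 + s) m"
      using H_norm_bounds(1)[OF s m(1-3), of e e] H_norm_bounds(3)[OF s m(1-3)] m(4,5) by simp_all
    have dkm: "((\<lambda>u. k u + m u) has_vector_derivative k' u + m' u) (at u)" for u
      by (rule has_vector_derivative_add[OF dk m(1)])
    have skm: "sobolev_bound s (\<lambda>u. k' u + m' u) (2 * Bk + 2)"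
      by (rule sobolev_bound_mono[OF sobolev_bound_add[OF Bk m(3)]]) (use e in simp)
    have pkm: "k (u + 1) + m (u + 1) = k u + m u" for u by (simp add: pk m(2))
    have kmH: "(\<lambda>u. k u + m u) \<in> H_circle (1 + s)" by (rule H_circleI[OF s dkm pkm skm])
    have kmn: "H_norm (1 + s) (\<lambda>u. \<epsilon> *\<^sub>R (k u + m u)) \<le> \<epsilon> * K"
    proof -
      have "norm (k u + m u) \<le> F + 1" for u
        using norm_triangle_ineq[of "k u" "m u"] kb[of u] m(4)[of u] e(2) by linarith
      moreover have "norm (k' u + m' u) \<le> F * L + M + 1" for u
        using norm_triangle_ineq[of "k' u" "m' u"] k'b[of u] m(5)[of u] e(2) by linarith
      ultimately have "H_norm (1 + s) (\<lambda>u. \<epsilon> *\<^sub>R (k u + m u)) \<le> \<bar>\<epsilon>\<bar> * sqrt ((F + 1)\<^sup>2 + (F * L + M + 1)\<^sup>2 + 2 * (2 * Bk + 2))"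
        by (intro H_norm_scale_le[OF s dkm pkm skm])
      also have "\<dots> \<le> \<epsilon> * K" unfolding K_def using \<epsilon> by (simp add: mult_left_mono)
      finally show ?thesis .
    qed
    define \<psi> where "\<psi> u = u + \<epsilon> * \<phi> u" for u
    define \<psi>' where "\<psi>' u = 1 + \<epsilon> * \<phi>' u" for u
    have d\<psi>: "(\<psi> has_real_derivative \<psi>' u) (at u)" for u
      unfolding \<psi>_def \<psi>'_def by (auto intro!: derivative_eq_intros d)
    have "\<bar>\<epsilon> * \<phi>' u\<bar> \<le> \<epsilon> * (M + 1)" for u
      unfolding abs_mult using M(2)[of u] \<epsilon> by (intro mult_mono) auto
    then have half: "\<bar>\<epsilon> * \<phi>' u\<bar> \<le> 1/2" for u using \<epsilon>M order_trans by blast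
    have pos: "0 < \<psi>' u" for u unfolding \<psi>'_def using half[of u] by linarith
    have mono: "\<psi> x < \<psi> y" if "x < y" for x y
      using DERIV_pos_imp_increasing[OF that, of \<psi>] d\<psi> pos by blast
    have s\<psi>': "\<exists>B'. sobolev_bound s \<psi>' B'"
      unfolding \<psi>'_def using sobolev_bound_add[OF sobolev_bound_const sobolev_bound_scaleR[OF \<phi>']] by auto
    have comp: "\<gamma> \<circ> \<psi> = (\<lambda>u. \<gamma> u + \<epsilon> *\<^sub>R (k u + m u))" by (simp add: fun_eq_iff \<psi>_def exp)
    have compH: "\<gamma> \<circ> \<psi> \<in> H_circle (1 + s)" unfolding comp by (rule H_circle_add_scale[OF s \<gamma>H kmH])
    have dcomp: "((\<gamma> \<circ> \<psi>) has_vector_derivative \<psi>' u *\<^sub>R p (\<psi> u)) (at u)" for u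
      using vector_diff_chain_at[of \<psi> "\<psi>' u" u \<gamma> "p (\<psi> u)"] d\<psi>[of u] \<gamma>(1)
      by (simp add: has_real_derivative_iff_has_vector_derivative)
    have compR: "\<gamma> \<circ> \<psi> \<in> regular_curves s"
      unfolding regular_curves_def
    proof (intro CollectI conjI allI compH)
      fix u
      have "curve_deriv (\<gamma> \<circ> \<psi>) u = \<psi>' u *\<^sub>R p (\<psi> u)" using dcomp by (rule vector_derivative_at)
      then show "0 < norm (curve_deriv (\<gamma> \<circ> \<psi>) u)" using pos[of u] unit by simp
    qed
    have \<psi>01: "\<psi> 0 = 0" "\<psi> 1 = 1" using \<phi>0 per[of 0] by (simp_all add: \<psi>_def)
    have "\<psi> u \<in> {0..<1}" if "u \<in> {0..<1}" for u
      using mono[of 0 u] mono[of u 1] that \<psi>01 by (cases "u = 0") auto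
    then have sub: "\<psi> ` {0..<1} \<subseteq> {0..<1}" by auto
    have inj\<psi>: "inj_on \<psi> A'" for A'
      by (rule inj_onI) (metis mono less_irrefl linorder_less_linear)
    have compO: "\<gamma> \<circ> \<psi> \<in> \<O>"
    proof (cases "\<O> = regular_curves s")
      case True
      then show ?thesis using compR by simp
    next
      case False
      then have O': "\<O> = injective_regular_curves s" using O by simp
      have "inj_on \<gamma> {0..<1}" using \<gamma>O unfolding O' injective_regular_curves_def by blast
      then have "inj_on \<gamma> (\<psi> ` {0..<1})" using sub by (rule inj_on_subset)
      then have "inj_on (\<gamma> \<circ> \<psi>) {0..<1}" by (rule comp_inj_on[OF inj\<psi>])
      then show ?thesis unfolding O' injective_regular_curves_def using compR by blast
    qed
    have "\<psi> \<in> H_interval (1 + s)" using H_intervalI[OF s d\<psi>] s\<psi>' by blast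
    moreover have "strict_mono_on {0..1} \<psi>" by (rule strict_mono_onI) (rule mono)
    moreover have "\<psi> (t + 1) = 1 + \<psi> t" for t by (simp add: \<psi>_def per)
    ultimately have "E \<gamma> = E (\<gamma> \<circ> \<psi>)"
      using inv \<gamma>O compO \<psi>01 unfolding parameter_invariant_def by blast
    moreover have "\<bar>E (\<lambda>u. \<gamma> u + \<epsilon> *\<^sub>R (k u + m u)) - E \<gamma> - D (\<lambda>u. \<epsilon> *\<^sub>R (k u + m u))\<bar> \<le> e * H_norm (1 + s) (\<lambda>u. \<epsilon> *\<^sub>R (k u + m u))"
      by (rule d1(2)) (use H_circle_scale[OF s kmH] kmn \<epsilon>1 in auto)
    ultimately have "\<bar>D (\<lambda>u. \<epsilon> *\<^sub>R (k u + m u))\<bar> \<le> e * H_norm (1 + s) (\<lambda>u. \<epsilon> *\<^sub>R (k u + m u))"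
      unfolding comp by simp
    also have "\<dots> \<le> e * (\<epsilon> * K)" using kmn e(1) by (intro mult_left_mono) auto
    finally have "\<epsilon> * \<bar>D k + D m\<bar> \<le> \<epsilon> * (e * K)"
      using \<epsilon> by (simp add: Dscale[OF kmH] Dadd[OF kH mH] abs_mult mult.left_commute)
    then have "\<bar>D k + D m\<bar> \<le> e * K" using \<epsilon> by simp
    moreover have "\<bar>D m\<bar> \<le> C * sqrt (e\<^sup>2 + e\<^sup>2 + e)"
      using C(2)[OF mH mn(2)] mult_left_mono[OF mn(1) C_nonneg] by linarith
    ultimately show ?thesis by linarith
  qed
  have "((\<lambda>e. e * K + C * sqrt (e\<^sup>2 + e\<^sup>2 + e)) \<longlongrightarrow> 0 * K + C * sqrt (0\<^sup>2 + 0\<^sup>2 + 0)) (at_right 0)"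
    by (intro tendsto_intros)
  moreover have "\<forall>\<^sub>F e in at_right 0. \<bar>D k\<bar> \<le> e * K + C * sqrt (e\<^sup>2 + e\<^sup>2 + e)"
    unfolding eventually_at_right_field by (intro exI[of _ 1]) (use small in auto)
  ultimately have "\<bar>D k\<bar> \<le> 0 * K + C * sqrt (0\<^sup>2 + 0\<^sup>2 + 0)"
    by (intro tendsto_lowerbound) auto
  then have "D k = 0" by simp
  then show ?thesis using kH unfolding k_def by blast
qed

theorem theorem3p10:
  fixes s :: real
    and \<M> \<O> :: "(real \<Rightarrow> real ^ 'n) set"
    and \<E> :: "(real \<Rightarrow> real ^ 'n) \<Rightarrow> real"
    and \<gamma> :: "real \<Rightarrow> real ^ 'n"
  assumes "CARD('n) \<ge> 2"
    and "1 / 2 < s" and "s \<le> 1"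
    and "(\<M> = arclength_curves s \<and> \<O> = regular_curves s) \<or>
         (\<M> = injective_arclength_curves s \<and> \<O> = injective_regular_curves s)"
    and "C1_energy s \<O> \<E>"
    and "parameter_invariant s \<O> \<E>"
    and "\<gamma> \<in> \<M> \<inter> H_circle (2 + s)"
    and "critical_restricted s \<M> \<E> \<gamma>"
  shows "(\<exists>\<mu>. critical_length_multiplier s \<O> \<E> \<mu> \<gamma>) \<and>
    (\<forall>\<mu> \<alpha>. critical_length_multiplier s \<O> \<E> \<mu> \<gamma> \<and> pos_homogeneous \<alpha> \<O> \<E> \<longrightarrow>
       \<mu> = \<alpha> * \<E> \<gamma> \<and> \<mu> = \<alpha> * restrict \<E> \<M> \<gamma> \<and>
       (\<alpha> \<noteq> 0 \<and> restrict \<E> \<M> \<gamma> \<noteq> 0 \<longrightarrow> \<mu> \<noteq> 0) \<and>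
       (\<alpha> = 0 \<or> restrict \<E> \<M> \<gamma> = 0 \<longrightarrow> \<mu> = 0))"
proof -
  note s = assms(2,3)
  have \<gamma>M: "\<gamma> \<in> \<M>" and \<gamma>2: "\<gamma> \<in> H_circle (2 + s)" using assms(7) by auto
  have arc: "\<gamma> \<in> arclength_curves s" using assms(4) \<gamma>M unfolding injective_arclength_curves_def by blast
  then have \<gamma>H: "\<gamma> \<in> H_circle (1 + s)" and unit0: "\<And>u. norm (curve_deriv \<gamma> u) = 1"
    unfolding arclength_curves_def by auto
  have reg: "\<gamma> \<in> regular_curves s" 
    unfolding regular_curves_def using \<gamma>H unit0 by (simp del: zero_less_norm_iff)
  have \<gamma>O: "\<gamma> \<in> \<O>"
    using assms(4) \<gamma>M reg unfolding injective_arclength_curves_def injective_regular_curves_def by auto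
  have O: "\<O> = regular_curves s \<or> \<O> = injective_regular_curves s" using assms(4) by blast
  obtain p g B where p: "\<And>u. (\<gamma> has_vector_derivative p u) (at u)" "\<And>u. p (u + 1) = p u"
    "\<And>u. (p has_vector_derivative g u) (at u)" and g: "sobolev_bound s g B"
    using H_circle_imp_C2[OF s \<gamma>2] by blast
  have cdp: "curve_deriv \<gamma> u = p u" for u by (rule vector_derivative_at) (rule p(1))
  have unit: "norm (p u) = 1" for u using unit0[of u] by (simp add: cdp)
  have per\<gamma>: "\<gamma> (u + 1) = \<gamma> u" for u by (rule H_circle_periodic[OF \<gamma>H])
  have pp: "p u \<bullet> p u = 1" for u using unit[of u] by (simp add: norm_eq_1)
  have pg: "p u \<bullet> g u = 0" for u
  proof -
    have "((\<lambda>u. p u \<bullet> p u) has_real_derivative (p u \<bullet> g u + g u \<bullet> p u)) (at u)"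
    proof -
      have "((\<lambda>u. p u \<bullet> p u) has_derivative (\<lambda>h. p u \<bullet> (h *\<^sub>R g u) + (h *\<^sub>R g u) \<bullet> p u)) (at u)"
        using p(3)[of u] unfolding has_vector_derivative_def by (intro has_derivative_inner)
      moreover have "(\<lambda>h. p u \<bullet> (h *\<^sub>R g u) + (h *\<^sub>R g u) \<bullet> p u) = (*) (p u \<bullet> g u + g u \<bullet> p u)"
        by (auto simp: fun_eq_iff algebra_simps)
      ultimately show ?thesis unfolding has_field_derivative_def by simp
    qed
    moreover have "((\<lambda>u. p u \<bullet> p u) has_real_derivative 0) (at u)" by (simp add: pp)
    ultimately have "p u \<bullet> g u + g u \<bullet> p u = 0" by (rule DERIV_unique)
    then show ?thesis by (simp add: inner_commute)
  qed
  have cp: "continuous_on A p" for A by (rule has_vector_derivative_imp_continuous_on[OF p(3)])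
  define D where "D = energy_derivative s \<E> \<gamma>"
  have "\<exists>D. has_energy_derivative s \<E> D \<gamma>" using assms(5) \<gamma>O unfolding C1_energy_def by blast
  then have D: "has_energy_derivative s \<E> D \<gamma>"
    unfolding D_def energy_derivative_def by (rule someI_ex)
  have Dadd: "D (\<lambda>u. h u + k u) = D h + D k" if "h \<in> H_circle (1 + s)" "k \<in> H_circle (1 + s)" for h k
    using D that unfolding has_energy_derivative_def by blast
  have Dscale: "D (\<lambda>u. c *\<^sub>R h u) = c * D h" if "h \<in> H_circle (1 + s)" for h c
    using D that unfolding has_energy_derivative_def by blast
  have DL: "energy_derivative s curve_length \<gamma> h = (LINT u:{0..1}|lborel. p u \<bullet> curve_deriv h u)" if "h \<in> H_circle (1 + s)" for h
    by (rule energy_derivative_eq[OF s curve_length_derivative[OF s p(1) cp unit] that])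
  have DL\<gamma>: "energy_derivative s curve_length \<gamma> \<gamma> = 1"
    unfolding DL[OF \<gamma>H] cdp pp by (simp add: set_lebesgue_integral_def)
  \<comment> \<open>The decomposition \<open>h = t + \<phi> \<gamma>' + c \<gamma>\<close>, with \<open>k = \<phi> \<gamma>'\<close>.\<close>
  have key: "D h = D \<gamma> * energy_derivative s curve_length \<gamma> h" if h: "h \<in> H_circle (1 + s)" for h
  proof -
    obtain Bh where q: "\<And>u. (h has_vector_derivative curve_deriv h u) (at u)" "sobolev_bound s (curve_deriv h) Bh"
      by (rule H_circle_curve_deriv[OF s h]) (rule that)
    define f where "f u = p u \<bullet> curve_deriv h u" for u
    define c where "c = (LINT u:{0..1}|lborel. f u)"
    define \<phi>' where "\<phi>' u = f u + - c" for u
    obtain L where L: "\<And>u. norm (g u) \<le> L"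
      by (rule periodic_bounded[OF sobolev_boundD(1)[OF g] sobolev_boundD(2)[OF g]]) (rule that)
    have sp: "sobolev_bound s p (C1_embedding_constant s * L\<^sup>2)"
      by (rule sobolev_bound_C1[OF s(1) p(3) sobolev_boundD(1)[OF g] p(2) L])
    obtain Bf where "sobolev_bound s f Bf" unfolding f_def using sobolev_bound_inner[OF sp q(2)] by blast
    from sobolev_bound_add[OF this sobolev_bound_const]
    obtain A where A: "sobolev_bound s \<phi>' A" unfolding \<phi>'_def by blast
    have cf: "continuous_on {0..1} f" unfolding f_def by (intro continuous_on_inner cp sobolev_boundD(1)[OF q(2)])
    have "(LINT u:{0..1}|lborel. \<phi>' u) = (LINT u:{0..1}|lborel. f u) + (LINT u:{0..1::real}|lborel. - c)"
      unfolding \<phi>'_def by (intro set_integral_add(2) borel_integrable_atLeastAtMost' cf continuous_intros)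
    also have "(LINT u:{0..1::real}|lborel. - c) = - c" by (simp add: set_lebesgue_integral_def)
    finally have z: "(LINT u:{0..1}|lborel. \<phi>' u) = 0" by (simp add: c_def)
    obtain \<phi> where \<phi>: "\<phi> 0 = 0" "\<And>u. (\<phi> has_vector_derivative \<phi>' u) (at u)" "\<And>u. \<phi> (u + 1) = \<phi> u"
      using periodic_antiderivative[OF sobolev_boundD(1)[OF A] sobolev_boundD(2)[OF A] z] by blast
    have d\<phi>: "(\<phi> has_real_derivative \<phi>' u) (at u)" for u
      using \<phi>(2)[of u] by (simp add: has_real_derivative_iff_has_vector_derivative)
    define k where "k u = \<phi> u *\<^sub>R p u" for u
    have k: "k \<in> H_circle (1 + s)" "D k = 0"
      using derivative_tangential_eq_0[OF s p(1) per\<gamma> p(3,2) unit g d\<phi> A \<phi>(3,1) O \<gamma>O assms(6) D]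
      unfolding k_def by blast+
    define t where "t u = (h u + (- 1) *\<^sub>R k u) + (- c) *\<^sub>R \<gamma> u" for u
    have tH: "t \<in> H_circle (1 + s)" unfolding t_def by (intro H_circle_add_scale s h k \<gamma>H)
    have dt: "(t has_vector_derivative ((curve_deriv h u + (- 1) *\<^sub>R (\<phi> u *\<^sub>R g u + \<phi>' u *\<^sub>R p u)) + (- c) *\<^sub>R p u)) (at u)" for u
      unfolding t_def k_def
      by (intro has_vector_derivative_add bounded_linear.has_vector_derivative[OF bounded_linear_scaleR_right]
          has_vector_derivative_scaleR q(1) d\<phi> p(1,3))
    have "t \<in> tangent_space s \<gamma>"
      unfolding tangent_space_def
    proof (intro CollectI conjI allI tH)
      fix u
      have "curve_deriv t u = (curve_deriv h u + (- 1) *\<^sub>R (\<phi> u *\<^sub>R g u + \<phi>' u *\<^sub>R p u)) + (- c) *\<^sub>R p u"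
        using dt by (rule vector_derivative_at)
      then have "p u \<bullet> curve_deriv t u = f u - \<phi> u * (p u \<bullet> g u) - \<phi>' u * (p u \<bullet> p u) - c * (p u \<bullet> p u)"
        by (simp add: inner_add_right inner_diff_right f_def)
      then show "curve_deriv \<gamma> u \<bullet> curve_deriv t u = 0" by (simp add: cdp pg pp \<phi>'_def)
    qed
    then have Dt: "D t = 0" using assms(8) unfolding critical_restricted_def D_def by blast
    have "h = (\<lambda>u. (t u + k u) + c *\<^sub>R \<gamma> u)" by (simp add: t_def fun_eq_iff)
    then have "D h = D (\<lambda>u. (t u + k u) + c *\<^sub>R \<gamma> u)" by metis
    also have "\<dots> = D (\<lambda>u. t u + k u) + D (\<lambda>u. c *\<^sub>R \<gamma> u)"
      using H_circle_add_scale[OF s tH k(1), of 1] H_circle_scale[OF s \<gamma>H] by (intro Dadd) simp_all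
    also have "D (\<lambda>u. t u + k u) = 0" using Dadd[OF tH k(1)] Dt k(2) by simp
    also have "D (\<lambda>u. c *\<^sub>R \<gamma> u) = c * D \<gamma>" by (rule Dscale[OF \<gamma>H])
    finally show ?thesis unfolding DL[OF h] c_def f_def by (simp add: mult.commute)
  qed
  have crit: "critical_length_multiplier s \<O> \<E> (D \<gamma>) \<gamma>"
    unfolding critical_length_multiplier_def D_def[symmetric] using \<gamma>O key by simp
  have hom: "\<mu> = \<alpha> * \<E> \<gamma>"
    if \<mu>: "critical_length_multiplier s \<O> \<E> \<mu> \<gamma>" and \<alpha>: "pos_homogeneous \<alpha> \<O> \<E>" for \<mu> \<alpha>
  proof -
    have \<mu>D: "\<mu> = D \<gamma>"
      using \<mu> \<gamma>H DL\<gamma> unfolding critical_length_multiplier_def D_def by force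
    \<comment> \<open>Euler's relation: the derivative of \<open>E((1 + c) \<gamma>)\<close> at \<open>c = 0\<close>, computed in two ways.\<close>
    have "((\<lambda>c. (1 + c) powr \<alpha> * \<E> \<gamma>) has_real_derivative \<alpha> * \<E> \<gamma>) (at 0)"
      by (auto intro!: derivative_eq_intros)
    moreover have "((\<lambda>c. (1 + c) powr \<alpha> * \<E> \<gamma>) has_real_derivative D \<gamma>) (at 0)"
    proof (rule has_field_derivative_transform_within[OF has_energy_derivative_ray[OF s D \<gamma>H], of 1])
      fix c :: real assume "dist c 0 < 1"
      then have "0 < 1 + c" by (auto simp: dist_real_def)
      then have "\<E> (\<lambda>u. (1 + c) *\<^sub>R \<gamma> u) = (1 + c) powr \<alpha> * \<E> \<gamma>" using \<alpha> \<gamma>O unfolding pos_homogeneous_def by blast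
      then show "\<E> (\<lambda>u. \<gamma> u + c *\<^sub>R \<gamma> u) = (1 + c) powr \<alpha> * \<E> \<gamma>" by (simp add: scaleR_add_left)
    qed simp_all
    ultimately show ?thesis unfolding \<mu>D by (metis DERIV_unique)
  qed
  have restr: "restrict \<E> \<M> \<gamma> = \<E> \<gamma>" using \<gamma>M by simp
  show ?thesis
    unfolding restr
  proof (intro conjI allI impI; (elim conjE)?)
    show "\<exists>\<mu>. critical_length_multiplier s \<O> \<E> \<mu> \<gamma>" using crit by blast
    fix \<mu> \<alpha> assume "critical_length_multiplier s \<O> \<E> \<mu> \<gamma>" "pos_homogeneous \<alpha> \<O> \<E>"
    then have \<mu>: "\<mu> = \<alpha> * \<E> \<gamma>" by (rule hom)
    then show "\<mu> = \<alpha> * \<E> \<gamma>" "\<mu> = \<alpha> * \<E> \<gamma>" by -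
    show "\<mu> \<noteq> 0" if "\<alpha> \<noteq> 0" "\<E> \<gamma> \<noteq> 0" using \<mu> that by simp
    show "\<mu> = 0" if "\<alpha> = 0 \<or> \<E> \<gamma> = 0" using \<mu> that by auto
  qed
qed

end
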